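(* Let $H$, $K$ be complex Hilbert spaces with $n=\dim H\le m=\dim K<\infty$. For every $r=1,2,\dots$, the space $V^r(H,K)$ is a compact, connected, real-analytic Riemannian manifold of dimension $d=n(2rm-n)$ (with the structure inherited from the ambient real inner product space $\mathcal B(H,K)^r$), on which the unitary group $\mathcal U(r\cdot K)$ acts as a transitive group of isometries. In particular, the natural measure associated with its Riemannian metric is proportional to the unique probability measure on $V^r(H,K)$ that is invariant under the transitive $\mathcal U(r\cdot K)$-action.
   Context: $V^r(H,K)$ is the space of all $r$-tuples $v=(v_1,\dots,v_r)$ of operators $v_k\in\mathcal B(H,K)$ with $v_1^*v_1+\cdots+v_r^*v_r=\mathbf 1_H$. It is a subset of $\mathcal B(H,K)^r$, regarded as a finite-dimensional real vector space with real inner product $\langle v,w\rangle=\Re\sum_{k=1}^r\operatorname{trace}(w_k^*v_k)$; the Riemannian metric on $V^r(H,K)$ is the restriction of this inner product to tangent spaces. $r\cdot K$ is the direct sum of $r$ copies of $K$; elements of its unitary group $\mathcal U(r\cdot K)$ are unitary $r\times r$ matrices $w=(w_{ij})$ with entries in $\mathcal B(K)$, acting on the left by $w\cdot v=v'$, $v_i'=\sum_{j=1}^r w_{ij}v_j$. *)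

theory Defs
  imports
    "HOL-Analysis.Analysis"
    "HOL-Probability.Probability_Measure"
    "HOL-Combinatorics.Permutations"
    "HOL-Algebra.Group_Action"
begin

section \<open>Complex Hilbert spaces of finite dimension\<close>

text \<open>
  The complex inner product is linear in the first argument. A space of this class also is a real
  inner product space, with real inner product \<open>Re (cinner x y)\<close> and hence the same norm.
\<close>

class complex_inner = real_inner +
  fixes scaleC :: "complex \<Rightarrow> 'a \<Rightarrow> 'a"  (infixr \<open>*\<^sub>C\<close> 75)
    and cinner :: "'a \<Rightarrow> 'a \<Rightarrow> complex"
  assumes scaleC_add_right: "a *\<^sub>C (x + y) = a *\<^sub>C x + a *\<^sub>C y"
    and scaleC_add_left: "(a + b) *\<^sub>C x = a *\<^sub>C x + b *\<^sub>C x"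
    and scaleC_scaleC: "a *\<^sub>C b *\<^sub>C x = (a * b) *\<^sub>C x"
    and scaleR_eq_scaleC: "t *\<^sub>R x = complex_of_real t *\<^sub>C x"
    and cinner_commute: "cinner x y = cnj (cinner y x)"
    and cinner_add_left: "cinner (x + y) z = cinner x z + cinner y z"
    and cinner_scaleC_left: "cinner (a *\<^sub>C x) y = a * cinner x y"
    and inner_eq_Re_cinner: "inner x y = Re (cinner x y)"

lemma scaleC_one: "1 *\<^sub>C x = (x :: 'a::complex_inner)"
  using scaleR_eq_scaleC[of 1 x] by simp

global_interpretation complex_vector: vector_space "scaleC :: complex \<Rightarrow> 'a \<Rightarrow> 'a::complex_inner"
  by unfold_locales (simp_all add: scaleC_add_right scaleC_add_left scaleC_scaleC scaleC_one)

text \<open>Completeness is automatic in finite dimension.\<close>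

class fd_hilbert = complex_inner +
  assumes finite_spanning: "\<exists>B. finite B \<and> (\<forall>x. \<exists>a. x = (\<Sum>b\<in>B. a b *\<^sub>C b))"

lemma finite_dimensional: "\<exists>B::'a::fd_hilbert set. finite B \<and> complex_vector.span B = UNIV"
proof -
  obtain B :: "'a set" where B: "finite B" "\<And>x. \<exists>a. x = (\<Sum>b\<in>B. a b *\<^sub>C b)"
    using finite_spanning by blast
  then show ?thesis
    using complex_vector.span_finite[OF B(1)] by blast
qed

abbreviation cdim :: "'a::complex_inner itself \<Rightarrow> nat"
  where "cdim _ \<equiv> complex_vector.dim (UNIV :: 'a set)"

lemma cinner_add_right: "cinner x (y + z) = cinner x y + cinner x (z::'a::complex_inner)"
  by (metis cinner_add_left cinner_commute complex_cnj_add)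

lemma cinner_scaleC_right: "cinner x (a *\<^sub>C y) = cnj a * cinner x (y::'a::complex_inner)"
  by (metis cinner_scaleC_left cinner_commute complex_cnj_mult)

lemma cinner_zero_left [simp]: "cinner 0 x = 0"
  using cinner_add_left[of 0 0 x] by simp

lemma cinner_zero_right [simp]: "cinner x 0 = 0"
  using cinner_add_right[of x 0 0] by simp

lemma cinner_diff_left: "cinner (x - y) z = cinner x z - cinner y (z::'a::complex_inner)"
  using cinner_add_left[of "x - y" y z] by simp

lemma cinner_sum_left: "cinner (sum f A) y = (\<Sum>i\<in>A. cinner (f i) (y::'a::complex_inner))"
  by (induction A rule: infinite_finite_induct) (simp_all add: cinner_add_left)

lemma cinner_sum_right: "cinner y (sum f A) = (\<Sum>i\<in>A. cinner (y::'a::complex_inner) (f i))"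
  by (induction A rule: infinite_finite_induct) (simp_all add: cinner_add_right)

lemma cinner_self: "cinner x x = complex_of_real ((norm (x::'a::complex_inner))\<^sup>2)"
proof -
  have "Im (cinner x x) = 0"
    using cinner_commute[of x x] by (metis cnj.simps(2) neg_equal_zero)
  then show ?thesis
    by (simp add: complex_eq_iff inner_eq_Re_cinner[symmetric] power2_norm_eq_inner)
qed

lemma cinner_self_eq_zero [simp]: "cinner x x = 0 \<longleftrightarrow> x = (0::'a::complex_inner)"
  by (simp add: cinner_self)

lemma norm_scaleC: "norm (a *\<^sub>C x) = cmod a * norm (x::'a::complex_inner)"
proof -
  have "complex_of_real ((norm (a *\<^sub>C x))\<^sup>2) = (a * cnj a) * cinner x x"
    unfolding cinner_self[symmetric] cinner_scaleC_left cinner_scaleC_right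
    by (simp only: mult.assoc mult.commute mult.left_commute)
  also have "\<dots> = complex_of_real ((cmod a * norm x)\<^sup>2)"
    unfolding cinner_self complex_norm_square[symmetric] power_mult_distrib of_real_mult ..
  finally have "(norm (a *\<^sub>C x))\<^sup>2 = (cmod a * norm x)\<^sup>2"
    unfolding of_real_eq_iff .
  then show ?thesis
    by (rule power2_eq_imp_eq) simp_all
qed

lemma norm_cinner_le: "cmod (cinner x y) \<le> norm x * norm (y::'a::complex_inner)"
proof (cases "cinner x y = 0")
  case False
  define z where "z = cinner x y"
  define a where "a = cnj z / complex_of_real (cmod z)"
  have z: "cmod z \<noteq> 0" using False by (simp add: z_def)
  have "a * z = complex_of_real ((cmod z)\<^sup>2) / complex_of_real (cmod z)"
    unfolding a_def complex_norm_square by (simp add: mult.commute)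
  also have "\<dots> = complex_of_real (cmod z)"
    using z by (simp add: power2_eq_square)
  finally have "cmod z = Re (cinner (a *\<^sub>C x) y)"
    by (simp add: cinner_scaleC_left z_def)
  also have "\<dots> \<le> norm (a *\<^sub>C x) * norm y"
    unfolding inner_eq_Re_cinner[symmetric] by (rule norm_cauchy_schwarz)
  also have "norm (a *\<^sub>C x) = norm x"
    using z by (simp add: norm_scaleC a_def norm_divide)
  finally show ?thesis by (simp add: z_def)
qed simp

definition orthonormal :: "'a::complex_inner set \<Rightarrow> bool"
  where "orthonormal B \<longleftrightarrow> (\<forall>x\<in>B. \<forall>y\<in>B. cinner x y = (if x = y then 1 else 0))"

definition orthonormal_basis :: "'a::complex_inner set \<Rightarrow> bool"
  where "orthonormal_basis B \<longleftrightarrow> finite B \<and> orthonormal B \<and> complex_vector.span B = UNIV"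

lemma gram_schmidt:
  "finite S \<Longrightarrow>
    \<exists>B. finite B \<and> orthonormal B \<and> complex_vector.span B = complex_vector.span (S::'a::complex_inner set)"
proof (induction S rule: finite_induct)
  case empty
  show ?case by (intro exI[of _ "{}"]) (simp add: orthonormal_def)
next
  case (insert x S)
  then obtain B where B: "finite B" "orthonormal B" "complex_vector.span B = complex_vector.span S"
    by blast
  define p where "p = (\<Sum>b\<in>B. cinner x b *\<^sub>C b)"
  define y where "y = x - p"
  have p: "p \<in> complex_vector.span B"
    unfolding p_def by (intro complex_vector.span_sum complex_vector.span_scale complex_vector.span_base)
  have SB: "complex_vector.span (insert x S) = complex_vector.span (insert x B)"
    using B(3) by (simp add: complex_vector.span_insert)
  have orth: "cinner y b = 0" if "b \<in> B" for b
  proof -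
    have "cinner p b = (\<Sum>e\<in>B. if e = b then cinner x e else 0)"
      unfolding p_def cinner_sum_left
      by (intro sum.cong) (use B(2) that in \<open>auto simp: cinner_scaleC_left orthonormal_def\<close>)
    then show ?thesis
      using B(1) that by (simp add: y_def cinner_diff_left)
  qed
  show ?case
  proof (cases "y = 0")
    case True
    then have "x \<in> complex_vector.span B" using p by (simp add: y_def)
    then have "complex_vector.span (insert x B) = complex_vector.span B"
      by (rule complex_vector.span_redundant)
    then show ?thesis
      using B(1,2) SB by auto
  next
    case False
    define a where "a = complex_of_real (inverse (norm y))"
    define u where "u = a *\<^sub>C y"
    have a: "a \<noteq> 0" using False by (simp add: a_def)
    have uu: "cinner u u = 1"
      using False by (simp add: cinner_self u_def norm_scaleC a_def norm_inverse)
    have ub: "cinner u b = 0" "cinner b u = 0" if "b \<in> B" for b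
      using orth[OF that] cinner_commute[of b u] by (simp_all add: u_def cinner_scaleC_left)
    have "orthonormal (insert u B)"
      using B(2) uu ub by (auto simp: orthonormal_def)
    moreover have "complex_vector.span (insert u B) = complex_vector.span (insert x B)"
    proof (rule complex_vector.span_eq[THEN iffD2], intro conjI subsetI)
      fix z assume z: "z \<in> insert u B"
      have "p \<in> complex_vector.span (insert x B)"
        using p complex_vector.span_mono[of B "insert x B"] by blast
      then have "u \<in> complex_vector.span (insert x B)"
        unfolding u_def y_def
        by (intro complex_vector.span_scale complex_vector.span_diff)
           (simp_all add: complex_vector.span_base)
      then show "z \<in> complex_vector.span (insert x B)"
        using z by (auto intro: complex_vector.span_base)
    next
      fix z assume z: "z \<in> insert x B"
      have "p \<in> complex_vector.span (insert u B)"
        using p complex_vector.span_mono[of B "insert u B"] by blast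
      moreover have "x = inverse a *\<^sub>C u + p"
        using a by (simp add: u_def y_def scaleC_scaleC scaleC_one)
      moreover have "inverse a *\<^sub>C u \<in> complex_vector.span (insert u B)"
        by (intro complex_vector.span_scale complex_vector.span_base insertI1)
      ultimately have "x \<in> complex_vector.span (insert u B)"
        using complex_vector.span_add by metis
      then show "z \<in> complex_vector.span (insert u B)"
        using z by (auto intro: complex_vector.span_base)
    qed
    ultimately show ?thesis
      using B(1) SB by (intro exI[of _ "insert u B"]) simp
  qed
qed

lemma orthonormal_basis_exists: "\<exists>B::'a::fd_hilbert set. orthonormal_basis B"
proof -
  obtain S :: "'a set" where S: "finite S" "complex_vector.span S = UNIV"
    using finite_dimensional by blast
  show ?thesis
    using gram_schmidt[OF S(1)] S(2) by (auto simp: orthonormal_basis_def)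
qed

lemma orthonormal_basis_expand:
  assumes "orthonormal_basis B"
  shows "x = (\<Sum>b\<in>B. cinner x b *\<^sub>C b)"
proof -
  define z where "z = x - (\<Sum>b\<in>B. cinner x b *\<^sub>C b)"
  have B: "finite B" "orthonormal B" "complex_vector.span B = UNIV"
    using assms by (auto simp: orthonormal_basis_def)
  have *: "cinner b z = 0" if "b \<in> B" for b
  proof -
    have "cinner (\<Sum>b\<in>B. cinner x b *\<^sub>C b) b = (\<Sum>e\<in>B. if e = b then cinner x e else 0)"
      unfolding cinner_sum_left
      by (intro sum.cong) (use B(2) that in \<open>auto simp: cinner_scaleC_left orthonormal_def\<close>)
    then have "cinner z b = 0"
      using B(1) that by (simp add: z_def cinner_diff_left)
    then show ?thesis
      using cinner_commute[of b z] by simp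
  qed
  have "cinner w z = 0" if "w \<in> complex_vector.span B" for w
    using that
    by (induction rule: complex_vector.span_induct_alt)
       (simp_all add: * cinner_add_left cinner_scaleC_left)
  then have "z = 0" using B(3) by (metis UNIV_I cinner_self_eq_zero)
  then show ?thesis by (simp add: z_def)
qed

text \<open>The spaces \<open>complex ^ 'n\<close> are instances of the class.\<close>

instantiation complex :: fd_hilbert
begin

definition scaleC_complex :: "complex \<Rightarrow> complex \<Rightarrow> complex"
  where "scaleC_complex a x = a * x"

definition cinner_complex :: "complex \<Rightarrow> complex \<Rightarrow> complex"
  where "cinner_complex x y = x * cnj y"

instance
proof
  show "\<exists>B::complex set. finite B \<and> (\<forall>x. \<exists>a. x = (\<Sum>b\<in>B. a b *\<^sub>C b))"
    by (intro exI[of _ "{1}"]) (auto simp: scaleC_complex_def intro: exI[of _ "\<lambda>_. x" for x])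
qed (simp_all add: scaleC_complex_def cinner_complex_def inner_complex_def scaleR_conv_of_real
       algebra_simps)

end

instantiation vec :: (complex_inner, finite) complex_inner
begin

definition scaleC_vec :: "complex \<Rightarrow> 'a ^ 'b \<Rightarrow> 'a ^ 'b"
  where "scaleC_vec a x = (\<chi> i. a *\<^sub>C x $ i)"

definition cinner_vec :: "'a ^ 'b \<Rightarrow> 'a ^ 'b \<Rightarrow> complex"
  where "cinner_vec x y = (\<Sum>i\<in>UNIV. cinner (x $ i) (y $ i))"

instance
proof
  fix x y :: "'a ^ 'b"
  show "cinner x y = cnj (cinner y x)"
    unfolding cinner_vec_def cnj_sum by (intro sum.cong refl cinner_commute)
qed (simp_all add: scaleC_vec_def cinner_vec_def vec_eq_iff inner_vec_def scaleC_add_right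
       scaleC_add_left scaleC_scaleC scaleR_eq_scaleC cinner_add_left cinner_scaleC_left
       inner_eq_Re_cinner sum.distrib sum_distrib_left)

end

instance vec :: (fd_hilbert, finite) fd_hilbert
proof
  obtain E :: "'a set" where E: "orthonormal_basis E" using orthonormal_basis_exists by blast
  define B where "B = (\<Union>i::'b. axis i ` E)"
  have "finite B" using E by (simp add: B_def orthonormal_basis_def)
  have "x \<in> complex_vector.span B" for x :: "'a ^ 'b"
  proof -
    have "x = (\<Sum>i\<in>UNIV. \<Sum>e\<in>E. cinner (x $ i) e *\<^sub>C axis i e)"
    proof (unfold vec_eq_iff, rule allI)
      fix k
      have "(\<Sum>i\<in>UNIV. \<Sum>e\<in>E. cinner (x $ i) e *\<^sub>C axis i e) $ k
        = (\<Sum>i\<in>UNIV. if i = k then \<Sum>e\<in>E. cinner (x $ i) e *\<^sub>C e else 0)"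
        unfolding sum_component by (intro sum.cong refl) (auto simp: scaleC_vec_def axis_def complex_vector.scale_zero_right)
      also have "\<dots> = x $ k"
        using orthonormal_basis_expand[OF E, of "x $ k"] by simp
      finally show "x $ k = (\<Sum>i\<in>UNIV. \<Sum>e\<in>E. cinner (x $ i) e *\<^sub>C axis i e) $ k" ..
    qed
    also have "\<dots> \<in> complex_vector.span B"
      by (intro complex_vector.span_sum complex_vector.span_scale complex_vector.span_base)
         (auto simp: B_def)
    finally show ?thesis .
  qed
  then show "\<exists>B::('a ^ 'b) set. finite B \<and> (\<forall>x. \<exists>a. x = (\<Sum>b\<in>B. a b *\<^sub>C b))"
    using complex_vector.span_finite[OF \<open>finite B\<close>] \<open>finite B\<close> by blast
qed


section \<open>The operator spaces B(H,K)\<close>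

typedef (overloaded) ('h, 'k) bop =
  "{A :: 'h::fd_hilbert \<Rightarrow> 'k::fd_hilbert. bounded_linear A \<and> (\<forall>c x. A (c *\<^sub>C x) = c *\<^sub>C A x)}"
  morphisms app Bop
  by (rule exI[of _ "\<lambda>_. 0"]) (simp add: complex_vector.scale_zero_right)

setup_lifting type_definition_bop

lemma app_bounded_linear: "bounded_linear (app A)"
  using app[of A] by simp

lemma app_add: "app A (x + y) = app A x + app A y"
  by (rule linear_add[OF bounded_linear.linear[OF app_bounded_linear]])

lemma app_scaleC: "app A (c *\<^sub>C x) = c *\<^sub>C app A x"
  using app[of A] by simp

lemma app_sum: "app A (sum f S) = (\<Sum>i\<in>S. app A (f i))"
  by (rule linear_sum[OF bounded_linear.linear[OF app_bounded_linear]])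

lemma bop_eqI: "(\<And>x. app A x = app B x) \<Longrightarrow> A = B"
  by (metis app_inject ext)

lift_definition bop_id :: "('h::fd_hilbert, 'h) bop" is "\<lambda>x. x"
  by simp

lift_definition bop_comp ::
  "('k::fd_hilbert, 'l::fd_hilbert) bop \<Rightarrow> ('h::fd_hilbert, 'k) bop \<Rightarrow> ('h, 'l) bop"  (infixl \<open>\<circ>\<^sub>B\<close> 70)
  is "\<lambda>A B x. A (B x)"
  by (auto intro: bounded_linear_compose)

definition adj :: "('h::fd_hilbert, 'k::fd_hilbert) bop \<Rightarrow> ('k, 'h) bop"
  where "adj A = (THE B. \<forall>x y. cinner (app A x) y = cinner x (app B y))"

lemma adj_exists:
  fixes A :: "('h::fd_hilbert, 'k::fd_hilbert) bop"
  shows "\<exists>B. \<forall>x y. cinner (app A x) y = cinner x (app B y)"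
proof -
  obtain E :: "'h set" where E: "orthonormal_basis E" using orthonormal_basis_exists by blast
  define B where "B = (\<lambda>y. \<Sum>e\<in>E. cinner y (app A e) *\<^sub>C e)"
  have "bounded_linear B"
    unfolding B_def
  proof (intro bounded_linear_sum)
    fix e
    show "bounded_linear (\<lambda>y. cinner y (app A e) *\<^sub>C e)"
    proof (rule bounded_linear_intro[of _ "norm (app A e) * norm e"])
      show "norm (cinner y (app A e) *\<^sub>C e) \<le> norm y * (norm (app A e) * norm e)" for y
        using mult_right_mono[OF norm_cinner_le[of y "app A e"] norm_ge_zero[of e]]
        by (simp only: norm_scaleC mult.assoc)
    qed (simp_all add: cinner_add_left scaleC_add_left scaleR_eq_scaleC cinner_scaleC_left scaleC_scaleC)
  qed
  moreover have "B (c *\<^sub>C x) = c *\<^sub>C B x" for c x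
    by (simp add: B_def cinner_scaleC_left complex_vector.scale_sum_right scaleC_scaleC)
  ultimately have app_B: "app (Bop B) = B"
    by (simp add: Bop_inverse)
  have "cinner (app A x) y = cinner x (B y)" for x :: 'h and y :: 'k
  proof -
    have "cinner (app A x) y = cinner (app A (\<Sum>e\<in>E. cinner x e *\<^sub>C e)) y"
      using orthonormal_basis_expand[OF E, of x] by simp
    also have "\<dots> = (\<Sum>e\<in>E. cinner x e * cinner (app A e) y)"
      by (simp add: app_sum app_scaleC cinner_sum_left cinner_scaleC_left)
    also have "\<dots> = cinner x (B y)"
      unfolding B_def cinner_sum_right
      by (intro sum.cong refl) (simp add: cinner_scaleC_right mult.commute
            cinner_commute[of "app A _" y])
    finally show ?thesis .
  qed
  then show ?thesis using app_B by metis
qed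

lemma cinner_adj: "cinner (app A x) y = cinner x (app (adj A) y)"
proof -
  have "\<exists>!B. \<forall>x y. cinner (app A x) y = cinner x (app B y)"
  proof (rule ex_ex1I[OF adj_exists])
    fix B C
    assume *: "\<forall>x y. cinner (app A x) y = cinner x (app B y)"
      "\<forall>x y. cinner (app A x) y = cinner x (app C y)"
    show "B = C"
    proof (rule bop_eqI)
      fix y
      have "cinner (app B y - app C y) x = 0" for x
        using * cinner_commute[of "app B y" x] cinner_commute[of "app C y" x]
        by (simp add: cinner_diff_left)
      then show "app B y = app C y"
        by (metis cinner_self_eq_zero eq_iff_diff_eq_0)
    qed
  qed
  from theI'[OF this] show ?thesis unfolding adj_def by blast
qed

lemma cinner_adj_left: "cinner (app (adj A) x) y = cinner x (app A y)"
  by (metis cinner_adj cinner_commute)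

definition trace_bop :: "('h::fd_hilbert, 'h) bop \<Rightarrow> complex"
  where "trace_bop A = (\<Sum>e\<in>(SOME E. orthonormal_basis E). cinner (app A e) e)"

lemma trace_bop_eq:
  assumes "orthonormal_basis E"
  shows "trace_bop A = (\<Sum>e\<in>E. cinner (app A e) e)"
proof -
  have *: "(\<Sum>e\<in>E. cinner (app A e) e) = (\<Sum>f\<in>F. cinner (app A f) f)"
    if E: "orthonormal_basis E" and F: "orthonormal_basis F" for E F
  proof -
    have "(\<Sum>e\<in>E. cinner (app A e) e) = (\<Sum>e\<in>E. \<Sum>f\<in>F. cinner e f * cinner (app A f) e)"
    proof (intro sum.cong refl)
      fix e
      have "cinner (app A e) e = cinner (app A (\<Sum>f\<in>F. cinner e f *\<^sub>C f)) e"
        using orthonormal_basis_expand[OF F, of e] by simp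
      then show "cinner (app A e) e = (\<Sum>f\<in>F. cinner e f * cinner (app A f) e)"
        by (simp add: app_sum app_scaleC cinner_sum_left cinner_scaleC_left)
    qed
    also have "\<dots> = (\<Sum>f\<in>F. \<Sum>e\<in>E. cinner e f * cinner (app A f) e)"
      by (rule sum.swap)
    also have "\<dots> = (\<Sum>f\<in>F. cinner (app A f) f)"
    proof (intro sum.cong refl)
      fix f
      have "cinner (app A f) f = cinner (\<Sum>e\<in>E. cinner (app A f) e *\<^sub>C e) f"
        using orthonormal_basis_expand[OF E, of "app A f"] by simp
      then show "(\<Sum>e\<in>E. cinner e f * cinner (app A f) e) = cinner (app A f) f"
        by (simp add: cinner_sum_left cinner_scaleC_left mult.commute)
    qed
    finally show ?thesis .
  qed
  show ?thesis
    unfolding trace_bop_def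
    by (rule *[OF someI_ex[OF orthonormal_basis_exists] assms])
qed

text \<open>
  The real inner product on \<open>B(H,K)\<close> is \<open>Re (trace (w\<^sup>* v))\<close>; norm and topology are those it induces.
\<close>

instantiation bop :: (fd_hilbert, fd_hilbert) real_inner
begin

lift_definition zero_bop :: "('a, 'b) bop" is "\<lambda>_. 0"
  by simp

lift_definition plus_bop :: "('a, 'b) bop \<Rightarrow> ('a, 'b) bop \<Rightarrow> ('a, 'b) bop" is "\<lambda>A B x. A x + B x"
  by (simp add: bounded_linear_add scaleC_add_right)

lift_definition uminus_bop :: "('a, 'b) bop \<Rightarrow> ('a, 'b) bop" is "\<lambda>A x. - A x"
  by (simp add: bounded_linear_minus)

lift_definition minus_bop :: "('a, 'b) bop \<Rightarrow> ('a, 'b) bop \<Rightarrow> ('a, 'b) bop" is "\<lambda>A B x. A x - B x"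
  by (simp add: bounded_linear_sub complex_vector.scale_right_diff_distrib)

lift_definition scaleR_bop :: "real \<Rightarrow> ('a, 'b) bop \<Rightarrow> ('a, 'b) bop" is "\<lambda>t A x. t *\<^sub>R A x"
proof (intro conjI allI)
  fix t :: real and A :: "'a \<Rightarrow> 'b" and c x
  assume A: "bounded_linear A \<and> (\<forall>c x. A (c *\<^sub>C x) = c *\<^sub>C A x)"
  then show "bounded_linear (\<lambda>x. t *\<^sub>R A x)"
    by (simp add: bounded_linear_const_scaleR)
  show "t *\<^sub>R A (c *\<^sub>C x) = c *\<^sub>C t *\<^sub>R A x"
    using A by (simp add: scaleR_eq_scaleC scaleC_scaleC mult.commute)
qed

definition inner_bop :: "('a, 'b) bop \<Rightarrow> ('a, 'b) bop \<Rightarrow> real"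
  where "inner_bop v w = Re (trace_bop (adj w \<circ>\<^sub>B v))"

definition norm_bop :: "('a, 'b) bop \<Rightarrow> real"
  where "norm_bop v = sqrt (inner v v)"

definition sgn_bop :: "('a, 'b) bop \<Rightarrow> ('a, 'b) bop"
  where "sgn_bop v = inverse (norm v) *\<^sub>R v"

definition dist_bop :: "('a, 'b) bop \<Rightarrow> ('a, 'b) bop \<Rightarrow> real"
  where "dist_bop v w = norm (v - w)"

definition uniformity_bop :: "(('a, 'b) bop \<times> ('a, 'b) bop) filter"
  where "uniformity_bop = (INF e\<in>{0<..}. principal {(v, w). dist v w < e})"

definition open_bop :: "('a, 'b) bop set \<Rightarrow> bool"
  where "open_bop U \<longleftrightarrow> (\<forall>v\<in>U. eventually (\<lambda>(v', w). v' = v \<longrightarrow> w \<in> U) uniformity)"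

instance
proof
  obtain E :: "'a set" where E: "orthonormal_basis E" using orthonormal_basis_exists by blast
  have inner_eq: "inner v w = (\<Sum>e\<in>E. inner (app v e) (app w e))" for v w :: "('a, 'b) bop"
    by (simp add: inner_bop_def trace_bop_eq[OF E] bop_comp.rep_eq cinner_adj_left inner_eq_Re_cinner)
  have finE: "finite E" using E by (simp add: orthonormal_basis_def)
  fix u v w :: "('a, 'b) bop" and s t :: real
  show "u + v + w = u + (v + w)" "u + v = v + u" "0 + v = v" "- v + v = 0" "v - w = v + - w"
    by (transfer; force)+
  show "s *\<^sub>R (v + w) = s *\<^sub>R v + s *\<^sub>R w" "(s + t) *\<^sub>R v = s *\<^sub>R v + t *\<^sub>R v"
    "s *\<^sub>R t *\<^sub>R v = (s * t) *\<^sub>R v" "1 *\<^sub>R v = v"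
    by (transfer; simp add: scaleR_add_right scaleR_add_left)+
  show "sgn v = inverse (norm v) *\<^sub>R v" "dist v w = norm (v - w)"
    "(uniformity :: (('a, 'b) bop \<times> ('a, 'b) bop) filter)
      = (INF e\<in>{0<..}. principal {(v, w). dist v w < e})"
    "norm v = sqrt (inner v v)"
    by (simp_all add: sgn_bop_def dist_bop_def uniformity_bop_def norm_bop_def)
  show "open U \<longleftrightarrow> (\<forall>v\<in>U. eventually (\<lambda>(v', w). v' = v \<longrightarrow> w \<in> U) uniformity)"
    for U :: "('a, 'b) bop set"
    by (simp add: open_bop_def)
  show "inner v w = inner w v" "0 \<le> inner v v"
    by (simp_all add: inner_eq inner_commute sum_nonneg)
  show "inner (u + v) w = inner u w + inner v w"
    by (simp add: inner_eq plus_bop.rep_eq inner_add_left sum.distrib)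
  show "inner (s *\<^sub>R v) w = s * inner v w"
    by (simp add: inner_eq scaleR_bop.rep_eq sum_distrib_left)
  show "inner v v = 0 \<longleftrightarrow> v = 0"
  proof
    assume "inner v v = 0"
    then have 0: "app v e = 0" if "e \<in> E" for e
      using that finE by (simp add: inner_eq sum_nonneg_eq_0_iff)
    have "app v x = 0" for x
    proof -
      have "app v x = app v (\<Sum>e\<in>E. cinner x e *\<^sub>C e)"
        using orthonormal_basis_expand[OF E, of x] by simp
      also have "\<dots> = 0"
        by (simp add: app_sum app_scaleC 0)
      finally show ?thesis .
    qed
    then show "v = 0" by (intro bop_eqI) (simp add: zero_bop.rep_eq)
  qed (simp add: inner_eq zero_bop.rep_eq)
qed

end

text \<open>An \<open>r\<close>-tuple is an element of \<open>('h, 'k) bop ^ 'r\<close> with \<open>r = CARD('r)\<close>.\<close>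

lemma inner_tuple:
  fixes v w :: "('h::fd_hilbert, 'k::fd_hilbert) bop ^ 'r"
  shows "v \<bullet> w = Re (\<Sum>k\<in>UNIV. trace_bop (adj (w $ k) \<circ>\<^sub>B v $ k))"
  by (simp add: inner_vec_def inner_bop_def)

definition stiefel :: "(('h::fd_hilbert, 'k::fd_hilbert) bop ^ 'r) set"
  where "stiefel = {v. (\<Sum>k\<in>UNIV. adj (v $ k) \<circ>\<^sub>B v $ k) = bop_id}"


section \<open>The unitary group of the direct sum of copies of K\<close>

definition block_mult ::
  "('k::fd_hilbert, 'k) bop ^ 'r ^ 'r \<Rightarrow> ('k, 'k) bop ^ 'r ^ 'r \<Rightarrow> ('k, 'k) bop ^ 'r ^ 'r"
  where "block_mult w w' = (\<chi> i j. \<Sum>k\<in>UNIV. w $ i $ k \<circ>\<^sub>B w' $ k $ j)"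

definition block_one :: "('k::fd_hilbert, 'k) bop ^ 'r ^ 'r"
  where "block_one = (\<chi> i j. if i = j then bop_id else 0)"

definition block_adj :: "('k::fd_hilbert, 'k) bop ^ 'r ^ 'r \<Rightarrow> ('k, 'k) bop ^ 'r ^ 'r"
  where "block_adj w = (\<chi> i j. adj (w $ j $ i))"

definition unitary_group :: "(('k::fd_hilbert, 'k) bop ^ 'r ^ 'r) monoid"
  where "unitary_group =
    \<lparr>carrier = {w. block_mult (block_adj w) w = block_one \<and> block_mult w (block_adj w) = block_one},
     mult = block_mult, one = block_one\<rparr>"

definition block_act ::
  "('k::fd_hilbert, 'k) bop ^ 'r ^ 'r \<Rightarrow> ('h::fd_hilbert, 'k) bop ^ 'r \<Rightarrow> ('h, 'k) bop ^ 'r"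
  where "block_act w v = (\<chi> i. \<Sum>j\<in>UNIV. w $ i $ j \<circ>\<^sub>B v $ j)"


section \<open>Real-analytic submanifolds of a real inner product space\<close>

text \<open>
  So that the dimension \<open>d\<close> can be an arbitrary number (including \<open>0\<close>), \<open>\<real>\<^sup>d\<close> is rendered by the
  extensional functions on \<open>{..<d}\<close>, with product topology and product Lebesgue measure.
\<close>

abbreviation coord_topology :: "nat \<Rightarrow> (nat \<Rightarrow> real) topology"
  where "coord_topology d \<equiv> product_topology (\<lambda>_. euclideanreal) {..<d}"

abbreviation coord_lebesgue :: "nat \<Rightarrow> (nat \<Rightarrow> real) measure"
  where "coord_lebesgue d \<equiv> PiM {..<d} (\<lambda>_. lborel)"

text \<open>
  Near each point the function is the sum of an unconditionally convergent power series in \<open>d\<close>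
  variables; \<open>\<alpha>\<close> ranges over all multi-indices.
\<close>

definition real_analytic_on :: "nat \<Rightarrow> ((nat \<Rightarrow> real) \<Rightarrow> 'e::real_normed_vector) \<Rightarrow> (nat \<Rightarrow> real) set \<Rightarrow> bool"
  where "real_analytic_on d f U \<longleftrightarrow>
    (\<forall>x\<in>U. \<exists>c::(nat \<Rightarrow> nat) \<Rightarrow> 'e. \<exists>\<epsilon>>0.
      \<forall>y\<in>topspace (coord_topology d). (\<forall>i<d. \<bar>y i - x i\<bar> < \<epsilon>) \<longrightarrow>
        ((\<lambda>\<alpha>. (\<Prod>i<d. (y i - x i) ^ \<alpha> i) *\<^sub>R c \<alpha>) has_sum f y) ({..<d} \<rightarrow>\<^sub>E UNIV))"

definition partial :: "nat \<Rightarrow> ((nat \<Rightarrow> real) \<Rightarrow> 'e::real_normed_vector) \<Rightarrow> (nat \<Rightarrow> real) \<Rightarrow> 'e"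
  where "partial i f x = vector_derivative (\<lambda>t. f (x(i := t))) (at (x i))"

text \<open>
  A local parametrization (inverse of a chart): a real-analytic immersion of an open set
  \<open>U \<subseteq> \<real>\<^sup>d\<close> that is a homeomorphism onto a relatively open subset of \<open>M\<close>.
\<close>

definition local_parametrization ::
  "nat \<Rightarrow> 'e::real_inner set \<Rightarrow> (nat \<Rightarrow> real) set \<Rightarrow> ((nat \<Rightarrow> real) \<Rightarrow> 'e) \<Rightarrow> bool"
  where "local_parametrization d M U \<phi> \<longleftrightarrow>
    openin (coord_topology d) U \<and>
    openin (top_of_set M) (\<phi> ` U) \<and>
    homeomorphic_map (subtopology (coord_topology d) U) (top_of_set (\<phi> ` U)) \<phi> \<and>
    real_analytic_on d \<phi> U \<and>
    (\<forall>x\<in>U. \<forall>a. (\<Sum>i<d. a i *\<^sub>R partial i \<phi> x) = 0 \<longrightarrow> (\<forall>i<d. a i = 0))"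

definition analytic_submanifold :: "nat \<Rightarrow> 'e::real_inner set \<Rightarrow> bool"
  where "analytic_submanifold d M \<longleftrightarrow>
    (\<forall>p\<in>M. \<exists>U \<phi>. local_parametrization d M U \<phi> \<and> p \<in> \<phi> ` U)"

definition tangent_space :: "'e::real_inner set \<Rightarrow> 'e \<Rightarrow> 'e set"
  where "tangent_space M p =
    {v. \<exists>\<gamma>::real \<Rightarrow> 'e. \<gamma> 0 = p \<and> (\<forall>\<^sub>F t in nhds 0. \<gamma> t \<in> M) \<and> (\<gamma> has_vector_derivative v) (at 0)}"

text \<open>
  A metric assigns to each point of \<open>M\<close> a bilinear form on the tangent space; its values elsewhere
  are irrelevant.
\<close>

type_synonym 'e metric_tensor = "'e \<Rightarrow> 'e \<Rightarrow> 'e \<Rightarrow> real"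

definition induced_metric :: "'e::real_inner metric_tensor"
  where "induced_metric = (\<lambda>p v w. v \<bullet> w)"

text \<open>
  The coefficients \<open>g(\<partial>\<^sub>i\<psi>, \<partial>\<^sub>j\<psi>)\<close> of the pullback of \<open>g\<close> along \<open>\<psi>\<close>.
\<close>

definition metric_coeff ::
  "'e::real_inner metric_tensor \<Rightarrow> ((nat \<Rightarrow> real) \<Rightarrow> 'e) \<Rightarrow> nat \<Rightarrow> nat \<Rightarrow> (nat \<Rightarrow> real) \<Rightarrow> real"
  where "metric_coeff g \<psi> i j x = g (\<psi> x) (partial i \<psi> x) (partial j \<psi> x)"

definition analytic_riemannian_manifold ::
  "nat \<Rightarrow> 'e::real_inner set \<Rightarrow> 'e metric_tensor \<Rightarrow> bool"
  where "analytic_riemannian_manifold d M g \<longleftrightarrow>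
    analytic_submanifold d M \<and>
    (\<forall>p\<in>M. \<forall>u\<in>tangent_space M p. \<forall>v\<in>tangent_space M p.
      g p u v = g p v u \<and>
      (u \<noteq> 0 \<longrightarrow> g p u u > 0) \<and>
      (\<forall>w\<in>tangent_space M p. \<forall>a b. g p (a *\<^sub>R u + b *\<^sub>R v) w = a * g p u w + b * g p v w)) \<and>
    (\<forall>U \<phi>. local_parametrization d M U \<phi> \<longrightarrow>
      (\<forall>i<d. \<forall>j<d. real_analytic_on d (metric_coeff g \<phi> i j) U))"

text \<open>
  An isometry is a real-analytic diffeomorphism of \<open>M\<close> under which \<open>g\<close> pulls back to \<open>g\<close>. As \<open>M\<close>
  is embedded, analyticity of a map into \<open>M\<close> may be tested in the ambient space.
\<close>

definition analytic_map_on :: "nat \<Rightarrow> 'e::real_inner set \<Rightarrow> ('e \<Rightarrow> 'e) \<Rightarrow> bool"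
  where "analytic_map_on d M f \<longleftrightarrow>
    (\<forall>U \<phi>. local_parametrization d M U \<phi> \<longrightarrow> real_analytic_on d (f \<circ> \<phi>) U)"

definition riemannian_isometry ::
  "nat \<Rightarrow> 'e::real_inner set \<Rightarrow> 'e metric_tensor \<Rightarrow> ('e \<Rightarrow> 'e) \<Rightarrow> bool"
  where "riemannian_isometry d M g f \<longleftrightarrow>
    bij_betw f M M \<and> analytic_map_on d M f \<and> analytic_map_on d M (inv_into M f) \<and>
    (\<forall>U \<phi>. local_parametrization d M U \<phi> \<longrightarrow>
      (\<forall>x\<in>U. \<forall>i<d. \<forall>j<d. metric_coeff g (f \<circ> \<phi>) i j x = metric_coeff g \<phi> i j x))"

text \<open>
  The Leibniz formula, as for \<^const>\<open>det\<close>, but for a matrix indexed by \<open>{..<d}\<close>.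
\<close>

definition det_upto :: "nat \<Rightarrow> (nat \<Rightarrow> nat \<Rightarrow> real) \<Rightarrow> real"
  where "det_upto d G = (\<Sum>p | p permutes {..<d}. of_int (sign p) * (\<Prod>i<d. G i (p i)))"

text \<open>
  The Riemannian measure is the Borel measure that is \<open>sqrt (det (g\<^sub>i\<^sub>j)) dx\<^sub>1\<dots>dx\<^sub>d\<close> in all local
  coordinates.
\<close>

definition is_riemannian_measure ::
  "nat \<Rightarrow> 'e::real_inner set \<Rightarrow> 'e metric_tensor \<Rightarrow> 'e measure \<Rightarrow> bool"
  where "is_riemannian_measure d M g \<mu> \<longleftrightarrow>
    sets \<mu> = sets (restrict_space borel M) \<and>
    (\<forall>U \<phi>. local_parametrization d M U \<phi> \<longrightarrow>
      (\<forall>A\<in>sets \<mu>. A \<subseteq> \<phi> ` U \<longrightarrow>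
        emeasure \<mu> A =
          (\<integral>\<^sup>+x\<in>U \<inter> \<phi> -` A. ennreal (sqrt (det_upto d (\<lambda>i j. metric_coeff g \<phi> i j x))) \<partial>coord_lebesgue d)))"

definition is_invariant_probability ::
  "('g, 'x) monoid_scheme \<Rightarrow> 'e::topological_space set \<Rightarrow> ('g \<Rightarrow> 'e \<Rightarrow> 'e) \<Rightarrow> 'e measure \<Rightarrow> bool"
  where "is_invariant_probability G M act P \<longleftrightarrow>
    sets P = sets (restrict_space borel M) \<and>
    prob_space P \<and>
    (\<forall>w\<in>carrier G. act w \<in> measurable P P \<and> distr P P (act w) = P)"

end

theory Submission
  imports Defs
begin

text \<open>
  For \<open>v\<close> in the Stiefel manifold the Cayley transform of a skew-adjoint operator on \<open>r \<cdot> K\<close>, applied to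
  \<open>v\<close>, is a rational function of \<open>\<xi>\<close> in the real space of all \<open>\<xi>\<close> with \<open>v\<^sup>* \<xi>\<close> skew-adjoint. It is an analytic
  homeomorphism from this space, of dimension \<open>2rnm - n\<^sup>2\<close>, onto the relatively open set of all \<open>w\<close>
  with \<open>1 + v\<^sup>* w\<close> invertible, and its inverse is rational too. As \<open>1 + \<lambda> v\<^sup>* w\<close> is invertible for some
  unimodular \<open>\<lambda>\<close>, two such charts joined by the circle through \<open>w\<close> give connectedness, and a
  scalar followed by a reflection gives transitivity. The Riemannian measure is glued from finitely many charts by the
  change of variables theorem; it is finite, positive and, being unique, invariant under isometries.
  Finally, balls of equal radius have equal measure under any invariant probability, so by Fubini's
  theorem there is only one.
\<close>

section \<open>Local power series\<close>

text \<open>Two features of the definitions shape the proof. They quantify over all local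
  parametrizations, not only over Cayley charts, so a transition map is at first no more than a
  homeomorphism; its derivative is extracted from the immersion property. And analyticity means
  unconditional summability over multi-indices; weighted absolute sums turn this into norm estimates
  that are stable under products, infinite sums and partial derivatives, while vector values are
  handled by components in an orthonormal basis. A Cayley chart is defined on a whole vector space
  because \<open>1 - \<Omega>\<close> is invertible for every skew-adjoint \<open>\<Omega>\<close>.
  So no implicit function theorem enters, and the dimension is linear algebra: the products of
  \<open>v\<close> with self-adjoint operators form the orthogonal complement of the tangent space,
  of real dimension \<open>n\<^sup>2\<close>. Unitaries act as restrictions of linear isometries of
  the ambient space; these carry parametrizations to parametrizations with the same metric
  coefficients. The invariant probability is the normalized Riemannian measure: compactness makes
  the total mass finite, and \<open>n \<le> m\<close> makes it positive, since then the manifold is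
  nonempty.\<close>

lemma has_sum_group:
  fixes f :: "'i \<Rightarrow> 'e :: {topological_comm_monoid_add, t3_space}"
  assumes "(f has_sum s) I" and "\<beta> ` I \<subseteq> A"
    and "\<And>a. a \<in> A \<Longrightarrow> (f has_sum g a) {i\<in>I. \<beta> i = a}"
  shows "(g has_sum s) A"
proof -
  have bij: "bij_betw snd (SIGMA a:A. {i\<in>I. \<beta> i = a}) I"
    by (rule bij_betw_byWitness[where f' = "\<lambda>i. (\<beta> i, i)"]) (use assms(2) in auto)
  have "((\<lambda>p. f (snd p)) has_sum s) (SIGMA a:A. {i\<in>I. \<beta> i = a})"
    using assms(1) has_sum_reindex_bij_betw[OF bij, of f s] by simp
  from has_sum_SigmaD[OF this, of g] show ?thesis
    using assms(3) by simp
qed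

abbreviation coord_space :: "nat \<Rightarrow> (nat \<Rightarrow> real) set"
  where "coord_space d \<equiv> {..<d} \<rightarrow>\<^sub>E UNIV"

abbreviation multi_indices :: "nat \<Rightarrow> (nat \<Rightarrow> nat) set"
  where "multi_indices d \<equiv> {..<d} \<rightarrow>\<^sub>E UNIV"

definition mpow :: "nat \<Rightarrow> (nat \<Rightarrow> real) \<Rightarrow> (nat \<Rightarrow> nat) \<Rightarrow> real"
  where "mpow d h \<alpha> = (\<Prod>i<d. h i ^ \<alpha> i)"

definition mdeg :: "nat \<Rightarrow> (nat \<Rightarrow> nat) \<Rightarrow> nat"
  where "mdeg d \<alpha> = (\<Sum>i<d. \<alpha> i)"

definition polydisc :: "nat \<Rightarrow> real \<Rightarrow> (nat \<Rightarrow> real) \<Rightarrow> (nat \<Rightarrow> real) set"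
  where "polydisc d \<rho> x = {y \<in> coord_space d. \<forall>i<d. \<bar>y i - x i\<bar> \<le> \<rho>}"

text \<open>The weights \<open>\<rho> ^ mdeg d \<alpha>\<close> are the values of the monomials at a
  corner of the polydisc. Absolute sums can be regrouped and multiplied freely, and this one
  estimate serves all points of the closed polydisc.\<close>

definition power_series ::
  "nat \<Rightarrow> real \<Rightarrow> (nat \<Rightarrow> real) \<Rightarrow> ((nat \<Rightarrow> real) \<Rightarrow> 'e::banach) \<Rightarrow> real \<Rightarrow> ((nat \<Rightarrow> nat) \<Rightarrow> 'e) \<Rightarrow> bool"
  where "power_series d \<rho> x f C c \<longleftrightarrow>
    (\<lambda>\<alpha>. \<rho> ^ mdeg d \<alpha> * norm (c \<alpha>)) summable_on multi_indices d \<and>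
    (\<Sum>\<^sub>\<infinity>\<alpha>\<in>multi_indices d. \<rho> ^ mdeg d \<alpha> * norm (c \<alpha>)) \<le> C \<and>
    (\<forall>y\<in>polydisc d \<rho> x. ((\<lambda>\<alpha>. mpow d (\<lambda>i. y i - x i) \<alpha> *\<^sub>R c \<alpha>) has_sum f y) (multi_indices d))"

text \<open>The bound \<open>C\<close> acts as a submultiplicative norm; this makes the Neumann series of an inverse converge.\<close>

definition pser :: "nat \<Rightarrow> real \<Rightarrow> (nat \<Rightarrow> real) \<Rightarrow> ((nat \<Rightarrow> real) \<Rightarrow> 'e::banach) \<Rightarrow> real \<Rightarrow> bool"
  where "pser d \<rho> x f C \<longleftrightarrow> (\<exists>c. power_series d \<rho> x f C c)"

lemma mpow_abs_le:
  assumes "\<And>i. i < d \<Longrightarrow> \<bar>h i\<bar> \<le> \<rho>"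
  shows "\<bar>mpow d h \<alpha>\<bar> \<le> \<rho> ^ mdeg d \<alpha>"
proof -
  have "\<bar>mpow d h \<alpha>\<bar> = (\<Prod>i<d. \<bar>h i\<bar> ^ \<alpha> i)"
    by (simp add: mpow_def abs_prod power_abs)
  also have "\<dots> \<le> (\<Prod>i<d. \<rho> ^ \<alpha> i)"
    using assms by (intro prod_mono) (auto intro!: power_mono)
  finally show ?thesis by (simp add: mdeg_def power_sum)
qed

lemma polydisc_mono: "\<rho>' \<le> \<rho> \<Longrightarrow> polydisc d \<rho>' x \<subseteq> polydisc d \<rho> x"
  by (force simp: polydisc_def)

lemma mpow_add: "mpow d h (restrict (\<lambda>i. \<alpha> i + \<beta> i) {..<d}) = mpow d h \<alpha> * mpow d h \<beta>"
  by (simp add: mpow_def power_add prod.distrib)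

lemma mdeg_add: "mdeg d (restrict (\<lambda>i. \<alpha> i + \<beta> i) {..<d}) = mdeg d \<alpha> + mdeg d \<beta>"
  by (simp add: mdeg_def sum.distrib)

lemma mpow_zero:
  assumes "\<alpha> \<in> multi_indices d" "\<alpha> \<noteq> (\<lambda>i\<in>{..<d}. 0)"
  shows "mpow d (\<lambda>i. 0) \<alpha> = 0"
proof -
  obtain i where i: "\<alpha> i \<noteq> (\<lambda>i\<in>{..<d}. 0 :: nat) i"
    using assms(2) by (meson ext)
  have "i < d" using i PiE_arb[OF assms(1), of i] by (rule_tac ccontr) simp
  then have "(0 :: real) ^ \<alpha> i = 0" "i \<in> {..<d}" using i by simp_all
  then show ?thesis unfolding mpow_def by (intro prod_zero bexI[of _ i]) simp_all
qed

lemma mpow_zero_index [simp]: "mpow d h (\<lambda>i\<in>{..<d}. 0) = 1"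
  and mdeg_zero_index [simp]: "mdeg d (\<lambda>i\<in>{..<d}. 0) = 0"
  by (simp_all add: mpow_def mdeg_def)

text \<open>The common tool of the closure proofs: monomials with repeated exponents, indexed by
  whatever set arises, are collected along the fibres of \<open>\<beta>\<close>. By the triangle
  inequality collecting can only lower the weighted sum, so the bound survives.\<close>

lemma pser_group:
  fixes c :: "'i \<Rightarrow> 'e::banach"
  assumes \<rho>: "\<rho> > 0" and \<beta>: "\<And>i. i \<in> I \<Longrightarrow> \<beta> i \<in> multi_indices d"
    and s: "((\<lambda>i. \<rho> ^ mdeg d (\<beta> i) * norm (c i)) has_sum s) I" and C: "s \<le> C"
    and f: "\<And>y. y \<in> polydisc d \<rho> x \<Longrightarrow> ((\<lambda>i. mpow d (\<lambda>i. y i - x i) (\<beta> i) *\<^sub>R c i) has_sum f y) I"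
  shows "pser d \<rho> x f C"
proof -
  define F where "F = (\<lambda>\<alpha>. {i\<in>I. \<beta> i = \<alpha>})"
  define c' where "c' = (\<lambda>\<alpha>. infsum c (F \<alpha>))"
  define n' where "n' = (\<lambda>\<alpha>. infsum (\<lambda>i. norm (c i)) (F \<alpha>))"
  have sub: "\<beta> ` I \<subseteq> multi_indices d" using \<beta> by blast
  have sm: "(\<lambda>i. norm (c i)) summable_on F \<alpha>" for \<alpha>
  proof -
    have "(\<lambda>i. \<rho> ^ mdeg d (\<beta> i) * norm (c i)) summable_on F \<alpha>"
      using has_sum_imp_summable[OF s] by (rule summable_on_subset) (auto simp: F_def)
    also have "?this \<longleftrightarrow> (\<lambda>i. \<rho> ^ mdeg d \<alpha> * norm (c i)) summable_on F \<alpha>"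
      by (intro summable_on_cong) (auto simp: F_def)
    finally show ?thesis
      using \<rho> by (subst (asm) summable_on_cmult_right') auto
  qed
  have hs: "(c has_sum c' \<alpha>) (F \<alpha>)" for \<alpha>
    unfolding c'_def by (rule has_sum_infsum[OF abs_summable_summable[OF sm]])
  have hn: "((\<lambda>i. norm (c i)) has_sum n' \<alpha>) (F \<alpha>)" for \<alpha>
    unfolding n'_def using sm by (intro has_sum_infsum)
  have le: "norm (c' \<alpha>) \<le> n' \<alpha>" for \<alpha>
    unfolding c'_def n'_def using sm by (rule norm_infsum_bound)
  have 1: "((\<lambda>\<alpha>. \<rho> ^ mdeg d \<alpha> * n' \<alpha>) has_sum s) (multi_indices d)"
  proof (rule has_sum_group[OF s sub])
    fix \<alpha>
    have "((\<lambda>i. \<rho> ^ mdeg d \<alpha> * norm (c i)) has_sum \<rho> ^ mdeg d \<alpha> * n' \<alpha>) (F \<alpha>)"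
      by (intro has_sum_cmult_right hn)
    then show "((\<lambda>i. \<rho> ^ mdeg d (\<beta> i) * norm (c i)) has_sum \<rho> ^ mdeg d \<alpha> * n' \<alpha>) {i\<in>I. \<beta> i = \<alpha>}"
      unfolding F_def by (rule has_sum_cong[THEN iffD1, rotated]) auto
  qed
  have 2: "(\<lambda>\<alpha>. \<rho> ^ mdeg d \<alpha> * norm (c' \<alpha>)) summable_on multi_indices d"
    by (rule summable_on_comparison_test[OF has_sum_imp_summable[OF 1]])
       (use \<rho> le in \<open>auto intro!: mult_left_mono\<close>)
  have "(\<Sum>\<^sub>\<infinity>\<alpha>\<in>multi_indices d. \<rho> ^ mdeg d \<alpha> * norm (c' \<alpha>)) \<le> s"
    by (rule has_sum_mono[OF has_sum_infsum[OF 2] 1]) (use \<rho> le in \<open>auto intro!: mult_left_mono\<close>)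
  moreover have "((\<lambda>\<alpha>. mpow d (\<lambda>i. y i - x i) \<alpha> *\<^sub>R c' \<alpha>) has_sum f y) (multi_indices d)"
    if y: "y \<in> polydisc d \<rho> x" for y
  proof (rule has_sum_group[OF f[OF y] sub])
    fix \<alpha>
    have "((\<lambda>i. mpow d (\<lambda>i. y i - x i) \<alpha> *\<^sub>R c i) has_sum mpow d (\<lambda>i. y i - x i) \<alpha> *\<^sub>R c' \<alpha>) (F \<alpha>)"
      by (intro has_sum_scaleR hs)
    then show "((\<lambda>i. mpow d (\<lambda>i. y i - x i) (\<beta> i) *\<^sub>R c i) has_sum
        mpow d (\<lambda>i. y i - x i) \<alpha> *\<^sub>R c' \<alpha>) {i\<in>I. \<beta> i = \<alpha>}"
      unfolding F_def by (rule has_sum_cong[THEN iffD1, rotated]) auto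
  qed
  ultimately show ?thesis
    unfolding pser_def power_series_def using 2 C by (auto intro!: exI[of _ c'])
qed

lemma abs_summable_terms:
  assumes "power_series d \<rho> x f C c" "y \<in> polydisc d \<rho> x"
  shows "(\<lambda>\<alpha>. norm (mpow d (\<lambda>i. y i - x i) \<alpha> *\<^sub>R c \<alpha>)) summable_on multi_indices d"
proof (rule summable_on_comparison_test)
  show "(\<lambda>\<alpha>. \<rho> ^ mdeg d \<alpha> * norm (c \<alpha>)) summable_on multi_indices d"
    using assms by (simp add: power_series_def)
  show "norm (mpow d (\<lambda>i. y i - x i) \<alpha> *\<^sub>R c \<alpha>) \<le> \<rho> ^ mdeg d \<alpha> * norm (c \<alpha>)" for \<alpha>
    using assms(2) by (auto simp: polydisc_def intro!: mult_right_mono mpow_abs_le)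
qed auto

lemma pser_norm_le:
  assumes "pser d \<rho> x f C" "y \<in> polydisc d \<rho> x"
  shows "norm (f y) \<le> C"
proof -
  obtain c where c: "power_series d \<rho> x f C c" using assms(1) by (auto simp: pser_def)
  have "norm (f y) \<le> (\<Sum>\<^sub>\<infinity>\<alpha>\<in>multi_indices d. norm (mpow d (\<lambda>i. y i - x i) \<alpha> *\<^sub>R c \<alpha>))"
    using c assms(2)
    by (intro norm_has_sum_bound[OF has_sum_infsum[OF abs_summable_terms[OF c assms(2)]]])
       (simp add: power_series_def)
  also have "\<dots> \<le> (\<Sum>\<^sub>\<infinity>\<alpha>\<in>multi_indices d. \<rho> ^ mdeg d \<alpha> * norm (c \<alpha>))"
    using c abs_summable_terms[OF c assms(2)] assms(2)
    by (intro infsum_mono) (auto simp: power_series_def polydisc_def intro!: mult_right_mono mpow_abs_le)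
  finally show ?thesis using c by (simp add: power_series_def)
qed

lemma pser_mono:
  assumes "pser d \<rho> x f C" "0 < \<rho>'" "\<rho>' \<le> \<rho>" "C \<le> C'"
  shows "pser d \<rho>' x f C'"
proof -
  obtain c where c: "power_series d \<rho> x f C c" using assms(1) by (auto simp: pser_def)
  have le: "\<rho>' ^ mdeg d \<alpha> * norm (c \<alpha>) \<le> \<rho> ^ mdeg d \<alpha> * norm (c \<alpha>)" for \<alpha>
    using assms(2,3) by (intro mult_right_mono power_mono) auto
  have s: "(\<lambda>\<alpha>. \<rho>' ^ mdeg d \<alpha> * norm (c \<alpha>)) summable_on multi_indices d"
    by (rule summable_on_comparison_test[of "\<lambda>\<alpha>. \<rho> ^ mdeg d \<alpha> * norm (c \<alpha>)"])
       (use c le assms(2) in \<open>auto simp: power_series_def\<close>)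
  have "(\<Sum>\<^sub>\<infinity>\<alpha>\<in>multi_indices d. \<rho>' ^ mdeg d \<alpha> * norm (c \<alpha>))
      \<le> (\<Sum>\<^sub>\<infinity>\<alpha>\<in>multi_indices d. \<rho> ^ mdeg d \<alpha> * norm (c \<alpha>))"
    using c le by (intro infsum_mono s) (auto simp: power_series_def)
  then show ?thesis
    unfolding pser_def power_series_def
    using c s assms(4) subsetD[OF polydisc_mono[OF assms(3)]]
    by (intro exI[of _ c]) (simp add: power_series_def)
qed

lemma has_sum_times_nonneg:
  fixes f :: "'a \<Rightarrow> real" and g :: "'b \<Rightarrow> real"
  assumes f: "(f has_sum a) A" and g: "(g has_sum b) B"
    and nn: "\<And>x. x \<in> A \<Longrightarrow> f x \<ge> 0" "\<And>y. y \<in> B \<Longrightarrow> g y \<ge> 0"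
  shows "((\<lambda>(x, y). f x * g y) has_sum a * b) (A \<times> B)"
proof -
  have 1: "((\<lambda>y. f x * g y) has_sum f x * b) B" for x
    using g by (rule has_sum_cmult_right)
  have 2: "((\<lambda>x. f x * b) has_sum a * b) A"
    using f by (rule has_sum_cmult_left)
  have "(\<lambda>(x, y). f x * g y) summable_on A \<times> B"
    by (rule summable_on_SigmaI[where g = "\<lambda>x. f x * b"])
       (use 1 has_sum_imp_summable[OF 2] nn in auto)
  then show ?thesis
    using 1 2 by (intro has_sum_SigmaI[where g = "\<lambda>x. f x * b"]) auto
qed

text \<open>The bounds add up like norms of a complete space, so a series of functions with summable
  bounds is again a power series on the same polydisc. With an infinite index set this sums the
  Neumann series in \<open>germ_inverse\<close>.\<close>

lemma pser_has_sum:
  fixes f :: "'k \<Rightarrow> (nat \<Rightarrow> real) \<Rightarrow> 'e::banach"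
  assumes \<rho>: "\<rho> > 0" and f: "\<And>k. k \<in> K \<Longrightarrow> pser d \<rho> x (f k) (C k)"
    and C: "(C has_sum S) K"
    and F: "\<And>y. y \<in> polydisc d \<rho> x \<Longrightarrow> ((\<lambda>k. f k y) has_sum F y) K"
  shows "pser d \<rho> x F S"
proof -
  obtain c where c: "power_series d \<rho> x (f k) (C k) (c k)" if "k \<in> K" for k
    using f unfolding pser_def by metis
  define t where "t = (\<lambda>k. \<Sum>\<^sub>\<infinity>\<alpha>\<in>multi_indices d. \<rho> ^ mdeg d \<alpha> * norm (c k \<alpha>))"
  have t: "((\<lambda>\<alpha>. \<rho> ^ mdeg d \<alpha> * norm (c k \<alpha>)) has_sum t k) (multi_indices d)" if "k \<in> K" for k
    using c[OF that] unfolding t_def by (intro has_sum_infsum) (simp add: power_series_def)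
  have tC: "t k \<le> C k" if "k \<in> K" for k
    using c[OF that] by (simp add: t_def power_series_def)
  have t0: "t k \<ge> 0" for k
    unfolding t_def using \<rho> by (intro infsum_nonneg) auto
  have ts: "t summable_on K"
    by (rule summable_on_comparison_test[OF has_sum_imp_summable[OF C] tC t0])
  have tS: "infsum t K \<le> S"
    by (rule has_sum_mono[OF has_sum_infsum[OF ts] C tC])
  have sm: "(\<lambda>(k, \<alpha>). \<rho> ^ mdeg d \<alpha> * norm (c k \<alpha>)) summable_on K \<times> multi_indices d"
    by (rule summable_on_SigmaI[where g = t]) (use t ts \<rho> in auto)
  have hs: "((\<lambda>(k, \<alpha>). \<rho> ^ mdeg d \<alpha> * norm (c k \<alpha>)) has_sum infsum t K) (K \<times> multi_indices d)"
    by (rule has_sum_SigmaI[where g = t]) (use t sm has_sum_infsum[OF ts] in auto)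
  show ?thesis
  proof (rule pser_group[OF \<rho>, where I = "K \<times> multi_indices d" and \<beta> = snd
        and c = "\<lambda>(k, \<alpha>). c k \<alpha>"])
    show "((\<lambda>i. \<rho> ^ mdeg d (snd i) * norm (case i of (k, x) \<Rightarrow> c k x)) has_sum infsum t K) (K \<times> multi_indices d)"
      using hs by (simp add: case_prod_unfold)
  next
    fix y assume y: "y \<in> polydisc d \<rho> x"
    have "((\<lambda>(k, \<alpha>). mpow d (\<lambda>i. y i - x i) \<alpha> *\<^sub>R c k \<alpha>) has_sum F y) (K \<times> multi_indices d)"
    proof (rule has_sum_SigmaI[OF _ F[OF y]])
      show "((\<lambda>\<alpha>. case (k, \<alpha>) of (k, \<alpha>) \<Rightarrow> mpow d (\<lambda>i. y i - x i) \<alpha> *\<^sub>R c k \<alpha>) has_sum f k y) (multi_indices d)"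
        if "k \<in> K" for k
        using c[OF that] y by (simp add: power_series_def)
      show "(\<lambda>(k, \<alpha>). mpow d (\<lambda>i. y i - x i) \<alpha> *\<^sub>R c k \<alpha>) summable_on K \<times> multi_indices d"
        by (rule abs_summable_summable, rule summable_on_comparison_test[OF sm])
           (use y \<rho> in \<open>auto simp: polydisc_def intro!: mult_right_mono mpow_abs_le\<close>)
    qed
    then show "((\<lambda>i. mpow d (\<lambda>i. y i - x i) (snd i) *\<^sub>R (case i of (k, x) \<Rightarrow> c k x)) has_sum F y) (K \<times> multi_indices d)"
      by (simp add: case_prod_unfold)
  qed (use tS in \<open>auto simp: PiE_def\<close>)
qed

text \<open>The Cauchy product, indexed by pairs of multi-indices and then collected by their sum.
  The constant 1 in \<open>nh\<close> makes the bounds multiply without a further factor, so that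
  the powers of a bound below 1 decay geometrically.\<close>

lemma pser_bilinear:
  fixes f :: "(nat \<Rightarrow> real) \<Rightarrow> 'e::banach" and g :: "(nat \<Rightarrow> real) \<Rightarrow> 'f::banach"
    and h :: "'e \<Rightarrow> 'f \<Rightarrow> 'g::banach"
  assumes \<rho>: "\<rho> > 0" and f: "pser d \<rho> x f C" and g: "pser d \<rho> x g D"
    and h: "bounded_bilinear h" and nh: "\<And>a b. norm (h a b) \<le> norm a * norm b"
  shows "pser d \<rho> x (\<lambda>y. h (f y) (g y)) (C * D)"
proof -
  interpret bounded_bilinear h by fact
  obtain a where a: "power_series d \<rho> x f C a" using f by (auto simp: pser_def)
  obtain b where b: "power_series d \<rho> x g D b" using g by (auto simp: pser_def)
  let ?M = "multi_indices d"
  define s where "s = (\<Sum>\<^sub>\<infinity>\<alpha>\<in>?M. \<rho> ^ mdeg d \<alpha> * norm (a \<alpha>))"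
  define t where "t = (\<Sum>\<^sub>\<infinity>\<alpha>\<in>?M. \<rho> ^ mdeg d \<alpha> * norm (b \<alpha>))"
  define add where "add = (\<lambda>(\<alpha>, \<beta>). restrict (\<lambda>i. \<alpha> i + \<beta> i :: nat) {..<d})"
  have s: "((\<lambda>\<alpha>. \<rho> ^ mdeg d \<alpha> * norm (a \<alpha>)) has_sum s) ?M" "s \<le> C" "0 \<le> s"
    unfolding s_def using a \<rho> by (auto simp: power_series_def intro!: infsum_nonneg)
  have t: "((\<lambda>\<alpha>. \<rho> ^ mdeg d \<alpha> * norm (b \<alpha>)) has_sum t) ?M" "t \<le> D" "0 \<le> t"
    unfolding t_def using b \<rho> by (auto simp: power_series_def intro!: infsum_nonneg)
  have st: "((\<lambda>(\<alpha>, \<beta>). (\<rho> ^ mdeg d \<alpha> * norm (a \<alpha>)) * (\<rho> ^ mdeg d \<beta> * norm (b \<beta>))) has_sum s * t) (?M \<times> ?M)"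
    using s(1) t(1) by (rule has_sum_times_nonneg) (use \<rho> in auto)
  define c where "c = (\<lambda>(\<alpha>, \<beta>). h (a \<alpha>) (b \<beta>))"
  have le: "\<rho> ^ mdeg d (add p) * norm (c p)
      \<le> (case p of (\<alpha>, \<beta>) \<Rightarrow> (\<rho> ^ mdeg d \<alpha> * norm (a \<alpha>)) * (\<rho> ^ mdeg d \<beta> * norm (b \<beta>)))" for p
  proof -
    obtain \<alpha> \<beta> where p: "p = (\<alpha>, \<beta>)" by (cases p)
    have "\<rho> ^ mdeg d \<alpha> * \<rho> ^ mdeg d \<beta> * norm (h (a \<alpha>) (b \<beta>))
      \<le> \<rho> ^ mdeg d \<alpha> * \<rho> ^ mdeg d \<beta> * (norm (a \<alpha>) * norm (b \<beta>))"
      using \<rho> by (intro mult_left_mono nh) auto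
    then show ?thesis by (simp add: p add_def c_def mdeg_add power_add mult_ac)
  qed
  have sm: "(\<lambda>p. \<rho> ^ mdeg d (add p) * norm (c p)) summable_on ?M \<times> ?M"
    by (rule summable_on_comparison_test[OF has_sum_imp_summable[OF st]]) (use le \<rho> in auto)
  have sle: "(\<Sum>\<^sub>\<infinity>p\<in>?M \<times> ?M. \<rho> ^ mdeg d (add p) * norm (c p)) \<le> s * t"
    by (rule has_sum_mono[OF has_sum_infsum[OF sm] st le])
  show ?thesis
  proof (rule pser_group[OF \<rho>, where I = "?M \<times> ?M" and \<beta> = add and c = c, OF _ has_sum_infsum[OF sm]])
    show "(\<Sum>\<^sub>\<infinity>p\<in>?M \<times> ?M. \<rho> ^ mdeg d (add p) * norm (c p)) \<le> C * D"
      using sle s t by (meson mult_mono order_trans)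
  next
    fix y assume y: "y \<in> polydisc d \<rho> x"
    define m where "m = mpow d (\<lambda>i. y i - x i)"
    have fa: "((\<lambda>\<alpha>. m \<alpha> *\<^sub>R a \<alpha>) has_sum f y) ?M" and gb: "((\<lambda>\<alpha>. m \<alpha> *\<^sub>R b \<alpha>) has_sum g y) ?M"
      using a b y by (auto simp: power_series_def m_def)
    have eq: "m (add p) *\<^sub>R c p = h (m (fst p) *\<^sub>R a (fst p)) (m (snd p) *\<^sub>R b (snd p))" for p
      by (cases p) (simp add: m_def add_def mpow_add c_def scaleR_left scaleR_right mult.commute)
    have "((\<lambda>p. m (add p) *\<^sub>R c p) has_sum h (f y) (g y)) (?M \<times> ?M)"
    proof (rule has_sum_SigmaI)
      show "((\<lambda>\<beta>. m (add (\<alpha>, \<beta>)) *\<^sub>R c (\<alpha>, \<beta>)) has_sum h (m \<alpha> *\<^sub>R a \<alpha>) (g y)) ?M" for \<alpha>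
        unfolding eq fst_conv snd_conv using bounded_linear_right gb by (rule has_sum_bounded_linear)
      show "((\<lambda>\<alpha>. h (m \<alpha> *\<^sub>R a \<alpha>) (g y)) has_sum h (f y) (g y)) ?M"
        using bounded_linear_left fa by (rule has_sum_bounded_linear)
      show "(\<lambda>p. m (add p) *\<^sub>R c p) summable_on ?M \<times> ?M"
        by (rule abs_summable_summable, rule summable_on_comparison_test[OF sm])
           (use y \<rho> in \<open>auto simp: polydisc_def m_def intro!: mult_right_mono mpow_abs_le\<close>)
    qed
    then show "((\<lambda>p. mpow d (\<lambda>i. y i - x i) (add p) *\<^sub>R c p) has_sum h (f y) (g y)) (?M \<times> ?M)"
      unfolding m_def .
  next
    show "add p \<in> ?M" for p by (cases p) (simp add: add_def)
  qed
qed

lemma pser_const: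
  assumes "\<rho> > 0"
  shows "pser d \<rho> x (\<lambda>_. a) (norm a)"
  by (rule pser_group[OF assms, where I = "{()}" and \<beta> = "\<lambda>_. \<lambda>i\<in>{..<d}. 0" and c = "\<lambda>_. a"
        and s = "norm a"])
     (auto intro!: has_sum_finiteI)

lemma mpow_unit [simp]:
  assumes "i < d"
  shows "mpow d h (\<lambda>j\<in>{..<d}. if j = i then 1 else 0) = h i"
    and "mdeg d (\<lambda>j\<in>{..<d}. if j = i then 1 else 0) = 1"
  using assms by (simp_all add: mpow_def mdeg_def if_distrib[of "\<lambda>k. _ ^ k"] cong: if_cong)

lemma pser_coord:
  assumes "\<rho> > 0" "i < d"
  shows "pser d \<rho> x (\<lambda>y. y i - x i) \<rho>"
  by (rule pser_group[OF assms(1), where I = "{()}" and \<beta> = "\<lambda>_. \<lambda>j\<in>{..<d}. if j = i then 1 else 0"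
        and c = "\<lambda>_. 1" and s = \<rho>])
     (use assms in \<open>auto intro!: has_sum_finiteI\<close>)

lemma pser_sum:
  assumes "\<rho> > 0" "finite K" "\<And>k. k \<in> K \<Longrightarrow> pser d \<rho> x (f k) (C k)"
  shows "pser d \<rho> x (\<lambda>y. \<Sum>k\<in>K. f k y) (\<Sum>k\<in>K. C k)"
  by (rule pser_has_sum[OF assms(1), where K = K and C = C and f = f])
     (use assms in \<open>auto intro!: has_sum_finiteI\<close>)

lemma power_series_center:
  assumes "power_series d \<rho> x f C c" "x \<in> coord_space d" "\<rho> > 0"
  shows "f x = c (\<lambda>i\<in>{..<d}. 0)"
proof -
  let ?M = "multi_indices d" and ?z = "\<lambda>i\<in>{..<d}. 0 :: nat"
  have "((\<lambda>\<alpha>. mpow d (\<lambda>i. x i - x i) \<alpha> *\<^sub>R c \<alpha>) has_sum f x) ?M"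
    using assms by (auto simp: power_series_def polydisc_def)
  moreover have "((\<lambda>\<alpha>. mpow d (\<lambda>i. x i - x i) \<alpha> *\<^sub>R c \<alpha>) has_sum c ?z) ?M"
    by (rule has_sum_finite_neutralI[of "{?z}"]) (auto simp: mpow_zero)
  ultimately show ?thesis using has_sum_unique by blast
qed

text \<open>A function vanishing at the centre has no constant term, so every monomial left has
  degree at least 1 and gains a factor \<open>t\<close> when the radius does. This is how a bound is
  pushed below 1.\<close>

lemma pser_shrink:
  assumes "pser d \<rho> x f C" "f x = 0" "x \<in> coord_space d" "0 < t" "t \<le> 1" "\<rho> > 0"
  shows "pser d (t * \<rho>) x f (t * C)"
proof -
  obtain c where c: "power_series d \<rho> x f C c" using assms(1) by (auto simp: pser_def)
  let ?M = "multi_indices d" and ?z = "\<lambda>i\<in>{..<d}. 0 :: nat"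
  have c0: "c ?z = 0" using power_series_center[OF c] assms by simp
  have le: "(t * \<rho>) ^ mdeg d \<alpha> * norm (c \<alpha>) \<le> t * (\<rho> ^ mdeg d \<alpha> * norm (c \<alpha>))" if "\<alpha> \<in> ?M" for \<alpha>
  proof (cases "mdeg d \<alpha> = 0")
    case True
    then have "\<alpha> = ?z" using that by (auto simp: mdeg_def PiE_def extensional_def fun_eq_iff)
    then show ?thesis using c0 by simp
  next
    case False
    then have "t ^ mdeg d \<alpha> \<le> t ^ 1" using assms(4,5) by (intro power_decreasing) auto
    then have "t ^ mdeg d \<alpha> * (\<rho> ^ mdeg d \<alpha> * norm (c \<alpha>)) \<le> t * (\<rho> ^ mdeg d \<alpha> * norm (c \<alpha>))"
      using assms(6) by (intro mult_right_mono) auto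
    then show ?thesis by (simp add: power_mult_distrib)
  qed
  have s: "((\<lambda>\<alpha>. t * (\<rho> ^ mdeg d \<alpha> * norm (c \<alpha>))) has_sum t * (\<Sum>\<^sub>\<infinity>\<alpha>\<in>?M. \<rho> ^ mdeg d \<alpha> * norm (c \<alpha>))) ?M"
    using c by (intro has_sum_cmult_right has_sum_infsum) (simp add: power_series_def)
  have s': "(\<lambda>\<alpha>. (t * \<rho>) ^ mdeg d \<alpha> * norm (c \<alpha>)) summable_on ?M"
    by (rule summable_on_comparison_test[OF has_sum_imp_summable[OF s] le]) (use assms in auto)
  have "(\<Sum>\<^sub>\<infinity>\<alpha>\<in>?M. (t * \<rho>) ^ mdeg d \<alpha> * norm (c \<alpha>)) \<le> t * (\<Sum>\<^sub>\<infinity>\<alpha>\<in>?M. \<rho> ^ mdeg d \<alpha> * norm (c \<alpha>))"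
    by (rule has_sum_mono[OF has_sum_infsum[OF s'] s le])
  also have "\<dots> \<le> t * C" using c assms(4) by (intro mult_left_mono) (auto simp: power_series_def)
  finally have "power_series d (t * \<rho>) x f (t * C) c"
    using c s' polydisc_mono[of "t * \<rho>" \<rho>] assms(4,5,6) by (auto simp: power_series_def)
  then show ?thesis by (auto simp: pser_def)
qed

lemma pser_bounded_linear:
  fixes f :: "(nat \<Rightarrow> real) \<Rightarrow> 'e::banach" and L :: "'e \<Rightarrow> 'f::banach"
  assumes f: "pser d \<rho> x f C" and L: "bounded_linear L" and \<rho>: "\<rho> > 0"
  shows "\<exists>D. pser d \<rho> x (\<lambda>y. L (f y)) D"
proof -
  interpret bounded_linear L by fact
  obtain c where c: "power_series d \<rho> x f C c" using f by (auto simp: pser_def)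
  obtain K where K: "\<And>a. norm (L a) \<le> norm a * K" "K \<ge> 0" using nonneg_bounded by blast
  let ?M = "multi_indices d"
  have "(\<lambda>\<alpha>. (\<rho> ^ mdeg d \<alpha> * norm (c \<alpha>)) * K) summable_on ?M"
    using c by (intro summable_on_cmult_left) (simp add: power_series_def)
  then have "(\<lambda>\<alpha>. \<rho> ^ mdeg d \<alpha> * norm (L (c \<alpha>))) summable_on ?M"
    by (rule summable_on_comparison_test) (use K \<rho> in \<open>auto simp: mult.assoc intro!: mult_left_mono\<close>)
  then have "power_series d \<rho> x (\<lambda>y. L (f y)) (\<Sum>\<^sub>\<infinity>\<alpha>\<in>?M. \<rho> ^ mdeg d \<alpha> * norm (L (c \<alpha>))) (\<lambda>\<alpha>. L (c \<alpha>))"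
    using c has_sum_bounded_linear[OF L]
    by (fastforce simp: power_series_def scaleR[symmetric] simp del: scaleR)
  then show ?thesis by (auto simp: pser_def)
qed

section \<open>Germs of analytic functions, with radius and bound left unspecified\<close>

definition germ :: "nat \<Rightarrow> ((nat \<Rightarrow> real) \<Rightarrow> 'e::banach) \<Rightarrow> (nat \<Rightarrow> real) \<Rightarrow> bool"
  where "germ d f x \<longleftrightarrow> (\<exists>\<rho>>0. \<exists>C. pser d \<rho> x f C)"

lemma germ_cong:
  assumes "germ d f x" "\<epsilon> > 0" "\<And>y. y \<in> polydisc d \<epsilon> x \<Longrightarrow> f y = g y"
  shows "germ d g x"
proof -
  obtain \<rho> C c where \<rho>: "\<rho> > 0" and c: "power_series d \<rho> x f C c"
    using assms(1) by (auto simp: germ_def pser_def)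
  have "pser d \<rho> x f C"
    using c by (auto simp: pser_def)
  then have "pser d (min \<rho> \<epsilon>) x f C"
    by (rule pser_mono) (use \<rho> assms(2) in auto)
  then have "pser d (min \<rho> \<epsilon>) x g C"
    using polydisc_mono[of "min \<rho> \<epsilon>" \<epsilon> d x] assms(3) by (auto simp: pser_def power_series_def subset_iff)
  then show ?thesis
    unfolding germ_def using \<rho> assms(2) by (intro exI[of _ "min \<rho> \<epsilon>"]) auto
qed

lemma germ_const [simp]: "germ d (\<lambda>_. a) x"
  unfolding germ_def using pser_const zero_less_one by blast

lemma germ_coord:
  assumes "i < d"
  shows "germ d (\<lambda>y. y i) x"
proof -
  have "pser d 1 x (\<lambda>y. \<Sum>k\<in>{True, False}. if k then y i - x i else x i)
    (\<Sum>k\<in>{True, False}. if k then 1 else norm (x i))"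
    by (rule pser_sum) (use assms pser_coord[of 1 i d x] pser_const[of 1 d x "x i"] in auto)
  then show ?thesis
    unfolding germ_def by (intro exI[of _ 1]) auto
qed

lemma germ_bilinear:
  assumes "germ d f x" "germ d g x" and h: "bounded_bilinear h" and nh: "\<And>a b. norm (h a b) \<le> norm a * norm b"
  shows "germ d (\<lambda>y. h (f y) (g y)) x"
proof -
  obtain \<rho> C \<rho>' C' where *: "\<rho> > 0" "pser d \<rho> x f C" "\<rho>' > 0" "pser d \<rho>' x g C'"
    using assms(1,2) by (auto simp: germ_def)
  have "pser d (min \<rho> \<rho>') x f C" "pser d (min \<rho> \<rho>') x g C'"
    using * by (auto intro: pser_mono[OF *(2)] pser_mono[OF *(4)])
  then have "pser d (min \<rho> \<rho>') x (\<lambda>y. h (f y) (g y)) (C * C')"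
    using * by (intro pser_bilinear h nh) auto
  then show ?thesis
    unfolding germ_def using * by (intro exI[of _ "min \<rho> \<rho>'"]) auto
qed

lemma germ_bounded_linear:
  assumes "germ d f x" and L: "bounded_linear L"
  shows "germ d (\<lambda>y. L (f y)) x"
  using assms pser_bounded_linear[OF _ L] unfolding germ_def by blast

lemma germ_add:
  assumes "germ d f x" "germ d g x"
  shows "germ d (\<lambda>y. f y + g y) x"
proof -
  obtain \<rho> C \<rho>' C' where *: "\<rho> > 0" "pser d \<rho> x f C" "\<rho>' > 0" "pser d \<rho>' x g C'"
    using assms(1,2) by (auto simp: germ_def)
  define r where "r = min \<rho> \<rho>'"
  have r: "r > 0" using * by (simp add: r_def)
  have "pser d r x f C" "pser d r x g C'"
    using * by (auto intro: pser_mono[OF *(2)] pser_mono[OF *(4)] simp: r_def)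
  then have "pser d r x (\<lambda>y. \<Sum>k\<in>{True, False}. (if k then f else g) y)
    (\<Sum>k\<in>{True, False}. if k then C else C')"
    by (intro pser_sum r) auto
  then show ?thesis
    unfolding germ_def using r by (intro exI[of _ r]) auto
qed

lemma germ_uminus: "germ d f x \<Longrightarrow> germ d (\<lambda>y. - f y) x"
  by (rule germ_bounded_linear[OF _ bounded_linear_minus[OF bounded_linear_ident]])

lemma germ_diff: "germ d f x \<Longrightarrow> germ d g x \<Longrightarrow> germ d (\<lambda>y. f y - g y) x"
  using germ_add[OF _ germ_uminus, of d f x g] by simp

lemma germ_sum: "(\<And>k. k \<in> K \<Longrightarrow> germ d (f k) x) \<Longrightarrow> germ d (\<lambda>y. \<Sum>k\<in>K. f k y) x"
  by (induction K rule: infinite_finite_induct) (auto intro: germ_add)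

lemma germ_scaleR: "germ d f x \<Longrightarrow> germ d g x \<Longrightarrow> germ d (\<lambda>y. f y *\<^sub>R g y) x"
  by (rule germ_bilinear[OF _ _ bounded_bilinear_scaleR]) simp_all

lemma real_analytic_onI:
  fixes f :: "(nat \<Rightarrow> real) \<Rightarrow> 'e::banach"
  assumes "\<And>x. x \<in> U \<Longrightarrow> germ d f x"
  shows "real_analytic_on d f U"
  unfolding real_analytic_on_def
proof
  fix x assume x: "x \<in> U"
  obtain \<rho> C c where \<rho>: "\<rho> > 0" and c: "power_series d \<rho> x f C c"
    using assms[OF x] unfolding germ_def pser_def by blast
  show "\<exists>c. \<exists>\<epsilon>>0. \<forall>y\<in>topspace (coord_topology d). (\<forall>i<d. \<bar>y i - x i\<bar> < \<epsilon>) \<longrightarrow>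
      ((\<lambda>\<alpha>. (\<Prod>i<d. (y i - x i) ^ \<alpha> i) *\<^sub>R c \<alpha>) has_sum f y) (multi_indices d)"
    by (intro exI[of _ c] exI[of _ \<rho>] conjI \<rho> ballI impI)
       (use c in \<open>auto simp: power_series_def polydisc_def mpow_def less_imp_le\<close>)
qed

text \<open>For real numbers unconditional and absolute summability coincide, so convergence at a
  single corner of a polydisc already yields the weighted estimate on all of it.\<close>

lemma real_analytic_onD:
  fixes f :: "(nat \<Rightarrow> real) \<Rightarrow> real"
  assumes "real_analytic_on d f U" "x \<in> U"
  shows "germ d f x"
proof -
  obtain c \<epsilon> where \<epsilon>: "\<epsilon> > 0" and c': "\<forall>y\<in>topspace (coord_topology d). (\<forall>i<d. \<bar>y i - x i\<bar> < \<epsilon>) \<longrightarrow>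
      ((\<lambda>\<alpha>. (\<Prod>i<d. (y i - x i) ^ \<alpha> i) *\<^sub>R c \<alpha>) has_sum f y) (multi_indices d)"
    using assms unfolding real_analytic_on_def by blast
  have c: "((\<lambda>\<alpha>. (\<Prod>i<d. (y i - x i) ^ \<alpha> i) *\<^sub>R c \<alpha>) has_sum f y) (multi_indices d)"
    if "y \<in> coord_space d" "\<And>i. i < d \<Longrightarrow> \<bar>y i - x i\<bar> < \<epsilon>" for y
    using c' that by simp
  \<comment> \<open>Half of \<open>\<epsilon>\<close> keeps the corner \<open>x + \<rho>\<close>
    strictly inside the region of convergence; at that corner the monomials are exactly the
    weights.\<close>
  define \<rho> where "\<rho> = \<epsilon> / 2"
  define y where "y = (\<lambda>i\<in>{..<d}. x i + \<rho>)"
  have "((\<lambda>\<alpha>. (\<Prod>i<d. (y i - x i) ^ \<alpha> i) *\<^sub>R c \<alpha>) has_sum f y) (multi_indices d)"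
    using \<epsilon> by (intro c) (simp_all add: y_def \<rho>_def PiE_iff extensional_def)
  also have "(\<lambda>\<alpha>. (\<Prod>i<d. (y i - x i) ^ \<alpha> i) *\<^sub>R c \<alpha>) = (\<lambda>\<alpha>. \<rho> ^ mdeg d \<alpha> * c \<alpha>)"
    by (simp add: y_def mdeg_def power_sum)
  finally have "(\<lambda>\<alpha>. norm (\<rho> ^ mdeg d \<alpha> * c \<alpha>)) summable_on multi_indices d"
    by (rule has_sum_imp_summable[THEN summable_on_iff_abs_summable_on_real[THEN iffD1]])
  then have "(\<lambda>\<alpha>. \<rho> ^ mdeg d \<alpha> * norm (c \<alpha>)) summable_on multi_indices d"
    using \<epsilon> by (simp add: abs_mult \<rho>_def)
  then have "power_series d \<rho> x f (\<Sum>\<^sub>\<infinity>\<alpha>\<in>multi_indices d. \<rho> ^ mdeg d \<alpha> * norm (c \<alpha>)) c"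
    unfolding power_series_def mpow_def
  proof (intro conjI ballI order_refl)
    fix y assume y: "y \<in> polydisc d \<rho> x"
    have "\<bar>y i - x i\<bar> < \<epsilon>" if "i < d" for i
    proof -
      have "\<bar>y i - x i\<bar> \<le> \<rho>" using y that by (simp add: polydisc_def)
      then show ?thesis using \<epsilon> by (simp add: \<rho>_def)
    qed
    then show "((\<lambda>\<alpha>. (\<Prod>i<d. (y i - x i) ^ \<alpha> i) *\<^sub>R c \<alpha>) has_sum f y) (multi_indices d)"
      using y by (intro c) (simp_all add: polydisc_def)
  qed
  then show ?thesis
    unfolding germ_def pser_def using \<epsilon> by (intro exI[of _ \<rho>]) (auto simp: \<rho>_def)
qed

section \<open>Termwise partial derivatives\<close>

lemma mpow_remove:
  assumes "i < d"
  shows "mpow d w \<alpha> = w i ^ \<alpha> i * (\<Prod>j\<in>{..<d} - {i}. w j ^ \<alpha> j)"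
  unfolding mpow_def using assms by (subst prod.remove[of _ i]) auto

lemma mdeg_remove:
  assumes "i < d"
  shows "mdeg d \<alpha> = \<alpha> i + (\<Sum>j\<in>{..<d} - {i}. \<alpha> j)"
  unfolding mdeg_def using assms by (subst sum.remove[of _ i]) auto

text \<open>Halving the radius pays for the factor \<open>n\<close> that differentiation produces,
  because \<open>n \<le> 2 ^ n\<close>.\<close>

lemma of_nat_times_half_power_le:
  assumes "\<rho> > (0::real)"
  shows "real n * (\<rho> / 2) ^ (n - 1) \<le> 2 / \<rho> * \<rho> ^ n"
proof (cases n)
  case (Suc m)
  have "real (Suc m) \<le> 2 ^ Suc m"
    using less_exp[of "Suc m"] by (metis less_imp_le of_nat_le_numeral_power_cancel_iff)
  then have "real (Suc m) * \<rho> ^ m \<le> 2 ^ Suc m * \<rho> ^ m"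
    using assms by (intro mult_right_mono) auto
  then show ?thesis using Suc assms by (simp add: power_divide field_simps)
qed (use assms in simp)

text \<open>With the other coordinates frozen, the terms are grouped by the exponent of variable
  \<open>i\<close>. This leaves a power series in one real variable, which may be differentiated
  termwise; undoing the grouping gives the formally differentiated series in \<open>d\<close>
  variables, convergent on the polydisc of half the radius.\<close>

lemma germ_partial:
  fixes f :: "(nat \<Rightarrow> real) \<Rightarrow> real"
  assumes "germ d f x" "i < d"
  shows "germ d (partial i f) x"
    and "\<exists>\<epsilon>>0. \<forall>y\<in>polydisc d \<epsilon> x. \<exists>D. ((\<lambda>t. f (y(i := t))) has_real_derivative D) (at (y i))"
proof -
  obtain \<rho> C c where \<rho>: "\<rho> > 0" and c: "power_series d \<rho> x f C c"
    using assms by (auto simp: germ_def pser_def)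
  let ?M = "multi_indices d"
  define r where "r = \<rho> / 2"
  have r: "r > 0" "r < \<rho>" using \<rho> by (auto simp: r_def)
  \<comment> \<open>Subtraction is truncated, so exponent 0 stays 0; the factor
    \<open>\<alpha> i\<close> in \<open>c'\<close> removes those terms.\<close>
  define \<beta> where "\<beta> = (\<lambda>\<alpha>::nat \<Rightarrow> nat. \<alpha>(i := \<alpha> i - 1))"
  define c' where "c' = (\<lambda>\<alpha>. real (\<alpha> i) * c \<alpha>)"
  have sc: "(\<lambda>\<alpha>. \<rho> ^ mdeg d \<alpha> * norm (c \<alpha>)) summable_on ?M"
    using c by (simp add: power_series_def)
  have deg\<beta>: "mdeg d (\<beta> \<alpha>) = mdeg d \<alpha> - 1" if "\<alpha> i \<noteq> 0" for \<alpha>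
    using that by (simp add: mdeg_remove[OF assms(2)] \<beta>_def)
  have le: "r ^ mdeg d (\<beta> \<alpha>) * norm (c' \<alpha>) \<le> 2 / \<rho> * (\<rho> ^ mdeg d \<alpha> * norm (c \<alpha>))" for \<alpha>
  proof (cases "\<alpha> i = 0")
    case False
    have "real (\<alpha> i) \<le> real (mdeg d \<alpha>)"
      by (simp add: mdeg_remove[OF assms(2)] sum_nonneg)
    then have "real (\<alpha> i) * r ^ mdeg d (\<beta> \<alpha>) \<le> real (mdeg d \<alpha>) * r ^ (mdeg d \<alpha> - 1)"
      unfolding deg\<beta>[where \<alpha> = \<alpha>, OF False] using r by (intro mult_right_mono) auto
    also have "\<dots> \<le> 2 / \<rho> * \<rho> ^ mdeg d \<alpha>"
      unfolding r_def by (rule of_nat_times_half_power_le[OF \<rho>])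
    finally have "real (\<alpha> i) * r ^ mdeg d (\<beta> \<alpha>) * norm (c \<alpha>) \<le> 2 / \<rho> * \<rho> ^ mdeg d \<alpha> * norm (c \<alpha>)"
      by (rule mult_right_mono) simp
    then show ?thesis by (simp add: c'_def abs_mult mult_ac)
  qed (use \<rho> in \<open>simp add: c'_def\<close>)
  have sM: "(\<lambda>\<alpha>. r ^ mdeg d (\<beta> \<alpha>) * norm (c' \<alpha>)) summable_on ?M"
    by (rule summable_on_comparison_test[OF summable_on_cmult_right[OF sc] le]) (use r in auto)
  have D: "\<exists>D. ((\<lambda>t. f (y(i := t))) has_real_derivative D) (at (y i)) \<and>
      ((\<lambda>\<alpha>. mpow d (\<lambda>j. y j - x j) (\<beta> \<alpha>) * c' \<alpha>) has_sum D) ?M"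
    if y: "y \<in> polydisc d r x" for y
  proof -
    define P where "P = (\<lambda>\<alpha>. \<Prod>j\<in>{..<d} - {i}. (y j - x j) ^ \<alpha> j)"
    define b where "b = (\<lambda>\<alpha>. P \<alpha> * c \<alpha>)"
    define F where "F = (\<lambda>k. {\<alpha>\<in>?M. \<alpha> i = k})"
    define a where "a = (\<lambda>k. infsum b (F k))"
    define h where "h = y i - x i"
    have h: "\<bar>h\<bar> \<le> r" using y assms(2) by (simp add: polydisc_def h_def)
    have Ple: "\<bar>P \<alpha>\<bar> * \<rho> ^ \<alpha> i \<le> \<rho> ^ mdeg d \<alpha>" for \<alpha>
    proof -
      \<comment> \<open>Putting the full radius into coordinate \<open>i\<close> bounds the
        remaining factors by \<open>\<rho> ^ mdeg d \<alpha>\<close> divided by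
        \<open>\<rho> ^ \<alpha> i\<close>. This makes the coefficient of each power of the single
        variable an absolutely convergent sum.\<close>
      have "\<bar>mpow d (\<lambda>j. if j = i then \<rho> else y j - x j) \<alpha>\<bar> \<le> \<rho> ^ mdeg d \<alpha>"
        using y r by (intro mpow_abs_le) (auto simp: polydisc_def intro: order_trans)
      also have "mpow d (\<lambda>j. if j = i then \<rho> else y j - x j) \<alpha> = \<rho> ^ \<alpha> i * P \<alpha>"
        unfolding mpow_remove[OF assms(2)] P_def by (auto intro!: prod.cong)
      finally show ?thesis using \<rho> by (simp add: abs_mult mult.commute)
    qed
    have sb: "(b has_sum a k) (F k)" for k
    proof -
      have "(\<lambda>\<alpha>. \<rho> ^ mdeg d \<alpha> * norm (c \<alpha>)) summable_on F k"
        using sc by (rule summable_on_subset) (auto simp: F_def)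
      then have "(\<lambda>\<alpha>. \<rho> ^ k * norm (b \<alpha>)) summable_on F k"
      proof (rule summable_on_comparison_test)
        fix \<alpha> assume "\<alpha> \<in> F k"
        then have "\<rho> ^ k * norm (b \<alpha>) = (\<bar>P \<alpha>\<bar> * \<rho> ^ \<alpha> i) * norm (c \<alpha>)"
          by (simp add: F_def b_def abs_mult)
        also have "\<dots> \<le> \<rho> ^ mdeg d \<alpha> * norm (c \<alpha>)"
          by (intro mult_right_mono Ple) auto
        finally show "\<rho> ^ k * norm (b \<alpha>) \<le> \<rho> ^ mdeg d \<alpha> * norm (c \<alpha>)" .
      qed (use \<rho> in auto)
      then have "(\<lambda>\<alpha>. norm (b \<alpha>)) summable_on F k"
        using \<rho> by (subst (asm) summable_on_cmult_right') auto
      then show ?thesis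
        unfolding a_def by (rule has_sum_infsum[OF abs_summable_summable])
    qed
    have g: "(\<lambda>k. a k * s ^ k) sums f (y(i := x i + s))" if s: "\<bar>s\<bar> \<le> \<rho>" for s
    proof -
      have "y(i := x i + s) \<in> polydisc d \<rho> x"
        using y s assms(2) r by (fastforce simp: polydisc_def PiE_iff extensional_def)
      then have "((\<lambda>\<alpha>. mpow d (\<lambda>j. (y(i := x i + s)) j - x j) \<alpha> *\<^sub>R c \<alpha>) has_sum f (y(i := x i + s))) ?M"
        using c unfolding power_series_def by blast
      also have "(\<lambda>\<alpha>. mpow d (\<lambda>j. (y(i := x i + s)) j - x j) \<alpha> *\<^sub>R c \<alpha>) = (\<lambda>\<alpha>. s ^ \<alpha> i * b \<alpha>)"
        unfolding mpow_remove[OF assms(2)] b_def P_def by (auto intro!: prod.cong)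
      finally have "((\<lambda>\<alpha>. s ^ \<alpha> i * b \<alpha>) has_sum f (y(i := x i + s))) ?M" .
      then have "((\<lambda>k. s ^ k * a k) has_sum f (y(i := x i + s))) UNIV"
      proof (rule has_sum_group[where \<beta> = "\<lambda>\<alpha>. \<alpha> i"])
        fix k
        have "((\<lambda>\<alpha>. s ^ k * b \<alpha>) has_sum s ^ k * a k) (F k)"
          by (intro has_sum_cmult_right sb)
        then show "((\<lambda>\<alpha>. s ^ \<alpha> i * b \<alpha>) has_sum s ^ k * a k) {\<alpha>\<in>?M. \<alpha> i = k}"
          unfolding F_def by (rule has_sum_cong[THEN iffD1, rotated]) auto
      qed simp
      then show ?thesis by (simp add: has_sum_imp_sums mult.commute)
    qed
    define G where "G = (\<lambda>s. \<Sum>k. a k * s ^ k)"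
    have "(G has_real_derivative (\<Sum>k. diffs a k * h ^ k)) (at h)"
      unfolding G_def
      by (rule termdiffs_strong[where K = \<rho>]) (use g[of \<rho>] h r in \<open>auto simp: sums_iff\<close>)
    then have "((\<lambda>t. G (t - x i)) has_real_derivative (\<Sum>k. diffs a k * h ^ k)) (at (y i))"
      unfolding h_def using DERIV_shift[of G _ "y i" "- x i"] by simp
    then have 1: "((\<lambda>t. f (y(i := t))) has_real_derivative (\<Sum>k. diffs a k * h ^ k)) (at (y i))"
    proof (rule DERIV_cong_ev[THEN iffD1, rotated 3])
      have "eventually (\<lambda>t. dist t (y i) < \<rho> - r) (nhds (y i))"
        using r by (auto simp: eventually_nhds_metric intro!: exI[of _ "\<rho> - r"])
      then show "eventually (\<lambda>t. G (t - x i) = f (y(i := t))) (nhds (y i))"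
      proof eventually_elim
        case (elim t)
        then have "\<bar>t - x i\<bar> \<le> \<rho>" using h by (simp add: dist_real_def h_def)
        from g[OF this] show ?case by (simp add: G_def sums_iff)
      qed
    qed auto
    define u where "u = (\<lambda>\<alpha>. mpow d (\<lambda>j. y j - x j) (\<beta> \<alpha>) * c' \<alpha>)"
    have u: "u \<alpha> = (real (\<alpha> i) * h ^ (\<alpha> i - 1)) * b \<alpha>" for \<alpha>
    proof -
      have "mpow d (\<lambda>j. y j - x j) (\<beta> \<alpha>) = h ^ (\<alpha> i - 1) * P \<alpha>"
        unfolding mpow_remove[OF assms(2)] h_def P_def \<beta>_def by (auto intro!: prod.cong)
      then show ?thesis by (simp add: u_def b_def c'_def)
    qed
    have us: "(\<lambda>\<alpha>. norm (u \<alpha>)) summable_on ?M"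
    proof (rule summable_on_comparison_test[OF sM])
      show "norm (u \<alpha>) \<le> r ^ mdeg d (\<beta> \<alpha>) * norm (c' \<alpha>)" for \<alpha>
        unfolding u_def real_norm_def abs_mult
        using y by (intro mult_right_mono mpow_abs_le) (auto simp: polydisc_def)
    qed auto
    define S where "S = infsum u ?M"
    have S: "(u has_sum S) ?M"
      unfolding S_def using us by (intro has_sum_infsum) (rule abs_summable_summable)
    \<comment> \<open>The formal derivative is grouped in the same way, so its sum is that of the
      termwise derivative of the one-variable series.\<close>
    then have "((\<lambda>k. (real k * h ^ (k - 1)) * a k) has_sum S) UNIV"
    proof (rule has_sum_group[where \<beta> = "\<lambda>\<alpha>. \<alpha> i"])
      fix k
      have "((\<lambda>\<alpha>. (real k * h ^ (k - 1)) * b \<alpha>) has_sum (real k * h ^ (k - 1)) * a k) (F k)"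
        by (intro has_sum_cmult_right sb)
      then show "(u has_sum (real k * h ^ (k - 1)) * a k) {\<alpha>\<in>?M. \<alpha> i = k}"
        unfolding F_def u by (rule has_sum_cong[THEN iffD1, rotated]) auto
    qed simp
    then have "(\<lambda>k. (real k * h ^ (k - 1)) * a k) sums S" by (rule has_sum_imp_sums)
    then have "(\<lambda>k. diffs a k * h ^ k) sums S"
      using sums_Suc_iff[of "\<lambda>k. (real k * h ^ (k - 1)) * a k" S] by (simp add: diffs_def mult_ac)
    then have "(\<Sum>k. diffs a k * h ^ k) = S" by (simp add: sums_iff)
    then show ?thesis using 1 S unfolding u_def by auto
  qed
  have "pser d r x (partial i f) (\<Sum>\<^sub>\<infinity>\<alpha>\<in>?M. r ^ mdeg d (\<beta> \<alpha>) * norm (c' \<alpha>))"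
  proof (rule pser_group[OF r(1), where I = ?M and \<beta> = \<beta> and c = c', OF _ has_sum_infsum[OF sM]])
    show "\<beta> \<alpha> \<in> ?M" if "\<alpha> \<in> ?M" for \<alpha>
      using that assms(2) by (auto simp: \<beta>_def PiE_iff extensional_def)
    fix y assume y: "y \<in> polydisc d r x"
    then obtain D where *: "((\<lambda>t. f (y(i := t))) has_real_derivative D) (at (y i))"
      "((\<lambda>\<alpha>. mpow d (\<lambda>j. y j - x j) (\<beta> \<alpha>) * c' \<alpha>) has_sum D) ?M"
      using D by blast
    from *(1) have "partial i f y = D"
      unfolding partial_def has_real_derivative_iff_has_vector_derivative by (rule vector_derivative_at)
    then show "((\<lambda>\<alpha>. mpow d (\<lambda>j. y j - x j) (\<beta> \<alpha>) *\<^sub>R c' \<alpha>) has_sum partial i f y) ?M"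
      using *(2) by simp
  qed simp
  then show "germ d (partial i f) x"
    unfolding germ_def using r by blast
  show "\<exists>\<epsilon>>0. \<forall>y\<in>polydisc d \<epsilon> x. \<exists>D. ((\<lambda>t. f (y(i := t))) has_real_derivative D) (at (y i))"
    using D r by blast
qed

section \<open>Frechet differentiability of analytic functions\<close>

definition to_coord :: "nat \<Rightarrow> (nat \<Rightarrow> 'd) \<Rightarrow> real ^ 'd \<Rightarrow> nat \<Rightarrow> real"
  where "to_coord d e z = (\<lambda>i\<in>{..<d}. z $ e i)"

lemma to_coord_in [simp]: "to_coord d e z \<in> coord_space d"
  by (simp add: to_coord_def)

text \<open>These indices carry the affine part of a power series, which becomes the Taylor
  polynomial of first order.\<close>

lemma low_degree_multi_indices:
  "{\<alpha> \<in> multi_indices d. mdeg d \<alpha> \<le> 1} =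
    insert (\<lambda>i\<in>{..<d}. 0) ((\<lambda>i. \<lambda>j\<in>{..<d}. if j = i then 1 else 0) ` {..<d})" (is "?N = insert ?z (?u ` _)")
proof (intro equalityI subsetI)
  fix \<alpha> assume "\<alpha> \<in> ?N"
  then have \<alpha>: "\<alpha> \<in> multi_indices d" and "mdeg d \<alpha> \<le> 1" by blast+
  from this(2) have "mdeg d \<alpha> = 0 \<or> mdeg d \<alpha> = 1" by linarith
  then show "\<alpha> \<in> insert ?z (?u ` {..<d})"
  proof
    assume "mdeg d \<alpha> = 0"
    then have "\<alpha> i = ?z i" for i
      using PiE_arb[OF \<alpha>, of i] by (cases "i < d") (simp_all add: mdeg_def)
    then have "\<alpha> = ?z" by (rule ext)
    then show ?thesis by blast
  next
    assume "mdeg d \<alpha> = 1"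
    then have "\<exists>i\<in>{..<d}. \<alpha> i = Suc 0 \<and> (\<forall>j\<in>{..<d}. i \<noteq> j \<longrightarrow> \<alpha> j = 0)"
      unfolding mdeg_def One_nat_def sum_eq_Suc0_iff[OF finite_lessThan] .
    then obtain i where i: "i < d" "\<alpha> i = 1" "\<And>j. j < d \<Longrightarrow> i \<noteq> j \<Longrightarrow> \<alpha> j = 0"
      by (metis One_nat_def lessThan_iff)
    then have "\<alpha> j = ?u i j" for j
      using PiE_arb[OF \<alpha>, of j] by (cases "j < d") simp_all
    then have "\<alpha> = ?u i" by (rule ext)
    then show ?thesis using i(1) by blast
  qed
next
  fix \<alpha> assume "\<alpha> \<in> insert ?z (?u ` {..<d})"
  then consider "\<alpha> = ?z" | i where "i < d" "\<alpha> = ?u i" by blast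
  then show "\<alpha> \<in> ?N" by cases (simp_all add: restrict_PiE_iff)
qed

text \<open>Outside the affine part every degree is at least 2. For a step of length
  \<open>s \<le> \<rho>\<close> each such term therefore carries a factor
  \<open>(s / \<rho>)\<^sup>2\<close>, and the remainder is quadratic in \<open>s\<close>.\<close>

lemma germ_has_derivative_real:
  fixes f :: "(nat \<Rightarrow> real) \<Rightarrow> real" and z :: "real ^ 'd::finite"
  assumes "germ d f (to_coord d e z)"
  shows "\<exists>D. ((\<lambda>w. f (to_coord d e w)) has_derivative D) (at z)"
proof -
  define x where "x = to_coord d e z"
  have x: "x \<in> coord_space d" by (simp add: x_def)
  obtain \<rho> C c where \<rho>: "\<rho> > 0" and c: "power_series d \<rho> x f C c"
    using assms by (auto simp: germ_def pser_def x_def)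
  let ?M = "multi_indices d"
  define N where "N = {\<alpha> \<in> ?M. mdeg d \<alpha> \<le> 1}"
  define u where "u = (\<lambda>i. \<lambda>j\<in>{..<d}. if j = i then 1 else 0 :: nat)"
  define D where "D = (\<lambda>w :: real ^ 'd. \<Sum>i<d. w $ e i * c (u i))"
  have inj: "inj_on u {..<d}"
  proof (rule inj_onI)
    fix i j assume "i \<in> {..<d}" "j \<in> {..<d}" "u i = u j"
    then have "u i i = u j i" "i < d" by simp_all
    then show "i = j" by (simp add: u_def split: if_splits)
  qed
  have z_notin: "(\<lambda>i\<in>{..<d}. 0) \<notin> u ` {..<d}"
  proof
    assume "(\<lambda>i\<in>{..<d}. 0) \<in> u ` {..<d}"
    then obtain i where "i < d" "(\<lambda>i\<in>{..<d}. 0) = u i" by blast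
    then have "(\<lambda>i\<in>{..<d}. 0 :: nat) i = u i i" "i < d" by simp_all
    then show False by (simp add: u_def)
  qed
  have N: "N = insert (\<lambda>i\<in>{..<d}. 0) (u ` {..<d})"
    unfolding N_def u_def by (rule low_degree_multi_indices)
  have D: "bounded_linear D"
    unfolding D_def
    by (intro bounded_linear_sum bounded_linear_mult_const bounded_linear_vec_nth)
  have rem: "\<bar>f (to_coord d e w) - f x - D (w - z)\<bar> \<le> C / \<rho>\<^sup>2 * (norm (w - z))\<^sup>2"
    if w: "norm (w - z) \<le> \<rho>" for w
  proof -
    define y where "y = to_coord d e w"
    define s where "s = norm (w - z)"
    have yx: "y i - x i = (w - z) $ e i" if "i < d" for i
      using that by (simp add: x_def y_def to_coord_def)
    have ys: "\<bar>y i - x i\<bar> \<le> s" if "i < d" for i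
      unfolding yx[OF that] s_def by (rule component_le_norm_cart)
    then have y: "y \<in> polydisc d \<rho> x"
      using w by (fastforce simp: polydisc_def y_def s_def intro: order_trans)
    define m where "m = mpow d (\<lambda>i. y i - x i)"
    have hs: "((\<lambda>\<alpha>. m \<alpha> * c \<alpha>) has_sum f y) ?M"
      using c y by (simp add: power_series_def m_def)
    have "(\<Sum>\<alpha>\<in>N. m \<alpha> * c \<alpha>) = c (\<lambda>i\<in>{..<d}. 0) + (\<Sum>i<d. m (u i) * c (u i))"
      unfolding N using z_notin by (simp add: sum.reindex[OF inj] m_def)
    also have "(\<Sum>i<d. m (u i) * c (u i)) = D (w - z)"
      unfolding D_def by (intro sum.cong refl) (simp add: m_def u_def yx)
    also have "c (\<lambda>i\<in>{..<d}. 0) = f x"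
      using power_series_center[OF c x \<rho>] by simp
    finally have "((\<lambda>\<alpha>. m \<alpha> * c \<alpha>) has_sum f x + D (w - z)) N"
      by (intro has_sum_finiteI) (auto simp: N)
    then have "((\<lambda>\<alpha>. m \<alpha> * c \<alpha>) has_sum f y - (f x + D (w - z))) (?M - N)"
      by (intro has_sum_Diff hs) (auto simp: N_def)
    moreover have s: "((\<lambda>\<alpha>. (s / \<rho>)\<^sup>2 * (\<rho> ^ mdeg d \<alpha> * norm (c \<alpha>))) has_sum
        (s / \<rho>)\<^sup>2 * (\<Sum>\<^sub>\<infinity>\<alpha>\<in>?M. \<rho> ^ mdeg d \<alpha> * norm (c \<alpha>))) ?M"
      using c by (intro has_sum_cmult_right has_sum_infsum) (simp add: power_series_def)
    have le: "norm (m \<alpha> * c \<alpha>) \<le> (s / \<rho>)\<^sup>2 * (\<rho> ^ mdeg d \<alpha> * norm (c \<alpha>))" if "\<alpha> \<in> ?M - N" for \<alpha>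
    proof -
      have "\<not> mdeg d \<alpha> \<le> 1" using that unfolding N_def by blast
      then have deg: "2 \<le> mdeg d \<alpha>" by linarith
      have "\<bar>m \<alpha>\<bar> \<le> s ^ mdeg d \<alpha>" unfolding m_def by (rule mpow_abs_le) (rule ys)
      also have "\<dots> = (s / \<rho>) ^ mdeg d \<alpha> * \<rho> ^ mdeg d \<alpha>" using \<rho> by (simp add: power_divide)
      also have "\<dots> \<le> (s / \<rho>)\<^sup>2 * \<rho> ^ mdeg d \<alpha>"
        using deg \<rho> w by (intro mult_right_mono power_decreasing) (auto simp: s_def)
      finally have "\<bar>m \<alpha>\<bar> * \<bar>c \<alpha>\<bar> \<le> (s / \<rho>)\<^sup>2 * \<rho> ^ mdeg d \<alpha> * \<bar>c \<alpha>\<bar>" by (rule mult_right_mono) simp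
      then show ?thesis by (simp add: abs_mult mult.assoc)
    qed
    have sm: "(\<lambda>\<alpha>. norm (m \<alpha> * c \<alpha>)) summable_on ?M - N"
      by (rule summable_on_comparison_test[OF summable_on_subset[OF has_sum_imp_summable[OF s]] le]) auto
    ultimately have "norm (f y - (f x + D (w - z))) \<le> (\<Sum>\<^sub>\<infinity>\<alpha>\<in>?M - N. norm (m \<alpha> * c \<alpha>))"
      by (intro norm_has_sum_bound[OF has_sum_infsum])
    also have "\<dots> \<le> (s / \<rho>)\<^sup>2 * (\<Sum>\<^sub>\<infinity>\<alpha>\<in>?M. \<rho> ^ mdeg d \<alpha> * norm (c \<alpha>))"
      by (rule has_sum_mono_neutral[OF has_sum_infsum[OF sm] s]) (use le \<rho> in auto)
    also have "\<dots> \<le> (s / \<rho>)\<^sup>2 * C"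
      using c by (intro mult_left_mono) (auto simp: power_series_def)
    finally show ?thesis by (simp add: s_def y_def power_divide mult.commute diff_diff_eq)
  qed
  have "((\<lambda>w. f (to_coord d e w)) has_derivative D) (at z within UNIV)"
  proof (rule has_derivativeI_sandwich[where e = \<rho> and H = "\<lambda>w. C / \<rho>\<^sup>2 * norm (w - z)"])
    fix w assume "w \<noteq> z" and "dist w z < \<rho>"
    then have "\<bar>f (to_coord d e w) - f x - D (w - z)\<bar> \<le> C / \<rho>\<^sup>2 * (norm (w - z))\<^sup>2"
      by (intro rem) (simp add: dist_norm)
    then show "norm (f (to_coord d e w) - f (to_coord d e z) - D (w - z)) / norm (w - z)
        \<le> C / \<rho>\<^sup>2 * norm (w - z)"
      using \<open>w \<noteq> z\<close> \<rho> by (simp add: x_def field_simps power2_eq_square)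
  next
    show "((\<lambda>w. C / \<rho>\<^sup>2 * norm (w - z)) \<longlongrightarrow> 0) (at z)"
      by (rule tendsto_eq_intros refl tendsto_norm LIM_zero tendsto_ident_at | simp)+
  qed (use \<rho> D in auto)
  then show ?thesis by auto
qed

text \<open>A finite orthonormal basis, given by its expansion formula. For tuples of operators,
  whose type is only a \<open>real_inner\<close> space with completeness, it takes the place of
  \<open>Basis\<close> and reduces vector values to real components.\<close>

definition real_onb :: "'e::real_inner set \<Rightarrow> bool"
  where "real_onb B \<longleftrightarrow> finite B \<and> (\<forall>a\<in>B. \<forall>b\<in>B. a \<bullet> b = (if a = b then 1 else 0)) \<and>
    (\<forall>v. v = (\<Sum>b\<in>B. (v \<bullet> b) *\<^sub>R b))"

lemma real_onb_expand: "real_onb B \<Longrightarrow> (\<Sum>b\<in>B. (v \<bullet> b) *\<^sub>R b) = v"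
  by (metis real_onb_def)

lemma real_analytic_on_bounded_linear:
  assumes "real_analytic_on d f U" "bounded_linear L"
  shows "real_analytic_on d (\<lambda>y. L (f y)) U"
  unfolding real_analytic_on_def
proof
  interpret L: bounded_linear L by fact
  fix x assume "x \<in> U"
  with assms(1) obtain c \<epsilon> where \<epsilon>: "\<epsilon> > 0" and c: "\<forall>y\<in>topspace (coord_topology d). (\<forall>i<d. \<bar>y i - x i\<bar> < \<epsilon>) \<longrightarrow>
      ((\<lambda>\<alpha>. (\<Prod>i<d. (y i - x i) ^ \<alpha> i) *\<^sub>R c \<alpha>) has_sum f y) (multi_indices d)"
    unfolding real_analytic_on_def by blast
  show "\<exists>c. \<exists>\<epsilon>>0. \<forall>y\<in>topspace (coord_topology d). (\<forall>i<d. \<bar>y i - x i\<bar> < \<epsilon>) \<longrightarrow>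
      ((\<lambda>\<alpha>. (\<Prod>i<d. (y i - x i) ^ \<alpha> i) *\<^sub>R c \<alpha>) has_sum L (f y)) (multi_indices d)"
  proof (intro exI[of _ "\<lambda>\<alpha>. L (c \<alpha>)"] exI[of _ \<epsilon>] conjI \<epsilon> ballI impI)
    fix y assume "y \<in> topspace (coord_topology d)" "\<forall>i<d. \<bar>y i - x i\<bar> < \<epsilon>"
    with c have "((\<lambda>\<alpha>. (\<Prod>i<d. (y i - x i) ^ \<alpha> i) *\<^sub>R c \<alpha>) has_sum f y) (multi_indices d)" by blast
    from has_sum_bounded_linear[OF assms(2) this]
    show "((\<lambda>\<alpha>. (\<Prod>i<d. (y i - x i) ^ \<alpha> i) *\<^sub>R L (c \<alpha>)) has_sum L (f y)) (multi_indices d)"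
      by (simp only: L.scaleR)
  qed
qed

lemma real_analytic_on_germ:
  fixes f :: "(nat \<Rightarrow> real) \<Rightarrow> 'e::{real_inner, banach}" and B :: "'e set"
  assumes B: "real_onb B" and "real_analytic_on d f U" "x \<in> U"
  shows "germ d f x"
proof -
  have "germ d (\<lambda>y. f y \<bullet> b) x" for b
    using real_analytic_on_bounded_linear[OF assms(2) bounded_linear_inner_left] assms(3)
    by (rule real_analytic_onD)
  then have "germ d (\<lambda>y. \<Sum>b\<in>B. (f y \<bullet> b) *\<^sub>R b) x"
    by (intro germ_sum germ_scaleR germ_const)
  then show ?thesis by (simp add: real_onb_expand[OF B])
qed

lemma germ_has_derivative:
  fixes f :: "(nat \<Rightarrow> real) \<Rightarrow> 'e::{real_inner, banach}" and z :: "real ^ 'd::finite" and B :: "'e set"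
  assumes B: "real_onb B" and "germ d f (to_coord d e z)"
  shows "\<exists>D. ((\<lambda>w. f (to_coord d e w)) has_derivative D) (at z)"
proof -
  have "\<exists>D. ((\<lambda>w. f (to_coord d e w) \<bullet> b) has_derivative D) (at z)" for b
    using germ_bounded_linear[OF assms(2) bounded_linear_inner_left] by (rule germ_has_derivative_real)
  then obtain D where D: "((\<lambda>w. f (to_coord d e w) \<bullet> b) has_derivative D b) (at z)" for b by metis
  have "((\<lambda>w. \<Sum>b\<in>B. (f (to_coord d e w) \<bullet> b) *\<^sub>R b) has_derivative (\<lambda>w. \<Sum>b\<in>B. D b w *\<^sub>R b)) (at z)"
    by (intro has_derivative_sum has_derivative_scaleR_left D)
  then show ?thesis unfolding real_onb_expand[OF B] by blast
qed

lemma germ_partial_vector: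
  fixes f :: "(nat \<Rightarrow> real) \<Rightarrow> 'e::{real_inner, banach}" and B :: "'e set"
  assumes B: "real_onb B" and f: "germ d f x" and i: "i < d"
  shows "germ d (partial i f) x"
    and "\<exists>\<epsilon>>0. \<forall>y\<in>polydisc d \<epsilon> x. ((\<lambda>t. f (y(i := t))) has_vector_derivative partial i f y) (at (y i))"
proof -
  have fb: "germ d (\<lambda>y. f y \<bullet> b) x" for b
    using germ_bounded_linear[OF f bounded_linear_inner_left] .
  have "\<exists>\<epsilon>>0. \<forall>y\<in>polydisc d \<epsilon> x. \<exists>D. ((\<lambda>t. f (y(i := t)) \<bullet> b) has_real_derivative D) (at (y i))" for b
    using germ_partial(2)[OF fb i] .
  then obtain \<epsilon> where \<epsilon>: "\<And>b. \<epsilon> b > 0" and D: "\<And>b y. y \<in> polydisc d (\<epsilon> b) x \<Longrightarrow>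
      \<exists>D. ((\<lambda>t. f (y(i := t)) \<bullet> b) has_real_derivative D) (at (y i))"
    by metis
  \<comment> \<open>The element 1 keeps the minimum meaningful when the basis is empty.\<close>
  define \<delta> where "\<delta> = Min (insert 1 (\<epsilon> ` B))"
  have fin: "finite B" using B by (simp add: real_onb_def)
  have \<delta>: "\<delta> > 0" using \<epsilon> fin by (auto simp: \<delta>_def)
  have \<delta>\<epsilon>: "\<delta> \<le> \<epsilon> b" if "b \<in> B" for b using that fin by (simp add: \<delta>_def)
  have pd: "((\<lambda>t. f (y(i := t))) has_vector_derivative (\<Sum>b\<in>B. partial i (\<lambda>y. f y \<bullet> b) y *\<^sub>R b)) (at (y i))"
    if y: "y \<in> polydisc d \<delta> x" for y
  proof -
    have "((\<lambda>t. f (y(i := t)) \<bullet> b) has_vector_derivative partial i (\<lambda>y. f y \<bullet> b) y) (at (y i))"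
      if b: "b \<in> B" for b
    proof -
      obtain D where "((\<lambda>t. f (y(i := t)) \<bullet> b) has_vector_derivative D) (at (y i))"
        using D[of y b] y polydisc_mono[OF \<delta>\<epsilon>[OF b], of d x]
        by (auto simp: has_real_derivative_iff_has_vector_derivative)
      then show ?thesis unfolding partial_def by (simp add: vector_derivative_at)
    qed
    then have "((\<lambda>t. \<Sum>b\<in>B. (f (y(i := t)) \<bullet> b) *\<^sub>R b) has_vector_derivative
        (\<Sum>b\<in>B. partial i (\<lambda>y. f y \<bullet> b) y *\<^sub>R b)) (at (y i))"
      by (intro has_vector_derivative_sum bounded_linear.has_vector_derivative[OF bounded_linear_scaleR_left])
    then show ?thesis by (simp add: real_onb_expand[OF B])
  qed
  have eq: "partial i f y = (\<Sum>b\<in>B. partial i (\<lambda>y. f y \<bullet> b) y *\<^sub>R b)" if "y \<in> polydisc d \<delta> x" for y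
    unfolding partial_def[of i f] by (rule vector_derivative_at[OF pd[OF that]])
  have "germ d (\<lambda>y. \<Sum>b\<in>B. partial i (\<lambda>y. f y \<bullet> b) y *\<^sub>R b) x"
    by (intro germ_sum germ_scaleR germ_const germ_partial(1)[OF fb i])
  then show "germ d (partial i f) x"
    by (rule germ_cong[OF _ \<delta>]) (simp add: eq)
  show "\<exists>\<epsilon>>0. \<forall>y\<in>polydisc d \<epsilon> x. ((\<lambda>t. f (y(i := t))) has_vector_derivative partial i f y) (at (y i))"
    using \<delta> pd eq by auto
qed

text \<open>Neumann series. With \<open>K y = h (G x) (F x - F y)\<close> the two hypotheses say
  that \<open>G y = G x + h (K y) (G y)\<close>, where \<open>G\<close> plays the inverse of
  \<open>F\<close>. As \<open>K\<close> vanishes at \<open>x\<close>, its bound can be made smaller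
  than 1, and iteration expresses \<open>G\<close> through analytic terms. Associativity and the
  unit of \<open>h\<close> enter only through \<open>inv\<close>.\<close>

lemma germ_inverse:
  fixes F G :: "(nat \<Rightarrow> real) \<Rightarrow> 'e::banach" and h :: "'e \<Rightarrow> 'e \<Rightarrow> 'e"
  assumes F: "germ d F x" and x: "x \<in> coord_space d"
    and h: "bounded_bilinear h" and nh: "\<And>a b. norm (h a b) \<le> norm a * norm b"
    and inv: "\<And>y. y \<in> coord_space d \<Longrightarrow> h (h (G x) (F x)) (G y) = G y"
      "\<And>y. y \<in> coord_space d \<Longrightarrow> h (h (G x) (F y)) (G y) = G x"
  shows "germ d G x"
proof -
  interpret bounded_bilinear h by fact
  define K where "K = (\<lambda>y. h (G x) (F x - F y))"
  have "germ d K x"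
    unfolding K_def by (intro germ_bilinear[OF _ _ h nh] germ_const germ_diff F)
  then obtain \<rho> C where \<rho>: "\<rho> > 0" and C: "pser d \<rho> x K C" by (auto simp: germ_def)
  have Kx: "K x = 0" by (simp add: K_def zero_right)
  have C0: "C \<ge> 0" using pser_norm_le[OF C, of x] x \<rho> by (auto simp: polydisc_def Kx)
  \<comment> \<open>Chosen so that \<open>q = t * C\<close> is below 1 for every
    \<open>C \<ge> 0\<close>, including 0.\<close>
  define t where "t = 1 / (2 * (C + 1))"
  define q where "q = t * C"
  have t: "0 < t" "t \<le> 1" using C0 by (auto simp: t_def)
  have q: "0 \<le> q" "q < 1" using C0 by (auto simp: q_def t_def field_simps)
  define r where "r = t * \<rho>"
  have r: "r > 0" using t \<rho> by (simp add: r_def)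
  have K: "pser d r x K q"
    unfolding r_def q_def using C Kx x t \<rho> by (rule pser_shrink)
  define T where "T = (\<lambda>k y. ((\<lambda>a. h (K y) a) ^^ k) (G x))"
  have T: "pser d r x (T k) (q ^ k * norm (G x))" for k
  proof (induction k)
    case (Suc k)
    have "pser d r x (\<lambda>y. h (K y) (T k y)) (q * (q ^ k * norm (G x)))"
      using r K Suc h nh by (rule pser_bilinear)
    then show ?case by (simp add: T_def mult.assoc)
  qed (use r pser_const in \<open>auto simp: T_def\<close>)
  have hs: "((\<lambda>k. T k y) has_sum G y) UNIV" if y: "y \<in> polydisc d r x" for y
  proof -
    have yc: "y \<in> coord_space d" using y by (simp add: polydisc_def)
    define S where "S = (\<lambda>k. ((\<lambda>a. h (K y) a) ^^ k) (G y))"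
    have Ky: "h (K y) (G y) = G y - G x"
      using inv[OF yc] by (simp add: K_def diff_right diff_left)
    \<comment> \<open>\<open>T\<close> iterates on \<open>G x\<close> and \<open>S\<close> on
      \<open>G y\<close>; since \<open>G x = G y - h (K y) (G y)\<close>, the series telescopes and
      its remainder is \<open>S n\<close>.\<close>
    have TS: "T k y = S k - S (Suc k)" for k
      by (induction k) (simp_all add: T_def S_def Ky diff_right)
    have sum: "(\<Sum>k<n. T k y) = G y - S n" for n
      by (induction n) (simp_all add: TS S_def)
    have Kn: "norm (K y) \<le> q" by (rule pser_norm_le[OF K y])
    have Sn: "norm (S n) \<le> q ^ n * norm (G y)" for n
    proof (induction n)
      case (Suc n)
      have "norm (S (Suc n)) \<le> norm (K y) * norm (S n)" unfolding S_def by (simp add: nh)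
      also have "\<dots> \<le> q * (q ^ n * norm (G y))" by (intro mult_mono Kn Suc q) auto
      finally show ?case by (simp add: mult.assoc)
    qed (simp add: S_def)
    have "(\<lambda>n. q ^ n * norm (G y)) \<longlonglongrightarrow> 0"
      using q by (intro tendsto_mult_left_zero LIMSEQ_realpow_zero) auto
    then have "S \<longlonglongrightarrow> 0" by (rule Lim_null_comparison[rotated]) (simp add: Sn)
    then have "(\<lambda>n. G y - S n) \<longlonglongrightarrow> G y" by (auto intro!: tendsto_eq_intros)
    then have "(\<lambda>k. T k y) sums G y" unfolding sums_def sum .
    moreover have "summable (\<lambda>k. norm (T k y))"
    proof (rule summable_comparison_test')
      show "summable (\<lambda>k. q ^ k * norm (G x))" using q by (intro summable_mult2 summable_geometric) auto
      show "norm (norm (T k y)) \<le> q ^ k * norm (G x)" for k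
        using pser_norm_le[OF T y] by simp
    qed
    ultimately show ?thesis by (rule norm_summable_imp_has_sum[rotated])
  qed
  have "((\<lambda>k. q ^ k) has_sum (1 / (1 - q))) UNIV"
  proof (rule norm_summable_imp_has_sum)
    show "summable (\<lambda>k. norm (q ^ k))" using q by (simp add: norm_power summable_geometric)
    show "(\<lambda>k. q ^ k) sums (1 / (1 - q))" using q by (intro geometric_sums) auto
  qed
  then have "((\<lambda>k. q ^ k * norm (G x)) has_sum (1 / (1 - q)) * norm (G x)) UNIV"
    by (rule has_sum_cmult_left)
  then have "pser d r x G ((1 / (1 - q)) * norm (G x))"
    by (rule pser_has_sum[where K = UNIV and f = T and C = "\<lambda>k. q ^ k * norm (G x)", OF r T _ hs])
  then show ?thesis
    unfolding germ_def using r by blast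
qed

section \<open>Operators between Hilbert spaces of finite dimension\<close>

lemma real_onbI:
  fixes B :: "'e::real_inner set"
  assumes fin: "finite B" and on: "\<And>a b. a \<in> B \<Longrightarrow> b \<in> B \<Longrightarrow> a \<bullet> b = (if a = b then 1 else 0)"
    and z: "\<And>v. (\<And>b. b \<in> B \<Longrightarrow> v \<bullet> b = 0) \<Longrightarrow> v = 0"
  shows "real_onb B"
  unfolding real_onb_def
proof (intro conjI fin ballI on allI)
  fix v
  have "(v - (\<Sum>b\<in>B. (v \<bullet> b) *\<^sub>R b)) \<bullet> a = 0" if "a \<in> B" for a
  proof -
    have "(\<Sum>b\<in>B. (v \<bullet> b) *\<^sub>R b) \<bullet> a = (\<Sum>b\<in>B. if b = a then v \<bullet> b else 0)"
      unfolding inner_sum_left by (intro sum.cong refl) (use on that in auto)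
    then show ?thesis using fin that by (simp add: inner_diff_left)
  qed
  then have "v - (\<Sum>b\<in>B. (v \<bullet> b) *\<^sub>R b) = 0" by (rule z)
  then show "v = (\<Sum>b\<in>B. (v \<bullet> b) *\<^sub>R b)" by simp
qed

lemma real_onb_finite: "real_onb B \<Longrightarrow> finite B"
  by (simp add: real_onb_def)

lemma real_onb_inner: "real_onb B \<Longrightarrow> a \<in> B \<Longrightarrow> b \<in> B \<Longrightarrow> a \<bullet> b = (if a = b then 1 else 0)"
  by (simp add: real_onb_def)

lemma real_onb_inner_sum:
  assumes "real_onb B" "b \<in> B"
  shows "(\<Sum>a\<in>B. f a *\<^sub>R a) \<bullet> b = f b"
proof -
  have "(\<Sum>a\<in>B. f a *\<^sub>R a) \<bullet> b = (\<Sum>a\<in>B. if a = b then f a else 0)"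
    unfolding inner_sum_left by (intro sum.cong refl) (use assms real_onb_inner[OF assms(1)] in auto)
  then show ?thesis using assms real_onb_finite[OF assms(1)] by simp
qed

lemma real_onb_eqI:
  assumes "real_onb B" "\<And>b. b \<in> B \<Longrightarrow> v \<bullet> b = w \<bullet> b"
  shows "v = w"
proof -
  have "v = (\<Sum>b\<in>B. (v \<bullet> b) *\<^sub>R b)" by (simp add: real_onb_expand[OF assms(1)])
  also have "\<dots> = (\<Sum>b\<in>B. (w \<bullet> b) *\<^sub>R b)" using assms(2) by simp
  finally show ?thesis by (simp add: real_onb_expand[OF assms(1)])
qed

lemma orthonormal_set_independent:
  fixes B :: "'e::real_inner set"
  assumes "\<And>a b. a \<in> B \<Longrightarrow> b \<in> B \<Longrightarrow> a \<bullet> b = (if a = b then 1 else 0)"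
  shows "independent B"
proof (rule pairwise_orthogonal_independent)
  show "pairwise orthogonal B" using assms by (auto simp: pairwise_def orthogonal_def)
  show "0 \<notin> B" using assms[of 0 0] by auto
qed

lemma real_onb_card_dim:
  fixes B :: "'e::real_inner set"
  assumes "real_onb B"
  shows "card B = real_vector.dim (UNIV :: 'e set)"
proof -
  have "independent B" using real_onb_inner[OF assms] by (rule orthonormal_set_independent)
  moreover have "v \<in> span B" for v
    using real_onb_expand[OF assms, of v] span_sum[of B "\<lambda>b. (v \<bullet> b) *\<^sub>R b" B]
    by (metis span_base span_scale)
  ultimately show ?thesis
    by (metis UNIV_eq_I dim_span dim_eq_card_independent)
qed

lemma real_onb_linear_bounded:
  fixes f :: "'e::real_inner \<Rightarrow> 'f::real_normed_vector" and B :: "'e set"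
  assumes B: "real_onb B" and f: "linear f"
  shows "bounded_linear f"
proof -
  have "f v = (\<Sum>b\<in>B. (v \<bullet> b) *\<^sub>R f b)" for v
    using linear_sum[OF f, of "\<lambda>b. (v \<bullet> b) *\<^sub>R b" B] linear_scale[OF f]
    by (simp add: real_onb_expand[OF B])
  then have "f = (\<lambda>v. \<Sum>b\<in>B. (v \<bullet> b) *\<^sub>R f b)" by (rule ext)
  moreover have "bounded_linear (\<lambda>v. \<Sum>b\<in>B. (v \<bullet> b) *\<^sub>R f b)"
    by (intro bounded_linear_sum bounded_linear_scaleR_const bounded_linear_inner_left)
  ultimately show ?thesis by simp
qed

text \<open>Bolzano-Weierstrass applied to finitely many coordinates at once. It makes the operator
  spaces instances of \<open>heine_borel\<close>, which brings the completeness needed for power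
  series.\<close>

lemma real_onb_convergent_subsequence:
  fixes f :: "nat \<Rightarrow> 'e::real_inner" and B :: "'e set"
  assumes B: "real_onb B" and f: "bounded (range f)"
  shows "\<exists>l r. strict_mono r \<and> (f \<circ> r) \<longlonglongrightarrow> l"
proof -
  have "\<forall>\<delta>\<subseteq>B. \<exists>l::'e. \<exists>r::nat \<Rightarrow> nat. strict_mono r \<and>
      (\<forall>\<epsilon>>0. eventually (\<lambda>n. \<forall>i\<in>\<delta>. dist (f (r n) \<bullet> i) (l \<bullet> i) < \<epsilon>) sequentially)"
  proof (rule compact_lemma_general[where unproj = "\<lambda>c. \<Sum>b\<in>B. c b *\<^sub>R b"])
    show "bounded ((\<lambda>x. x \<bullet> k) ` range f)" for k
      by (intro bounded_linear_image f bounded_linear_inner_left)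
  qed (use B in \<open>auto simp: real_onb_finite real_onb_inner_sum real_onb_expand\<close>)
  then obtain l :: 'e and r :: "nat \<Rightarrow> nat" where r: "strict_mono r"
    and l: "\<And>\<epsilon>. \<epsilon> > 0 \<Longrightarrow> eventually (\<lambda>n. \<forall>b\<in>B. dist (f (r n) \<bullet> b) (l \<bullet> b) < \<epsilon>) sequentially"
    by blast
  have "(\<lambda>n. f (r n) \<bullet> b) \<longlonglongrightarrow> l \<bullet> b" if "b \<in> B" for b
    by (rule tendstoI) (rule eventually_mono[OF l], use that in auto)
  then have "(\<lambda>n. \<Sum>b\<in>B. (f (r n) \<bullet> b) *\<^sub>R b) \<longlonglongrightarrow> (\<Sum>b\<in>B. (l \<bullet> b) *\<^sub>R b)"
    by (intro tendsto_sum tendsto_scaleR tendsto_const)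
  then show ?thesis using r by (auto simp: real_onb_expand[OF B] o_def)
qed

lemma real_onb_vec:
  fixes B :: "'e::real_inner set"
  assumes B: "real_onb B"
  shows "real_onb ((\<lambda>(i, b). axis i b :: 'e ^ 'r) ` (UNIV \<times> B))"
    and "card ((\<lambda>(i, b). axis i b :: 'e ^ 'r) ` (UNIV \<times> B)) = CARD('r) * card B"
proof -
  have nz: "b \<noteq> 0" if "b \<in> B" for b using real_onb_inner[OF B that that] by auto
  have inj: "inj_on (\<lambda>(i, b). axis i b :: 'e ^ 'r) (UNIV \<times> B)"
    using nz by (auto simp: inj_on_def axis_eq_axis)
  show "card ((\<lambda>(i, b). axis i b :: 'e ^ 'r) ` (UNIV \<times> B)) = CARD('r) * card B"
    by (simp add: card_image[OF inj] card_cartesian_product)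
  have ax: "axis i a \<bullet> axis j b = (if i = j then a \<bullet> b else 0)" for i j :: 'r and a b :: 'e
    by (rule inner_axis_axis)
  show "real_onb ((\<lambda>(i, b). axis i b :: 'e ^ 'r) ` (UNIV \<times> B))"
  proof (rule real_onbI)
    show "finite ((\<lambda>(i, b). axis i b :: 'e ^ 'r) ` (UNIV \<times> B))"
      using real_onb_finite[OF B] by simp
  next
    fix v w :: "'e ^ 'r"
    assume "v \<in> (\<lambda>(i, b). axis i b) ` (UNIV \<times> B)" "w \<in> (\<lambda>(i, b). axis i b) ` (UNIV \<times> B)"
    then obtain i a j b where v: "v = axis i a" "a \<in> B" and w: "w = axis j b" "b \<in> B"
      by auto
    show "v \<bullet> w = (if v = w then 1 else 0)"
      unfolding v w ax axis_eq_axis using real_onb_inner[OF B v(2) w(2)] nz[OF v(2)] by auto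
  next
    fix v :: "'e ^ 'r"
    assume v: "\<And>b. b \<in> (\<lambda>(i, b). axis i b) ` (UNIV \<times> B) \<Longrightarrow> v \<bullet> b = 0"
    have "v $ i \<bullet> b = 0 \<bullet> b" if "b \<in> B" for i b
      using v[of "axis i b"] that by (force simp: inner_axis)
    then have "v $ i = 0" for i by (rule real_onb_eqI[OF B])
    then show "v = 0" by (simp add: vec_eq_iff)
  qed
qed

lemma orthonormal_independent:
  fixes E :: "'a::complex_inner set"
  assumes "orthonormal E"
  shows "complex_vector.independent E"
  unfolding complex_vector.dependent_explicit
proof safe
  fix S u v assume S: "finite S" "S \<subseteq> E" and sum: "(\<Sum>v\<in>S. u v *\<^sub>C v) = 0" and v: "v \<in> S" "u v \<noteq> 0"
  have "0 = cinner (\<Sum>w\<in>S. u w *\<^sub>C w) v" by (simp add: sum)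
  also have "\<dots> = (\<Sum>w\<in>S. if w = v then u w else 0)"
    unfolding cinner_sum_left cinner_scaleC_left
  proof (intro sum.cong refl)
    fix w assume "w \<in> S"
    then have "cinner w v = (if w = v then 1 else 0)"
      using assms S v unfolding orthonormal_def by blast
    then show "u w * cinner w v = (if w = v then u w else 0)" by simp
  qed
  also have "\<dots> = u v" using S v by simp
  finally show False using v by simp
qed

lemma orthonormal_basis_card:
  fixes E :: "'a::fd_hilbert set"
  assumes "orthonormal_basis E"
  shows "card E = cdim TYPE('a)"
  using assms orthonormal_independent[of E]
  by (metis complex_vector.dim_span complex_vector.dim_eq_card_independent orthonormal_basis_def)

lemma orthonormal_basis_eqI:
  assumes "orthonormal_basis E" "\<And>e. e \<in> E \<Longrightarrow> cinner x e = cinner y e"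
  shows "x = y"
  by (subst (1 2) orthonormal_basis_expand[OF assms(1)]) (simp add: assms(2))

text \<open>The vectors \<open>f\<close> and \<open>\<i> *\<^sub>C f\<close> are orthogonal for the
  real part of the inner product, whence the factor 2.\<close>

lemma orthonormal_basis_real_onb:
  fixes F :: "'k::fd_hilbert set"
  assumes F: "orthonormal_basis F"
  shows "real_onb (F \<union> (\<lambda>f. \<i> *\<^sub>C f) ` F)" (is "real_onb ?G")
    and "card (F \<union> (\<lambda>f. \<i> *\<^sub>C f) ` F) = 2 * cdim TYPE('k)"
proof -
  have on: "cinner a b = (if a = b then 1 else 0)" if "a \<in> F" "b \<in> F" for a b
    using F that by (auto simp: orthonormal_basis_def orthonormal_def)
  have ii: "\<i> *\<^sub>C a = \<i> *\<^sub>C b \<longleftrightarrow> a = b" for a b :: 'k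
    by (simp add: complex_vector.scale_left_imp_eq complex_vector.scale_cancel_left)
  have ne: "a \<noteq> \<i> *\<^sub>C b" if "a \<in> F" "b \<in> F" for a b
  proof
    assume a: "a = \<i> *\<^sub>C b"
    have "cinner a a = \<i> * cinner b a" unfolding a cinner_scaleC_left ..
    then show False using on[OF that(2,1)] on[OF that(1,1)] by (auto simp: complex_eq_iff split: if_splits)
  qed
  have fin: "finite F" using F by (simp add: orthonormal_basis_def)
  show "real_onb ?G"
  proof (rule real_onbI)
    show "finite ?G" using fin by simp
    fix a b assume "a \<in> ?G" "b \<in> ?G"
    then show "a \<bullet> b = (if a = b then 1 else 0)"
      by (elim UnE imageE)
        (auto simp: inner_eq_Re_cinner cinner_scaleC_left cinner_scaleC_right on ii
          ne ne[THEN not_sym])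
  next
    fix v assume v: "\<And>b. b \<in> ?G \<Longrightarrow> v \<bullet> b = 0"
    have "cinner v f = cinner 0 f" if "f \<in> F" for f
      using v[of f] v[of "\<i> *\<^sub>C f"] that
      by (simp add: inner_eq_Re_cinner cinner_scaleC_right complex_eq_iff)
    then show "v = 0" by (rule orthonormal_basis_eqI[OF F])
  qed
  have "card ?G = card F + card ((\<lambda>f. \<i> *\<^sub>C f) ` F)"
    using fin ne by (intro card_Un_disjoint) auto
  also have "card ((\<lambda>f. \<i> *\<^sub>C f) ` F) = card F"
    by (intro card_image inj_onI) (simp add: ii)
  finally show "card ?G = 2 * cdim TYPE('k)" using orthonormal_basis_card[OF F] by simp
qed

lemma inner_bop_eq:
  assumes "orthonormal_basis E"
  shows "v \<bullet> w = (\<Sum>e\<in>E. app v e \<bullet> app w e)"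
  by (simp add: inner_bop_def trace_bop_eq[OF assms] bop_comp.rep_eq cinner_adj_left inner_eq_Re_cinner)

text \<open>The dyad of \<open>g\<close> with the functional \<open>cinner _ e\<close>; over
  orthonormal bases these are the matrix units.\<close>

definition rank_one :: "'h::fd_hilbert \<Rightarrow> 'k::fd_hilbert \<Rightarrow> ('h, 'k) bop"
  where "rank_one e g = Bop (\<lambda>x. cinner x e *\<^sub>C g)"

lemma app_rank_one: "app (rank_one e g) x = cinner x e *\<^sub>C g"
proof -
  have "bounded_linear (\<lambda>x. cinner x e *\<^sub>C g)"
  proof (rule bounded_linear_intro[of _ "norm e * norm g"])
    show "norm (cinner y e *\<^sub>C g) \<le> norm y * (norm e * norm g)" for y
      using mult_right_mono[OF norm_cinner_le[of y e] norm_ge_zero[of g]]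
      by (simp only: norm_scaleC mult.assoc)
  qed (simp_all add: cinner_add_left scaleC_add_left scaleR_eq_scaleC cinner_scaleC_left scaleC_scaleC)
  then show ?thesis
    unfolding rank_one_def by (subst Bop_inverse) (simp_all add: cinner_scaleC_left scaleC_scaleC)
qed

lemma bop_eq_on_basis:
  assumes "orthonormal_basis E" "\<And>e. e \<in> E \<Longrightarrow> app A e = app B e"
  shows "A = B"
proof (rule bop_eqI)
  fix x
  have "app A (\<Sum>e\<in>E. cinner x e *\<^sub>C e) = app B (\<Sum>e\<in>E. cinner x e *\<^sub>C e)"
    by (simp add: app_sum app_scaleC assms(2))
  then show "app A x = app B x" by (simp only: orthonormal_basis_expand[OF assms(1), of x, symmetric])
qed

lemma real_onb_bop:
  fixes E :: "'h::fd_hilbert set" and G :: "'k::fd_hilbert set"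
  assumes E: "orthonormal_basis E" and G: "real_onb G"
  shows "real_onb ((\<lambda>(e, g). rank_one e g) ` (E \<times> G))"
    and "card ((\<lambda>(e, g). rank_one e g) ` (E \<times> G)) = card E * card G"
proof -
  have on: "cinner a b = (if a = b then 1 else 0)" if "a \<in> E" "b \<in> E" for a b
    using E that by (auto simp: orthonormal_basis_def orthonormal_def)
  have fin: "finite E" using E by (simp add: orthonormal_basis_def)
  have v: "v \<bullet> rank_one e g = app v e \<bullet> g" if "e \<in> E" for v :: "('h, 'k) bop" and e g
  proof -
    have "v \<bullet> rank_one e g = (\<Sum>b\<in>E. if b = e then app v b \<bullet> g else 0)"
      unfolding inner_bop_eq[OF E]
      by (intro sum.cong refl) (simp add: app_rank_one on that scaleC_one)
    then show ?thesis using fin that by simp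
  qed
  have rr: "rank_one e g \<bullet> rank_one e' g' = (if e = e' \<and> g = g' then 1 else 0)"
    if "e \<in> E" "e' \<in> E" "g \<in> G" "g' \<in> G" for e e' g g'
    using that by (simp add: v app_rank_one on real_onb_inner[OF G] scaleC_one)
  have inj: "inj_on (\<lambda>(e, g). rank_one e g) (E \<times> G)"
  proof (rule inj_onI, clarsimp)
    fix e g e' g' assume *: "e \<in> E" "e' \<in> E" "g \<in> G" "g' \<in> G" and eq: "rank_one e g = rank_one e' g'"
    show "e = e' \<and> g = g'"
      using rr[OF *] rr[of e e g g] * eq by (auto split: if_splits)
  qed
  show "card ((\<lambda>(e, g). rank_one e g) ` (E \<times> G)) = card E * card G"
    by (simp add: card_image[OF inj] card_cartesian_product)
  show "real_onb ((\<lambda>(e, g). rank_one e g) ` (E \<times> G))"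
  proof (rule real_onbI)
    show "finite ((\<lambda>(e, g). rank_one e g) ` (E \<times> G))"
      using fin real_onb_finite[OF G] by simp
  next
    fix a b :: "('h, 'k) bop"
    assume "a \<in> (\<lambda>(e, g). rank_one e g) ` (E \<times> G)" "b \<in> (\<lambda>(e, g). rank_one e g) ` (E \<times> G)"
    then obtain p q where p: "p \<in> E \<times> G" "a = (\<lambda>(e, g). rank_one e g) p"
      and q: "q \<in> E \<times> G" "b = (\<lambda>(e, g). rank_one e g) q" by blast
    then have "a = b \<longleftrightarrow> p = q" using inj_on_eq_iff[OF inj p(1) q(1)] by simp
    then show "a \<bullet> b = (if a = b then 1 else 0)"
      using p q rr by (cases p; cases q) auto
  next
    fix A :: "('h, 'k) bop"
    assume A: "\<And>b. b \<in> (\<lambda>(e, g). rank_one e g) ` (E \<times> G) \<Longrightarrow> A \<bullet> b = 0"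
    have "app A e = app 0 e" if e: "e \<in> E" for e
    proof (rule real_onb_eqI[OF G])
      fix g assume "g \<in> G"
      then have "A \<bullet> rank_one e g = 0" using e by (intro A) force
      then show "app A e \<bullet> g = app 0 e \<bullet> g" by (simp add: v[OF e] zero_bop.rep_eq)
    qed
    then show "A = 0" by (rule bop_eq_on_basis[OF E])
  qed
qed

lemma real_onb_bop_exists:
  obtains B :: "('h::fd_hilbert, 'k::fd_hilbert) bop set"
  where "real_onb B" "card B = 2 * cdim TYPE('h) * cdim TYPE('k)"
proof -
  obtain E :: "'h set" where E: "orthonormal_basis E" using orthonormal_basis_exists by blast
  obtain F :: "'k set" where F: "orthonormal_basis F" using orthonormal_basis_exists by blast
  show ?thesis
    using that[OF real_onb_bop(1)[OF E orthonormal_basis_real_onb(1)[OF F]]]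
      real_onb_bop(2)[OF E orthonormal_basis_real_onb(1)[OF F]]
      orthonormal_basis_real_onb(2)[OF F] orthonormal_basis_card[OF E] by simp
qed

instance bop :: (fd_hilbert, fd_hilbert) heine_borel
proof
  fix f :: "nat \<Rightarrow> ('a, 'b) bop"
  assume "bounded (range f)"
  obtain B :: "('a, 'b) bop set" where "real_onb B" using real_onb_bop_exists .
  then show "\<exists>l r. strict_mono r \<and> (f \<circ> r) \<longlonglongrightarrow> l"
    using \<open>bounded (range f)\<close> by (rule real_onb_convergent_subsequence)
qed

instance bop :: (fd_hilbert, fd_hilbert) banach ..

lemma real_onb_tuple_exists:
  obtains B :: "(('h::fd_hilbert, 'k::fd_hilbert) bop ^ 'r) set"
  where "real_onb B" "card B = 2 * CARD('r) * cdim TYPE('h) * cdim TYPE('k)"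
proof -
  obtain B :: "('h, 'k) bop set" where B: "real_onb B" "card B = 2 * cdim TYPE('h) * cdim TYPE('k)"
    by (rule real_onb_bop_exists)
  show ?thesis using that[OF real_onb_vec(1)[OF B(1)]] real_onb_vec(2)[OF B(1), where 'r = 'r] B(2) by simp
qed

section \<open>Algebra and norm estimates of operators\<close>

lemma app_bop_simps [simp]:
  "app (A + B) x = app A x + app B x" "app (A - B) x = app A x - app B x"
  "app (- A) x = - app A x" "app 0 x = 0" "app (t *\<^sub>R A) x = t *\<^sub>R app A x"
  by (simp_all add: plus_bop.rep_eq minus_bop.rep_eq uminus_bop.rep_eq zero_bop.rep_eq scaleR_bop.rep_eq)

lemma app_comp [simp]: "app (A \<circ>\<^sub>B B) x = app A (app B x)"
  by (simp add: bop_comp.rep_eq)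

lemma app_id [simp]: "app bop_id x = x"
  by (simp add: bop_id.rep_eq)

lemma app_arg_simps [simp]:
  "app A (x - y) = app A x - app A y" "app A (- x) = - app A x" "app A 0 = 0"
  "app A (t *\<^sub>R x) = t *\<^sub>R app A x"
  using linear_diff[OF bounded_linear.linear[OF app_bounded_linear]]
    linear_neg[OF bounded_linear.linear[OF app_bounded_linear]]
    linear_0[OF bounded_linear.linear[OF app_bounded_linear]]
    linear_scale[OF bounded_linear.linear[OF app_bounded_linear]] by metis+

lemma app_sum_bop: "app (sum f S) x = (\<Sum>i\<in>S. app (f i) x)"
  by (induction S rule: infinite_finite_induct) simp_all

lemma comp_assoc: "(A \<circ>\<^sub>B B) \<circ>\<^sub>B C = A \<circ>\<^sub>B (B \<circ>\<^sub>B C)"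
  by (rule bop_eqI) simp

lemma comp_simps [simp]:
  "A \<circ>\<^sub>B bop_id = A" "bop_id \<circ>\<^sub>B B = B" "0 \<circ>\<^sub>B C = 0" "D \<circ>\<^sub>B 0 = 0"
  "(- E) \<circ>\<^sub>B F = - (E \<circ>\<^sub>B F)" "E \<circ>\<^sub>B (- F) = - (E \<circ>\<^sub>B F)"
  "(t *\<^sub>R E) \<circ>\<^sub>B F = t *\<^sub>R (E \<circ>\<^sub>B F)" "E \<circ>\<^sub>B (t *\<^sub>R F) = t *\<^sub>R (E \<circ>\<^sub>B F)"
  by (rule bop_eqI; simp)+

lemma comp_distrib:
  "(A + B) \<circ>\<^sub>B C = A \<circ>\<^sub>B C + B \<circ>\<^sub>B C" "D \<circ>\<^sub>B (E + F) = D \<circ>\<^sub>B E + D \<circ>\<^sub>B F"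
  "(A - B) \<circ>\<^sub>B C = A \<circ>\<^sub>B C - B \<circ>\<^sub>B C" "D \<circ>\<^sub>B (E - F) = D \<circ>\<^sub>B E - D \<circ>\<^sub>B F"
  by (rule bop_eqI; simp add: app_add)+

lemma comp_sum_left: "sum f S \<circ>\<^sub>B A = (\<Sum>i\<in>S. f i \<circ>\<^sub>B A)"
  by (induction S rule: infinite_finite_induct) (simp_all add: comp_distrib)

lemma comp_sum_right: "A \<circ>\<^sub>B sum f S = (\<Sum>i\<in>S. A \<circ>\<^sub>B f i)"
  by (induction S rule: infinite_finite_induct) (simp_all add: comp_distrib)

lemma adj_eqI: "(\<And>x y. cinner (app A x) y = cinner x (app B y)) \<Longrightarrow> adj A = B"
proof (rule bop_eqI)
  fix y assume *: "\<And>x y. cinner (app A x) y = cinner x (app B y)"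
  have "cinner (app (adj A) y - app B y) x = 0" for x
    using *[of x y] cinner_adj[of A x y] cinner_commute[of "app (adj A) y" x] cinner_commute[of "app B y" x]
    by (simp add: cinner_diff_left)
  then show "app (adj A) y = app B y" by (metis cinner_self_eq_zero eq_iff_diff_eq_0)
qed

lemma cinner_minus_left: "cinner (- x) y = - cinner x y"
  using cinner_diff_left[of 0 x y] by simp

lemma cinner_minus_right: "cinner x (- y) = - cinner x y"
  by (metis cinner_commute cinner_minus_left complex_cnj_minus)

lemma cinner_scaleR_left: "cinner (t *\<^sub>R x) y = complex_of_real t * cinner x y"
  by (simp add: scaleR_eq_scaleC cinner_scaleC_left)

lemma cinner_scaleR_right: "cinner x (t *\<^sub>R y) = complex_of_real t * cinner x y"
  by (simp add: scaleR_eq_scaleC cinner_scaleC_right)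

lemma cinner_diff_right: "cinner x (y - z) = cinner x y - cinner x (z :: 'a::complex_inner)"
  using cinner_add_right[of x y "- z"] by (simp add: cinner_minus_right)

lemma adj_adj [simp]: "adj (adj A) = A"
  by (rule adj_eqI) (rule cinner_adj_left)

lemma adj_simps [simp]:
  "adj (A \<circ>\<^sub>B B) = adj B \<circ>\<^sub>B adj A" "adj (C + D) = adj C + adj D"
  "adj (C - D) = adj C - adj D" "adj (- C) = - adj C" "adj (t *\<^sub>R C) = t *\<^sub>R adj C"
  "adj bop_id = bop_id" "adj 0 = 0"
  by (rule adj_eqI; simp add: cinner_adj cinner_add_left cinner_add_right cinner_diff_left
      cinner_diff_right cinner_minus_left cinner_minus_right cinner_scaleR_left cinner_scaleR_right)+

lemma adj_sum: "adj (sum f S) = (\<Sum>i\<in>S. adj (f i))"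
  by (induction S rule: infinite_finite_induct) simp_all

lemma bounded_linear_adj: "bounded_linear adj"
proof -
  obtain B :: "('a, 'b) bop set" where "real_onb B" using real_onb_bop_exists .
  then show ?thesis by (rule real_onb_linear_bounded) (auto intro!: linearI)
qed

lemma norm_bop_sq:
  assumes "orthonormal_basis E"
  shows "(norm A)\<^sup>2 = (\<Sum>e\<in>E. (norm (app A e))\<^sup>2)"
  by (simp add: power2_norm_eq_inner inner_bop_eq[OF assms])

lemma parseval:
  assumes E: "orthonormal_basis E"
  shows "(norm x)\<^sup>2 = (\<Sum>e\<in>E. (cmod (cinner x e))\<^sup>2)"
proof -
  have "cinner x x = cinner (\<Sum>e\<in>E. cinner x e *\<^sub>C e) x"
    using orthonormal_basis_expand[OF E, of x] by simp
  also have "\<dots> = (\<Sum>e\<in>E. cinner x e * cnj (cinner x e))"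
    unfolding cinner_sum_left cinner_scaleC_left by (intro sum.cong refl arg_cong2[of _ _ _ _ "(*)"] cinner_commute)
  also have "\<dots> = complex_of_real (\<Sum>e\<in>E. (cmod (cinner x e))\<^sup>2)"
    by (simp only: complex_norm_square of_real_sum)
  finally show ?thesis unfolding cinner_self of_real_eq_iff .
qed

text \<open>The norm of \<open>bop\<close> is the Hilbert-Schmidt norm. It dominates the operator
  norm by Parseval and the Cauchy-Schwarz inequality.\<close>

lemma norm_app_le:
  fixes A :: "('h::fd_hilbert, 'k::fd_hilbert) bop"
  shows "norm (app A x) \<le> norm A * norm x"
proof -
  obtain E :: "'h set" where E: "orthonormal_basis E" using orthonormal_basis_exists by blast
  have "norm (app A x) = norm (app A (\<Sum>e\<in>E. cinner x e *\<^sub>C e))"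
    using orthonormal_basis_expand[OF E, of x] by simp
  also have "\<dots> \<le> (\<Sum>e\<in>E. \<bar>cmod (cinner x e)\<bar> * \<bar>norm (app A e)\<bar>)"
    unfolding app_sum app_scaleC by (rule order_trans[OF norm_sum]) (simp add: norm_scaleC)
  also have "\<dots> \<le> L2_set (\<lambda>e. cmod (cinner x e)) E * L2_set (\<lambda>e. norm (app A e)) E"
    by (rule L2_set_mult_ineq)
  also have "\<dots> = norm A * norm x"
    by (simp add: L2_set_def parseval[OF E, symmetric] norm_bop_sq[OF E, symmetric])
  finally show ?thesis .
qed

lemma norm_comp_le:
  fixes A :: "('k::fd_hilbert, 'l::fd_hilbert) bop" and B :: "('h::fd_hilbert, 'k) bop"
  shows "norm (A \<circ>\<^sub>B B) \<le> norm A * norm B"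
proof -
  obtain E :: "'h set" where E: "orthonormal_basis E" using orthonormal_basis_exists by blast
  have "(norm (A \<circ>\<^sub>B B))\<^sup>2 = (\<Sum>e\<in>E. (norm (app A (app B e)))\<^sup>2)" by (simp add: norm_bop_sq[OF E])
  also have "\<dots> \<le> (\<Sum>e\<in>E. (norm A * norm (app B e))\<^sup>2)"
    by (intro sum_mono power_mono norm_app_le) simp
  also have "\<dots> = (norm A * norm B)\<^sup>2"
    by (simp add: power_mult_distrib sum_distrib_left[symmetric] norm_bop_sq[OF E])
  finally show ?thesis by (rule power2_le_imp_le) simp
qed

lemma bounded_bilinear_comp: "bounded_bilinear (\<circ>\<^sub>B)"
  by (rule bounded_bilinear.intro)
    (auto simp: comp_distrib norm_comp_le intro!: exI[of _ 1])

section \<open>Inverses of operators and their continuity\<close>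

definition bop_inv :: "('h::fd_hilbert, 'h) bop \<Rightarrow> ('h, 'h) bop"
  where "bop_inv A = (SOME C. C \<circ>\<^sub>B A = bop_id \<and> A \<circ>\<^sub>B C = bop_id)"

lemma bop_inv:
  fixes A :: "('h::fd_hilbert, 'h) bop"
  assumes inj: "\<And>x. app A x = 0 \<Longrightarrow> x = 0"
  shows "bop_inv A \<circ>\<^sub>B A = bop_id" "A \<circ>\<^sub>B bop_inv A = bop_id"
proof -
  obtain E :: "'h set" where E: "orthonormal_basis E" using orthonormal_basis_exists by blast
  interpret cv: finite_dimensional_vector_space "scaleC :: complex \<Rightarrow> 'h \<Rightarrow> 'h" E
    by unfold_locales (use E orthonormal_independent[of E] in \<open>auto simp: orthonormal_basis_def\<close>)
  have lin: "Vector_Spaces.linear scaleC scaleC (app A)"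
    by unfold_locales (simp_all add: app_add app_scaleC)
  have injA: "inj (app A)"
  proof (rule injI)
    fix x y assume "app A x = app A y"
    then have "app A (x - y) = 0" by simp
    then show "x = y" using inj by fastforce
  qed
  then have surj: "surj (app A)"
    using cv.linear_inj_imp_surj[OF lin] by simp
  define C where "C = inv_into UNIV (app A)"
  have AC: "app A (C y) = y" for y unfolding C_def by (rule surj_f_inv_f[OF surj])
  have CA: "C (app A x) = x" for x unfolding C_def by (rule inv_f_f[OF injA])
  have add: "C (x + y) = C x + C y" for x y
    using CA[of "C x + C y"] by (simp add: app_add AC)
  have scC: "C (c *\<^sub>C x) = c *\<^sub>C C x" for c x
    using CA[of "c *\<^sub>C C x"] by (simp add: app_scaleC AC)
  have "linear C" by (rule linearI) (simp_all add: add scC scaleR_eq_scaleC)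
  then have "bounded_linear C"
    by (rule real_onb_linear_bounded[OF orthonormal_basis_real_onb(1)[OF E]])
  then have appC: "app (Bop C) = C" by (simp add: Bop_inverse scC)
  have "\<exists>C. C \<circ>\<^sub>B A = bop_id \<and> A \<circ>\<^sub>B C = bop_id"
    by (intro exI[of _ "Bop C"] conjI bop_eqI) (simp_all add: appC AC CA)
  from someI_ex[OF this] show "bop_inv A \<circ>\<^sub>B A = bop_id" "A \<circ>\<^sub>B bop_inv A = bop_id"
    unfolding bop_inv_def by auto
qed

definition bop_invertible :: "('h::fd_hilbert, 'h) bop \<Rightarrow> bool"
  where "bop_invertible A \<longleftrightarrow> (\<forall>x. app A x = 0 \<longrightarrow> x = 0)"

lemma bop_invertible_inv:
  assumes "bop_invertible A"
  shows "bop_inv A \<circ>\<^sub>B A = bop_id" "A \<circ>\<^sub>B bop_inv A = bop_id"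
  using bop_inv assms by (auto simp: bop_invertible_def)

lemma bop_invertibleI: "C \<circ>\<^sub>B A = bop_id \<Longrightarrow> bop_invertible A"
  unfolding bop_invertible_def by (metis app_comp app_id app_arg_simps(3))

lemma bop_inv_unique:
  assumes "C \<circ>\<^sub>B A = bop_id"
  shows "bop_inv A = C"
proof -
  have "A \<circ>\<^sub>B bop_inv A = bop_id" by (rule bop_invertible_inv[OF bop_invertibleI[OF assms]])
  then have "C \<circ>\<^sub>B (A \<circ>\<^sub>B bop_inv A) = C" by simp
  then show ?thesis unfolding comp_assoc[symmetric] assms by simp
qed

text \<open>A kernel vector \<open>x\<close> of \<open>B\<close> is fixed by
  \<open>bop_inv A \<circ>\<^sub>B (A - B)\<close>, a strict contraction, and so vanishes.\<close>

lemma bop_invertible_near: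
  fixes A :: "('h::fd_hilbert, 'h) bop"
  assumes A: "bop_invertible A" and B: "norm (bop_inv A) * norm (B - A) < 1"
  shows "bop_invertible B"
  unfolding bop_invertible_def
proof (intro allI impI, rule ccontr)
  fix x assume x: "app B x = 0" "x \<noteq> 0"
  have "x = app (bop_inv A \<circ>\<^sub>B A) x" using bop_invertible_inv(1)[OF A] by simp
  also have "\<dots> = app (bop_inv A \<circ>\<^sub>B (A - B)) x" using x(1) by simp
  finally have "norm x = norm (app (bop_inv A \<circ>\<^sub>B (A - B)) x)" by simp
  also have "\<dots> \<le> norm (bop_inv A) * norm (A - B) * norm x"
    by (rule order_trans[OF norm_app_le]) (intro mult_right_mono norm_comp_le norm_ge_zero)
  also have "\<dots> < 1 * norm x"
    using B x(2) by (intro mult_strict_right_mono) (simp_all add: norm_minus_commute)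
  finally show False by simp
qed

text \<open>The difference of the inverses is \<open>bop_inv (f x) \<circ>\<^sub>B (A - f x)
  \<circ>\<^sub>B bop_inv A\<close>. Since the first factor is not yet known to be bounded, it is
  estimated by the very difference under study.\<close>

lemma bop_inv_tendsto:
  fixes f :: "'x \<Rightarrow> ('h::fd_hilbert, 'h) bop"
  assumes f: "(f \<longlongrightarrow> A) F" and A: "bop_invertible A"
  shows "((\<lambda>x. bop_inv (f x)) \<longlongrightarrow> bop_inv A) F"
proof -
  define M where "M = norm (bop_inv A)"
  define g where "g = (\<lambda>x. norm (f x - A))"
  have g: "(g \<longlongrightarrow> 0) F"
    unfolding g_def using f by (simp add: LIM_zero tendsto_norm_zero)
  then have Mg: "((\<lambda>x. M * g x) \<longlongrightarrow> 0) F" by (rule tendsto_mult_right_zero)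
  have ev: "eventually (\<lambda>x. M * g x < 1/2) F"
    using order_tendstoD(2)[OF Mg, of "1/2"] by simp
  have bound: "norm (bop_inv (f x) - bop_inv A) \<le> 2 * M * M * g x" if x: "M * g x < 1/2" for x
  proof -
    have inv: "bop_invertible (f x)"
      using bop_invertible_near[OF A, of "f x"] x by (simp add: M_def g_def)
    define \<delta> where "\<delta> = norm (bop_inv (f x) - bop_inv A)"
    have "bop_inv (f x) - bop_inv A = bop_inv (f x) \<circ>\<^sub>B (A - f x) \<circ>\<^sub>B bop_inv A"
      by (simp add: comp_distrib comp_assoc bop_invertible_inv[OF A])
        (simp add: comp_assoc[symmetric] bop_invertible_inv[OF inv])
    then have "\<delta> = norm (bop_inv (f x) \<circ>\<^sub>B (A - f x) \<circ>\<^sub>B bop_inv A)" by (simp only: \<delta>_def)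
    also have "\<dots> \<le> norm (bop_inv (f x)) * norm (A - f x) * M"
      unfolding M_def by (rule order_trans[OF norm_comp_le]) (intro mult_right_mono norm_comp_le norm_ge_zero)
    also have "\<dots> = norm (bop_inv (f x)) * (M * g x)" by (simp add: g_def norm_minus_commute)
    \<comment> \<open>As \<open>M * g x < 1/2\<close>, at most half of \<open>\<delta>\<close>
      appears on the right and can be absorbed on the left; this gives the constant
      \<open>2 * M * M\<close>.\<close>
    also have "\<dots> \<le> (\<delta> + M) * (M * g x)"
      using norm_triangle_sub[of "bop_inv (f x)" "bop_inv A"]
      by (intro mult_right_mono) (simp_all add: \<delta>_def M_def g_def add.commute)
    also have "\<dots> \<le> \<delta> * (1/2) + M * (M * g x)"
      using mult_left_mono[OF less_imp_le[OF x], of \<delta>] by (simp add: distrib_right \<delta>_def)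
    finally show ?thesis by (simp add: \<delta>_def)
  qed
  have "((\<lambda>x. bop_inv (f x) - bop_inv A) \<longlongrightarrow> 0) F"
  proof (rule Lim_null_comparison)
    show "eventually (\<lambda>x. norm (bop_inv (f x) - bop_inv A) \<le> 2 * M * M * g x) F"
      using ev by eventually_elim (rule bound)
    show "((\<lambda>x. 2 * M * M * g x) \<longlongrightarrow> 0) F" using g by (rule tendsto_mult_right_zero)
  qed
  then show ?thesis by (rule LIM_zero_cancel)
qed

text \<open>A tuple is a column, that is, an operator into the direct sum of copies of
  \<open>'k\<close>. In that reading this is \<open>v\<^sup>* w\<close>, and
  \<open>v \<odot> A\<close> below is the composition \<open>v A\<close>.\<close>

definition gram :: "('h::fd_hilbert, 'k::fd_hilbert) bop ^ 'r \<Rightarrow> ('g::fd_hilbert, 'k) bop ^ 'r \<Rightarrow> ('g, 'h) bop"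
  where "gram v w = (\<Sum>k\<in>UNIV. adj (v $ k) \<circ>\<^sub>B w $ k)"

definition rmul :: "('h::fd_hilbert, 'k::fd_hilbert) bop ^ 'r \<Rightarrow> ('g::fd_hilbert, 'h) bop \<Rightarrow> ('g, 'k) bop ^ 'r"
    (infixl \<open>\<odot>\<close> 75)
  where "v \<odot> A = (\<chi> k. v $ k \<circ>\<^sub>B A)"

lemma gram_simps [simp]:
  "gram (v + v') w = gram v w + gram v' w" "gram v (w + w') = gram v w + gram v w'"
  "gram (v - v') w = gram v w - gram v' w" "gram v (w - w') = gram v w - gram v w'"
  "gram (t *\<^sub>R v) w = t *\<^sub>R gram v w" "gram v (t *\<^sub>R w) = t *\<^sub>R gram v w"
  "gram (v \<odot> A) w = adj A \<circ>\<^sub>B gram v w" "gram v (w \<odot> C) = gram v w \<circ>\<^sub>B C"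
  "gram 0 w = 0" "gram v 0 = 0" "gram (- v) w = - gram v w" "gram v (- w) = - gram v w"
  by (simp_all add: gram_def rmul_def comp_distrib sum.distrib sum_subtractf scaleR_sum_right
      comp_sum_left comp_sum_right comp_assoc sum_negf)

lemma adj_gram [simp]: "adj (gram v w) = gram w v"
  by (simp add: gram_def adj_sum)

lemma rmul_simps [simp]:
  "v \<odot> bop_id = v" "v \<odot> A \<odot> C = v \<odot> (A \<circ>\<^sub>B C)" "v \<odot> 0 = 0" "0 \<odot> A = 0"
  "(t *\<^sub>R v) \<odot> A = t *\<^sub>R (v \<odot> A)" "v \<odot> (t *\<^sub>R A) = t *\<^sub>R (v \<odot> A)"
  "(- v) \<odot> A = - (v \<odot> A)" "v \<odot> (- A) = - (v \<odot> A)"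
  by (simp_all add: rmul_def vec_eq_iff comp_assoc)

lemma rmul_distrib:
  "(v + w) \<odot> A = v \<odot> A + w \<odot> A" "v \<odot> (A + C) = v \<odot> A + v \<odot> C"
  "(v - w) \<odot> A = v \<odot> A - w \<odot> A" "v \<odot> (A - C) = v \<odot> A - v \<odot> C"
  by (simp_all add: rmul_def vec_eq_iff comp_distrib)

lemma stiefel_iff: "v \<in> stiefel \<longleftrightarrow> gram v v = bop_id"
  by (simp add: stiefel_def gram_def)

lemma cinner_gram: "cinner (app (gram v w) x) y = (\<Sum>k\<in>UNIV. cinner (app (w $ k) x) (app (v $ k) y))"
  by (simp add: gram_def app_sum_bop cinner_sum_left cinner_adj_left)

lemma cinner_gram_self: "cinner (app (gram v v) x) x = complex_of_real (\<Sum>k\<in>UNIV. (norm (app (v $ k) x))\<^sup>2)"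
  by (simp add: cinner_gram cinner_self)

lemma inner_trace: "v \<bullet> w = Re (trace_bop (gram w v))"
  unfolding inner_tuple gram_def
  by (rule arg_cong[of _ _ Re]) (simp add: trace_bop_def app_sum_bop cinner_sum_left sum.swap[of _ UNIV])

lemma norm_rmul_le: "norm (v \<odot> A) \<le> norm v * norm A"
proof -
  have "(norm (v \<odot> A))\<^sup>2 = (\<Sum>k\<in>UNIV. (norm (v $ k \<circ>\<^sub>B A))\<^sup>2)"
    by (simp add: norm_vec_def L2_set_def rmul_def sum_nonneg)
  also have "\<dots> \<le> (\<Sum>k\<in>UNIV. (norm (v $ k) * norm A)\<^sup>2)"
    by (intro sum_mono power_mono norm_comp_le) simp
  also have "\<dots> = (norm v * norm A)\<^sup>2"
    by (simp add: norm_vec_def L2_set_def sum_nonneg power_mult_distrib sum_distrib_right)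
  finally show ?thesis by (rule power2_le_imp_le) simp
qed

lemma bounded_bilinear_rmul: "bounded_bilinear (\<odot>)"
  by (rule bounded_bilinear.intro) (auto simp: rmul_distrib norm_rmul_le intro!: exI[of _ 1])

lemma bounded_bilinear_gram: "bounded_bilinear gram"
proof -
  have *: "norm (gram v w) \<le> (\<Sum>k\<in>UNIV. norm (adj (v $ k)) * norm (w $ k))"
    for v :: "('a, 'b) bop ^ 'c" and w :: "('d, 'b) bop ^ 'c"
    unfolding gram_def by (rule order_trans[OF norm_sum]) (intro sum_mono norm_comp_le)
  obtain K where K: "K \<ge> 0" "\<And>A :: ('a, 'b) bop. norm (adj A) \<le> norm A * K"
    using bounded_linear.nonneg_bounded[OF bounded_linear_adj] by blast
  have "norm (gram v w) \<le> norm v * norm w * (CARD('c) * K)" for v :: "('a, 'b) bop ^ 'c" and w :: "('d, 'b) bop ^ 'c"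
  proof -
    have "norm (adj (v $ k)) * norm (w $ k) \<le> (norm v * K) * norm w" for k
      using K Finite_Cartesian_Product.norm_nth_le[of v k] Finite_Cartesian_Product.norm_nth_le[of w k]
      by (intro mult_mono order_trans[OF K(2)] mult_right_mono) auto
    then have "(\<Sum>k\<in>UNIV. norm (adj (v $ k)) * norm (w $ k)) \<le> (\<Sum>k\<in>(UNIV :: 'c set). (norm v * K) * norm w)"
      by (intro sum_mono)
    then show ?thesis by (intro order_trans[OF *]) (simp add: mult_ac)
  qed
  then show ?thesis by (intro bounded_bilinear.intro) auto
qed

section \<open>The Cayley parametrization\<close>

text \<open>The linearization at \<open>v\<close> of the equation \<open>v\<^sup>* v = 1\<close>; it
  is the domain of the Cayley chart centred at \<open>v\<close>.\<close>

definition skew_tangent :: "('h::fd_hilbert, 'k::fd_hilbert) bop ^ 'r \<Rightarrow> (('h, 'k) bop ^ 'r) set"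
  where "skew_tangent v = {\<xi>. gram v \<xi> + gram \<xi> v = 0}"

text \<open>For \<open>v\<close> in the Stiefel manifold this is the component of
  \<open>\<xi>\<close> orthogonal to the range of \<open>v\<close>, since \<open>v v\<^sup>*\<close>
  is the projection onto that range.\<close>

definition normal_part :: "('h::fd_hilbert, 'k::fd_hilbert) bop ^ 'r \<Rightarrow> ('h, 'k) bop ^ 'r \<Rightarrow> ('h, 'k) bop ^ 'r"
  where "normal_part v \<xi> = \<xi> - v \<odot> gram v \<xi>"

text \<open>In blocks for the range of \<open>v\<close> and its complement, the operator
  \<open>1 - \<Omega>\<close> of the Cayley transform has the lower right entry 1. This is its Schur
  complement, so only an inverse on \<open>'h\<close> has to be taken instead of one on the direct
  sum.\<close>

definition cayley_den :: "('h::fd_hilbert, 'k::fd_hilbert) bop ^ 'r \<Rightarrow> ('h, 'k) bop ^ 'r \<Rightarrow> ('h, 'h) bop"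
  where "cayley_den v \<xi> = bop_id - gram v \<xi> + gram (normal_part v \<xi>) (normal_part v \<xi>)"

text \<open>
  This is \<open>(1 + \<Omega>) (1 - \<Omega>)\<^sup>-\<^sup>1 v\<close> for the skew-adjoint operator \<open>\<Omega> = v X v\<^sup>* + B v\<^sup>* - v B\<^sup>*\<close> on \<open>r \<cdot> K\<close>,
  where \<open>\<xi> = v X + B\<close> with \<open>X\<close> skew-adjoint and \<open>v\<^sup>* B = 0\<close>.
\<close>

definition cayley :: "('h::fd_hilbert, 'k::fd_hilbert) bop ^ 'r \<Rightarrow> ('h, 'k) bop ^ 'r \<Rightarrow> ('h, 'k) bop ^ 'r"
  where "cayley v \<xi> =
    v \<odot> (2 *\<^sub>R bop_inv (cayley_den v \<xi>) - bop_id) + normal_part v \<xi> \<odot> (2 *\<^sub>R bop_inv (cayley_den v \<xi>))"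

text \<open>Solves \<open>w = cayley v \<xi>\<close> for \<open>\<xi>\<close>. Since
  \<open>gram v w = 2 a - 1\<close> with \<open>a\<close> the inverse denominator, the denominator
  is \<open>2 c\<close>. The normal part of \<open>w\<close> is \<open>2 B a\<close>, so multiplying
  it by \<open>c\<close> recovers \<open>B\<close>, and the denominator then determines
  \<open>gram v \<xi>\<close>.\<close>

definition cayley_inv :: "('h::fd_hilbert, 'k::fd_hilbert) bop ^ 'r \<Rightarrow> ('h, 'k) bop ^ 'r \<Rightarrow> ('h, 'k) bop ^ 'r"
  where "cayley_inv v w = (let c = bop_inv (bop_id + gram v w); B = normal_part v w \<odot> c
    in v \<odot> ((gram B (normal_part v w) + gram v w - bop_id) \<circ>\<^sub>B c) + B)"

lemma gram_normal_part:
  assumes "v \<in> stiefel"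
  shows "gram v (normal_part v \<xi>) = 0" "gram (normal_part v \<xi>) v = 0"
proof -
  show "gram v (normal_part v \<xi>) = 0"
    using assms by (simp add: normal_part_def stiefel_iff)
  then have "adj (gram v (normal_part v \<xi>)) = 0" by simp
  then show "gram (normal_part v \<xi>) v = 0" by simp
qed

lemma adj_gram_skew: "\<xi> \<in> skew_tangent v \<Longrightarrow> gram \<xi> v = - gram v \<xi>"
  by (simp add: skew_tangent_def eq_neg_iff_add_eq_0 add.commute)

text \<open>A skew-adjoint operator has purely imaginary quadratic form. Hence the real part of the
  quadratic form at \<open>x\<close> is the squared norm of \<open>x\<close> plus the squared norms
  of the \<open>app (w $ k) x\<close>, which is zero only for \<open>x = 0\<close>.\<close>

lemma accretive_invertible:
  assumes X: "adj X = - X" and "w = (w :: ('h::fd_hilbert, 'k::fd_hilbert) bop ^ 'r)"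
  shows "bop_invertible (bop_id - X + gram w w)"
  unfolding bop_invertible_def
proof (intro allI impI)
  fix x assume 0: "app (bop_id - X + gram w w) x = 0"
  have "cinner (app X x) x = - cnj (cinner (app X x) x)"
    unfolding cinner_adj X using cinner_commute[of x "app X x"] by (simp add: cinner_minus_right cinner_adj X)
  then have "Re (cinner (app X x) x) = - Re (cinner (app X x) x)"
    by (metis cnj.simps(1) uminus_complex.simps(1))
  then have ReX: "Re (cinner (app X x) x) = 0" by simp
  have "cinner (x - app X x + app (gram w w) x) x = 0" using 0 by simp
  then have "Re (cinner x x) - Re (cinner (app X x) x) + Re (cinner (app (gram w w) x) x) = 0"
    by (simp add: cinner_add_left cinner_diff_left complex_eq_iff)
  then have "(norm x)\<^sup>2 + (\<Sum>k\<in>UNIV. (norm (app (w $ k) x))\<^sup>2) = 0"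
    by (simp only: ReX cinner_gram_self cinner_self Re_complex_of_real)
  moreover have "0 \<le> (\<Sum>k\<in>UNIV. (norm (app (w $ k) x))\<^sup>2)" by (intro sum_nonneg) simp
  ultimately have "(norm x)\<^sup>2 \<le> 0" by linarith
  then show "x = 0" by simp
qed

lemma cayley_den_invertible:
  assumes "\<xi> \<in> skew_tangent v"
  shows "bop_invertible (cayley_den v \<xi>)"
  unfolding cayley_den_def by (rule accretive_invertible) (simp_all add: adj_gram_skew[OF assms])

lemma gram_cayley:
  assumes "v \<in> stiefel"
  shows "gram v (cayley v \<xi>) = 2 *\<^sub>R bop_inv (cayley_den v \<xi>) - bop_id"
  using assms gram_normal_part[OF assms] by (simp add: cayley_def stiefel_iff)

lemma normal_part_cayley:
  assumes "v \<in> stiefel"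
  shows "normal_part v (cayley v \<xi>) = normal_part v \<xi> \<odot> (2 *\<^sub>R bop_inv (cayley_den v \<xi>))"
  unfolding normal_part_def[of v "cayley v \<xi>"] gram_cayley[OF assms] by (simp add: cayley_def)

text \<open>For \<open>S = cayley_den v \<xi>\<close> with inverse \<open>a\<close>, skewness gives
  \<open>S + adj S = 2 (1 + gram B B)\<close>. Multiplied by \<open>adj a\<close> from the left and
  \<open>a\<close> from the right this reads \<open>adj a + a = 2 adj a (1 + gram B B) a\<close>,
  and the expansion of the Gram operator of \<open>cayley v \<xi>\<close> reduces to exactly this
  identity.\<close>

lemma cayley_in_stiefel:
  assumes v: "v \<in> stiefel" and \<xi>: "\<xi> \<in> skew_tangent v"
  shows "cayley v \<xi> \<in> stiefel"
proof -
  define a where "a = bop_inv (cayley_den v \<xi>)"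
  define B where "B = normal_part v \<xi>"
  define Q where "Q = gram B B"
  have inv: "a \<circ>\<^sub>B cayley_den v \<xi> = bop_id" "cayley_den v \<xi> \<circ>\<^sub>B a = bop_id"
    unfolding a_def using bop_invertible_inv[OF cayley_den_invertible[OF \<xi>]] .
  have adjS: "cayley_den v \<xi> + adj (cayley_den v \<xi>) = 2 *\<^sub>R (bop_id + Q)"
    by (simp add: cayley_den_def adj_gram_skew[OF \<xi>] Q_def B_def scaleR_2)
  have "adj a \<circ>\<^sub>B adj (cayley_den v \<xi>) = bop_id"
    by (metis adj_simps(1,6) inv(2))
  then have "adj a \<circ>\<^sub>B (cayley_den v \<xi> + adj (cayley_den v \<xi>)) \<circ>\<^sub>B a = adj a + a"
    by (simp add: comp_distrib comp_assoc inv)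
  then have key: "2 *\<^sub>R (adj a \<circ>\<^sub>B a) + 2 *\<^sub>R (adj a \<circ>\<^sub>B (Q \<circ>\<^sub>B a)) = adj a + a"
    unfolding adjS by (simp add: comp_distrib comp_assoc scaleR_add_right)
  have "gram (cayley v \<xi>) (cayley v \<xi>) = (2 *\<^sub>R adj a - bop_id) \<circ>\<^sub>B (2 *\<^sub>R a - bop_id) + 4 *\<^sub>R (adj a \<circ>\<^sub>B (Q \<circ>\<^sub>B a))"
    unfolding cayley_def a_def[symmetric] B_def[symmetric]
    using v gram_normal_part[OF v, of \<xi>] by (simp add: stiefel_iff B_def[symmetric] Q_def comp_assoc)
  also have "\<dots> = 2 *\<^sub>R (2 *\<^sub>R (adj a \<circ>\<^sub>B a) + 2 *\<^sub>R (adj a \<circ>\<^sub>B (Q \<circ>\<^sub>B a))) - 2 *\<^sub>R a - 2 *\<^sub>R adj a + bop_id"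
    by (simp add: comp_distrib scaleR_add_right scaleR_diff_right algebra_simps)
  also have "\<dots> = bop_id"
    unfolding key by (simp add: scaleR_add_right)
  finally show ?thesis by (simp add: stiefel_iff)
qed

lemma cayley_inv_cayley:
  assumes v: "v \<in> stiefel" and \<xi>: "\<xi> \<in> skew_tangent v"
  shows "cayley_inv v (cayley v \<xi>) = \<xi>"
    and "bop_invertible (bop_id + gram v (cayley v \<xi>))"
proof -
  define S where "S = cayley_den v \<xi>"
  define a where "a = bop_inv S"
  define B where "B = normal_part v \<xi>"
  have inv: "a \<circ>\<^sub>B S = bop_id" "S \<circ>\<^sub>B a = bop_id"
    unfolding a_def S_def using bop_invertible_inv[OF cayley_den_invertible[OF \<xi>]] .
  have A: "gram v (cayley v \<xi>) = 2 *\<^sub>R a - bop_id" unfolding a_def S_def by (rule gram_cayley[OF v])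
  have N: "normal_part v (cayley v \<xi>) = B \<odot> (2 *\<^sub>R a)"
    unfolding a_def B_def S_def by (rule normal_part_cayley[OF v])
  have c0: "((1/2) *\<^sub>R S) \<circ>\<^sub>B (bop_id + gram v (cayley v \<xi>)) = bop_id"
    unfolding A using inv by simp
  then show "bop_invertible (bop_id + gram v (cayley v \<xi>))" by (rule bop_invertibleI)
  have c: "bop_inv (bop_id + gram v (cayley v \<xi>)) = (1/2) *\<^sub>R S"
    using c0 by (rule bop_inv_unique)
  have BB: "B \<odot> (2 *\<^sub>R a) \<odot> ((1/2) *\<^sub>R S) = B" by (simp add: inv)
  have eq: "(gram B (B \<odot> (2 *\<^sub>R a)) + (2 *\<^sub>R a - bop_id) - bop_id) \<circ>\<^sub>B ((1/2) *\<^sub>R S) = gram v \<xi>"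
  proof -
    have "(gram B (B \<odot> (2 *\<^sub>R a)) + (2 *\<^sub>R a - bop_id) - bop_id) \<circ>\<^sub>B S = 2 *\<^sub>R (gram B B + bop_id - S)"
      by (simp add: comp_distrib comp_assoc inv scaleR_2)
    then show ?thesis by (simp add: S_def cayley_den_def B_def)
  qed
  have "cayley_inv v (cayley v \<xi>) =
      v \<odot> ((gram B (B \<odot> (2 *\<^sub>R a)) + (2 *\<^sub>R a - bop_id) - bop_id) \<circ>\<^sub>B ((1/2) *\<^sub>R S)) + B"
    unfolding cayley_inv_def c Let_def N BB unfolding A ..
  also have "\<dots> = \<xi>" unfolding eq by (simp add: B_def normal_part_def)
  finally show "cayley_inv v (cayley v \<xi>) = \<xi>" .
qed

text \<open>Membership of \<open>w\<close> enters through \<open>gram N N = 1 - adj A A\<close>. It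
  yields \<open>adj D X D = A - adj A\<close> for the candidate \<open>X\<close>, which must
  therefore be skew-adjoint. The denominator then comes out as \<open>2 c\<close>, and substituting
  it returns \<open>w\<close>.\<close>

lemma cayley_cayley_inv:
  assumes v: "v \<in> stiefel" and w: "w \<in> stiefel" and i: "bop_invertible (bop_id + gram v w)"
  shows "cayley_inv v w \<in> skew_tangent v" "cayley v (cayley_inv v w) = w"
proof -
  define A where "A = gram v w"
  define D where "D = bop_id + A"
  define c where "c = bop_inv D"
  define N where "N = normal_part v w"
  define B where "B = N \<odot> c"
  define P where "P = gram B N + A - bop_id"
  define X where "X = P \<circ>\<^sub>B c"
  have cD: "c \<circ>\<^sub>B D = bop_id" "D \<circ>\<^sub>B c = bop_id"
    unfolding c_def D_def A_def using bop_invertible_inv[OF i] .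
  have \<xi>: "cayley_inv v w = v \<odot> X + B"
    by (simp add: cayley_inv_def Let_def A_def c_def N_def B_def X_def P_def D_def)
  have vB: "gram v B = 0" "gram B v = 0"
    using gram_normal_part[OF v, of w] by (simp_all add: B_def N_def)
  have g\<xi>: "gram v (v \<odot> X + B) = X" using v vB by (simp add: stiefel_iff)
  have np: "normal_part v (v \<odot> X + B) = B" unfolding normal_part_def g\<xi> by simp
  have "bop_id = gram w w" using w by (simp add: stiefel_iff)
  also have "w = v \<odot> A + N" by (simp add: N_def A_def normal_part_def)
  also have "gram (v \<odot> A + N) (v \<odot> A + N) = adj A \<circ>\<^sub>B A + gram N N"
    using v gram_normal_part[OF v, of w] by (simp add: stiefel_iff N_def)
  finally have NN: "gram N N = bop_id - adj A \<circ>\<^sub>B A" by (simp add: algebra_simps)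
  have adjDc: "adj D \<circ>\<^sub>B adj c = bop_id" by (metis adj_simps(1,6) cD(1))
  have DP: "adj D \<circ>\<^sub>B P = A - adj A"
  proof -
    have "adj D \<circ>\<^sub>B gram B N = gram N N"
      unfolding B_def gram_simps comp_assoc[symmetric] adjDc by simp
    then have "adj D \<circ>\<^sub>B P = gram N N + adj D \<circ>\<^sub>B (A - bop_id)"
      by (simp add: P_def comp_distrib)
    then show ?thesis by (simp add: NN D_def comp_distrib)
  qed
  \<comment> \<open>Congruence by the invertible \<open>D\<close> loses nothing, so skewness may be
    tested after it.\<close>
  have "adj D \<circ>\<^sub>B (X + adj X) \<circ>\<^sub>B D = 0"
  proof -
    have 1: "adj D \<circ>\<^sub>B X \<circ>\<^sub>B D = A - adj A" using DP by (simp add: X_def comp_assoc cD)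
    have "adj D \<circ>\<^sub>B adj X \<circ>\<^sub>B D = adj (adj D \<circ>\<^sub>B X \<circ>\<^sub>B D)" by (simp add: comp_assoc)
    also have "\<dots> = adj A - A" unfolding 1 by simp
    finally show ?thesis using 1 by (simp add: comp_distrib)
  qed
  then have "adj c \<circ>\<^sub>B (adj D \<circ>\<^sub>B (X + adj X) \<circ>\<^sub>B D) \<circ>\<^sub>B c = 0" by simp
  moreover have "adj c \<circ>\<^sub>B adj D = bop_id" by (metis adj_simps(1,6) cD(2))
  ultimately have skew: "X + adj X = 0"
    by (simp add: comp_assoc cD) (simp add: comp_assoc[symmetric])
  have "gram (v \<odot> X + B) v = adj X" using v vB by (simp add: stiefel_iff)
  then show *: "cayley_inv v w \<in> skew_tangent v"
    unfolding \<xi> skew_tangent_def using g\<xi> skew by simp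
  have "gram B B = gram B N \<circ>\<^sub>B c" by (simp add: B_def)
  then have "cayley_den v (v \<odot> X + B) = (D - P + gram B N) \<circ>\<^sub>B c"
    unfolding cayley_den_def np g\<xi> by (simp add: X_def comp_distrib cD)
  also have "D - P + gram B N = 2 *\<^sub>R bop_id" by (simp add: D_def P_def scaleR_2)
  finally have den: "cayley_den v (v \<odot> X + B) = 2 *\<^sub>R c" by simp
  have "bop_inv (2 *\<^sub>R c) = (1/2) *\<^sub>R D" by (rule bop_inv_unique) (simp add: cD)
  then have "cayley v (v \<odot> X + B) = v \<odot> (D - bop_id) + B \<odot> D"
    unfolding cayley_def den np by simp
  also have "B \<odot> D = N" by (simp add: B_def cD)
  also have "v \<odot> (D - bop_id) + N = w" by (simp add: D_def N_def A_def normal_part_def)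
  finally show "cayley v (cayley_inv v w) = w" unfolding \<xi> .
qed

text \<open>Linearizing these two relations between \<open>\<xi>\<close> and \<open>w = cayley v \<xi>\<close> shows that the parametrization is an immersion.\<close>

lemma cayley_relations:
  assumes v: "v \<in> stiefel" and \<xi>: "\<xi> \<in> skew_tangent v" and w: "w = cayley v \<xi>"
  shows "normal_part v \<xi> \<odot> (bop_id + gram v w) = normal_part v w"
    and "gram v \<xi> \<circ>\<^sub>B (bop_id + gram v w) = gram (normal_part v \<xi>) (normal_part v w) + gram v w - bop_id"
proof -
  define S where "S = cayley_den v \<xi>"
  define a where "a = bop_inv S"
  have inv: "a \<circ>\<^sub>B S = bop_id" "S \<circ>\<^sub>B a = bop_id"
    unfolding a_def S_def using bop_invertible_inv[OF cayley_den_invertible[OF \<xi>]] .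
  have A: "gram v w = 2 *\<^sub>R a - bop_id" unfolding a_def S_def w by (rule gram_cayley[OF v])
  have N: "normal_part v w = normal_part v \<xi> \<odot> (2 *\<^sub>R a)"
    unfolding a_def S_def w by (rule normal_part_cayley[OF v])
  show "normal_part v \<xi> \<odot> (bop_id + gram v w) = normal_part v w" unfolding A N by simp
  have "gram v \<xi> = bop_id + gram (normal_part v \<xi>) (normal_part v \<xi>) - S"
    by (simp add: S_def cayley_den_def)
  then show "gram v \<xi> \<circ>\<^sub>B (bop_id + gram v w) = gram (normal_part v \<xi>) (normal_part v w) + gram v w - bop_id"
    unfolding A N by (simp add: comp_distrib inv scaleR_2)
qed

lemma cayley_immersion:
  assumes v: "v \<in> stiefel" and \<xi>: "\<xi> \<in> skew_tangent v"
    and line: "\<And>t. \<xi> + t *\<^sub>R \<eta> \<in> skew_tangent v"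
    and der: "((\<lambda>t. cayley v (\<xi> + t *\<^sub>R \<eta>)) has_vector_derivative 0) (at 0)"
  shows "\<eta> = 0"
proof -
  define w where "w = (\<lambda>t. cayley v (\<xi> + t *\<^sub>R \<eta>))"
  define D where "D = (\<lambda>t. bop_id + gram v (w t))"
  interpret gr: bounded_bilinear gram by (rule bounded_bilinear_gram)
  interpret rm: bounded_bilinear "(\<odot>)" by (rule bounded_bilinear_rmul)
  interpret cp: bounded_bilinear "(\<circ>\<^sub>B)" by (rule bounded_bilinear_comp)
  have w: "(w has_vector_derivative 0) (at 0)" using der by (simp add: w_def)
  have gw: "((\<lambda>t. gram v (w t)) has_vector_derivative 0) (at 0)"
    using gr.has_vector_derivative[OF has_vector_derivative_const w, of v] by simp
  have D: "(D has_vector_derivative 0) (at 0)"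
    unfolding D_def using has_vector_derivative_add[OF has_vector_derivative_const gw, of bop_id] by simp
  have nw: "((\<lambda>t. normal_part v (w t)) has_vector_derivative 0) (at 0)"
    unfolding normal_part_def
    using has_vector_derivative_diff[OF w rm.has_vector_derivative[OF has_vector_derivative_const gw, of v]] by simp
  have np: "normal_part v (\<xi> + t *\<^sub>R \<eta>) = normal_part v \<xi> + t *\<^sub>R normal_part v \<eta>" for t
    by (simp add: normal_part_def rmul_distrib scaleR_diff_right algebra_simps)
  have lin: "((\<lambda>t. a + t *\<^sub>R b) has_vector_derivative b) (at 0)" for a b :: "'x::real_normed_vector"
    by (auto intro!: derivative_eq_intros)
  have D0: "bop_invertible (D 0)"
    using cayley_inv_cayley(2)[OF v \<xi>] by (simp add: D_def w_def)
  have "((\<lambda>t. (normal_part v \<xi> + t *\<^sub>R normal_part v \<eta>) \<odot> D t) has_vector_derivative normal_part v \<eta> \<odot> D 0) (at 0)"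
    using rm.has_vector_derivative[OF lin D, of "normal_part v \<xi>" "normal_part v \<eta>"] by simp
  moreover have "(\<lambda>t. (normal_part v \<xi> + t *\<^sub>R normal_part v \<eta>) \<odot> D t) = (\<lambda>t. normal_part v (w t))"
    using cayley_relations(1)[OF v line refl] by (simp add: np D_def w_def)
  ultimately have "normal_part v \<eta> \<odot> D 0 = 0"
    using vector_derivative_unique_at[OF _ nw] by simp
  then have "normal_part v \<eta> \<odot> D 0 \<odot> bop_inv (D 0) = 0" by simp
  then have N0: "normal_part v \<eta> = 0" by (simp add: bop_invertible_inv[OF D0])
  \<comment> \<open>The normal part is now known to be constant along the line, so the second
    relation becomes linear in \<open>t\<close> on the left and has derivative zero on the
    right.\<close>
  have "((\<lambda>t. (gram v \<xi> + t *\<^sub>R gram v \<eta>) \<circ>\<^sub>B D t) has_vector_derivative gram v \<eta> \<circ>\<^sub>B D 0) (at 0)"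
    using cp.has_vector_derivative[OF lin D, of "gram v \<xi>" "gram v \<eta>"] by simp
  moreover have "(\<lambda>t. (gram v \<xi> + t *\<^sub>R gram v \<eta>) \<circ>\<^sub>B D t)
      = (\<lambda>t. gram (normal_part v \<xi>) (normal_part v (w t)) + gram v (w t) - bop_id)"
    using cayley_relations(2)[OF v line refl] by (simp add: np D_def w_def N0)
  moreover have "((\<lambda>t. gram (normal_part v \<xi>) (normal_part v (w t)) + gram v (w t) - bop_id)
      has_vector_derivative 0) (at 0)"
    using has_vector_derivative_diff[OF has_vector_derivative_add[OF
        gr.has_vector_derivative[OF has_vector_derivative_const nw, of "normal_part v \<xi>"] gw]
        has_vector_derivative_const, of bop_id] by simp
  ultimately have "gram v \<eta> \<circ>\<^sub>B D 0 = 0"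
    using vector_derivative_unique_at[of _ _ 0] by simp
  then have "gram v \<eta> \<circ>\<^sub>B D 0 \<circ>\<^sub>B bop_inv (D 0) = 0" by simp
  then have "gram v \<eta> = 0" by (simp add: comp_assoc bop_invertible_inv[OF D0])
  then show "\<eta> = 0" using N0 by (simp add: normal_part_def)
qed

section \<open>Dimension of the tangent space, and compactness\<close>

lemma subspace_orthonormal_set:
  fixes S :: "'e::real_inner set" and B0 :: "'e set"
  assumes B0: "real_onb B0" and S: "subspace S"
  obtains B where "finite B" "B \<subseteq> S" "span B = S" "\<And>a b. a \<in> B \<Longrightarrow> b \<in> B \<Longrightarrow> a \<bullet> b = (if a = b then 1 else 0)"
proof -
  obtain C where C: "C \<subseteq> S" "independent C" "S \<subseteq> span C"
    using maximal_independent_subset by blast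
  have "UNIV \<subseteq> span B0"
  proof
    fix v
    have "(\<Sum>b\<in>B0. (v \<bullet> b) *\<^sub>R b) \<in> span B0" by (intro span_sum span_scale span_base)
    then show "v \<in> span B0" by (simp add: real_onb_expand[OF B0])
  qed
  then have "finite C" using independent_span_bound[OF real_onb_finite[OF B0] C(2)] by blast
  then obtain D where D: "finite D" "span D = span C" "pairwise orthogonal D"
    using basis_orthogonal[of C] by blast
  have spanC: "span C = S" using span_minimal[OF C(1) S] C(3) by simp
  define B where "B = (\<lambda>x. x /\<^sub>R norm x) ` (D - {0})"
  have DS: "D \<subseteq> S" using D(2) spanC span_superset by blast
  show ?thesis
  proof
    show "finite B" using D(1) by (simp add: B_def)
    show BS: "B \<subseteq> S"
      unfolding B_def using DS by (intro image_subsetI subspace_scale[OF S]) blast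
    show "span B = S"
    proof
      show "span B \<subseteq> S" using BS S by (rule span_minimal)
      have "x \<in> span B" if "x \<in> D" for x
      proof (cases "x = 0")
        case False
        then have "norm x *\<^sub>R (x /\<^sub>R norm x) \<in> span B"
          using that by (intro span_scale span_base) (auto simp: B_def)
        then show ?thesis using False by simp
      qed (simp add: span_zero)
      then have "span D \<subseteq> span B" by (intro span_minimal) auto
      then show "S \<subseteq> span B" using D(2) spanC by simp
    qed
    fix a b assume "a \<in> B" "b \<in> B"
    then obtain x y where x: "x \<in> D" "x \<noteq> 0" "a = x /\<^sub>R norm x" and y: "y \<in> D" "y \<noteq> 0" "b = y /\<^sub>R norm y"
      by (auto simp: B_def)
    show "a \<bullet> b = (if a = b then 1 else 0)"
    proof (cases "x = y")
      case True
      then show ?thesis using x y by (simp add: power2_norm_eq_inner[symmetric] power2_eq_square)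
    next
      case False
      then have "x \<bullet> y = 0" using D(3) x y by (auto simp: pairwise_def orthogonal_def)
      then have ab: "a \<bullet> b = 0" using x y by simp
      moreover have "a \<bullet> a \<noteq> 0" using x by simp
      ultimately show ?thesis by auto
    qed
  qed
qed

text \<open>Turns an orthogonal decomposition of the whole space into an equation between
  cardinalities; this is how the two dimension counts below are made.\<close>

lemma real_onb_Un:
  fixes B C :: "'e::real_inner set"
  assumes "finite B" "finite C"
    and B: "\<And>a b. a \<in> B \<Longrightarrow> b \<in> B \<Longrightarrow> a \<bullet> b = (if a = b then 1 else 0)"
    and C: "\<And>a b. a \<in> C \<Longrightarrow> b \<in> C \<Longrightarrow> a \<bullet> b = (if a = b then 1 else 0)"
    and BC: "\<And>a b. a \<in> B \<Longrightarrow> b \<in> C \<Longrightarrow> a \<bullet> b = 0"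
    and sum: "\<And>w. \<exists>a\<in>span B. \<exists>b\<in>span C. w = a + b"
  shows "real_onb (B \<union> C) \<and> card (B \<union> C) = card B + card C"
proof
  have disj: "B \<inter> C = {}"
  proof (rule ccontr)
    assume "B \<inter> C \<noteq> {}"
    then obtain a where "a \<in> B" "a \<in> C" by blast
    then show False using B[of a a] BC[of a a] by simp
  qed
  show "card (B \<union> C) = card B + card C" using assms(1,2) disj by (rule card_Un_disjoint)
  show "real_onb (B \<union> C)"
  proof (rule real_onbI)
    show "finite (B \<union> C)" using assms(1,2) by simp
    show "a \<bullet> b = (if a = b then 1 else 0)" if "a \<in> B \<union> C" "b \<in> B \<union> C" for a b
      using that
    proof (elim UnE)
      assume "a \<in> C" "b \<in> B"
      then have "b \<bullet> a = 0" "a \<noteq> b" using BC disj by auto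
      then show ?thesis by (simp add: inner_commute)
    qed (use B C BC disj in auto)
    fix v assume v: "\<And>b. b \<in> B \<union> C \<Longrightarrow> v \<bullet> b = 0"
    have "subspace {x. v \<bullet> x = 0}" by (rule subspace_hyperplane)
    then have "span (B \<union> C) \<subseteq> {x. v \<bullet> x = 0}" using v by (intro span_minimal) auto
    moreover obtain a b where "a \<in> span B" "b \<in> span C" "v = a + b" using sum by blast
    then have "v \<in> span (B \<union> C)" by (metis Un_upper1 Un_upper2 span_add span_mono subsetD)
    ultimately have "v \<bullet> v = 0" by blast
    then show "v = 0" by simp
  qed
qed

lemma parseval_cinner:
  assumes "orthonormal_basis E"
  shows "cinner x y = (\<Sum>e\<in>E. cinner x e * cnj (cinner y e))"
proof -
  have "cinner x y = cinner (\<Sum>e\<in>E. cinner x e *\<^sub>C e) y"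
    using orthonormal_basis_expand[OF assms, of x] by simp
  also have "\<dots> = (\<Sum>e\<in>E. cinner x e * cnj (cinner y e))"
    unfolding cinner_sum_left cinner_scaleC_left by (intro sum.cong refl arg_cong2[of _ _ _ _ "(*)"] cinner_commute)
  finally show ?thesis .
qed

lemma inner_adj:
  fixes A B :: "('h::fd_hilbert, 'k::fd_hilbert) bop"
  shows "adj A \<bullet> adj B = A \<bullet> B"
proof -
  obtain E :: "'h set" where E: "orthonormal_basis E" using orthonormal_basis_exists by blast
  obtain F :: "'k set" where F: "orthonormal_basis F" using orthonormal_basis_exists by blast
  have "A \<bullet> B = Re (\<Sum>e\<in>E. cinner (app A e) (app B e))"
    by (simp add: inner_bop_eq[OF E] inner_eq_Re_cinner)
  also have "(\<Sum>e\<in>E. cinner (app A e) (app B e))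
      = (\<Sum>e\<in>E. \<Sum>f\<in>F. cinner (app A e) f * cnj (cinner (app B e) f))"
    by (intro sum.cong refl parseval_cinner[OF F])
  also have "\<dots> = (\<Sum>f\<in>F. \<Sum>e\<in>E. cinner (app (adj B) f) e * cnj (cinner (app (adj A) f) e))"
  proof (subst sum.swap, intro sum.cong refl)
    fix f e
    have "cinner (app A e) f = cnj (cinner (app (adj A) f) e)"
      unfolding cinner_adj_left by (rule cinner_commute)
    moreover have "cnj (cinner (app B e) f) = cinner (app (adj B) f) e"
      unfolding cinner_adj_left by (rule cinner_commute[symmetric])
    ultimately show "cinner (app A e) f * cnj (cinner (app B e) f)
        = cinner (app (adj B) f) e * cnj (cinner (app (adj A) f) e)" by simp
  qed
  also have "\<dots> = (\<Sum>f\<in>F. cinner (app (adj B) f) (app (adj A) f))"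
    by (intro sum.cong refl parseval_cinner[OF E, symmetric])
  finally show ?thesis
    by (simp add: inner_bop_eq[OF F] inner_eq_Re_cinner[symmetric] inner_commute)
qed

lift_definition bop_scal :: "complex \<Rightarrow> ('h::fd_hilbert, 'h) bop" is "\<lambda>c x. c *\<^sub>C x"
proof (intro conjI allI)
  fix c :: complex
  show "bounded_linear (\<lambda>x :: 'h. c *\<^sub>C x)"
  proof (rule bounded_linear_intro[of _ "cmod c"])
    show "norm (c *\<^sub>C x) \<le> norm x * cmod c" for x :: 'h by (simp add: norm_scaleC)
  qed (simp_all add: scaleC_add_right scaleR_eq_scaleC scaleC_scaleC mult.commute)
qed (simp add: scaleC_scaleC mult.commute)

lemma app_bop_scal [simp]: "app (bop_scal c) x = c *\<^sub>C x"
  by (simp add: bop_scal.rep_eq)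

lemma adj_bop_scal [simp]: "adj (bop_scal c) = bop_scal (cnj c)"
  by (rule adj_eqI) (simp add: cinner_scaleC_left cinner_scaleC_right)

lemma bop_scal_simps [simp]:
  "bop_scal c \<circ>\<^sub>B bop_scal c' = bop_scal (c * c')" "bop_scal 1 = bop_id" "bop_scal (- c) = - bop_scal c"
  by (rule bop_eqI; simp add: scaleC_scaleC scaleC_one complex_vector.scale_minus_left)+

lemma bop_scal_commute: "bop_scal c \<circ>\<^sub>B A = A \<circ>\<^sub>B bop_scal c"
  by (rule bop_eqI) (simp add: app_scaleC)

lemma inner_bop_scal_unit:
  assumes "cmod c = 1"
  shows "(bop_scal c \<circ>\<^sub>B A) \<bullet> (bop_scal c \<circ>\<^sub>B B) = A \<bullet> B"
proof -
  have "c * cnj c = 1" using assms by (simp add: complex_norm_square[symmetric])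
  then show ?thesis
    unfolding inner_bop_def by (simp add: comp_assoc) (simp add: comp_assoc[symmetric] mult.commute)
qed

text \<open>Multiplication by \<open>\<i>\<close> is an isometry from the self-adjoint onto the
  skew-adjoint operators, and the two spaces are orthogonal complements. So the self-adjoint ones
  have half of the real dimension \<open>2 n\<^sup>2\<close>.\<close>

lemma selfadjoint_orthonormal_set:
  obtains B :: "('h::fd_hilbert, 'h) bop set"
  where "finite B" "card B = (cdim TYPE('h))\<^sup>2" "span B = {A. adj A = A}"
    "\<And>a b. a \<in> B \<Longrightarrow> b \<in> B \<Longrightarrow> a \<bullet> b = (if a = b then 1 else 0)"
proof -
  let ?S = "{A :: ('h, 'h) bop. adj A = A}" and ?J = "\<lambda>A :: ('h, 'h) bop. bop_scal \<i> \<circ>\<^sub>B A"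
  obtain B0 :: "('h, 'h) bop set" where B0: "real_onb B0" "card B0 = 2 * cdim TYPE('h) * cdim TYPE('h)"
    by (rule real_onb_bop_exists)
  have "subspace ?S" by (simp add: subspace_def)
  from subspace_orthonormal_set[OF B0(1) this]
  obtain B where B: "finite B" "B \<subseteq> ?S" "span B = ?S"
    and on: "\<And>a b. a \<in> B \<Longrightarrow> b \<in> B \<Longrightarrow> a \<bullet> b = (if a = b then 1 else 0)"
    by blast
  have JJ: "?J A \<bullet> ?J C = A \<bullet> C" for A C by (rule inner_bop_scal_unit) simp
  have lin: "linear ?J" by (rule linearI) (simp_all add: comp_distrib)
  have J2: "?J (?J A) = - A" for A by (simp add: comp_assoc[symmetric])
  have injJ: "inj ?J"
  proof (rule injI)
    fix A C assume "?J A = ?J C"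
    then have "?J (?J A) = ?J (?J C)" by simp
    then show "A = C" unfolding J2 by simp
  qed
  have U: "real_onb (B \<union> ?J ` B) \<and> card (B \<union> ?J ` B) = card B + card (?J ` B)"
  proof (rule real_onb_Un)
    show "a \<bullet> b = (if a = b then 1 else 0)" if "a \<in> ?J ` B" "b \<in> ?J ` B" for a b
      using that on JJ injJ by (auto simp: inj_eq)
    show "a \<bullet> b = 0" if a: "a \<in> B" and b: "b \<in> ?J ` B" for a b
    proof -
      obtain c where c: "c \<in> B" "b = ?J c" using b by blast
      have "adj a = a" "adj c = c" using a c B(2) by auto
      then have "adj b = - b" unfolding c(2) by (simp add: bop_scal_commute)
      then have "a \<bullet> b = - (a \<bullet> b)" using inner_adj[of a b] \<open>adj a = a\<close> by simp
      then show ?thesis by simp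
    qed
    show "\<exists>a\<in>span B. \<exists>b\<in>span (?J ` B). w = a + b" for w
    proof (intro bexI)
      show "w = (1/2) *\<^sub>R (w + adj w) + (1/2) *\<^sub>R (w - adj w)"
        by (simp add: scaleR_add_right scaleR_diff_right flip: scaleR_add_left)
      show "(1/2) *\<^sub>R (w + adj w) \<in> span B" unfolding B(3) by (simp add: add.commute)
      \<comment> \<open>The skew-adjoint part of \<open>w\<close> times \<open>-\<i>\<close> is
        self-adjoint, and \<open>\<i>\<close> carries it back.\<close>
      have "- ?J ((1/2) *\<^sub>R (w - adj w)) \<in> span B"
        unfolding B(3) by (simp add: bop_scal_commute comp_distrib scaleR_diff_right)
      then have "?J (- ?J ((1/2) *\<^sub>R (w - adj w))) \<in> ?J ` span B" by blast
      also have "?J (- ?J ((1/2) *\<^sub>R (w - adj w))) = (1/2) *\<^sub>R (w - adj w)"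
        using J2[of "(1/2) *\<^sub>R (w - adj w)"] by simp
      finally show "(1/2) *\<^sub>R (w - adj w) \<in> span (?J ` B)"
        by (simp add: linear_span_image[OF lin])
    qed
  qed (use B on in auto)
  have "2 * card B = 2 * cdim TYPE('h) * cdim TYPE('h)"
    using U real_onb_card_dim[OF B0(1)] B0(2) real_onb_card_dim[OF conjunct1[OF U]]
      card_image[OF inj_on_subset[OF injJ], of B] by simp
  then have "card B = (cdim TYPE('h))\<^sup>2" by (simp add: power2_eq_square)
  then show ?thesis using that B on by blast
qed

lemma inner_rmul: "v \<bullet> (w \<odot> A) = gram w v \<bullet> A"
  unfolding inner_trace inner_bop_def by simp

lemma subspace_skew_tangent: "subspace (skew_tangent v)"
  unfolding subspace_def skew_tangent_def
  by (auto simp: algebra_simps) (metis scaleR_add_right scaleR_zero_right)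

text \<open>The inner product of \<open>\<xi>\<close> with \<open>v \<odot> A\<close> is that of
  \<open>gram v \<xi>\<close> with \<open>A\<close>. Hence the products of \<open>v\<close> with
  self-adjoint \<open>A\<close> are orthogonal to the tangent space; they form an isometric copy of
  a space of dimension \<open>n\<^sup>2\<close> and complete the tangent space to all
  \<open>2 r n m\<close> dimensions.\<close>

lemma skew_tangent_orthonormal_set:
  fixes v :: "('h::fd_hilbert, 'k::fd_hilbert) bop ^ 'r"
  assumes v: "v \<in> stiefel"
  obtains B where "finite B" "span B = skew_tangent v"
    "card B = cdim TYPE('h) * (2 * CARD('r) * cdim TYPE('k) - cdim TYPE('h))"
    "\<And>a b. a \<in> B \<Longrightarrow> b \<in> B \<Longrightarrow> a \<bullet> b = (if a = b then 1 else 0)"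
proof -
  have vv: "gram v v = bop_id" using v by (simp add: stiefel_iff)
  obtain B0 :: "(('h, 'k) bop ^ 'r) set" where B0: "real_onb B0"
    "card B0 = 2 * CARD('r) * cdim TYPE('h) * cdim TYPE('k)"
    by (rule real_onb_tuple_exists)
  from subspace_orthonormal_set[OF B0(1) subspace_skew_tangent]
  obtain B where B: "finite B" "B \<subseteq> skew_tangent v" "span B = skew_tangent v"
    and on: "\<And>a b. a \<in> B \<Longrightarrow> b \<in> B \<Longrightarrow> a \<bullet> b = (if a = b then 1 else 0)"
    by blast
  obtain C :: "('h, 'h) bop set" where C: "finite C" "card C = (cdim TYPE('h))\<^sup>2" "span C = {A. adj A = A}"
    and onC: "\<And>a b. a \<in> C \<Longrightarrow> b \<in> C \<Longrightarrow> a \<bullet> b = (if a = b then 1 else 0)"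
    using selfadjoint_orthonormal_set[where 'h = 'h] by blast
  have iso: "(v \<odot> a) \<bullet> (v \<odot> b) = a \<bullet> b" for a b :: "('h, 'h) bop"
    unfolding inner_rmul by (simp add: vv)
  have lin: "linear ((\<odot>) v :: ('h, 'h) bop \<Rightarrow> _)" by (rule linearI) (simp_all add: rmul_distrib)
  have inj: "inj ((\<odot>) v :: ('h, 'h) bop \<Rightarrow> _)"
  proof (rule injI)
    fix a b :: "('h, 'h) bop" assume "v \<odot> a = v \<odot> b"
    then have "gram v (v \<odot> a) = gram v (v \<odot> b)" by simp
    then show "a = b" by (simp add: vv)
  qed
  have U: "real_onb (B \<union> (\<odot>) v ` C) \<and> card (B \<union> (\<odot>) v ` C) = card B + card ((\<odot>) v ` C)"
  proof (rule real_onb_Un)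
    show "a \<bullet> b = (if a = b then 1 else 0)" if "a \<in> (\<odot>) v ` C" "b \<in> (\<odot>) v ` C" for a b
      using that onC iso inj by (auto simp: inj_eq)
    show "a \<bullet> b = 0" if a: "a \<in> B" and b: "b \<in> (\<odot>) v ` C" for a b
    proof -
      obtain c where c: "c \<in> C" "b = v \<odot> c" using b by blast
      have sa: "adj c = c" using c(1) C(3) span_base by blast
      have "adj (gram v a) = - gram v a" using a B(2) adj_gram_skew by auto
      then have "gram v a \<bullet> c = - (gram v a \<bullet> c)" using inner_adj[of "gram v a" c] sa by simp
      then show ?thesis unfolding c(2) inner_rmul by simp
    qed
    show "\<exists>a\<in>span B. \<exists>b\<in>span ((\<odot>) v ` C). w = a + b" for w
    proof (intro bexI)
      \<comment> \<open>The self-adjoint part of \<open>gram v w\<close>: removing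
        \<open>v \<odot> ?h\<close> leaves a tangent vector.\<close>
      let ?h = "(1/2) *\<^sub>R (gram v w + gram w v)"
      show "w = (w - v \<odot> ?h) + v \<odot> ?h" by simp
      have "adj ?h = ?h" by (simp add: add.commute)
      then have "?h \<in> span C" unfolding C(3) by blast
      then show "v \<odot> ?h \<in> span ((\<odot>) v ` C)" unfolding linear_span_image[OF lin] by blast
      have "gram v (w - v \<odot> ?h) + gram (w - v \<odot> ?h) v = 0"
        by (simp add: vv algebra_simps flip: scaleR_add_left)
      then show "w - v \<odot> ?h \<in> span B" unfolding B(3) skew_tangent_def by blast
    qed
  qed (use B C on in auto)
  have "card B + (cdim TYPE('h))\<^sup>2 = 2 * CARD('r) * cdim TYPE('h) * cdim TYPE('k)"
    using U real_onb_card_dim[OF B0(1)] B0(2) real_onb_card_dim[OF conjunct1[OF U]]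
      card_image[OF inj_on_subset[OF inj], of C] C(2) by simp
  then have "card B = 2 * CARD('r) * cdim TYPE('h) * cdim TYPE('k) - (cdim TYPE('h))\<^sup>2" by simp
  also have "\<dots> = cdim TYPE('h) * (2 * CARD('r) * cdim TYPE('k) - cdim TYPE('h))"
    by (simp add: power2_eq_square diff_mult_distrib2 mult_ac)
  finally show ?thesis using that B on by blast
qed

lemma compact_stiefel: "compact (stiefel :: (('h::fd_hilbert, 'k::fd_hilbert) bop ^ 'r) set)"
proof -
  let ?g = "\<lambda>v :: ('h, 'k) bop ^ 'r. gram v v"
  interpret gr: bounded_bilinear gram by (rule bounded_bilinear_gram)
  have "continuous_on UNIV ?g" by (intro gr.continuous_on continuous_on_id)
  then have "closed (?g -` {bop_id})" by (intro closed_vimage) simp_all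
  moreover have "stiefel = ?g -` {bop_id}" by (auto simp: stiefel_iff)
  ultimately have "closed (stiefel :: (('h, 'k) bop ^ 'r) set)" by simp
  moreover have "norm v \<le> sqrt (Re (trace_bop (bop_id :: ('h, 'h) bop)))" if "v \<in> stiefel"
    for v :: "('h, 'k) bop ^ 'r"
    using that by (simp add: norm_eq_sqrt_inner inner_trace stiefel_iff)
  then have "bounded (stiefel :: (('h, 'k) bop ^ 'r) set)" unfolding bounded_iff by blast
  ultimately show ?thesis using compact_eq_bounded_closed by blast
qed

section \<open>Connectedness and the unitary action\<close>

lemma infinite_unit_circle: "infinite {z :: complex. cmod z = 1}"
proof
  assume "finite {z :: complex. cmod z = 1}"
  then have fin: "finite (sphere (0 :: complex) 1)" by (simp add: sphere_def)
  have "connected (sphere (0 :: complex) 1)" by (rule connected_sphere) simp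
  then obtain a where "sphere (0 :: complex) 1 = {a}"
    using connected_finite_iff_sing[of "sphere (0 :: complex) 1"] fin by auto
  moreover have "1 \<in> sphere (0 :: complex) 1" "-1 \<in> sphere (0 :: complex) 1" by simp_all
  ultimately have "(1 :: complex) = -1" by (metis singletonD)
  then show False by simp
qed

lemma orthonormal_finite:
  fixes S :: "'h::fd_hilbert set"
  assumes "orthonormal S"
  shows "finite S"
proof -
  obtain E :: "'h set" where E: "orthonormal_basis E" using orthonormal_basis_exists by blast
  then show ?thesis
    using complex_vector.independent_span_bound[of E S] orthonormal_independent[OF assms]
    by (simp add: orthonormal_basis_def)
qed

text \<open>The squared distance between the two sides expands to the squared norm of
  \<open>app (adj A) x\<close> minus that of \<open>x\<close>, which the contraction property makes
  nonpositive.\<close>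

lemma contraction_eigenvector_adj:
  fixes A :: "('h::fd_hilbert, 'h) bop"
  assumes A: "\<And>x. norm (app (adj A) x) \<le> norm x" and x: "app A x = \<mu> *\<^sub>C x" and \<mu>: "cmod \<mu> = 1"
  shows "app (adj A) x = cnj \<mu> *\<^sub>C x"
proof -
  define y where "y = app (adj A) x"
  have mm: "\<mu> * cnj \<mu> = 1" using \<mu> by (simp add: complex_norm_square[symmetric])
  have yx: "cinner y x = cnj \<mu> * cinner x x"
    unfolding y_def cinner_adj_left x by (simp add: cinner_scaleC_right)
  have xy: "cinner x y = \<mu> * cinner x x"
    unfolding y_def cinner_adj[symmetric] x by (simp add: cinner_scaleC_left)
  have "cinner (y - cnj \<mu> *\<^sub>C x) (y - cnj \<mu> *\<^sub>C x) = cinner y y - \<mu> * cinner y x - cnj \<mu> * cinner x y + (\<mu> * cnj \<mu>) * cinner x x"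
    by (simp add: cinner_diff_left cinner_diff_right cinner_scaleC_left cinner_scaleC_right algebra_simps)
  also have "\<dots> = cinner y y - (\<mu> * cnj \<mu>) * cinner x x" unfolding yx xy by (simp add: algebra_simps)
  also have "\<dots> = complex_of_real ((norm y)\<^sup>2 - (norm x)\<^sup>2)" unfolding mm by (simp add: cinner_self)
  finally have "(norm (y - cnj \<mu> *\<^sub>C x))\<^sup>2 = (norm y)\<^sup>2 - (norm x)\<^sup>2"
    unfolding cinner_self of_real_eq_iff .
  also have "\<dots> \<le> 0" using power_mono[OF A[of x] norm_ge_zero, of 2] by (simp add: y_def)
  finally show ?thesis by (simp add: y_def)
qed

text \<open>Unimodular eigenvalues of a contraction have orthogonal eigenvectors, so only finitely many exist.\<close>

lemma contraction_shift_invertible: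
  fixes A :: "('h::fd_hilbert, 'h) bop"
  assumes A: "\<And>x. norm (app (adj A) x) \<le> norm x"
  shows "\<exists>\<mu>. cmod \<mu> = 1 \<and> bop_invertible (bop_id + A \<circ>\<^sub>B bop_scal \<mu>)"
proof (rule ccontr)
  assume no: "\<not> ?thesis"
  have "\<exists>x. norm x = 1 \<and> app A x = \<mu> *\<^sub>C x" if "\<mu> \<in> {z. cmod z = 1}" for \<mu>
  proof -
    have m: "cmod (- cnj \<mu>) = 1" "\<mu> * cnj \<mu> = 1" using that by (simp_all add: complex_norm_square[symmetric])
    then obtain x where x: "app (bop_id + A \<circ>\<^sub>B bop_scal (- cnj \<mu>)) x = 0" "x \<noteq> 0"
      using no unfolding bop_invertible_def by blast
    have "x = cnj \<mu> *\<^sub>C app A x" using x(1) by (simp add: app_scaleC complex_vector.scale_minus_left)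
    then have "\<mu> *\<^sub>C x = \<mu> *\<^sub>C cnj \<mu> *\<^sub>C app A x" by (rule arg_cong)
    then have Ax: "app A x = \<mu> *\<^sub>C x" unfolding scaleC_scaleC m scaleC_one by (rule sym)
    define y where "y = x /\<^sub>R norm x"
    have "norm y = 1" using x(2) by (simp add: y_def)
    moreover have "app A y = \<mu> *\<^sub>C y"
      unfolding y_def app_arg_simps Ax by (simp add: scaleR_eq_scaleC scaleC_scaleC mult.commute)
    ultimately show ?thesis by blast
  qed
  then obtain f where f: "\<And>\<mu>. cmod \<mu> = 1 \<Longrightarrow> norm (f \<mu>) = 1" "\<And>\<mu>. cmod \<mu> = 1 \<Longrightarrow> app A (f \<mu>) = \<mu> *\<^sub>C f \<mu>"
    using bchoice[of "{z. cmod z = 1}" "\<lambda>\<mu> x. norm x = 1 \<and> app A x = \<mu> *\<^sub>C x"] by auto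
  have orth: "cinner (f \<mu>) (f \<nu>) = (if \<mu> = \<nu> then 1 else 0)" if "cmod \<mu> = 1" "cmod \<nu> = 1" for \<mu> \<nu>
  proof (cases "\<mu> = \<nu>")
    case True
    then show ?thesis using f(1)[OF that(1)] by (simp add: cinner_self)
  next
    case False
    have "\<mu> * cinner (f \<mu>) (f \<nu>) = cinner (app A (f \<mu>)) (f \<nu>)"
      by (simp add: f(2)[OF that(1)] cinner_scaleC_left)
    also have "\<dots> = \<nu> * cinner (f \<mu>) (f \<nu>)"
      unfolding cinner_adj contraction_eigenvector_adj[OF A f(2)[OF that(2)] that(2)]
      by (simp add: cinner_scaleC_right)
    finally have "(\<mu> - \<nu>) * cinner (f \<mu>) (f \<nu>) = 0" by (simp add: algebra_simps)
    then show ?thesis using False by simp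
  qed
  have eq: "\<mu> = \<nu>" if "cmod \<mu> = 1" "cmod \<nu> = 1" "f \<mu> = f \<nu>" for \<mu> \<nu>
    using orth[OF that(1,2)] orth[OF that(1,1)] that(3) by (auto split: if_splits)
  have "orthonormal (f ` {z. cmod z = 1})"
    unfolding orthonormal_def using orth eq by auto
  then have "finite (f ` {z. cmod z = 1})" by (rule orthonormal_finite)
  moreover have "inj_on f {z. cmod z = 1}" using eq by (auto simp: inj_on_def)
  ultimately show False using infinite_unit_circle finite_imageD by blast
qed

text \<open>With \<open>u\<close> the part of \<open>w\<close> orthogonal to the range of
  \<open>v\<close>, the defect \<open>bop_id - gram w v \<circ>\<^sub>B gram v w\<close> equals
  \<open>gram u u\<close>, a positive operator.\<close>

lemma stiefel_gram_contraction:
  assumes v: "v \<in> stiefel" and w: "w \<in> stiefel"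
  shows "norm (app (gram v w) x) \<le> norm x"
proof -
  define y where "y = app (gram v w) x"
  define u where "u = w - v \<odot> gram v w"
  have vv: "gram v v = bop_id" and ww: "gram w w = bop_id" using v w by (simp_all add: stiefel_iff)
  have "gram u u = bop_id - gram w v \<circ>\<^sub>B gram v w"
    by (simp add: u_def vv ww)
  then have "cinner (app (gram u u) x) x = cinner x x - cinner y y"
    by (simp add: cinner_diff_left cinner_adj y_def)
  then have "complex_of_real (\<Sum>k\<in>UNIV. (norm (app (u $ k) x))\<^sup>2) = complex_of_real ((norm x)\<^sup>2 - (norm y)\<^sup>2)"
    unfolding cinner_gram_self cinner_self by simp
  then have "(norm x)\<^sup>2 - (norm y)\<^sup>2 = (\<Sum>k\<in>UNIV. (norm (app (u $ k) x))\<^sup>2)"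
    unfolding of_real_eq_iff ..
  moreover have "0 \<le> (\<Sum>k\<in>UNIV. (norm (app (u $ k) x))\<^sup>2)" by (intro sum_nonneg) simp
  ultimately have "(norm y)\<^sup>2 \<le> (norm x)\<^sup>2" by linarith
  then show ?thesis unfolding y_def by (rule power2_le_imp_le) simp
qed

lemma stiefel_shift_invertible:
  assumes "v \<in> stiefel" "w \<in> stiefel"
  obtains \<mu> where "cmod \<mu> = 1" "bop_invertible (bop_id + gram v (w \<odot> bop_scal \<mu>))"
proof -
  have "norm (app (adj (gram v w)) x) \<le> norm x" for x
    using stiefel_gram_contraction[OF assms(2,1)] by simp
  then obtain \<mu> where "cmod \<mu> = 1" "bop_invertible (bop_id + gram v w \<circ>\<^sub>B bop_scal \<mu>)"
    using contraction_shift_invertible[of "gram v w"] by blast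
  then show ?thesis using that by simp
qed

lemma stiefel_scal:
  assumes "v \<in> stiefel" "cmod c = 1"
  shows "v \<odot> bop_scal c \<in> stiefel"
proof -
  have "cnj c * c = 1" using assms(2) by (simp add: complex_norm_square[symmetric] mult.commute)
  then show ?thesis using assms(1) by (simp add: stiefel_iff)
qed

lemma zero_skew_tangent [simp]: "0 \<in> skew_tangent v"
  by (simp add: skew_tangent_def)

lemma cayley_zero: "cayley v 0 = v"
proof -
  have den: "cayley_den v 0 = bop_id" by (simp add: cayley_den_def normal_part_def)
  have "bop_inv (cayley_den v 0) = bop_id" by (rule bop_inv_unique) (simp add: den)
  then show ?thesis by (simp add: cayley_def normal_part_def scaleR_2)
qed

lemma tendsto_normal_part: "(f \<longlongrightarrow> \<xi>) F \<Longrightarrow> ((\<lambda>x. normal_part v (f x)) \<longlongrightarrow> normal_part v \<xi>) F"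
  unfolding normal_part_def
  by (intro tendsto_diff bounded_bilinear.tendsto[OF bounded_bilinear_rmul]
      bounded_bilinear.tendsto[OF bounded_bilinear_gram] tendsto_const)

lemma continuous_on_cayley: "continuous_on (skew_tangent v) (cayley v)"
  unfolding continuous_on_def
proof
  fix \<xi> assume \<xi>: "\<xi> \<in> skew_tangent v"
  note np = tendsto_normal_part[OF tendsto_ident_at, of v \<xi> "skew_tangent v"]
  have den: "((\<lambda>\<xi>. cayley_den v \<xi>) \<longlongrightarrow> cayley_den v \<xi>) (at \<xi> within skew_tangent v)"
    unfolding cayley_den_def
    by (intro tendsto_add tendsto_diff bounded_bilinear.tendsto[OF bounded_bilinear_gram] np tendsto_const tendsto_ident_at)
  show "(cayley v \<longlongrightarrow> cayley v \<xi>) (at \<xi> within skew_tangent v)"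
    unfolding cayley_def[abs_def]
    by (intro tendsto_add tendsto_diff bounded_bilinear.tendsto[OF bounded_bilinear_rmul] np tendsto_scaleR
        tendsto_const bop_inv_tendsto[OF den cayley_den_invertible[OF \<xi>]])
qed

lemma continuous_on_cayley_inv:
  "continuous_on {w. bop_invertible (bop_id + gram v w)} (cayley_inv v)"
  unfolding continuous_on_def
proof
  fix w assume w: "w \<in> {w. bop_invertible (bop_id + gram v w)}"
  let ?F = "at w within {w. bop_invertible (bop_id + gram v w)}"
  note np = tendsto_normal_part[OF tendsto_ident_at, of v w]
  have g: "((\<lambda>w. gram v w) \<longlongrightarrow> gram v w) ?F"
    by (intro bounded_bilinear.tendsto[OF bounded_bilinear_gram] tendsto_const tendsto_ident_at)
  have c: "((\<lambda>w. bop_inv (bop_id + gram v w)) \<longlongrightarrow> bop_inv (bop_id + gram v w)) ?F"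
    by (rule bop_inv_tendsto) (use w in \<open>auto intro!: tendsto_add g\<close>)
  show "(cayley_inv v \<longlongrightarrow> cayley_inv v w) ?F"
    unfolding cayley_inv_def[abs_def] Let_def
    by (intro tendsto_add tendsto_diff bounded_bilinear.tendsto[OF bounded_bilinear_rmul]
        bounded_bilinear.tendsto[OF bounded_bilinear_gram] bounded_bilinear.tendsto[OF bounded_bilinear_comp]
        np c g tendsto_const)
qed

lemma open_cayley_range: "open {w. bop_invertible (bop_id + gram v w)}"
  unfolding open_contains_ball
proof
  fix w assume "w \<in> {w. bop_invertible (bop_id + gram v w)}"
  then have w: "bop_invertible (bop_id + gram v w)" by simp
  define M where "M = norm (bop_inv (bop_id + gram v w))"
  have "((\<lambda>u. M * norm (gram v u - gram v w)) \<longlongrightarrow> M * norm (gram v w - gram v w)) (nhds w)"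
    by (intro tendsto_mult tendsto_norm tendsto_diff bounded_bilinear.tendsto[OF bounded_bilinear_gram]
        tendsto_const) (rule filterlim_ident)
  then have "eventually (\<lambda>u. M * norm (gram v u - gram v w) < 1) (nhds w)"
    by (rule order_tendstoD) simp
  then have "eventually (\<lambda>u. bop_invertible (bop_id + gram v u)) (nhds w)"
    by eventually_elim (rule bop_invertible_near[OF w], simp add: M_def)
  then show "\<exists>e>0. ball w e \<subseteq> {w. bop_invertible (bop_id + gram v w)}"
    by (auto simp: eventually_nhds_metric subset_eq dist_commute)
qed

lemma connected_stiefel: "connected stiefel"
  unfolding connected_iff_connected_component
proof (intro ballI)
  fix v w :: "('a, 'b) bop ^ 'c"
  assume v: "v \<in> stiefel" and w: "w \<in> stiefel"
  obtain \<mu> where \<mu>: "cmod \<mu> = 1" and inv: "bop_invertible (bop_id + gram v (w \<odot> bop_scal \<mu>))"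
    using stiefel_shift_invertible[OF v w] .
  let ?w = "w \<odot> bop_scal \<mu>"
  \<comment> \<open>The range of the chart centred at \<open>v\<close>, and the circle of unimodular
    multiples of \<open>w\<close>. The scalar \<open>\<mu>\<close> makes them meet, and the circle
    contains \<open>w\<close> itself.\<close>
  let ?S1 = "cayley v ` skew_tangent v" and ?S2 = "(\<lambda>c. w \<odot> bop_scal c) ` sphere 0 1"
  have w': "?w \<in> stiefel" by (rule stiefel_scal[OF w \<mu>])
  have c1: "connected ?S1"
    by (intro connected_continuous_image continuous_on_cayley convex_connected subspace_imp_convex
        subspace_skew_tangent)
  have "linear (bop_scal :: complex \<Rightarrow> ('a, 'a) bop)"
  proof (rule linearI; rule bop_eqI)
    show "app (bop_scal (c + c')) x = app (bop_scal c + bop_scal c') x" for c c' and x :: 'a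
      by (simp add: scaleC_add_left)
    show "app (bop_scal (t *\<^sub>R c)) x = app (t *\<^sub>R bop_scal c) x" for t c and x :: 'a
      by (simp only: app_bop_scal app_bop_simps scaleR_conv_of_real scaleR_eq_scaleC[of t "_ *\<^sub>C x"] scaleC_scaleC)
  qed
  then have "bounded_linear (bop_scal :: complex \<Rightarrow> ('a, 'a) bop)" by (simp add: linear_conv_bounded_linear)
  then have "continuous_on (sphere 0 1) (bop_scal :: complex \<Rightarrow> ('a, 'a) bop)" by (rule linear_continuous_on)
  then have c2: "connected ?S2"
    by (intro connected_continuous_image connected_sphere bounded_bilinear.continuous_on[OF bounded_bilinear_rmul]
        continuous_on_const) simp_all
  have mem: "?w \<in> ?S1"
    by (rule image_eqI[where x = "cayley_inv v ?w"]) (simp_all add: cayley_cayley_inv[OF v w' inv])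
  moreover have "?w \<in> ?S2" using \<mu> by simp
  ultimately have "?S1 \<inter> ?S2 \<noteq> {}" by blast
  then have "connected (?S1 \<union> ?S2)" by (rule connected_Un[OF c1 c2])
  moreover have "?S1 \<union> ?S2 \<subseteq> stiefel" using cayley_in_stiefel[OF v] stiefel_scal[OF w] by auto
  moreover have "v \<in> ?S1" by (rule image_eqI[where x = 0]) (simp_all add: cayley_zero)
  moreover have "w \<in> ?S2"
    by (rule image_eqI[of _ _ 1]) simp_all
  ultimately show "connected_component stiefel v w"
    unfolding connected_component_def by blast
qed

section \<open>Block matrices and transitivity of the unitary action\<close>

lemma block_mult_assoc: "block_mult (block_mult a b) c = block_mult a (block_mult b c)"
  unfolding block_mult_def vec_eq_iff vec_lambda_beta comp_sum_left comp_sum_right comp_assoc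
  by (intro allI sum.swap)

lemma sum_delta_comp:
  fixes f :: "'r::finite \<Rightarrow> ('h::fd_hilbert, 'k::fd_hilbert) bop"
  shows "(\<Sum>j\<in>UNIV. (if i = j then bop_id else 0) \<circ>\<^sub>B f j) = f i"
proof -
  have "(\<Sum>j\<in>UNIV. (if i = j then bop_id else 0) \<circ>\<^sub>B f j) = (\<Sum>j\<in>UNIV. if i = j then f j else 0)"
    by (intro sum.cong refl) simp
  then show ?thesis by simp
qed

lemma sum_comp_delta:
  fixes f :: "'r::finite \<Rightarrow> ('h::fd_hilbert, 'k::fd_hilbert) bop"
  shows "(\<Sum>j\<in>UNIV. f j \<circ>\<^sub>B (if j = i then bop_id else 0)) = f i"
proof -
  have "(\<Sum>j\<in>UNIV. f j \<circ>\<^sub>B (if j = i then bop_id else 0)) = (\<Sum>j\<in>UNIV. if j = i then f j else 0)"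
    by (intro sum.cong refl) simp
  then show ?thesis by simp
qed

lemma block_mult_one [simp]: "block_mult block_one a = a" "block_mult a block_one = a"
  by (simp_all add: block_mult_def block_one_def vec_eq_iff sum_delta_comp sum_comp_delta)

lemma block_adj_simps [simp]:
  "block_adj (block_mult a b) = block_mult (block_adj b) (block_adj a)"
  "block_adj (block_adj a) = a" "block_adj block_one = block_one"
  by (simp_all add: block_adj_def block_mult_def block_one_def vec_eq_iff adj_sum eq_commute)

lemma block_act_mult: "block_act (block_mult a b) v = block_act a (block_act b v)"
  unfolding block_act_def block_mult_def vec_eq_iff vec_lambda_beta comp_sum_left comp_sum_right comp_assoc
  by (intro allI sum.swap)

lemma block_act_one [simp]: "block_act block_one v = v"
  by (simp add: block_act_def block_one_def vec_eq_iff sum_delta_comp)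

lemma gram_block_act: "gram (block_act a v) w = gram v (block_act (block_adj a) w)"
  unfolding gram_def block_act_def block_adj_def vec_lambda_beta adj_sum adj_simps comp_sum_left comp_sum_right comp_assoc
  by (rule sum.swap)

lemma unitary_group_iff:
  "a \<in> carrier unitary_group \<longleftrightarrow> block_mult (block_adj a) a = block_one \<and> block_mult a (block_adj a) = block_one"
  by (simp add: unitary_group_def)

lemma unitary_group_simps [simp]:
  "mult unitary_group = block_mult" "one unitary_group = block_one"
  by (simp_all add: unitary_group_def)

lemma unitary_mult:
  assumes "a \<in> carrier unitary_group" "b \<in> carrier unitary_group"
  shows "block_mult a b \<in> carrier unitary_group"
proof -
  have "block_mult (block_mult (block_adj b) (block_adj a)) (block_mult a b)
      = block_mult (block_adj b) (block_mult (block_mult (block_adj a) a) b)"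
    "block_mult (block_mult a b) (block_mult (block_adj b) (block_adj a))
      = block_mult a (block_mult (block_mult b (block_adj b)) (block_adj a))"
    by (simp_all only: block_mult_assoc)
  then show ?thesis using assms by (simp add: unitary_group_iff)
qed

lemma unitary_adj: "a \<in> carrier unitary_group \<Longrightarrow> block_adj a \<in> carrier unitary_group"
  by (simp add: unitary_group_iff)

lemma group_unitary_group: "group unitary_group"
proof (rule groupI)
  fix a assume a: "a \<in> carrier unitary_group"
  then show "\<exists>b\<in>carrier unitary_group. b \<otimes>\<^bsub>unitary_group\<^esub> a = \<one>\<^bsub>unitary_group\<^esub>"
    by (intro bexI[of _ "block_adj a"] unitary_adj) (simp_all add: unitary_group_iff)
next
  show "\<one>\<^bsub>unitary_group\<^esub> \<in> carrier unitary_group" by (simp add: unitary_group_iff)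
qed (simp_all add: unitary_mult block_mult_assoc)

lemma gram_unitary:
  assumes "a \<in> carrier unitary_group"
  shows "gram (block_act a v) (block_act a w) = gram v w"
  unfolding gram_block_act block_act_mult[symmetric] using assms by (simp add: unitary_group_iff)

lemma unitary_act_stiefel: "a \<in> carrier unitary_group \<Longrightarrow> v \<in> stiefel \<Longrightarrow> block_act a v \<in> stiefel"
  by (simp add: stiefel_iff gram_unitary)

lemma unitary_inverse_act:
  assumes "a \<in> carrier unitary_group"
  shows "block_act (block_adj a) (block_act a v) = v" "block_act a (block_act (block_adj a) v) = v"
  unfolding block_act_mult[symmetric] using assms by (simp_all add: unitary_group_iff)

text \<open>The block matrix of the composition \<open>z M w\<^sup>*\<close> with \<open>z\<close>
  and \<open>w\<close> read as columns. Products of such matrices stay of this form.\<close>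

definition block_outer ::
  "('h::fd_hilbert, 'k::fd_hilbert) bop ^ 'r \<Rightarrow> ('h, 'h) bop \<Rightarrow> ('h, 'k) bop ^ 'r \<Rightarrow> ('k, 'k) bop ^ 'r ^ 'r"
  where "block_outer z M w = (\<chi> i j. z $ i \<circ>\<^sub>B M \<circ>\<^sub>B adj (w $ j))"

lemma block_outer_simps:
  "block_mult (block_outer z M w) (block_outer z' M' w') = block_outer z (M \<circ>\<^sub>B gram w z' \<circ>\<^sub>B M') w'"
  "block_adj (block_outer z M w) = block_outer w (adj M) z"
  "block_act (block_outer z M w) v = z \<odot> (M \<circ>\<^sub>B gram w v)"
  "block_outer z (M + N) w = block_outer z M w + block_outer z N w"
  "block_outer z (M - N) w = block_outer z M w - block_outer z N w"
  by (simp_all add: block_outer_def block_mult_def block_adj_def block_act_def gram_def rmul_def vec_eq_iff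
      comp_sum_left comp_sum_right comp_assoc comp_distrib)

lemma block_arith:
  "block_mult (a - b) c = block_mult a c - block_mult b c" "block_mult c (a - b) = block_mult c a - block_mult c b"
  "block_adj (a - b) = block_adj a - block_adj b" "block_act (a - b) v = block_act a v - block_act b v"
  by (simp_all add: block_mult_def block_adj_def block_act_def vec_eq_iff comp_distrib sum_subtractf)

text \<open>The unitary is a complex Householder reflection along \<open>v - w\<close>.\<close>

lemma unitary_reflection:
  assumes v: "v \<in> stiefel" and w: "w \<in> stiefel" and inv: "bop_invertible (bop_id - gram w v)"
  shows "\<exists>a\<in>carrier unitary_group. block_act a v = w"
proof -
  define z where "z = v - w"
  define D where "D = bop_id - gram w v"
  define M where "M = bop_inv D"
  have MD: "M \<circ>\<^sub>B D = bop_id" "D \<circ>\<^sub>B M = bop_id"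
    unfolding M_def using bop_invertible_inv[OF inv] by (simp_all add: D_def)
  have aMD: "adj M \<circ>\<^sub>B adj D = bop_id" "adj D \<circ>\<^sub>B adj M = bop_id"
    using arg_cong[OF MD(2), of adj] arg_cong[OF MD(1), of adj] by simp_all
  have vv: "gram v v = bop_id" and ww: "gram w w = bop_id" using v w by (simp_all add: stiefel_iff)
  have zz: "gram z z = D + adj D" by (simp add: z_def D_def vv ww)
  have zv: "gram z v = D" by (simp add: z_def D_def vv)
  \<comment> \<open>Since \<open>gram z v = D\<close>, the term subtracted maps \<open>v\<close> to
    \<open>z\<close>, and \<open>v - z = w\<close>. Unitarity comes from
    \<open>gram z z = D + adj D\<close>, so the generally non-self-adjoint \<open>M\<close> takes
    the role of the usual scalar factor of a reflection.\<close>
  define a where "a = block_one - block_outer z M z"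
  have "adj M \<circ>\<^sub>B (D + adj D) \<circ>\<^sub>B M = adj M + M"
    by (simp add: comp_distrib comp_assoc MD) (simp add: comp_assoc[symmetric] aMD)
  then have 1: "block_outer z (adj M \<circ>\<^sub>B gram z z \<circ>\<^sub>B M) z = block_outer z (adj M) z + block_outer z M z"
    by (simp add: zz block_outer_simps)
  have "M \<circ>\<^sub>B (D + adj D) \<circ>\<^sub>B adj M = M + adj M"
    by (simp add: comp_distrib comp_assoc aMD) (simp add: comp_assoc[symmetric] MD)
  then have 2: "block_outer z (M \<circ>\<^sub>B gram z z \<circ>\<^sub>B adj M) z = block_outer z M z + block_outer z (adj M) z"
    by (simp add: zz block_outer_simps)
  have "a \<in> carrier unitary_group"
    unfolding unitary_group_iff a_def by (simp add: block_arith block_outer_simps(1,2) 1 2)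
  moreover have "block_act a v = w"
    unfolding a_def block_arith block_outer_simps zv MD by (simp add: z_def)
  ultimately show ?thesis by blast
qed

lemma unitary_transitive:
  fixes v w :: "('h::fd_hilbert, 'k::fd_hilbert) bop ^ 'r"
  assumes v: "v \<in> stiefel" and w: "w \<in> stiefel"
  shows "\<exists>a\<in>carrier unitary_group. block_act a v = w"
proof -
  obtain \<mu> where \<mu>: "cmod \<mu> = 1" and inv: "bop_invertible (bop_id + gram w (v \<odot> bop_scal \<mu>))"
    using stiefel_shift_invertible[OF w v] .
  \<comment> \<open>The shift makes 1 plus a Gram operator invertible, whereas the reflection needs
    1 minus one; the sign is moved into the scalar.\<close>
  have \<mu>': "cmod (- \<mu>) = 1" using \<mu> by simp
  obtain a where a: "a \<in> carrier unitary_group" "block_act a (v \<odot> bop_scal (- \<mu>)) = w"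
    using unitary_reflection[OF stiefel_scal[OF v \<mu>'] w] inv by auto
  define b :: "('k, 'k) bop ^ 'r ^ 'r" where "b = (\<chi> i j. if i = j then bop_scal (- \<mu>) else 0)"
  have delta: "(\<Sum>k\<in>UNIV. (if i = k then X else 0) \<circ>\<^sub>B (if k = j then Y else 0)) = (if i = j then X \<circ>\<^sub>B Y else 0)"
    for i j :: 'r and X Y :: "('k, 'k) bop"
  proof -
    have "(\<Sum>k\<in>UNIV. (if i = k then X else 0) \<circ>\<^sub>B (if k = j then Y else 0))
        = (\<Sum>k\<in>UNIV. if i = k then (if k = j then X \<circ>\<^sub>B Y else 0) else 0)"
      by (intro sum.cong refl) simp
    then show ?thesis by simp
  qed
  have "block_adj b = (\<chi> i j. if i = j then bop_scal (cnj (- \<mu>)) else 0)"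
    by (simp add: b_def block_adj_def vec_eq_iff)
  moreover have "cnj \<mu> * \<mu> = 1" "\<mu> * cnj \<mu> = 1" using \<mu> by (simp_all add: complex_norm_square[symmetric] mult.commute)
  ultimately have "b \<in> carrier unitary_group"
    unfolding unitary_group_iff by (simp add: block_mult_def b_def block_one_def delta vec_eq_iff del: bop_scal_simps(3))
  moreover have "block_act b v = v \<odot> bop_scal (- \<mu>)"
  proof -
    have "(\<Sum>j\<in>UNIV. (if i = j then bop_scal (- \<mu>) else 0) \<circ>\<^sub>B v $ j) = bop_scal (- \<mu>) \<circ>\<^sub>B v $ i" for i
    proof -
      have "(\<Sum>j\<in>UNIV. (if i = j then bop_scal (- \<mu>) else 0) \<circ>\<^sub>B v $ j)
          = (\<Sum>j\<in>UNIV. if i = j then bop_scal (- \<mu>) \<circ>\<^sub>B v $ j else 0)"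
        by (intro sum.cong refl) (simp del: bop_scal_simps(3))
      then show ?thesis by (simp del: bop_scal_simps(3))
    qed
    then show ?thesis
      by (simp add: block_act_def b_def rmul_def vec_eq_iff bop_scal_commute del: bop_scal_simps(3))
  qed
  ultimately show ?thesis
    using a by (intro bexI[of _ "block_mult a b"] unitary_mult) (simp_all add: block_act_mult)
qed

lemma bij_betw_unitary_act:
  assumes "a \<in> carrier unitary_group"
  shows "bij_betw (block_act a) stiefel stiefel"
  using assms by (intro bij_betw_byWitness[where f' = "block_act (block_adj a)"])
    (auto simp: unitary_inverse_act unitary_act_stiefel unitary_adj)

lemma transitive_action_stiefel:
  "transitive_action unitary_group (stiefel :: (('h::fd_hilbert, 'k::fd_hilbert) bop ^ 'r) set)
    (\<lambda>w. restrict (block_act w) stiefel)"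
proof -
  let ?V = "stiefel :: (('h, 'k) bop ^ 'r) set"
  have bij: "restrict (block_act a) ?V \<in> Bij ?V" if "a \<in> carrier unitary_group" for a
    using bij_betw_unitary_act[OF that] by (simp add: Bij_def bij_betw_restrict_eq)
  have "group_hom unitary_group (BijGroup ?V) (\<lambda>w. restrict (block_act w) ?V)"
  proof (intro group_hom.intro group_unitary_group group_BijGroup group_hom_axioms.intro homI)
    show "restrict (block_act a) ?V \<in> carrier (BijGroup ?V)" if "a \<in> carrier unitary_group" for a
      using bij[OF that] by (simp add: BijGroup_def)
  next
    fix a b :: "('k, 'k) bop ^ 'r ^ 'r"
    assume ab: "a \<in> carrier unitary_group" "b \<in> carrier unitary_group"
    show "restrict (block_act (a \<otimes>\<^bsub>unitary_group\<^esub> b)) ?V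
        = restrict (block_act a) ?V \<otimes>\<^bsub>BijGroup ?V\<^esub> restrict (block_act b) ?V"
      using bij[OF ab(1)] bij[OF ab(2)] unitary_act_stiefel[OF ab(2)]
      by (auto simp: BijGroup_def compose_def block_act_mult fun_eq_iff)
  qed
  then show ?thesis
    unfolding transitive_action_def group_action_def transitive_action_axioms_def
  proof (intro conjI allI impI)
    fix v w :: "('h, 'k) bop ^ 'r"
    assume vw: "v \<in> stiefel" "w \<in> stiefel"
    show "\<exists>a\<in>carrier unitary_group. restrict (block_act a) ?V v = w"
      using unitary_transitive[OF vw] vw(1) by simp
  qed
qed

section \<open>The Riemannian measure\<close>

definition of_coord :: "nat \<Rightarrow> (nat \<Rightarrow> 'd) \<Rightarrow> (nat \<Rightarrow> real) \<Rightarrow> real ^ 'd"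
  where "of_coord d e x = (\<chi> j. x (inv_into {..<d} e j))"

lemma to_coord_apply [simp]: "i < d \<Longrightarrow> to_coord d e z i = z $ e i"
  by (simp add: to_coord_def)

lemma to_of_coord:
  assumes "bij_betw e {..<d} UNIV" "x \<in> coord_space d"
  shows "to_coord d e (of_coord d e x) = x"
proof
  fix i
  show "to_coord d e (of_coord d e x) i = x i"
    using PiE_arb[OF assms(2), of i] bij_betw_imp_inj_on[OF assms(1)]
    by (cases "i < d") (simp_all add: to_coord_def of_coord_def inv_into_f_f)
qed

lemma of_to_coord:
  assumes "bij_betw e {..<d} UNIV"
  shows "of_coord d e (to_coord d e z) = z"
proof -
  have "inv_into {..<d} e j < d" "e (inv_into {..<d} e j) = j" for j
    using assms inv_into_into[of j e "{..<d}"] f_inv_into_f[of j e "{..<d}"]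
    by (auto simp: bij_betw_def)
  then show ?thesis by (simp add: of_coord_def to_coord_def vec_eq_iff)
qed

lemma vec_eq_sum_axis:
  assumes "bij_betw e {..<d} UNIV"
  shows "(\<Sum>i<d. a i *\<^sub>R axis (e i) 1) = of_coord d e a"
proof -
  have "(\<Sum>i<d. a i *\<^sub>R axis (e i) 1) = (\<Sum>i<d. of_coord d e a $ e i *\<^sub>R axis (e i) (1::real))"
    using bij_betw_imp_inj_on[OF assms] by (intro sum.cong refl) (simp add: of_coord_def inv_into_f_f)
  also have "\<dots> = (\<Sum>j\<in>UNIV. of_coord d e a $ j *\<^sub>R axis j 1)"
    by (rule sum.reindex_bij_betw[OF assms])
  also have "\<dots> = of_coord d e a"
    by (simp add: vec_eq_iff axis_def if_distrib[of "\<lambda>x. _ * x"] cong: if_cong)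
  finally show ?thesis .
qed

lemma line_to_coord:
  assumes "bij_betw e {..<d} UNIV"
  shows "(\<lambda>i\<in>{..<d}. to_coord d e z i + t * a i) = to_coord d e (z + t *\<^sub>R of_coord d e a)"
  using bij_betw_imp_inj_on[OF assms] by (auto simp: to_coord_def of_coord_def inv_into_f_f)

lemma upd_to_coord:
  assumes e: "bij_betw e {..<d} UNIV" and i: "i < d"
  shows "(to_coord d e z)(i := t) = to_coord d e (z + (t - to_coord d e z i) *\<^sub>R axis (e i) 1)"
proof
  fix j
  have "e j = e i \<longleftrightarrow> j = i" if "j < d"
    using bij_betw_imp_inj_on[OF e] that i by (auto dest: inj_onD)
  then show "((to_coord d e z)(i := t)) j = to_coord d e (z + (t - to_coord d e z i) *\<^sub>R axis (e i) 1) j"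
    using i by (cases "j < d") (auto simp: to_coord_def axis_def)
qed

lemma partial_eq_derivative:
  fixes f :: "(nat \<Rightarrow> real) \<Rightarrow> 'e::real_normed_vector" and z :: "real ^ 'd::finite"
  assumes e: "bij_betw e {..<d} UNIV" and i: "i < d"
    and D: "((\<lambda>w. f (to_coord d e w)) has_derivative D) (at z)"
  shows "partial i f (to_coord d e z) = D (axis (e i) 1)"
proof -
  let ?g = "\<lambda>t. z + (t - to_coord d e z i) *\<^sub>R axis (e i) (1 :: real)"
  have "(?g has_derivative (\<lambda>t. t *\<^sub>R axis (e i) 1)) (at (to_coord d e z i))"
    by (auto intro!: derivative_eq_intros)
  moreover have "?g (to_coord d e z i) = z" by simp
  ultimately have "((\<lambda>t. f (to_coord d e (?g t))) has_derivative (\<lambda>t. D (t *\<^sub>R axis (e i) 1))) (at (to_coord d e z i))"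
    using has_derivative_compose[of ?g _ "to_coord d e z i" UNIV "\<lambda>w. f (to_coord d e w)" D] D by simp
  then have "((\<lambda>t. f ((to_coord d e z)(i := t))) has_vector_derivative D (axis (e i) 1)) (at (to_coord d e z i))"
    unfolding upd_to_coord[OF e i] has_vector_derivative_def
    using linear_scale[OF has_derivative_linear[OF D]] by simp
  then show ?thesis unfolding partial_def by (rule vector_derivative_at)
qed

lemma germ_directional_derivative:
  fixes f :: "(nat \<Rightarrow> real) \<Rightarrow> 'e::{real_inner, banach}" and e :: "nat \<Rightarrow> 'd::finite" and B :: "'e set"
  assumes B: "real_onb B" and e: "bij_betw e {..<d} UNIV" and f: "germ d f x" and x: "x \<in> coord_space d"
  shows "((\<lambda>t. f (\<lambda>i\<in>{..<d}. x i + t * a i)) has_vector_derivative (\<Sum>i<d. a i *\<^sub>R partial i f x)) (at 0)"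
proof -
  define z where "z = of_coord d e x"
  have zx: "to_coord d e z = x" unfolding z_def by (rule to_of_coord[OF e x])
  obtain D where D: "((\<lambda>w. f (to_coord d e w)) has_derivative D) (at z)"
    using germ_has_derivative[OF B, of d f e z] f zx by auto
  let ?g = "\<lambda>t. z + t *\<^sub>R of_coord d e a"
  have "(?g has_derivative (\<lambda>t. t *\<^sub>R of_coord d e a)) (at 0)"
    by (auto intro!: derivative_eq_intros)
  then have "((\<lambda>t. f (to_coord d e (?g t))) has_derivative (\<lambda>t. D (t *\<^sub>R of_coord d e a))) (at 0)"
    using has_derivative_compose[of ?g _ 0 UNIV "\<lambda>w. f (to_coord d e w)" D] D by simp
  then have "((\<lambda>t. f (\<lambda>i\<in>{..<d}. x i + t * a i)) has_vector_derivative D (of_coord d e a)) (at 0)"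
    unfolding has_vector_derivative_def using line_to_coord[OF e, of z _ a]
      linear_scale[OF has_derivative_linear[OF D]] by (simp add: zx)
  also have "D (of_coord d e a) = (\<Sum>i<d. a i *\<^sub>R D (axis (e i) 1))"
    unfolding vec_eq_sum_axis[OF e, symmetric]
    using linear_sum[OF has_derivative_linear[OF D], of "\<lambda>i. a i *\<^sub>R axis (e i) 1" "{..<d}"]
      linear_scale[OF has_derivative_linear[OF D]] by simp
  also have "\<dots> = (\<Sum>i<d. a i *\<^sub>R partial i f x)"
    using partial_eq_derivative[OF e _ D] by (intro sum.cong refl) (simp add: zx)
  finally show ?thesis .
qed

lemma continuous_map_to_coord: "continuous_map euclidean (coord_topology d) (to_coord d e)"
  unfolding continuous_map_componentwise
  by (auto simp: to_coord_def intro!: continuous_intros continuous_on_component)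

lemma continuous_map_of_coord:
  assumes "bij_betw e {..<d} UNIV"
  shows "continuous_map (coord_topology d) euclidean (of_coord d e)"
proof -
  have *: "inv_into {..<d} e j < d" for j
    using assms inv_into_into[of j e "{..<d}"] by (auto simp: bij_betw_def)
  have "continuous_map (coord_topology d) euclidean (\<lambda>x. \<Sum>j\<in>UNIV. x (inv_into {..<d} e j) *\<^sub>R axis j (1::real))"
  proof (intro continuous_map_sum)
    fix j
    have "continuous_map (coord_topology d) euclideanreal (\<lambda>x. x (inv_into {..<d} e j))"
      by (rule continuous_map_product_projection) (simp add: *)
    moreover have "continuous_map euclideanreal euclidean (\<lambda>t. t *\<^sub>R axis j (1::real))"
      by (auto intro!: continuous_intros)
    ultimately show "continuous_map (coord_topology d) euclidean (\<lambda>x. x (inv_into {..<d} e j) *\<^sub>R axis j (1::real))"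
      using continuous_map_compose[of _ _ "\<lambda>x. x (inv_into {..<d} e j)" _ "\<lambda>t. t *\<^sub>R axis j (1::real)"]
      by (simp add: o_def)
  qed simp
  also have "(\<lambda>x. \<Sum>j\<in>UNIV. x (inv_into {..<d} e j) *\<^sub>R axis j (1::real)) = of_coord d e"
    by (auto simp: of_coord_def vec_eq_iff axis_def if_distrib[of "\<lambda>x. _ * x"] cong: if_cong)
  finally show ?thesis .
qed

lemma open_to_coord_vimage:
  assumes "openin (coord_topology d) U"
  shows "open (to_coord d e -` U)"
proof -
  have "openin euclidean {x \<in> topspace euclidean. to_coord d e x \<in> U}"
    by (rule openin_continuous_map_preimage[OF continuous_map_to_coord assms])
  then show ?thesis by (simp add: vimage_def)
qed

lemma polydisc_subset_open:
  assumes "openin (coord_topology d) U" "x \<in> U"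
  shows "\<exists>\<epsilon>>0. polydisc d \<epsilon> x \<subseteq> U"
proof -
  obtain V where V': "\<forall>i\<in>{..<d}. openin euclideanreal (V i)"
    and V: "x \<in> Pi\<^sub>E {..<d} V" "Pi\<^sub>E {..<d} V \<subseteq> U"
    using assms(2) assms(1)[unfolded openin_product_topology_alt] by blast
  have "\<exists>\<epsilon>>0. \<forall>t. \<bar>t - x i\<bar> < \<epsilon> \<longrightarrow> t \<in> V i" if "i < d" for i
  proof -
    have "x i \<in> V i" using PiE_mem[OF V(1)] that by simp
    moreover have "open (V i)" using V' that by simp
    ultimately show ?thesis unfolding open_dist dist_real_def by blast
  qed
  then obtain \<epsilon> where \<epsilon>: "\<And>i. i < d \<Longrightarrow> \<epsilon> i > 0" "\<And>i t. i < d \<Longrightarrow> \<bar>t - x i\<bar> < \<epsilon> i \<Longrightarrow> t \<in> V i"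
    by metis
  \<comment> \<open>The element 1 covers \<open>d = 0\<close>; the division by 2 fits the closed
    polydisc into the open intervals.\<close>
  define \<delta> where "\<delta> = Min (insert 1 (\<epsilon> ` {..<d})) / 2"
  have \<delta>: "\<delta> > 0" using \<epsilon>(1) by (simp add: \<delta>_def)
  have le: "2 * \<delta> \<le> \<epsilon> i" if "i < d" for i using that by (simp add: \<delta>_def)
  have "y \<in> U" if y: "y \<in> polydisc d \<delta> x" for y
  proof -
    have "y i \<in> V i" if "i < d" for i
    proof (rule \<epsilon>(2)[OF that])
      have "\<bar>y i - x i\<bar> \<le> \<delta>" using y that by (simp add: polydisc_def)
      then show "\<bar>y i - x i\<bar> < \<epsilon> i" using le[OF that] \<delta> by linarith
    qed
    then have "y \<in> Pi\<^sub>E {..<d} V" using y by (simp add: polydisc_def PiE_iff)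
    then show ?thesis using V(2) by blast
  qed
  then show ?thesis using \<delta> by blast
qed

lemma real_analytic_on_cong:
  fixes f g :: "(nat \<Rightarrow> real) \<Rightarrow> 'e::{real_inner, banach}" and B :: "'e set"
  assumes B: "real_onb B" and f: "real_analytic_on d f U" and U: "openin (coord_topology d) U"
    and eq: "\<And>x. x \<in> U \<Longrightarrow> f x = g x"
  shows "real_analytic_on d g U"
proof (rule real_analytic_onI)
  fix x assume x: "x \<in> U"
  obtain \<epsilon> where "\<epsilon> > 0" "polydisc d \<epsilon> x \<subseteq> U" using polydisc_subset_open[OF U x] by blast
  then show "germ d g x"
    using eq by (intro germ_cong[OF real_analytic_on_germ[OF B f x], of \<epsilon>]) auto
qed

lemma measurable_to_coord: "to_coord d e \<in> measurable borel (coord_lebesgue d)"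
  unfolding to_coord_def by (rule measurable_restrict) simp

lemma measurable_of_coord:
  assumes "bij_betw e {..<d} UNIV"
  shows "of_coord d e \<in> measurable (coord_lebesgue d) borel"
proof -
  have *: "inv_into {..<d} e j \<in> {..<d}" for j
    using assms inv_into_into[of j e "{..<d}"] by (auto simp: bij_betw_def)
  have "(\<lambda>x. \<Sum>j\<in>UNIV. x (inv_into {..<d} e j) *\<^sub>R axis j (1::real)) \<in> measurable (coord_lebesgue d) borel"
    by (intro borel_measurable_sum borel_measurable_scaleR borel_measurable_const)
      (use measurable_component_singleton[OF *, where M = "\<lambda>_. lborel :: real measure"] in simp)
  also have "(\<lambda>x. \<Sum>j\<in>UNIV. x (inv_into {..<d} e j) *\<^sub>R axis j (1::real)) = of_coord d e"
    by (auto simp: of_coord_def vec_eq_iff axis_def if_distrib[of "\<lambda>x. _ * x"] cong: if_cong)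
  finally show ?thesis .
qed

lemma lborel_eq_distr_of_coord:
  assumes e: "bij_betw e {..<d} UNIV"
  shows "lborel = distr (coord_lebesgue d) borel (of_coord d e)"
proof (rule lborel_eqI)
  fix l u :: "real ^ 'a"
  assume lu: "\<And>b. b \<in> Basis \<Longrightarrow> l \<bullet> b \<le> u \<bullet> b"
  interpret product_sigma_finite "\<lambda>_ :: nat. lborel :: real measure" by standard
  have le: "l $ j \<le> u $ j" for j using lu[of "axis j 1"] by (simp add: inner_axis axis_in_Basis_iff)
  have inv: "e (inv_into {..<d} e j) = j" "inv_into {..<d} e j < d" for j
    using e inv_into_into[of j e "{..<d}"] f_inv_into_f[of j e "{..<d}"] by (auto simp: bij_betw_def)
  have inv': "inv_into {..<d} e (e i) = i" if "i < d" for i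
    using bij_betw_imp_inj_on[OF e] that by (simp add: inv_into_f_f)
  have pre: "of_coord d e -` box l u \<inter> space (coord_lebesgue d) = Pi\<^sub>E {..<d} (\<lambda>i. {l $ e i <..< u $ e i})"
  proof (intro equalityI subsetI)
    fix x assume "x \<in> of_coord d e -` box l u \<inter> space (coord_lebesgue d)"
    then have x: "\<And>j. l $ j < x (inv_into {..<d} e j) \<and> x (inv_into {..<d} e j) < u $ j" "x \<in> coord_space d"
      by (simp_all add: mem_box_cart of_coord_def space_PiM)
    show "x \<in> Pi\<^sub>E {..<d} (\<lambda>i. {l $ e i <..< u $ e i})"
    proof (rule PiE_I)
      fix i assume "i \<in> {..<d}"
      then show "x i \<in> {l $ e i <..< u $ e i}" using x(1)[of "e i"] inv' by simp
    qed (rule PiE_arb[OF x(2)])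
  next
    fix x assume x: "x \<in> Pi\<^sub>E {..<d} (\<lambda>i. {l $ e i <..< u $ e i})"
    then have "l $ j < x (inv_into {..<d} e j) \<and> x (inv_into {..<d} e j) < u $ j" for j
      using PiE_mem[OF x, of "inv_into {..<d} e j"] inv[of j] by simp
    then show "x \<in> of_coord d e -` box l u \<inter> space (coord_lebesgue d)"
      using x by (simp add: mem_box_cart of_coord_def space_PiM PiE_iff)
  qed
  have "emeasure (distr (coord_lebesgue d) borel (of_coord d e)) (box l u)
      = emeasure (coord_lebesgue d) (Pi\<^sub>E {..<d} (\<lambda>i. {l $ e i <..< u $ e i}))"
    unfolding pre[symmetric] by (rule emeasure_distr[OF measurable_of_coord[OF e]]) simp
  also have "\<dots> = (\<Prod>i<d. ennreal (u $ e i - l $ e i))"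
    by (subst emeasure_PiM) (auto simp: le)
  also have "\<dots> = (\<Prod>j\<in>UNIV. ennreal (u $ j - l $ j))"
    by (rule prod.reindex_bij_betw[OF e])
  also have "\<dots> = ennreal (\<Prod>j\<in>UNIV. u $ j - l $ j)" by (rule prod_ennreal) (simp add: le)
  also have "(\<Prod>j\<in>UNIV. u $ j - l $ j) = (\<Prod>b\<in>Basis. (u - l) \<bullet> b)"
  proof -
    have B: "Basis = range (\<lambda>j :: 'a. axis j (1::real))" by (auto simp: Basis_vec_def)
    have inj: "inj (\<lambda>j :: 'a. axis j (1::real))" by (simp add: inj_on_def axis_eq_axis)
    show ?thesis unfolding B by (subst prod.reindex[OF inj]) (simp add: inner_axis)
  qed
  finally show "emeasure (distr (coord_lebesgue d) borel (of_coord d e)) (box l u) = ennreal (\<Prod>b\<in>Basis. (u - l) \<bullet> b)" .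
qed simp

lemma coord_lebesgue_eq_distr:
  fixes e :: "nat \<Rightarrow> 'd::finite"
  assumes e: "bij_betw e {..<d} UNIV"
  shows "coord_lebesgue d = distr (lborel :: (real ^ 'd) measure) (coord_lebesgue d) (to_coord d e)"
proof -
  have "distr (lborel :: (real ^ 'd) measure) (coord_lebesgue d) (to_coord d e)
      = distr (distr (coord_lebesgue d) borel (of_coord d e)) (coord_lebesgue d) (to_coord d e)"
    using lborel_eq_distr_of_coord[OF e] by simp
  also have "\<dots> = distr (coord_lebesgue d) (coord_lebesgue d) (to_coord d e \<circ> of_coord d e)"
    by (rule distr_distr[OF measurable_to_coord measurable_of_coord[OF e]])
  also have "\<dots> = distr (coord_lebesgue d) (coord_lebesgue d) (\<lambda>x. x)"
    by (rule distr_cong) (simp_all add: to_of_coord[OF e] space_PiM)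
  finally show ?thesis by (simp add: distr_id)
qed

text \<open>
  This differentiates a chart transition knowing only its continuity, in place of the inverse
  function theorem.
\<close>

lemma has_derivative_through_immersion:
  fixes \<psi> :: "'a::euclidean_space \<Rightarrow> 'e::real_inner" and \<phi> :: "'b::real_normed_vector \<Rightarrow> 'e" and B :: "'e set"
  assumes B: "real_onb B"
    and \<psi>: "(\<psi> has_derivative D\<psi>) (at (\<tau> z))" and inj: "\<And>w. D\<psi> w = 0 \<Longrightarrow> w = 0"
    and \<phi>: "(\<phi> has_derivative D\<phi>) (at z)" and cont: "isCont \<tau> z"
    and eq: "eventually (\<lambda>y. \<psi> (\<tau> y) = \<phi> y) (nhds z)"
  obtains T where "(\<tau> has_derivative T) (at z)" "\<And>y. D\<psi> (T y) = D\<phi> y"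
proof -
  have lin: "linear D\<psi>" by (rule has_derivative_linear[OF \<psi>])
  have "inj D\<psi>" using inj linear_injective_0[OF lin] by blast
  \<comment> \<open>Composition with a left inverse of the derivative turns \<open>\<psi>\<close>
    into a map \<open>h\<close> between spaces of equal dimension, with identity derivative at
    \<open>\<tau> z\<close>. From \<open>h (\<tau> y) = k y\<close> the increment of
    \<open>\<tau>\<close> can then be read off.\<close>
  then obtain L where L: "linear L" "L \<circ> D\<psi> = id" using linear_injective_left_inverse[OF lin] by blast
  have bL: "bounded_linear L" by (rule real_onb_linear_bounded[OF B L(1)])
  have LD: "L (D\<psi> w) = w" for w using fun_cong[OF L(2), of w] by simp
  define h where "h = (\<lambda>w. L (\<psi> w))"
  define k where "k = (\<lambda>y. L (\<phi> y))"
  define K where "K = (\<lambda>y. L (D\<phi> y))"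
  define w0 where "w0 = \<tau> z"
  have h: "(h has_derivative (\<lambda>w. w)) (at w0)"
    using bounded_linear.has_derivative[OF bL \<psi>] by (simp add: h_def w0_def LD)
  have k: "(k has_derivative K) (at z)"
    using bounded_linear.has_derivative[OF bL \<phi>] by (simp add: k_def K_def)
  have hk: "eventually (\<lambda>y. h (\<tau> y) = k y) (nhds z)"
    using eq by eventually_elim (simp add: h_def k_def)
  have bK: "bounded_linear K" by (rule has_derivative_bounded_linear[OF k])
  obtain C where C: "C > 0" "\<And>y. norm (K y) \<le> norm y * C"
    using bounded_linear.pos_bounded[OF bK] by blast
  have "(\<tau> has_derivative K) (at z)"
    unfolding has_derivative_at_alt
  proof (intro conjI bK allI impI)
    fix \<epsilon> :: real assume \<epsilon>: "\<epsilon> > 0"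
    \<comment> \<open>The bound 1/2 lets the increment of \<open>\<tau>\<close> be absorbed, which
      gives at most \<open>2 * (C + 1)\<close> times the increment of \<open>y\<close>. The other
      bound then turns the error of \<open>h\<close> into half of \<open>\<epsilon>\<close>.\<close>
    define \<eta> where "\<eta> = min (1/2) (\<epsilon> / (4 * (C + 1)))"
    have \<eta>: "\<eta> \<le> 1/2" "\<eta> \<le> \<epsilon> / (4 * (C + 1))" unfolding \<eta>_def by (rule min.cobounded1 min.cobounded2)+
    have \<eta>0: "\<eta> > 0" using \<epsilon> C(1) by (simp add: \<eta>_def)
    have \<eta>C: "\<eta> * (2 * (C + 1)) \<le> \<epsilon> / 2" using \<eta>(2) C(1) by (simp add: field_simps)
    obtain \<delta> where \<delta>: "\<delta> > 0" "\<And>w. norm (w - w0) < \<delta> \<Longrightarrow> norm (h w - h w0 - (w - w0)) \<le> \<eta> * norm (w - w0)"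
      using h \<eta>0 unfolding has_derivative_at_alt by blast
    obtain \<delta>1 where \<delta>1: "\<delta>1 > 0" "\<And>y. norm (y - z) < \<delta>1 \<Longrightarrow> norm (\<tau> y - \<tau> z) < \<delta>"
      using cont \<delta>(1) unfolding continuous_at_eps_delta dist_norm by blast
    define \<epsilon>' where "\<epsilon>' = min 1 (\<epsilon> / 2)"
    have \<epsilon>': "\<epsilon>' > 0" "\<epsilon>' \<le> 1" "\<epsilon>' \<le> \<epsilon> / 2" using \<epsilon> by (auto simp: \<epsilon>'_def)
    obtain \<delta>2 where \<delta>2: "\<delta>2 > 0" "\<And>y. norm (y - z) < \<delta>2 \<Longrightarrow> norm (k y - k z - K (y - z)) \<le> \<epsilon>' * norm (y - z)"
      using k \<epsilon>'(1) unfolding has_derivative_at_alt by blast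
    obtain \<delta>3 where \<delta>3: "\<delta>3 > 0" "\<And>y. norm (y - z) < \<delta>3 \<Longrightarrow> h (\<tau> y) = k y"
      using hk unfolding eventually_nhds_metric dist_norm by blast
    have hz: "h w0 = k z" using \<delta>3(2)[of z] \<delta>3(1) by (simp add: w0_def)
    show "\<exists>d>0. \<forall>y. norm (y - z) < d \<longrightarrow> norm (\<tau> y - \<tau> z - K (y - z)) \<le> \<epsilon> * norm (y - z)"
    proof (intro exI[of _ "min \<delta>1 (min \<delta>2 \<delta>3)"] conjI allI impI)
      fix y assume "norm (y - z) < min \<delta>1 (min \<delta>2 \<delta>3)"
      then have y: "norm (y - z) < \<delta>1" "norm (y - z) < \<delta>2" "norm (y - z) < \<delta>3" by auto
      define r where "r = k y - k z - (\<tau> y - w0)"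
      define s where "s = k y - k z - K (y - z)"
      have r: "norm r \<le> \<eta> * norm (\<tau> y - w0)"
        using \<delta>(2)[of "\<tau> y"] \<delta>1(2)[OF y(1)] unfolding r_def \<delta>3(2)[OF y(3)] hz by (simp add: w0_def)
      have s: "norm s \<le> \<epsilon>' * norm (y - z)" unfolding s_def by (rule \<delta>2(2)[OF y(2)])
      have eq1: "\<tau> y - w0 = (s + K (y - z)) - r" by (simp add: r_def s_def)
      have "norm (\<tau> y - w0) \<le> norm (s + K (y - z)) + norm r" unfolding eq1 by (rule norm_triangle_ineq4)
      also have "norm (s + K (y - z)) \<le> norm s + norm (K (y - z))" by (rule norm_triangle_ineq)
      also have "norm s \<le> 1 * norm (y - z)" using s mult_right_mono[OF \<epsilon>'(2) norm_ge_zero[of "y - z"]] by linarith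
      also have "norm (K (y - z)) \<le> norm (y - z) * C" by (rule C(2))
      finally have "norm (\<tau> y - w0) \<le> 1 * norm (y - z) + norm (y - z) * C + norm r" by simp
      moreover have "\<eta> * norm (\<tau> y - w0) \<le> (1/2) * norm (\<tau> y - w0)" using \<eta>(1) by (intro mult_right_mono) auto
      ultimately have t: "norm (\<tau> y - w0) \<le> 2 * (C + 1) * norm (y - z)" using r by (simp add: algebra_simps)
      have "norm r \<le> \<eta> * (2 * (C + 1)) * norm (y - z)"
        using r mult_left_mono[OF t less_imp_le[OF \<eta>0]] by (simp add: mult.assoc)
      also have "\<dots> \<le> \<epsilon> / 2 * norm (y - z)" by (intro mult_right_mono \<eta>C) simp
      finally have "norm r \<le> \<epsilon> / 2 * norm (y - z)" .
      moreover have "norm s \<le> \<epsilon> / 2 * norm (y - z)"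
        using s mult_right_mono[OF \<epsilon>'(3) norm_ge_zero[of "y - z"]] by linarith
      moreover have "\<tau> y - \<tau> z - K (y - z) = s - r" using eq1 by (simp add: w0_def)
      ultimately show "norm (\<tau> y - \<tau> z - K (y - z)) \<le> \<epsilon> * norm (y - z)"
        using norm_triangle_ineq4[of s r] by simp
    qed (use \<delta>1 \<delta>2 \<delta>3 in auto)
  qed
  \<comment> \<open>\<open>L\<close> is only a left inverse, so this does not follow from the
    definition of \<open>K\<close>. It follows from the uniqueness of the derivative of
    \<open>\<phi>\<close>, which is \<open>\<psi>\<close> after \<open>\<tau>\<close> near
    \<open>z\<close>.\<close>
  moreover have "D\<psi> (K y) = D\<phi> y" for y
  proof -
    have "((\<lambda>y. \<psi> (\<tau> y)) has_derivative (\<lambda>y. D\<psi> (K y))) (at z)"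
      using has_derivative_compose[OF calculation] \<psi> by blast
    moreover obtain \<delta> where \<delta>: "\<delta> > 0" "\<And>y. dist y z < \<delta> \<Longrightarrow> \<psi> (\<tau> y) = \<phi> y"
      using eq unfolding eventually_nhds_metric by blast
    ultimately have "(\<phi> has_derivative (\<lambda>y. D\<psi> (K y))) (at z)"
      using has_derivative_transform_within[of "\<lambda>y. \<psi> (\<tau> y)" _ z UNIV \<delta> \<phi>] by simp
    then have "(\<lambda>y. D\<psi> (K y)) = D\<phi>" by (rule has_derivative_unique[OF _ \<phi>])
    then show ?thesis by (rule fun_cong)
  qed
  ultimately show ?thesis by (rule that)
qed

section \<open>Gram determinants and change of variables\<close>

definition gram_matrix :: "(real ^ 'd \<Rightarrow> 'e::real_inner) \<Rightarrow> real ^ 'd ^ 'd"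
  where "gram_matrix D = (\<chi> a b. D (axis a 1) \<bullet> D (axis b 1))"

text \<open>The Gram matrix changes by the congruence with the Jacobian matrix. The square root of
  its determinant thus acquires exactly the Jacobian factor of the change of variables
  formula.\<close>

lemma det_gram_matrix_compose:
  fixes D :: "real ^ 'd::finite \<Rightarrow> 'e::real_inner" and T :: "real ^ 'd \<Rightarrow> real ^ 'd"
  assumes D: "linear D" and T: "linear T"
  shows "det (gram_matrix (\<lambda>y. D (T y))) = (det (matrix T))\<^sup>2 * det (gram_matrix D)"
proof -
  let ?J = "matrix T"
  have DT: "D (T (axis a 1)) = (\<Sum>c\<in>UNIV. ?J $ c $ a *\<^sub>R D (axis c 1))" for a
  proof -
    have "T (axis a 1) = (\<Sum>c\<in>UNIV. T (axis a 1) $ c *\<^sub>R axis c 1)"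
      by (simp add: vec_eq_iff axis_def if_distrib[of "\<lambda>x. _ * x"] cong: if_cong)
    then have "D (T (axis a 1)) = D (\<Sum>c\<in>UNIV. T (axis a 1) $ c *\<^sub>R axis c 1)" by (rule arg_cong)
    also have "\<dots> = (\<Sum>c\<in>UNIV. T (axis a 1) $ c *\<^sub>R D (axis c 1))"
      using linear_sum[OF D, of "\<lambda>c. T (axis a 1) $ c *\<^sub>R axis c 1" UNIV] linear_scale[OF D] by simp
    finally show ?thesis by (simp add: matrix_def)
  qed
  have "gram_matrix (\<lambda>y. D (T y)) = transpose ?J ** gram_matrix D ** ?J"
    unfolding vec_eq_iff
  proof (intro allI)
    fix a b
    have "gram_matrix (\<lambda>y. D (T y)) $ a $ b
        = (\<Sum>c'\<in>UNIV. \<Sum>c\<in>UNIV. ?J $ c $ a * (?J $ c' $ b * (D (axis c 1) \<bullet> D (axis c' 1))))"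
      by (simp add: gram_matrix_def DT inner_sum_left inner_sum_right sum_distrib_left mult.left_commute)
    also have "\<dots> = (transpose ?J ** gram_matrix D ** ?J) $ a $ b"
      unfolding gram_matrix_def matrix_matrix_mult_def transpose_def vec_lambda_beta sum_distrib_right
      by (intro sum.cong refl) (simp only: mult_ac)
    finally show "gram_matrix (\<lambda>y. D (T y)) $ a $ b = (transpose ?J ** gram_matrix D ** ?J) $ a $ b" .
  qed
  then show ?thesis by (simp add: det_mul det_transpose power2_eq_square)
qed

text \<open>Conjugation with \<open>e\<close> matches the permutations of \<open>{..<d}\<close> with
  those of the index type and preserves their signs.\<close>

lemma det_upto_eq_det:
  fixes A :: "real ^ 'd::finite ^ 'd"
  assumes e: "bij_betw e {..<d} (UNIV :: 'd set)"
  shows "det_upto d (\<lambda>i j. A $ e i $ e j) = det A"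
proof -
  define E where "E = inv_into {..<d} e"
  have e': "bij_betw E UNIV {..<d}" unfolding E_def by (rule bij_betw_inv_into[OF e])
  have Ee: "E (e i) = i" if "i < d" for i
    unfolding E_def using bij_betw_imp_inj_on[OF e] that by (simp add: inv_into_f_f)
  have eE: "e (E j) = j" for j
    unfolding E_def using e by (simp add: bij_betw_def f_inv_into_f)
  have Ed: "E j < d" for j using bij_betwE[OF e'] by simp
  define F where "F = (\<lambda>p :: nat \<Rightarrow> nat. \<lambda>j. e (p (E j)))"
  define G where "G = (\<lambda>q :: 'd \<Rightarrow> 'd. \<lambda>i. if i < d then E (q (e i)) else i)"
  have GF: "G (F p) = p" if "p permutes {..<d}" for p
  proof
    fix i
    show "G (F p) i = p i"
      using permutes_in_image[OF that, of i] permutes_not_in[OF that, of i] Ee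
      by (cases "i < d") (auto simp: G_def F_def)
  qed
  have FG: "F (G q) = q" for q by (rule ext) (simp add: F_def G_def Ed eE)
  have Fp: "F p permutes UNIV" if p: "p permutes {..<d}" for p
  proof -
    have "bij_betw (e \<circ> p \<circ> E) UNIV UNIV"
      using bij_betw_trans[OF bij_betw_trans[OF e' permutes_imp_bij[OF p]] e] by (simp add: o_assoc)
    then show ?thesis by (intro bij_imp_permutes) (simp_all add: F_def o_def)
  qed
  have Gp: "G q permutes {..<d}" if q: "q permutes UNIV" for q
  proof (rule bij_imp_permutes)
    have "bij_betw (E \<circ> q \<circ> e) {..<d} {..<d}"
      using bij_betw_trans[OF bij_betw_trans[OF e permutes_imp_bij[OF q]] e'] by (simp add: o_assoc)
    then show "bij_betw (G q) {..<d} {..<d}"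
      by (rule bij_betw_cong[THEN iffD1, rotated]) (simp add: G_def)
  qed (simp add: G_def)
  have sgn: "sign (F p) = sign p" if p: "p permutes {..<d}" for p
  proof -
    have "F p = map_permutation {..<d} e p"
      using e by (auto simp: F_def E_def bij_betw_def map_permutation_def restrict_id_def)
    then show ?thesis using sign_map_permutation[OF bij_betw_imp_inj_on[OF e] p] by simp
  qed
  have "det A = (\<Sum>q | q permutes (UNIV :: 'd set). of_int (sign q) * (\<Prod>j\<in>UNIV. A $ j $ q j))"
    by (simp add: det_def)
  also have "\<dots> = (\<Sum>p | p permutes {..<d}. of_int (sign (F p)) * (\<Prod>j\<in>UNIV. A $ j $ F p j))"
    by (rule sum.reindex_bij_witness[of _ F G]) (auto simp: GF FG Fp Gp)
  also have "\<dots> = (\<Sum>p | p permutes {..<d}. of_int (sign p) * (\<Prod>i<d. A $ e i $ e (p i)))"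
  proof (intro sum.cong refl)
    fix p assume p: "p \<in> {p. p permutes {..<d}}"
    have "(\<Prod>j\<in>UNIV. A $ j $ F p j) = (\<Prod>i<d. A $ e i $ F p (e i))"
      by (rule prod.reindex_bij_betw[OF e, symmetric])
    also have "\<dots> = (\<Prod>i<d. A $ e i $ e (p i))" by (intro prod.cong refl) (simp add: F_def Ee)
    finally show "of_int (sign (F p)) * (\<Prod>j\<in>UNIV. A $ j $ F p j) = of_int (sign p) * (\<Prod>i<d. A $ e i $ e (p i))"
      using sgn p by simp
  qed
  finally show ?thesis by (simp add: det_upto_def)
qed

text \<open>Along the segment from the identity to the Gram matrix all matrices are positive
  definite, so the determinant has no zero there. By continuity it keeps the sign that it has at the
  identity.\<close>

lemma det_gram_matrix_pos:
  fixes D :: "real ^ 'd::finite \<Rightarrow> 'e::real_inner"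
  assumes D: "linear D" and inj: "\<And>w. D w = 0 \<Longrightarrow> w = 0"
  shows "det (gram_matrix D) > 0"
proof (rule ccontr)
  let ?G = "gram_matrix D"
  define M where "M = (\<lambda>t :: real. (\<chi> a b. (1 - t) * (if a = b then 1 else 0) + t * ?G $ a $ b) :: real ^ 'd ^ 'd)"
  assume "\<not> det ?G > 0"
  then have "det (M 1) \<le> 0" by (simp add: M_def)
  moreover have "M 0 = mat 1" by (simp add: M_def mat_def vec_eq_iff)
  then have "0 \<le> det (M 0)" by simp
  moreover have "continuous_on {0..1} (\<lambda>t. det (M t))"
    unfolding det_def M_def by (auto intro!: continuous_intros)
  ultimately obtain t where t: "0 \<le> t" "t \<le> 1" "det (M t) = 0"
    using IVT2'[of "\<lambda>t. det (M t)" 1 0 0] by auto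
  then have "\<not> invertible (M t)" by (simp add: invertible_det_nz)
  then obtain x where x: "M t *v x = 0" "x \<noteq> 0"
    using matrix_left_invertible_ker[of "M t"] invertible_left_inverse[of "M t"] by blast
  have Dx: "D x = (\<Sum>a\<in>UNIV. x $ a *\<^sub>R D (axis a 1))"
  proof -
    have "x = (\<Sum>a\<in>UNIV. x $ a *\<^sub>R axis a 1)"
      by (simp add: vec_eq_iff axis_def if_distrib[of "\<lambda>x. _ * x"] cong: if_cong)
    then have "D x = D (\<Sum>a\<in>UNIV. x $ a *\<^sub>R axis a 1)" by (rule arg_cong)
    then show ?thesis
      using linear_sum[OF D, of "\<lambda>a. x $ a *\<^sub>R axis a 1" UNIV] linear_scale[OF D] by simp
  qed
  have Mx: "(M t *v x) $ a = (1 - t) * x $ a + t * (D (axis a 1) \<bullet> D x)" for a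
  proof -
    have "(M t *v x) $ a = (\<Sum>b\<in>UNIV. (if a = b then (1 - t) * x $ b else 0) + t * (x $ b * ?G $ a $ b))"
      unfolding matrix_vector_mult_def M_def vec_lambda_beta by (intro sum.cong refl) (simp add: distrib_right)
    also have "\<dots> = (1 - t) * x $ a + t * (\<Sum>b\<in>UNIV. x $ b * ?G $ a $ b)"
      by (simp add: sum.distrib sum_distrib_left)
    also have "(\<Sum>b\<in>UNIV. x $ b * ?G $ a $ b) = D (axis a 1) \<bullet> D x"
      by (simp add: gram_matrix_def Dx inner_sum_right)
    finally show ?thesis .
  qed
  have "x \<bullet> (M t *v x) = (\<Sum>a\<in>UNIV. (1 - t) * (x $ a * x $ a) + t * (x $ a * (D (axis a 1) \<bullet> D x)))"
    unfolding inner_vec_def Mx by (intro sum.cong refl) (simp add: algebra_simps)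
  also have "\<dots> = (1 - t) * (x \<bullet> x) + t * (\<Sum>a\<in>UNIV. x $ a * (D (axis a 1) \<bullet> D x))"
    by (simp add: sum.distrib sum_distrib_left inner_vec_def)
  also have "(\<Sum>a\<in>UNIV. x $ a * (D (axis a 1) \<bullet> D x)) = D x \<bullet> D x"
    unfolding Dx inner_sum_left[of _ _ "\<Sum>a\<in>UNIV. x $ a *\<^sub>R D (axis a 1)"] by simp
  finally have "(1 - t) * (x \<bullet> x) + t * (D x \<bullet> D x) = x \<bullet> (M t *v x)" ..
  also have "\<dots> = 0" by (simp add: x)
  finally have 0: "(1 - t) * (x \<bullet> x) + t * (D x \<bullet> D x) = 0" .
  have "x \<bullet> x > 0" "D x \<bullet> D x > 0" using x(2) inj[of x] by auto
  moreover have "(1 - t) * (x \<bullet> x) \<ge> 0" "t * (D x \<bullet> D x) \<ge> 0" using t by auto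
  moreover have "(1 - t) * (x \<bullet> x) > 0" if "t < 1" using that \<open>x \<bullet> x > 0\<close> by simp
  ultimately show False
  proof (cases "t < 1")
    case True
    then show ?thesis
      using 0 \<open>t * (D x \<bullet> D x) \<ge> 0\<close> \<open>t < 1 \<Longrightarrow> (1 - t) * (x \<bullet> x) > 0\<close> by linarith
  next
    case False
    then have "t = 1" using t by simp
    then show ?thesis using 0 \<open>D x \<bullet> D x > 0\<close> by simp
  qed
qed

text \<open>The formula for absolutely integrable functions is read as an equivalence: one integral
  exists with value \<open>b\<close> if and only if the other does. For nonnegative measurable
  functions this is a statement about the nonnegative integrals. Functions into
  \<open>real ^ 1\<close> merely fit the vector-valued form of that formula.\<close>

lemma nn_integral_change_of_variables:
  fixes f :: "real ^ 'd::{finite,wellorder} \<Rightarrow> real" and g :: "real ^ 'd::_ \<Rightarrow> real ^ 'd::_"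
  assumes S: "S \<in> sets borel" and der: "\<And>x. x \<in> S \<Longrightarrow> (g has_derivative g' x) (at x within S)"
    and inj: "inj_on g S" and f0: "\<And>x. 0 \<le> f x"
    and m1: "(\<lambda>x. if x \<in> S then \<bar>det (matrix (g' x))\<bar> * f (g x) else 0) \<in> borel_measurable borel"
    and m2: "(\<lambda>x. if x \<in> g ` S then f x else 0) \<in> borel_measurable borel"
  shows "(\<integral>\<^sup>+x. ennreal (if x \<in> S then \<bar>det (matrix (g' x))\<bar> * f (g x) else 0) \<partial>lborel)
    = (\<integral>\<^sup>+x. ennreal (if x \<in> g ` S then f x else 0) \<partial>lborel)"
proof -
  let ?h = "\<lambda>x. \<bar>det (matrix (g' x))\<bar> * f (g x)"
  let ?F1 = "\<lambda>x. if x \<in> S then ?h x else 0" and ?F2 = "\<lambda>x. if x \<in> g ` S then f x else 0"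
  have Sl: "S \<in> sets lebesgue" using S by (simp add: sets_completionI_sets)
  have cov: "?h absolutely_integrable_on S \<and> integral S ?h = b \<longleftrightarrow>
      f absolutely_integrable_on (g ` S) \<and> integral (g ` S) f = b" for b
  proof -
    have "(\<lambda>x. \<bar>det (matrix (g' x))\<bar> *\<^sub>R vec (f (g x)) :: real ^ 1) absolutely_integrable_on S \<and>
        integral S (\<lambda>x. \<bar>det (matrix (g' x))\<bar> *\<^sub>R vec (f (g x)) :: real ^ 1) = vec b \<longleftrightarrow>
      (\<lambda>x. vec (f x) :: real ^ 1) absolutely_integrable_on (g ` S) \<and> integral (g ` S) (\<lambda>x. vec (f x) :: real ^ 1) = vec b"
      by (rule has_absolute_integral_change_of_variables[OF Sl der inj])
    then show ?thesis
      by (auto simp: absolutely_integrable_on_1_iff integral_on_1_eq)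
  qed
  have iff: "(?h has_integral b) S \<longleftrightarrow> (f has_integral b) (g ` S)" for b
    using cov[of b] absolutely_integrable_on_iff_nonneg[of S ?h] absolutely_integrable_on_iff_nonneg[of "g ` S" f] f0
    by (auto simp: has_integral_iff)
  have 1: "(?h has_integral b) S \<longleftrightarrow> integral\<^sup>N lborel (\<lambda>x. ennreal (?F1 x)) = ennreal b \<and> 0 \<le> b" for b
  proof -
    have "(?h has_integral b) S \<longleftrightarrow> (?F1 has_integral b) UNIV" by (rule has_integral_restrict_UNIV[symmetric])
    also have "\<dots> \<longleftrightarrow> (?F1 \<in> lebesgue \<rightarrow>\<^sub>M borel \<and> integral\<^sup>N lebesgue ?F1 = b \<and> 0 \<le> b)"
      by (rule has_integral_iff_nn_integral_lebesgue) (simp add: f0)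
    finally show ?thesis using m1 by (simp add: nn_integral_completion measurable_completion)
  qed
  have 2: "(f has_integral b) (g ` S) \<longleftrightarrow> integral\<^sup>N lborel (\<lambda>x. ennreal (?F2 x)) = ennreal b \<and> 0 \<le> b" for b
  proof -
    have "(f has_integral b) (g ` S) \<longleftrightarrow> (?F2 has_integral b) UNIV" by (rule has_integral_restrict_UNIV[symmetric])
    also have "\<dots> \<longleftrightarrow> (?F2 \<in> lebesgue \<rightarrow>\<^sub>M borel \<and> integral\<^sup>N lebesgue ?F2 = b \<and> 0 \<le> b)"
      by (rule has_integral_iff_nn_integral_lebesgue) (simp add: f0)
    finally show ?thesis using m2 by (simp add: nn_integral_completion measurable_completion)
  qed
  show ?thesis
  proof (cases "integral\<^sup>N lborel (\<lambda>x. ennreal (?F1 x))" rule: ennreal_cases)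
    case (real r)
    then show ?thesis using 1[of r] 2[of r] iff[of r] by simp
  next
    \<comment> \<open>No finite value is attained on the left, hence none on the right.\<close>
    case top
    then have "integral\<^sup>N lborel (\<lambda>x. ennreal (?F2 x)) \<noteq> ennreal r" if "0 \<le> r" for r
      using 1[of r] 2[of r] iff[of r] that by auto
    then show ?thesis
      using top by (cases "integral\<^sup>N lborel (\<lambda>x. ennreal (?F2 x))" rule: ennreal_cases) auto
  qed
qed

section \<open>The measure seen in a single chart, and its independence of the chart\<close>

definition chart_density :: "nat \<Rightarrow> ((nat \<Rightarrow> real) \<Rightarrow> 'e::real_inner) \<Rightarrow> (nat \<Rightarrow> real) \<Rightarrow> real"
  where "chart_density d \<phi> x = sqrt (det_upto d (\<lambda>i j. metric_coeff induced_metric \<phi> i j x))"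

definition chart_measure :: "nat \<Rightarrow> (nat \<Rightarrow> real) set \<Rightarrow> ((nat \<Rightarrow> real) \<Rightarrow> 'e::real_inner) \<Rightarrow> 'e set \<Rightarrow> ennreal"
  where "chart_measure d U \<phi> A = (\<integral>\<^sup>+x\<in>U \<inter> \<phi> -` A. ennreal (chart_density d \<phi> x) \<partial>coord_lebesgue d)"

lemma is_riemannian_measure_iff:
  "is_riemannian_measure d M induced_metric \<mu> \<longleftrightarrow> sets \<mu> = sets (restrict_space borel M) \<and>
    (\<forall>U \<phi>. local_parametrization d M U \<phi> \<longrightarrow>
      (\<forall>A\<in>sets (restrict_space borel M). A \<subseteq> \<phi> ` U \<longrightarrow> emeasure \<mu> A = chart_measure d U \<phi> A))"
  unfolding is_riemannian_measure_def chart_measure_def chart_density_def by auto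

lemma
  assumes "local_parametrization d M U \<phi>"
  shows local_parametrization_open: "openin (coord_topology d) U"
    and local_parametrization_subset: "U \<subseteq> coord_space d"
    and local_parametrization_image_open: "openin (top_of_set M) (\<phi> ` U)"
    and local_parametrization_image_subset: "\<phi> ` U \<subseteq> M"
    and local_parametrization_homeo:
      "homeomorphic_map (subtopology (coord_topology d) U) (top_of_set (\<phi> ` U)) \<phi>"
    and local_parametrization_analytic: "real_analytic_on d \<phi> U"
    and local_parametrization_immersion:
      "\<And>x a i. x \<in> U \<Longrightarrow> (\<Sum>i<d. a i *\<^sub>R partial i \<phi> x) = 0 \<Longrightarrow> i < d \<Longrightarrow> a i = 0"
proof -
  show U: "openin (coord_topology d) U" and "openin (top_of_set M) (\<phi> ` U)"
    and "homeomorphic_map (subtopology (coord_topology d) U) (top_of_set (\<phi> ` U)) \<phi>"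
    and "real_analytic_on d \<phi> U"
    using assms unfolding local_parametrization_def by blast+
  then show "\<phi> ` U \<subseteq> M" using openin_imp_subset by blast
  show "U \<subseteq> coord_space d" using openin_subset[OF U] by simp
  show "\<And>x a i. x \<in> U \<Longrightarrow> (\<Sum>i<d. a i *\<^sub>R partial i \<phi> x) = 0 \<Longrightarrow> i < d \<Longrightarrow> a i = 0"
    using assms unfolding local_parametrization_def by blast
qed

lemma local_parametrization_topspace:
  assumes "local_parametrization d M U \<phi>"
  shows "topspace (subtopology (coord_topology d) U) = U"
  using local_parametrization_subset[OF assms] by (simp add: Int_absorb1)

lemma local_parametrization_inj: "local_parametrization d M U \<phi> \<Longrightarrow> inj_on \<phi> U"
  using homeomorphic_imp_injective_map[OF local_parametrization_homeo] local_parametrization_topspace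
  by metis

lemma local_parametrization_inverse:
  assumes "local_parametrization d M U \<phi>"
  obtains g where "continuous_map (top_of_set (\<phi> ` U)) (coord_topology d) g" "\<And>x. x \<in> U \<Longrightarrow> g (\<phi> x) = x"
proof -
  obtain g where g: "homeomorphic_maps (subtopology (coord_topology d) U) (top_of_set (\<phi> ` U)) \<phi> g"
    using local_parametrization_homeo[OF assms] homeomorphic_map_maps by blast
  show ?thesis
  proof
    show "continuous_map (top_of_set (\<phi> ` U)) (coord_topology d) g"
      using g continuous_map_into_fulltopology by (auto simp: homeomorphic_maps_def)
    show "g (\<phi> x) = x" if "x \<in> U" for x
      using g that local_parametrization_topspace[OF assms] by (auto simp: homeomorphic_maps_def)
  qed
qed

lemma metric_coeff_germ:
  fixes \<phi> :: "(nat \<Rightarrow> real) \<Rightarrow> 'e::{real_inner, banach}" and B :: "'e set"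
  assumes B: "real_onb B" and \<phi>: "real_analytic_on d \<phi> U" and x: "x \<in> U" and ij: "i < d" "j < d"
  shows "germ d (metric_coeff induced_metric \<phi> i j) x"
proof -
  have "germ d (\<lambda>x. partial i \<phi> x \<bullet> partial j \<phi> x) x"
    using real_analytic_on_germ[OF B \<phi> x] ij
    by (intro germ_bilinear[OF _ _ bounded_bilinear_inner] germ_partial_vector(1)[OF B])
      (simp_all add: Cauchy_Schwarz_ineq2)
  then show ?thesis by (simp add: metric_coeff_def[abs_def] induced_metric_def)
qed

text \<open>Types are inhabited, so a bijection between \<open>{..<d}\<close> and an index type
  requires \<open>d > 0\<close>; the disjunction carries \<open>d = 0\<close> along as a separate
  case. The basis supplies components of ambient vectors.\<close>

locale coord_dim =
  fixes d :: nat and e :: "nat \<Rightarrow> 'd::{finite,wellorder}" and B :: "'e::{real_inner, banach} set"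
  assumes onb: "real_onb B" and dim: "d = 0 \<or> bij_betw e {..<d} (UNIV :: 'd set)"

locale coord_dim_pos = coord_dim d e B
  for d :: nat and e :: "nat \<Rightarrow> 'd::{finite,wellorder}" and B :: "'e::{real_inner, banach} set" +
  assumes e: "bij_betw e {..<d} (UNIV :: 'd set)"
begin

abbreviation "T \<equiv> to_coord d e"

context
  fixes M :: "'e set" and U \<phi>
  assumes lp: "local_parametrization d M U \<phi>"
begin

lemma open_dom: "open (T -` U)"
  by (rule open_to_coord_vimage[OF local_parametrization_open[OF lp]])

lemma has_derivative_chart:
  assumes "T z \<in> U"
  shows "((\<lambda>w. \<phi> (T w)) has_derivative frechet_derivative (\<lambda>w. \<phi> (T w)) (at z)) (at z)"
  using germ_has_derivative[OF onb real_analytic_on_germ[OF onb local_parametrization_analytic[OF lp] assms]]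
  by (metis differentiable_def frechet_derivative_works)

lemma derivative_chart_inj:
  assumes z: "T z \<in> U" and 0: "frechet_derivative (\<lambda>w. \<phi> (T w)) (at z) w = 0"
  shows "w = 0"
proof -
  let ?D = "frechet_derivative (\<lambda>w. \<phi> (T w)) (at z)"
  have lin: "linear ?D" by (rule has_derivative_linear[OF has_derivative_chart[OF z]])
  have "w = of_coord d e (T w)" by (simp add: of_to_coord[OF e])
  also have "\<dots> = (\<Sum>i<d. T w i *\<^sub>R axis (e i) 1)" by (rule vec_eq_sum_axis[OF e, symmetric])
  finally have "?D w = ?D (\<Sum>i<d. T w i *\<^sub>R axis (e i) 1)" by (rule arg_cong)
  also have "\<dots> = (\<Sum>i<d. T w i *\<^sub>R ?D (axis (e i) 1))"
    using linear_sum[OF lin, of "\<lambda>i. T w i *\<^sub>R axis (e i) 1" "{..<d}"] linear_scale[OF lin] by simp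
  also have "\<dots> = (\<Sum>i<d. T w i *\<^sub>R partial i \<phi> (T z))"
    using partial_eq_derivative[OF e _ has_derivative_chart[OF z]] by (intro sum.cong refl) simp
  finally have "T w i = 0" if "i < d" for i
    using local_parametrization_immersion[OF lp z _ that, of "T w"] 0 by simp
  then have "T w = T 0" by (auto simp: to_coord_def)
  then show "w = 0" using of_to_coord[OF e] by metis
qed

lemma chart_density_eq:
  assumes z: "T z \<in> U"
  shows "chart_density d \<phi> (T z) = sqrt (det (gram_matrix (frechet_derivative (\<lambda>w. \<phi> (T w)) (at z))))"
proof -
  let ?D = "frechet_derivative (\<lambda>w. \<phi> (T w)) (at z)"
  have "det_upto d (\<lambda>i j. metric_coeff induced_metric \<phi> i j (T z))
      = det_upto d (\<lambda>i j. gram_matrix ?D $ e i $ e j)"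
    unfolding det_upto_def
  proof (intro sum.cong refl arg_cong2[of _ _ _ _ "(*)"] prod.cong)
    fix p i assume p: "p \<in> {p. p permutes {..<d}}" and i: "i \<in> {..<d}"
    then have "i < d" "p i < d" using permutes_in_image[of p "{..<d}" i] by auto
    then show "metric_coeff induced_metric \<phi> i (p i) (T z) = gram_matrix ?D $ e i $ e (p i)"
      using partial_eq_derivative[OF e _ has_derivative_chart[OF z]]
      by (simp add: metric_coeff_def induced_metric_def gram_matrix_def)
  qed
  then show ?thesis unfolding chart_density_def det_upto_eq_det[OF e] by simp
qed

lemma chart_density_pos: "T z \<in> U \<Longrightarrow> chart_density d \<phi> (T z) > 0"
  using det_gram_matrix_pos[OF has_derivative_linear[OF has_derivative_chart] derivative_chart_inj]
  by (simp add: chart_density_eq)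

lemma continuous_on_chart: "continuous_on (T -` U) (\<lambda>z. \<phi> (T z))"
  by (intro continuous_at_imp_continuous_on ballI has_derivative_continuous[OF has_derivative_chart]) simp

lemma continuous_on_chart_density: "continuous_on (T -` U) (\<lambda>z. chart_density d \<phi> (T z))"
proof -
  have "continuous_on (T -` U) (\<lambda>z. metric_coeff induced_metric \<phi> i j (T z))" if ij: "i < d" "j < d" for i j
  proof (rule continuous_at_imp_continuous_on, rule ballI)
    fix z assume "z \<in> T -` U"
    then have "germ d (metric_coeff induced_metric \<phi> i j) (T z)"
      using metric_coeff_germ[OF onb local_parametrization_analytic[OF lp] _ ij] by simp
    then show "isCont (\<lambda>z. metric_coeff induced_metric \<phi> i j (T z)) z"
      using germ_has_derivative_real has_derivative_continuous by blast
  qed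
  moreover have "p i < d" if "p permutes {..<d}" "i < d" for p i
    using permutes_in_image[of p "{..<d}" i] that by auto
  ultimately show ?thesis
    unfolding chart_density_def det_upto_def by (intro continuous_intros) auto
qed

lemma chart_set_measurable:
  assumes A: "A \<in> sets (restrict_space borel M)"
  shows "{z. T z \<in> U \<and> \<phi> (T z) \<in> A} \<in> sets borel"
proof -
  obtain A0 where A0: "A = M \<inter> A0" "A0 \<in> sets borel" using A by (auto simp: sets_restrict_space)
  have "(\<lambda>z. \<phi> (T z)) \<in> borel_measurable (restrict_space borel (T -` U))"
    by (rule borel_measurable_continuous_on_restrict[OF continuous_on_chart])
  then have "(\<lambda>z. \<phi> (T z)) -` A0 \<inter> space (restrict_space borel (T -` U)) \<in> sets (restrict_space borel (T -` U))"
    using A0(2) by (rule measurable_sets)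
  then have "(\<lambda>z. \<phi> (T z)) -` A0 \<inter> T -` U \<in> sets borel"
    using open_dom by (subst (asm) sets_restrict_space_iff) (auto simp: space_restrict_space)
  moreover have "(\<lambda>z. \<phi> (T z)) -` A0 \<inter> T -` U = {z. T z \<in> U \<and> \<phi> (T z) \<in> A}"
    using A0(1) local_parametrization_image_subset[OF lp] by auto
  ultimately show ?thesis by simp
qed

lemma chart_density_measurable:
  assumes A: "A \<in> sets (restrict_space borel M)"
  shows "(\<lambda>z. if T z \<in> U \<and> \<phi> (T z) \<in> A then chart_density d \<phi> (T z) else 0) \<in> borel_measurable borel"
proof -
  let ?S = "{z. T z \<in> U \<and> \<phi> (T z) \<in> A}"
  have "(\<lambda>z. indicator (T -` U) z *\<^sub>R chart_density d \<phi> (T z)) \<in> borel_measurable borel"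
    using open_dom by (intro borel_measurable_continuous_on_indicator continuous_on_chart_density) auto
  then have "(\<lambda>z. indicator ?S z * (indicator (T -` U) z *\<^sub>R chart_density d \<phi> (T z))) \<in> borel_measurable borel"
    using chart_set_measurable[OF A] by (intro borel_measurable_times borel_measurable_indicator) auto
  also have "(\<lambda>z. indicator ?S z * (indicator (T -` U) z *\<^sub>R chart_density d \<phi> (T z)))
      = (\<lambda>z. if T z \<in> U \<and> \<phi> (T z) \<in> A then chart_density d \<phi> (T z) else 0)"
    by (auto simp: indicator_def)
  finally show ?thesis .
qed

lemma chart_integrand_measurable_pos:
  assumes A: "A \<in> sets (restrict_space borel M)"
  shows "(\<lambda>x. ennreal (chart_density d \<phi> x) * indicator (U \<inter> \<phi> -` A) x) \<in> borel_measurable (coord_lebesgue d)"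
proof -
  let ?H = "\<lambda>z. if T z \<in> U \<and> \<phi> (T z) \<in> A then chart_density d \<phi> (T z) else 0"
  have "(\<lambda>x. ennreal (?H (of_coord d e x))) \<in> borel_measurable (coord_lebesgue d)"
    using measurable_compose[OF measurable_of_coord[OF e] chart_density_measurable[OF A]]
    by (rule measurable_compose) simp
  also have "?this \<longleftrightarrow> ?thesis"
    by (rule measurable_cong) (simp add: space_PiM to_of_coord[OF e] indicator_def)
  finally show ?thesis .
qed

lemma chart_measure_lborel:
  assumes A: "A \<in> sets (restrict_space borel M)"
  shows "chart_measure d U \<phi> A
    = (\<integral>\<^sup>+z. ennreal (if T z \<in> U \<and> \<phi> (T z) \<in> A then chart_density d \<phi> (T z) else 0) \<partial>lborel)"
proof -
  let ?F = "\<lambda>x. ennreal (chart_density d \<phi> x) * indicator (U \<inter> \<phi> -` A) x"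
  have "chart_measure d U \<phi> A = (\<integral>\<^sup>+x. ?F x \<partial>distr lborel (coord_lebesgue d) T)"
    unfolding chart_measure_def using coord_lebesgue_eq_distr[OF e] by metis
  also have "\<dots> = (\<integral>\<^sup>+z. ?F (T z) \<partial>lborel)"
    using measurable_to_coord[of d e] chart_integrand_measurable_pos[OF A] by (intro nn_integral_distr) simp_all
  also have "\<dots> = (\<integral>\<^sup>+z. ennreal (if T z \<in> U \<and> \<phi> (T z) \<in> A then chart_density d \<phi> (T z) else 0) \<partial>lborel)"
    by (intro nn_integral_cong) (simp add: indicator_def)
  finally show ?thesis .
qed

end

text \<open>The transition map \<open>\<tau>\<close> is continuous because charts are
  homeomorphisms, and differentiable because \<open>\<psi>\<close> is an immersion. The Gram
  determinants of the two charts differ by the squared Jacobian determinant of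
  \<open>\<tau>\<close>, so the densities match under the change of variables.\<close>

lemma chart_measure_eq_pos:
  fixes M :: "'e set"
  assumes lp: "local_parametrization d M U \<phi>" and lq: "local_parametrization d M W \<psi>"
    and A: "A \<in> sets (restrict_space borel M)" "A \<subseteq> \<phi> ` U" "A \<subseteq> \<psi> ` W"
  shows "chart_measure d U \<phi> A = chart_measure d W \<psi> A"
proof -
  obtain g where g: "continuous_map (top_of_set (\<psi> ` W)) (coord_topology d) g" "\<And>x. x \<in> W \<Longrightarrow> g (\<psi> x) = x"
    using local_parametrization_inverse[OF lq] by blast
  define \<tau> where "\<tau> = (\<lambda>z. of_coord d e (g (\<phi> (T z))))"
  define S0 where "S0 = {z. T z \<in> U \<and> \<phi> (T z) \<in> \<psi> ` W}"
  have \<tau>T: "T (\<tau> z) \<in> W" "\<psi> (T (\<tau> z)) = \<phi> (T z)" if z: "\<phi> (T z) \<in> \<psi> ` W" for z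
  proof -
    obtain w where w: "w \<in> W" "\<phi> (T z) = \<psi> w" using z by blast
    then have "T (\<tau> z) = w"
      using local_parametrization_subset[OF lq] by (auto simp: \<tau>_def g(2) to_of_coord[OF e])
    then show "T (\<tau> z) \<in> W" "\<psi> (T (\<tau> z)) = \<phi> (T z)" using w by simp_all
  qed
  have \<tau>I: "\<tau> z = w" if "T w \<in> W" "\<phi> (T z) = \<psi> (T w)" for z w
    using that by (simp add: \<tau>_def g(2) of_to_coord[OF e])
  obtain O' where O': "open O'" "\<psi> ` W = M \<inter> O'"
    using local_parametrization_image_open[OF lq] by (auto simp: openin_open)
  have "open ((\<lambda>z. \<phi> (T z)) -` O' \<inter> T -` U)"
    using continuous_on_chart[OF lp] open_dom[OF lp] O'(1) continuous_on_open_vimage by blast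
  also have "(\<lambda>z. \<phi> (T z)) -` O' \<inter> T -` U = S0"
    using O'(2) local_parametrization_image_subset[OF lp] by (auto simp: S0_def)
  finally have S0: "open S0" .
  have cont: "continuous_on S0 \<tau>"
  proof -
    have "continuous_on (\<psi> ` W) (of_coord d e \<circ> g)"
      using continuous_map_compose[OF g(1) continuous_map_of_coord[OF e]] by simp
    moreover have "continuous_on S0 (\<lambda>z. \<phi> (T z))"
      using continuous_on_chart[OF lp] by (rule continuous_on_subset) (auto simp: S0_def)
    ultimately have "continuous_on S0 (\<lambda>z. (of_coord d e \<circ> g) (\<phi> (T z)))"
      by (rule continuous_on_compose2) (auto simp: S0_def)
    then show ?thesis by (simp add: \<tau>_def)
  qed
  let ?D\<phi> = "\<lambda>z. frechet_derivative (\<lambda>w. \<phi> (T w)) (at z)"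
  let ?D\<psi> = "\<lambda>z. frechet_derivative (\<lambda>w. \<psi> (T w)) (at z)"
  have "\<exists>K. (\<tau> has_derivative K) (at z) \<and> (\<forall>y. ?D\<psi> (\<tau> z) (K y) = ?D\<phi> z y)" if z: "z \<in> S0" for z
  proof -
    have Uz: "T z \<in> U" "T (\<tau> z) \<in> W" using z \<tau>T by (auto simp: S0_def)
    have "eventually (\<lambda>y. y \<in> S0) (nhds z)" using S0 z by (rule eventually_nhds_in_open)
    then have ev: "eventually (\<lambda>y. \<psi> (T (\<tau> y)) = \<phi> (T y)) (nhds z)"
      by eventually_elim (simp add: \<tau>T S0_def)
    have "isCont \<tau> z" using cont S0 z by (simp add: continuous_on_eq_continuous_at)
    from has_derivative_through_immersion[OF onb has_derivative_chart[OF lq Uz(2)]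
        derivative_chart_inj[OF lq Uz(2)] has_derivative_chart[OF lp Uz(1)] this ev]
    show ?thesis by metis
  qed
  then obtain K where K: "\<And>z. z \<in> S0 \<Longrightarrow> (\<tau> has_derivative K z) (at z)"
    "\<And>z y. z \<in> S0 \<Longrightarrow> ?D\<psi> (\<tau> z) (K z y) = ?D\<phi> z y" by metis
  define S where "S = {z. T z \<in> U \<and> \<phi> (T z) \<in> A}"
  \<comment> \<open>Outside the chart domain the density is an arbitrary real number; cutting it off
    makes the integrand nonnegative everywhere.\<close>
  define f where "f = (\<lambda>w. if T w \<in> W then chart_density d \<psi> (T w) else 0)"
  have SS0: "S \<subseteq> S0" using A(3) by (auto simp: S_def S0_def)
  have img: "\<tau> ` S = {w. T w \<in> W \<and> \<psi> (T w) \<in> A}"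
  proof (intro equalityI subsetI)
    fix w assume "w \<in> \<tau> ` S"
    then show "w \<in> {w. T w \<in> W \<and> \<psi> (T w) \<in> A}"
      using \<tau>T A(3) by (auto simp: S_def subset_iff)
  next
    fix w assume "w \<in> {w. T w \<in> W \<and> \<psi> (T w) \<in> A}"
    then have w: "T w \<in> W" "\<psi> (T w) \<in> A" by auto
    then obtain x where x: "x \<in> U" "\<psi> (T w) = \<phi> x" using A(2) by blast
    have Tx: "T (of_coord d e x) = x"
      using x(1) local_parametrization_subset[OF lp] by (intro to_of_coord[OF e]) auto
    have "\<tau> (of_coord d e x) = w" by (rule \<tau>I[OF w(1)]) (simp add: Tx x)
    moreover have "of_coord d e x \<in> S" using x w by (simp add: S_def Tx)
    ultimately show "w \<in> \<tau> ` S" by blast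
  qed
  have eq: "\<bar>det (matrix (K z))\<bar> * f (\<tau> z) = chart_density d \<phi> (T z)" if z: "z \<in> S" for z
  proof -
    have z0: "z \<in> S0" using z SS0 by blast
    then have Uz: "T z \<in> U" "T (\<tau> z) \<in> W" using \<tau>T by (auto simp: S0_def)
    have "?D\<phi> z = (\<lambda>y. ?D\<psi> (\<tau> z) (K z y))" using K(2)[OF z0] by auto
    then have "det (gram_matrix (?D\<phi> z)) = (det (matrix (K z)))\<^sup>2 * det (gram_matrix (?D\<psi> (\<tau> z)))"
      using det_gram_matrix_compose[OF has_derivative_linear[OF has_derivative_chart[OF lq Uz(2)]]
          has_derivative_linear[OF K(1)[OF z0]]] by simp
    then show ?thesis
      using Uz by (simp add: f_def chart_density_eq[OF lp] chart_density_eq[OF lq] real_sqrt_mult)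
  qed
  have inj: "inj_on \<tau> S"
  proof (rule inj_onI)
    fix y z assume yz: "y \<in> S" "z \<in> S" "\<tau> y = \<tau> z"
    then have "\<phi> (T y) = \<phi> (T z)" using \<tau>T(2) A(3) by (auto simp: S_def subset_iff) metis
    then have "T y = T z" using inj_onD[OF local_parametrization_inj[OF lp]] yz by (simp add: S_def)
    then show "y = z" using of_to_coord[OF e] by metis
  qed
  have f0: "0 \<le> f w" for w using chart_density_pos[OF lq] by (simp add: f_def less_imp_le)
  have F1: "(\<lambda>z. if z \<in> S then \<bar>det (matrix (K z))\<bar> * f (\<tau> z) else 0)
      = (\<lambda>z. if T z \<in> U \<and> \<phi> (T z) \<in> A then chart_density d \<phi> (T z) else 0)"
    using eq by (auto simp: S_def)
  have F2: "(\<lambda>w. if w \<in> \<tau> ` S then f w else 0)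
      = (\<lambda>w. if T w \<in> W \<and> \<psi> (T w) \<in> A then chart_density d \<psi> (T w) else 0)"
    unfolding img by (auto simp: f_def)
  have "(\<integral>\<^sup>+z. ennreal (if z \<in> S then \<bar>det (matrix (K z))\<bar> * f (\<tau> z) else 0) \<partial>lborel)
      = (\<integral>\<^sup>+w. ennreal (if w \<in> \<tau> ` S then f w else 0) \<partial>lborel)"
  proof (rule nn_integral_change_of_variables[OF _ _ inj f0])
    show "S \<in> sets borel" unfolding S_def by (rule chart_set_measurable[OF lp A(1)])
    show "(\<tau> has_derivative K z) (at z within S)" if "z \<in> S" for z
      using K(1) that SS0 has_derivative_at_withinI by blast
    show "(\<lambda>z. if z \<in> S then \<bar>det (matrix (K z))\<bar> * f (\<tau> z) else 0) \<in> borel_measurable borel"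
      unfolding F1 by (rule chart_density_measurable[OF lp A(1)])
    show "(\<lambda>w. if w \<in> \<tau> ` S then f w else 0) \<in> borel_measurable borel"
      unfolding F2 by (rule chart_density_measurable[OF lq A(1)])
  qed
  then show ?thesis
    unfolding chart_measure_lborel[OF lp A(1)] chart_measure_lborel[OF lq A(1)] fun_cong[OF F1] fun_cong[OF F2] .
qed

text \<open>By continuity the density stays below its value plus 1 on a small ball, and balls have
  finite Lebesgue measure. Together with compactness this makes the total Riemannian measure
  finite.\<close>

lemma chart_measure_locally_finite_pos:
  fixes M :: "'e set"
  assumes lp: "local_parametrization d M U \<phi>" and x: "x \<in> U"
  shows "\<exists>V. openin (top_of_set M) V \<and> \<phi> x \<in> V \<and> V \<subseteq> \<phi> ` U \<and> chart_measure d U \<phi> V < \<infinity>"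
proof -
  define z where "z = of_coord d e x"
  have Tz: "T z = x" unfolding z_def using x local_parametrization_subset[OF lp] by (intro to_of_coord[OF e]) auto
  define c where "c = chart_density d \<phi> (T z) + 1"
  have zU: "z \<in> T -` U" using x Tz by simp
  have "isCont (\<lambda>z. chart_density d \<phi> (T z)) z"
    using continuous_on_chart_density[OF lp] open_dom[OF lp] zU by (simp add: continuous_on_eq_continuous_at)
  then have "eventually (\<lambda>w. chart_density d \<phi> (T w) < c) (at z)"
    unfolding isCont_def by (rule order_tendstoD) (simp add: c_def)
  then have "eventually (\<lambda>w. chart_density d \<phi> (T w) < c) (nhds z)"
    by (simp add: eventually_nhds_conv_at c_def)
  moreover have "eventually (\<lambda>w. w \<in> T -` U) (nhds z)" using open_dom[OF lp] zU by (rule eventually_nhds_in_open)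
  ultimately have "eventually (\<lambda>w. chart_density d \<phi> (T w) < c \<and> w \<in> T -` U) (nhds z)" by eventually_elim simp
  then obtain r where r: "r > 0" "\<And>w. dist w z < r \<Longrightarrow> chart_density d \<phi> (T w) < c \<and> T w \<in> U"
    unfolding eventually_nhds_metric by auto
  define V' where "V' = {y \<in> topspace (coord_topology d). of_coord d e y \<in> ball z r}"
  have V'open: "openin (coord_topology d) V'"
    unfolding V'_def by (rule openin_continuous_map_preimage[OF continuous_map_of_coord[OF e]]) simp
  have V'U: "V' \<subseteq> U"
  proof
    fix y assume "y \<in> V'"
    then have "y \<in> coord_space d" "dist (of_coord d e y) z < r" by (auto simp: V'_def dist_commute)
    then show "y \<in> U" using r(2)[of "of_coord d e y"] to_of_coord[OF e, of y] by simp
  qed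
  define V where "V = \<phi> ` V'"
  have "openin (subtopology (coord_topology d) U) V'"
    using V'open V'U by (simp add: openin_subset_topspace_eq openin_open_subtopology local_parametrization_open[OF lp])
  then have "openin (top_of_set (\<phi> ` U)) V"
    unfolding V_def using homeomorphic_imp_open_map[OF local_parametrization_homeo[OF lp]] by (simp add: open_map_def)
  then have V: "openin (top_of_set M) V" using local_parametrization_image_open[OF lp] openin_trans by blast
  have VU: "V \<subseteq> \<phi> ` U" using V'U by (auto simp: V_def)
  have "x \<in> V'" using x local_parametrization_subset[OF lp] r(1) by (auto simp: V'_def z_def[symmetric])
  then have xV: "\<phi> x \<in> V" by (simp add: V_def)
  obtain O' where "open O'" "V = M \<inter> O'" using V by (auto simp: openin_open)
  then have Vs: "V \<in> sets (restrict_space borel M)" by (auto simp: sets_restrict_space)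
  have "chart_measure d U \<phi> V \<le> (\<integral>\<^sup>+w. ennreal c * indicator (ball z r) w \<partial>lborel)"
    unfolding chart_measure_lborel[OF lp Vs]
  proof (rule nn_integral_mono)
    fix w
    show "ennreal (if T w \<in> U \<and> \<phi> (T w) \<in> V then chart_density d \<phi> (T w) else 0) \<le> ennreal c * indicator (ball z r) w"
    proof (cases "T w \<in> U \<and> \<phi> (T w) \<in> V")
      case True
      then obtain y where "y \<in> V'" "\<phi> (T w) = \<phi> y" by (auto simp: V_def)
      then have "T w = y" using inj_onD[OF local_parametrization_inj[OF lp]] True V'U by blast
      then have "w \<in> ball z r" using \<open>y \<in> V'\<close> of_to_coord[OF e, of w] by (simp add: V'_def)
      then show ?thesis using True r(2)[of w] by (simp add: dist_commute ennreal_leI less_imp_le)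
    next
      case False
      show ?thesis unfolding if_not_P[OF False] by simp
    qed
  qed
  also have "\<dots> = ennreal c * emeasure lborel (ball z r)" by (rule nn_integral_cmult_indicator) simp
  also have "\<dots> < \<infinity>" using emeasure_lborel_ball_finite[of z r] by (simp add: ennreal_mult_less_top)
  finally show ?thesis using V VU xV by blast
qed

text \<open>Otherwise the integrand would vanish almost everywhere, although the density is positive
  and a nonempty open set is not a null set.\<close>

lemma chart_measure_positive_pos:
  fixes M :: "'e set"
  assumes lp: "local_parametrization d M U \<phi>" and "U \<noteq> {}"
  shows "chart_measure d U \<phi> (\<phi> ` U) > 0"
proof (rule ccontr)
  assume "\<not> ?thesis"
  then have 0: "chart_measure d U \<phi> (\<phi> ` U) = 0" by (simp add: not_gr_zero)
  obtain O' where "open O'" "\<phi> ` U = M \<inter> O'"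
    using local_parametrization_image_open[OF lp] by (auto simp: openin_open)
  then have Vs: "\<phi> ` U \<in> sets (restrict_space borel M)" by (auto simp: sets_restrict_space)
  let ?F = "\<lambda>z. if T z \<in> U \<and> \<phi> (T z) \<in> \<phi> ` U then chart_density d \<phi> (T z) else 0"
  have "AE z in lborel. ennreal (?F z) = 0"
    using 0 chart_density_measurable[OF lp Vs] unfolding chart_measure_lborel[OF lp Vs]
    by (subst (asm) nn_integral_0_iff_AE) auto
  then have "AE z in lborel. z \<notin> T -` U"
  proof eventually_elim
    case (elim z)
    show ?case
    proof
      assume "z \<in> T -` U"
      then show False using elim chart_density_pos[OF lp, of z] by (simp add: ennreal_eq_0_iff)
    qed
  qed
  then have "T -` U \<in> null_sets lborel"
    using open_dom[OF lp] by (subst (asm) AE_iff_null_sets[symmetric]) auto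
  then have "negligible (T -` U)" by (simp add: negligible_iff_null_sets null_sets_completionI)
  moreover obtain x where "x \<in> U" using assms(2) by blast
  then have "of_coord d e x \<in> T -` U"
    using local_parametrization_subset[OF lp] to_of_coord[OF e, of x] by auto
  ultimately show False using open_not_negligible[OF open_dom[OF lp]] by blast
qed

end

context coord_dim
begin

lemma dim_cases:
  obtains "d = 0" | "coord_dim_pos d e B"
  using dim coord_dim_axioms by (auto simp: coord_dim_pos_def coord_dim_pos_axioms_def)

lemma chart_integrand_measurable:
  fixes M :: "'e set"
  assumes lp: "local_parametrization d M U \<phi>" and A: "A \<in> sets (restrict_space borel M)"
  shows "(\<lambda>x. ennreal (chart_density d \<phi> x) * indicator (U \<inter> \<phi> -` A) x) \<in> borel_measurable (coord_lebesgue d)"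
proof (cases rule: dim_cases)
  case 1
  let ?f = "\<lambda>x. ennreal (chart_density d \<phi> x) * indicator (U \<inter> \<phi> -` A) x"
  have "?f \<in> borel_measurable (coord_lebesgue d) \<longleftrightarrow> (\<lambda>_. ?f (\<lambda>_. undefined)) \<in> borel_measurable (coord_lebesgue d)"
    by (rule measurable_cong) (simp add: space_PiM 1)
  then show ?thesis by simp
next
  case 2
  then show ?thesis using lp A by (rule coord_dim_pos.chart_integrand_measurable_pos)
qed

lemma chart_measure_eq:
  fixes M :: "'e set"
  assumes lp: "local_parametrization d M U \<phi>" and lq: "local_parametrization d M W \<psi>"
    and A: "A \<in> sets (restrict_space borel M)" "A \<subseteq> \<phi> ` U" "A \<subseteq> \<psi> ` W"
  shows "chart_measure d U \<phi> A = chart_measure d W \<psi> A"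
proof (cases rule: dim_cases)
  case 1
  \<comment> \<open>For \<open>d = 0\<close> the coordinate space is this single point, and the
    density is the same empty determinant in every chart.\<close>
  have "U \<subseteq> {\<lambda>_. undefined}" "W \<subseteq> {\<lambda>_. undefined}"
    using local_parametrization_subset[OF lp] local_parametrization_subset[OF lq] by (simp_all add: 1)
  then have "(x \<in> U \<and> \<phi> x \<in> A) \<longleftrightarrow> x = (\<lambda>_. undefined) \<and> A \<noteq> {}" "(x \<in> W \<and> \<psi> x \<in> A) \<longleftrightarrow> x = (\<lambda>_. undefined) \<and> A \<noteq> {}" for x
    using A(2,3) by (metis all_not_in_conv imageE singletonD subsetD)+
  then have "U \<inter> \<phi> -` A = W \<inter> \<psi> -` A" by auto
  moreover have "chart_density d \<phi> x = chart_density d \<psi> x" for x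
    by (simp add: chart_density_def det_upto_def 1)
  ultimately show ?thesis by (simp add: chart_measure_def)
next
  case 2
  then show ?thesis using assms by (rule coord_dim_pos.chart_measure_eq_pos)
qed

lemma chart_measure_locally_finite:
  fixes M :: "'e set"
  assumes lp: "local_parametrization d M U \<phi>" and x: "x \<in> U"
  shows "\<exists>V. openin (top_of_set M) V \<and> \<phi> x \<in> V \<and> V \<subseteq> \<phi> ` U \<and> chart_measure d U \<phi> V < \<infinity>"
proof (cases rule: dim_cases)
  case 1
  have "chart_measure d U \<phi> (\<phi> ` U) \<le> (\<integral>\<^sup>+y. ennreal (chart_density d \<phi> x) \<partial>coord_lebesgue d)"
    unfolding chart_measure_def
  proof (rule nn_integral_mono)
    fix y assume "y \<in> space (coord_lebesgue d)"
    then have "y = x" using x local_parametrization_subset[OF lp] by (auto simp: space_PiM 1)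
    then show "ennreal (chart_density d \<phi> y) * indicator (U \<inter> \<phi> -` \<phi> ` U) y \<le> ennreal (chart_density d \<phi> x)"
      by (simp add: indicator_def)
  qed
  also have "\<dots> < \<infinity>" by (simp add: 1 ennreal_mult_less_top space_PiM emeasure_PiM_empty)
  finally show ?thesis using local_parametrization_image_open[OF lp] x by blast
next
  case 2
  then show ?thesis using assms by (rule coord_dim_pos.chart_measure_locally_finite_pos)
qed

lemma chart_measure_positive:
  fixes M :: "'e set"
  assumes lp: "local_parametrization d M U \<phi>" and "U \<noteq> {}"
  shows "chart_measure d U \<phi> (\<phi> ` U) > 0"
proof (cases rule: dim_cases)
  case 1
  then have U: "U = {\<lambda>_. undefined}"
    using local_parametrization_subset[OF lp] assms(2) by auto
  have "chart_measure d U \<phi> (\<phi> ` U) = (\<integral>\<^sup>+y. 1 \<partial>coord_lebesgue d)"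
    unfolding chart_measure_def
    by (rule nn_integral_cong) (auto simp: space_PiM 1 U chart_density_def det_upto_def permutes_empty)
  then show ?thesis by (simp add: 1 space_PiM emeasure_PiM_empty)
next
  case 2
  then show ?thesis using assms by (rule coord_dim_pos.chart_measure_positive_pos)
qed

section \<open>Gluing the chart measures\<close>

lemma chart_measure_suminf:
  fixes M :: "'e set"
  assumes lp: "local_parametrization d M U \<phi>" and A: "\<And>i :: nat. A i \<in> sets (restrict_space borel M)"
    and disj: "disjoint_family A"
  shows "(\<Sum>i. chart_measure d U \<phi> (A i)) = chart_measure d U \<phi> (\<Union>i. A i)"
proof -
  have "(\<Sum>i. chart_measure d U \<phi> (A i))
      = (\<integral>\<^sup>+x. (\<Sum>i. ennreal (chart_density d \<phi> x) * indicator (U \<inter> \<phi> -` A i) x) \<partial>coord_lebesgue d)"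
    unfolding chart_measure_def by (rule nn_integral_suminf[symmetric]) (rule chart_integrand_measurable[OF lp A])
  also have "\<dots> = chart_measure d U \<phi> (\<Union>i. A i)"
    unfolding chart_measure_def
  proof (rule nn_integral_cong)
    fix x
    have "disjoint_family (\<lambda>i. U \<inter> \<phi> -` A i)" using disj by (auto simp: disjoint_family_on_def)
    then have "(\<Sum>i. indicator (U \<inter> \<phi> -` A i) x :: ennreal) = indicator (\<Union>i. U \<inter> \<phi> -` A i) x"
      by (rule suminf_indicator)
    moreover have "(\<Union>i. U \<inter> \<phi> -` A i) = U \<inter> \<phi> -` (\<Union>i. A i)" by auto
    ultimately show "(\<Sum>i. ennreal (chart_density d \<phi> x) * indicator (U \<inter> \<phi> -` A i) x)
        = ennreal (chart_density d \<phi> x) * indicator (U \<inter> \<phi> -` (\<Union>i. A i)) x"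
      by (simp add: ennreal_suminf_cmult)
  qed
  finally show ?thesis .
qed

lemma chart_measure_empty [simp]: "chart_measure d U \<phi> {} = 0"
  by (simp add: chart_measure_def)

lemma chart_measure_mono: "A \<subseteq> A' \<Longrightarrow> chart_measure d U \<phi> A \<le> chart_measure d U \<phi> A'"
  unfolding chart_measure_def by (intro nn_integral_mono mult_left_mono) (auto simp: indicator_def)

lemma chart_measure_sum:
  fixes M :: "'e set" and N :: nat
  assumes lp: "local_parametrization d M U \<phi>" and A: "\<And>i. i < N \<Longrightarrow> A i \<in> sets (restrict_space borel M)"
    and disj: "disjoint_family_on A {..<N}"
  shows "(\<Sum>i<N. chart_measure d U \<phi> (A i)) = chart_measure d U \<phi> (\<Union>i<N. A i)"
proof -
  let ?A = "\<lambda>i. if i < N then A i else {}"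
  have "(\<Sum>i. chart_measure d U \<phi> (?A i)) = chart_measure d U \<phi> (\<Union>i. ?A i)"
    using A disj by (intro chart_measure_suminf[OF lp]) (auto simp: disjoint_family_on_def)
  moreover have "(\<Union>i. ?A i) = (\<Union>i<N. A i)" by (auto split: if_splits)
  moreover have "(\<Sum>i. chart_measure d U \<phi> (?A i)) = (\<Sum>i<N. chart_measure d U \<phi> (?A i))"
    by (rule suminf_finite) auto
  ultimately show ?thesis by simp
qed

text \<open>Disjoint Borel pieces, each within one chart and of finite chart measure, let the
  measure be written as a finite sum, with no partition of unity and no account of overlaps.\<close>

lemma finite_atlas:
  fixes M :: "'e set"
  assumes M: "compact M" "analytic_submanifold d M"
  obtains N :: nat and U \<phi> and P :: "nat \<Rightarrow> 'e set"
  where "\<And>k. k < N \<Longrightarrow> local_parametrization d M (U k) (\<phi> k)"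
    "\<And>k. k < N \<Longrightarrow> P k \<in> sets (restrict_space borel M)" "\<And>k. k < N \<Longrightarrow> P k \<subseteq> \<phi> k ` U k"
    "\<And>k. k < N \<Longrightarrow> chart_measure d (U k) (\<phi> k) (P k) < \<infinity>"
    "disjoint_family_on P {..<N}" "(\<Union>k<N. P k) = M"
proof -
  have "\<exists>O' U \<phi>. open O' \<and> p \<in> O' \<and> local_parametrization d M U \<phi> \<and> M \<inter> O' \<subseteq> \<phi> ` U \<and>
      chart_measure d U \<phi> (M \<inter> O') < \<infinity>" if p: "p \<in> M" for p
  proof -
    obtain U \<phi> x where lp: "local_parametrization d M U \<phi>" "x \<in> U" "p = \<phi> x"
      using M(2) p unfolding analytic_submanifold_def by blast
    obtain V where V: "openin (top_of_set M) V" "p \<in> V" "V \<subseteq> \<phi> ` U" "chart_measure d U \<phi> V < \<infinity>"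
      using chart_measure_locally_finite[OF lp(1,2)] lp(3) by blast
    then obtain O' where O': "open O'" "V = M \<inter> O'" by (auto simp: openin_open)
    then show ?thesis using lp V by blast
  qed
  then obtain O' U0 \<phi>0 where O': "\<And>p. p \<in> M \<Longrightarrow> open (O' p)" "\<And>p. p \<in> M \<Longrightarrow> p \<in> O' p"
    and lp: "\<And>p. p \<in> M \<Longrightarrow> local_parametrization d M (U0 p) (\<phi>0 p)"
    and sub: "\<And>p. p \<in> M \<Longrightarrow> M \<inter> O' p \<subseteq> \<phi>0 p ` U0 p"
    and fin: "\<And>p. p \<in> M \<Longrightarrow> chart_measure d (U0 p) (\<phi>0 p) (M \<inter> O' p) < \<infinity>"
    by metis
  obtain C where C: "C \<subseteq> M" "finite C" "M \<subseteq> (\<Union>p\<in>C. O' p)"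
    using compactE_image[OF M(1), of M O'] O' by blast
  obtain c :: "nat \<Rightarrow> 'e" and N where c: "C = c ` {..<N}"
    using finite_imp_nat_seg_image_inj_on[OF C(2)] unfolding lessThan_def by blast
  have cM: "c k \<in> M" if "k < N" for k using C(1) c that by auto
  define P where "P = (\<lambda>k. M \<inter> O' (c k) - (\<Union>l<k. O' (c l)))"
  show ?thesis
  proof (rule that[of N "\<lambda>k. U0 (c k)" "\<lambda>k. \<phi>0 (c k)" P])
    show "local_parametrization d M (U0 (c k)) (\<phi>0 (c k))" if "k < N" for k by (rule lp[OF cM[OF that]])
    show "P k \<in> sets (restrict_space borel M)" if "k < N" for k
    proof -
      have "O' (c k) - (\<Union>l<k. O' (c l)) \<in> sets borel"
        using O'(1) cM that by (intro sets.Diff sets.finite_UN borel_open) auto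
      moreover have "P k = M \<inter> (O' (c k) - (\<Union>l<k. O' (c l)))" by (auto simp: P_def)
      ultimately show ?thesis by (auto simp: sets_restrict_space)
    qed
    show "P k \<subseteq> \<phi>0 (c k) ` U0 (c k)" if "k < N" for k using sub[OF cM[OF that]] by (auto simp: P_def)
    show "chart_measure d (U0 (c k)) (\<phi>0 (c k)) (P k) < \<infinity>" if "k < N" for k
      by (rule le_less_trans[OF chart_measure_mono fin[OF cM[OF that]]]) (auto simp: P_def)
    show "disjoint_family_on P {..<N}"
      unfolding disjoint_family_on_def
    proof (intro ballI impI)
      fix k l :: nat assume "k \<noteq> l"
      then show "P k \<inter> P l = {}" by (cases "k < l") (auto simp: P_def not_less)
    qed
    show "(\<Union>k<N. P k) = M"
    proof (intro equalityI subsetI)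
      fix p assume p: "p \<in> M"
      define k where "k = (LEAST k. k < N \<and> p \<in> O' (c k))"
      have "\<exists>k. k < N \<and> p \<in> O' (c k)" using C(3) p c by auto
      then have "k < N \<and> p \<in> O' (c k)" unfolding k_def by (rule LeastI_ex)
      moreover have "p \<notin> O' (c l)" if "l < k" for l
        using not_less_Least[of l "\<lambda>k. k < N \<and> p \<in> O' (c k)"] that calculation by (auto simp: k_def)
      ultimately show "p \<in> (\<Union>k<N. P k)" using p by (auto simp: P_def)
    qed (auto simp: P_def)
  qed
qed

text \<open>Every Riemannian measure is prescribed on each piece of the atlas and hence takes the
  values \<open>f\<close>; uniqueness and finiteness both come from this. For existence, the measure
  with values \<open>f\<close> is compared, piece by piece, with an arbitrary further chart by
  \<open>chart_measure_eq\<close>.\<close>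

lemma riemannian_measure_exists_unique:
  fixes M :: "'e set"
  assumes M: "compact M" "analytic_submanifold d M"
  shows "\<exists>!\<mu>. is_riemannian_measure d M induced_metric \<mu>"
    and "is_riemannian_measure d M induced_metric \<mu> \<Longrightarrow> emeasure \<mu> M < \<infinity>"
proof -
  obtain N :: nat and U \<phi> and P :: "nat \<Rightarrow> 'e set"
    where lp: "\<And>k. k < N \<Longrightarrow> local_parametrization d M (U k) (\<phi> k)"
    and Ps: "\<And>k. k < N \<Longrightarrow> P k \<in> sets (restrict_space borel M)" and PU: "\<And>k. k < N \<Longrightarrow> P k \<subseteq> \<phi> k ` U k"
    and fin: "\<And>k. k < N \<Longrightarrow> chart_measure d (U k) (\<phi> k) (P k) < \<infinity>"
    and disj: "disjoint_family_on P {..<N}" and cover: "(\<Union>k<N. P k) = M"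
    using finite_atlas[OF M] by blast
  let ?R = "restrict_space borel M :: 'e measure"
  define f where "f = (\<lambda>A. \<Sum>k<N. chart_measure d (U k) (\<phi> k) (A \<inter> P k))"
  have spR: "space ?R = M" by (simp add: space_restrict_space)
  have AP: "A \<inter> P k \<in> sets ?R" if "A \<in> sets ?R" "k < N" for A k using that Ps by blast
  have decomp: "A = (\<Union>k<N. A \<inter> P k)" if "A \<in> sets ?R" for A
    using sets.sets_into_space[OF that] cover spR by auto
  have disjA: "disjoint_family_on (\<lambda>k. A \<inter> P k) {..<N}" for A
    using disj by (auto simp: disjoint_family_on_def)
  have val: "emeasure \<mu> A = f A" if \<mu>: "is_riemannian_measure d M induced_metric \<mu>" and A: "A \<in> sets ?R" for \<mu> A
  proof -
    have s: "sets \<mu> = sets ?R" using \<mu> by (simp add: is_riemannian_measure_iff)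
    have "emeasure \<mu> (A \<inter> P k) = chart_measure d (U k) (\<phi> k) (A \<inter> P k)" if "k < N" for k
      using \<mu> lp[OF that] AP[OF A that] PU[OF that] unfolding is_riemannian_measure_iff by blast
    then have "f A = (\<Sum>k<N. emeasure \<mu> (A \<inter> P k))" by (simp add: f_def)
    also have "\<dots> = emeasure \<mu> (\<Union>k<N. A \<inter> P k)"
      using AP[OF A] disjA by (intro sum_emeasure) (auto simp: s)
    finally show ?thesis using decomp[OF A] by simp
  qed
  define \<nu> where "\<nu> = measure_of M (sets ?R) f"
  have sub: "sets ?R \<subseteq> Pow M" using sets.space_closed[of ?R] spR by simp
  have sig: "sigma_algebra M (sets ?R)" using sets.sigma_algebra_axioms[of ?R] spR by simp
  have s\<nu>: "sets \<nu> = sets ?R"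
    unfolding \<nu>_def using sub sig by (simp add: sigma_algebra.sigma_sets_eq)
  have e\<nu>: "emeasure \<nu> A = f A" if "A \<in> sets ?R" for A
  proof (rule emeasure_measure_of[OF \<nu>_def sub])
    show "positive (sets \<nu>) f" by (simp add: positive_def f_def)
    show "countably_additive (sets \<nu>) f"
      unfolding countably_additive_def s\<nu>
    proof (intro allI impI)
      fix A :: "nat \<Rightarrow> 'e set" assume A: "range A \<subseteq> sets ?R" "disjoint_family A"
      have "(\<Sum>i. f (A i)) = (\<Sum>k<N. \<Sum>i. chart_measure d (U k) (\<phi> k) (A i \<inter> P k))"
        unfolding f_def by (rule suminf_sum) auto
      also have "\<dots> = (\<Sum>k<N. chart_measure d (U k) (\<phi> k) (\<Union>i. A i \<inter> P k))"
      proof (intro sum.cong refl chart_measure_suminf)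
        fix k assume "k \<in> {..<N}"
        then show "local_parametrization d M (U k) (\<phi> k)" "A i \<inter> P k \<in> sets ?R" for i
          using lp AP A(1) by auto
        show "disjoint_family (\<lambda>i. A i \<inter> P k)" using A(2) by (auto simp: disjoint_family_on_def)
      qed
      also have "\<dots> = f (\<Union>i. A i)" by (simp add: f_def)
      finally show "(\<Sum>i. f (A i)) = f (\<Union>i. A i)" .
    qed
  qed (use that s\<nu> in simp)
  have riem: "is_riemannian_measure d M induced_metric \<nu>"
    unfolding is_riemannian_measure_iff
  proof (intro conjI s\<nu> allI impI ballI)
    fix W \<psi> A assume lq: "local_parametrization d M W \<psi>" and A: "A \<in> sets ?R" "A \<subseteq> \<psi> ` W"
    have "f A = (\<Sum>k<N. chart_measure d W \<psi> (A \<inter> P k))"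
      unfolding f_def
    proof (intro sum.cong refl chart_measure_eq)
      fix k assume "k \<in> {..<N}"
      then show "local_parametrization d M (U k) (\<phi> k)" "A \<inter> P k \<in> sets ?R" "A \<inter> P k \<subseteq> \<phi> k ` U k"
        using lp AP[OF A(1)] PU by blast+
      show "A \<inter> P k \<subseteq> \<psi> ` W" using A(2) by blast
    qed (rule lq)
    also have "\<dots> = chart_measure d W \<psi> (\<Union>k<N. A \<inter> P k)"
      using AP[OF A(1)] disjA by (intro chart_measure_sum[OF lq]) auto
    finally show "emeasure \<nu> A = chart_measure d W \<psi> A" using decomp[OF A(1)] e\<nu>[OF A(1)] by simp
  qed
  have "\<mu> = \<nu>" if \<mu>: "is_riemannian_measure d M induced_metric \<mu>" for \<mu>
  proof -
    have s: "sets \<mu> = sets ?R" using \<mu> by (simp add: is_riemannian_measure_iff)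
    show ?thesis by (rule measure_eqI) (simp_all add: s s\<nu> val[OF \<mu>] e\<nu>)
  qed
  then show "\<exists>!\<mu>. is_riemannian_measure d M induced_metric \<mu>" using riem by blast
  have fM: "f M < \<infinity>"
  proof -
    have "chart_measure d (U k) (\<phi> k) (M \<inter> P k) < \<infinity>" if "k < N" for k
    proof -
      have "M \<inter> P k = P k" using cover that by blast
      then show ?thesis using fin[OF that] by simp
    qed
    then show ?thesis unfolding f_def by simp
  qed
  have "M \<in> sets ?R" using sets.top[of ?R] spR by simp
  then show "is_riemannian_measure d M induced_metric \<mu> \<Longrightarrow> emeasure \<mu> M < \<infinity>"
    using val fM by simp
qed

lemma riemannian_measure_positive:
  fixes M :: "'e set"
  assumes M: "analytic_submanifold d M" "M \<noteq> {}" and \<mu>: "is_riemannian_measure d M induced_metric \<mu>"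
  shows "emeasure \<mu> M > 0"
proof -
  obtain p where "p \<in> M" using M(2) by blast
  then obtain U \<phi> x where lp: "local_parametrization d M U \<phi>" "x \<in> U"
    using M(1) unfolding analytic_submanifold_def by blast
  have s: "sets \<mu> = sets (restrict_space borel M)" using \<mu> by (simp add: is_riemannian_measure_iff)
  obtain O' where "open O'" "\<phi> ` U = M \<inter> O'"
    using local_parametrization_image_open[OF lp(1)] by (auto simp: openin_open)
  then have A: "\<phi> ` U \<in> sets (restrict_space borel M)" by (auto simp: sets_restrict_space)
  have "0 < chart_measure d U \<phi> (\<phi> ` U)" using lp by (intro chart_measure_positive) auto
  also have "\<dots> = emeasure \<mu> (\<phi> ` U)" using \<mu> lp(1) A unfolding is_riemannian_measure_iff by auto
  also have "\<dots> \<le> emeasure \<mu> M"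
    using local_parametrization_image_subset[OF lp(1)] sets.top[of \<mu>] sets_eq_imp_space_eq[OF s]
    by (intro emeasure_mono) (auto simp: space_restrict_space)
  finally show ?thesis .
qed

end

section \<open>Isometries induced by the ambient space\<close>

lemma partial_bounded_linear:
  fixes \<phi> :: "(nat \<Rightarrow> real) \<Rightarrow> 'e::{real_inner, banach}" and B :: "'e set"
  assumes B: "real_onb B" and \<phi>: "germ d \<phi> x" and x: "x \<in> coord_space d" and i: "i < d" and F: "bounded_linear F"
  shows "partial i (F \<circ> \<phi>) x = F (partial i \<phi> x)"
proof -
  obtain \<epsilon> where "\<epsilon> > 0" and "\<And>y. y \<in> polydisc d \<epsilon> x \<Longrightarrow> ((\<lambda>t. \<phi> (y(i := t))) has_vector_derivative partial i \<phi> y) (at (y i))"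
    using germ_partial_vector(2)[OF B \<phi> i] by blast
  then have "((\<lambda>t. \<phi> (x(i := t))) has_vector_derivative partial i \<phi> x) (at (x i))"
    using x by (simp add: polydisc_def)
  from bounded_linear.has_vector_derivative[OF F this] show ?thesis
    unfolding partial_def by (simp add: vector_derivative_at)
qed

text \<open>The isometries of interest are restrictions of ambient linear maps. The inverse is a
  parameter of its own, so that the situation is symmetric and every fact about \<open>F\<close> is
  available for \<open>F'\<close> through \<open>swap\<close>.\<close>

locale linear_isometry_pair =
  fixes F F' :: "'e::{real_inner, banach} \<Rightarrow> 'e" and M B :: "'e set"
  assumes onb: "real_onb B" and F: "bounded_linear F" and F': "bounded_linear F'"
    and FF': "\<And>x. F (F' x) = x" and F'F: "\<And>x. F' (F x) = x"
    and inner_F: "\<And>x y. F x \<bullet> F y = x \<bullet> y"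
    and FM: "\<And>x. x \<in> M \<Longrightarrow> F x \<in> M" and F'M: "\<And>x. x \<in> M \<Longrightarrow> F' x \<in> M"
begin

lemma bij_M: "bij_betw F M M"
  by (rule bij_betw_byWitness[where f' = F']) (auto simp: FF' F'F FM F'M)

lemma metric_coeff_isometry:
  assumes lp: "local_parametrization d M U \<phi>" and x: "x \<in> U" and "i < d" "j < d"
  shows "metric_coeff induced_metric (F \<circ> \<phi>) i j x = metric_coeff induced_metric \<phi> i j x"
proof -
  have "germ d \<phi> x" by (rule real_analytic_on_germ[OF onb local_parametrization_analytic[OF lp] x])
  moreover have "x \<in> coord_space d" using x local_parametrization_subset[OF lp] by blast
  ultimately show ?thesis
    using partial_bounded_linear[OF onb _ _ _ F] assms(3,4)
    by (simp add: metric_coeff_def induced_metric_def inner_F)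
qed

text \<open>A linear isomorphism preserving \<open>M\<close> commutes with partial derivatives and
  keeps them independent. Every chart can thus be moved, and the measure of an image set can be
  computed in the moved chart.\<close>

lemma local_parametrization_isometry:
  assumes lp: "local_parametrization d M U \<phi>"
  shows "local_parametrization d M U (F \<circ> \<phi>)"
  unfolding local_parametrization_def
proof (intro conjI ballI allI impI)
  let ?X = "\<phi> ` U"
  have XM: "?X \<subseteq> M" by (rule local_parametrization_image_subset[OF lp])
  show "openin (coord_topology d) U" by (rule local_parametrization_open[OF lp])
  show "openin (top_of_set M) ((F \<circ> \<phi>) ` U)"
  proof -
    obtain O' where O': "open O'" "?X = M \<inter> O'"
      using local_parametrization_image_open[OF lp] by (auto simp: openin_open)
    have "open (F' -` O')"
      using O'(1) linear_continuous_on[OF F', of UNIV] by (simp add: open_vimage)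
    moreover have "(F \<circ> \<phi>) ` U = M \<inter> F' -` O'"
    proof (intro equalityI subsetI)
      fix y assume "y \<in> (F \<circ> \<phi>) ` U"
      then show "y \<in> M \<inter> F' -` O'" using O'(2) XM FM by (auto simp: F'F)
    next
      fix y assume y: "y \<in> M \<inter> F' -` O'"
      then have "F' y \<in> ?X" using O'(2) F'M by blast
      then obtain x where "x \<in> U" "F' y = \<phi> x" by blast
      then show "y \<in> (F \<circ> \<phi>) ` U" using FF'[of y] by (intro image_eqI[of _ _ x]) simp_all
    qed
    ultimately show ?thesis by (auto simp: openin_open)
  qed
  have "homeomorphic_maps (top_of_set ?X) (top_of_set (F ` ?X)) F F'"
    unfolding homeomorphic_maps_def
    using linear_continuous_on[OF F] linear_continuous_on[OF F'] by (auto simp: F'F FF')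
  then have "homeomorphic_map (top_of_set ?X) (top_of_set (F ` ?X)) F"
    using homeomorphic_map_maps by blast
  then show "homeomorphic_map (subtopology (coord_topology d) U) (top_of_set ((F \<circ> \<phi>) ` U)) (F \<circ> \<phi>)"
    using homeomorphic_map_compose[OF local_parametrization_homeo[OF lp]] by (simp add: image_comp)
  show "real_analytic_on d (F \<circ> \<phi>) U"
    using real_analytic_on_bounded_linear[OF local_parametrization_analytic[OF lp] F] by (simp add: o_def)
  fix x a i assume x: "x \<in> U" and 0: "(\<Sum>i<d. a i *\<^sub>R partial i (F \<circ> \<phi>) x) = 0" and i: "i < d"
  have "germ d \<phi> x" by (rule real_analytic_on_germ[OF onb local_parametrization_analytic[OF lp] x])
  then have "F (\<Sum>i<d. a i *\<^sub>R partial i \<phi> x) = 0"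
    using partial_bounded_linear[OF onb _ _ _ F] x local_parametrization_subset[OF lp] 0
      linear_sum[OF bounded_linear.linear[OF F], of "\<lambda>i. a i *\<^sub>R partial i \<phi> x" "{..<d}"]
      linear_scale[OF bounded_linear.linear[OF F]] by (simp add: subset_iff)
  then have "(\<Sum>i<d. a i *\<^sub>R partial i \<phi> x) = 0"
    using F'F[of "\<Sum>i<d. a i *\<^sub>R partial i \<phi> x"] linear_0[OF bounded_linear.linear[OF F']] by simp
  then show "a i = 0" by (rule local_parametrization_immersion[OF lp x _ i])
qed

lemma measurable_F: "sets \<mu> = sets (restrict_space borel M) \<Longrightarrow> F \<in> measurable \<mu> \<mu>"
proof -
  assume s: "sets \<mu> = sets (restrict_space borel M)"
  have "F \<in> borel_measurable borel" using linear_continuous_on[OF F] by (rule borel_measurable_continuous_onI)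
  then have "F \<in> measurable (restrict_space borel M) (restrict_space borel M)"
    by (intro measurable_restrict_space3) (auto simp: FM)
  then show "F \<in> measurable \<mu> \<mu>" using s measurable_cong_sets by blast
qed

lemma vimage_eq_image: "A \<subseteq> M \<Longrightarrow> F' -` A \<inter> M = F ` A"
proof (intro equalityI subsetI)
  fix y assume "y \<in> F' -` A \<inter> M"
  then show "y \<in> F ` A" using FF'[of y] by (intro image_eqI[of _ _ "F' y"]) simp_all
qed (auto simp: F'F FM)

lemma riemannian_isometry_F: "riemannian_isometry d M induced_metric F"
  unfolding riemannian_isometry_def analytic_map_on_def
proof (intro conjI allI impI ballI bij_M)
  fix U \<phi> assume lp: "local_parametrization d M U \<phi>"
  show "real_analytic_on d (F \<circ> \<phi>) U"
    by (rule local_parametrization_analytic[OF local_parametrization_isometry[OF lp]])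
  \<comment> \<open>The inverse of the restriction agrees with the linear map on \<open>M\<close>
    only, so analyticity is transferred along an equality that holds just on the chart
    domain.\<close>
  have "inv_into M F y = F' y" if "y \<in> M" for y
    using that FF' F'M inv_into_f_f[OF bij_betw_imp_inj_on[OF bij_M], of "F' y"] by simp
  then have eq: "F' (\<phi> x) = (inv_into M F \<circ> \<phi>) x" if "x \<in> U" for x
    using local_parametrization_image_subset[OF lp] that by auto
  have "real_analytic_on d (\<lambda>x. F' (\<phi> x)) U"
    by (rule real_analytic_on_bounded_linear[OF local_parametrization_analytic[OF lp] F'])
  then show "real_analytic_on d (inv_into M F \<circ> \<phi>) U"
    using local_parametrization_open[OF lp] eq by (rule real_analytic_on_cong[OF onb])
  fix x i j assume "x \<in> U" "i < d" "j < d"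
  then show "metric_coeff induced_metric (F \<circ> \<phi>) i j x = metric_coeff induced_metric \<phi> i j x"
    by (rule metric_coeff_isometry[OF lp])
qed

end

lemma (in linear_isometry_pair) swap: "linear_isometry_pair F' F M B"
proof -
  have "F' x \<bullet> F' y = x \<bullet> y" for x y using inner_F[of "F' x" "F' y"] by (simp add: FF')
  then show ?thesis by (simp add: linear_isometry_pair_def onb F F' FF' F'F FM F'M)
qed

text \<open>The preimage of a set in the chart \<open>\<phi>\<close> lies in the moved chart
  \<open>F' \<circ> \<phi>\<close>, has the same coordinates there, and meets the same density, as
  metric coefficients are preserved.\<close>

lemma (in linear_isometry_pair) distr_riemannian_measure:
  assumes \<mu>: "is_riemannian_measure d M induced_metric \<mu>"
  shows "is_riemannian_measure d M induced_metric (distr \<mu> \<mu> F)"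
  unfolding is_riemannian_measure_iff
proof (intro conjI allI impI ballI)
  interpret sw: linear_isometry_pair F' F M B by (rule swap)
  have s: "sets \<mu> = sets (restrict_space borel M)" using \<mu> by (simp add: is_riemannian_measure_iff)
  have sp: "space \<mu> = M" using sets_eq_imp_space_eq[OF s] by (simp add: space_restrict_space)
  show "sets (distr \<mu> \<mu> F) = sets (restrict_space borel M)" using s by simp
  fix U \<phi> A assume lp: "local_parametrization d M U \<phi>" and A: "A \<in> sets (restrict_space borel M)" "A \<subseteq> \<phi> ` U"
  have AM: "A \<subseteq> M" using A(2) local_parametrization_image_subset[OF lp] by blast
  have lp': "local_parametrization d M U (F' \<circ> \<phi>)" by (rule sw.local_parametrization_isometry[OF lp])
  have "emeasure (distr \<mu> \<mu> F) A = emeasure \<mu> (F -` A \<inter> M)"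
    using A(1) s by (subst emeasure_distr[OF measurable_F[OF s]]) (simp_all add: sp)
  also have "F -` A \<inter> M = F' ` A" by (rule sw.vimage_eq_image[OF AM])
  also have "emeasure \<mu> (F' ` A) = chart_measure d U (F' \<circ> \<phi>) (F' ` A)"
  proof -
    have "F' ` A \<in> sets (restrict_space borel M)"
      using measurable_sets[OF measurable_F[OF s], of A] A(1) sw.vimage_eq_image[OF AM] by (simp add: s sp)
    moreover have "F' ` A \<subseteq> (F' \<circ> \<phi>) ` U" using A(2) by auto
    ultimately show ?thesis using \<mu> lp' unfolding is_riemannian_measure_iff by blast
  qed
  also have "\<dots> = chart_measure d U \<phi> A"
    unfolding chart_measure_def
  proof (rule nn_integral_cong)
    fix x
    show "ennreal (chart_density d (F' \<circ> \<phi>) x) * indicator (U \<inter> (F' \<circ> \<phi>) -` F' ` A) x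
        = ennreal (chart_density d \<phi> x) * indicator (U \<inter> \<phi> -` A) x"
    proof (cases "x \<in> U")
      case True
      have "det_upto d (\<lambda>i j. metric_coeff induced_metric (F' \<circ> \<phi>) i j x)
          = det_upto d (\<lambda>i j. metric_coeff induced_metric \<phi> i j x)"
        unfolding det_upto_def
      proof (intro sum.cong refl arg_cong2[of _ _ _ _ "(*)"] prod.cong)
        fix p i assume p: "p \<in> {p. p permutes {..<d}}" and i: "i \<in> {..<d}"
        then have "i < d" "p i < d" using permutes_in_image[of p "{..<d}" i] by auto
        then show "metric_coeff induced_metric (F' \<circ> \<phi>) i (p i) x = metric_coeff induced_metric \<phi> i (p i) x"
          by (rule sw.metric_coeff_isometry[OF lp True])
      qed
      moreover have "F' (\<phi> x) \<in> F' ` A \<longleftrightarrow> \<phi> x \<in> A" using FF' by (metis imageE imageI)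
      ultimately show ?thesis using True by (simp add: chart_density_def indicator_def)
    qed simp
  qed
  finally show "emeasure (distr \<mu> \<mu> F) A = chart_measure d U \<phi> A" .
qed

section \<open>Charts of the Stiefel manifold\<close>

text \<open>Division by the bound of \<open>h\<close> produces the constant 1 that
  \<open>germ_bilinear\<close> requires; the factor is restored afterwards. The Gram pairing is used
  in this way.\<close>

lemma germ_bounded_bilinear:
  fixes h :: "'a::banach \<Rightarrow> 'b::banach \<Rightarrow> 'c::banach"
  assumes f: "germ d f x" and g: "germ d g x" and h: "bounded_bilinear h"
  shows "germ d (\<lambda>y. h (f y) (g y)) x"
proof -
  interpret bounded_bilinear h by fact
  obtain K where K: "K > 0" "\<And>a b. norm (h a b) \<le> norm a * norm b * K" using pos_bounded by blast
  have "bounded_bilinear (\<lambda>a b. inverse K *\<^sub>R h a b)"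
    by (rule bounded_bilinear.intro)
      (use K in \<open>auto simp: add_left add_right scaleR_left scaleR_right scaleR_add_right field_simps intro!: exI[of _ 1]\<close>)
  moreover have "norm (inverse K *\<^sub>R h a b) \<le> norm a * norm b" for a b
    using K by (simp add: field_simps)
  ultimately have "germ d (\<lambda>y. inverse K *\<^sub>R h (f y) (g y)) x" by (rule germ_bilinear[OF f g])
  from germ_bounded_linear[OF this bounded_linear_scaleR_right, of K] show ?thesis using K(1) by simp
qed

locale cayley_chart =
  fixes v :: "('h::fd_hilbert, 'k::fd_hilbert) bop ^ 'r" and d :: nat and b :: "nat \<Rightarrow> ('h, 'k) bop ^ 'r"
  assumes v: "v \<in> stiefel"
    and orth: "\<And>i j. i < d \<Longrightarrow> j < d \<Longrightarrow> b i \<bullet> b j = (if i = j then 1 else 0)"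
    and span_b: "span (b ` {..<d}) = skew_tangent v"
begin

definition vec :: "(nat \<Rightarrow> real) \<Rightarrow> ('h, 'k) bop ^ 'r"
  where "vec x = (\<Sum>i<d. x i *\<^sub>R b i)"

definition chart :: "(nat \<Rightarrow> real) \<Rightarrow> ('h, 'k) bop ^ 'r"
  where "chart x = cayley v (vec x)"

definition coords :: "('h, 'k) bop ^ 'r \<Rightarrow> nat \<Rightarrow> real"
  where "coords w = (\<lambda>i\<in>{..<d}. cayley_inv v w \<bullet> b i)"

lemma vec_tangent [simp]: "vec x \<in> skew_tangent v"
  unfolding vec_def span_b[symmetric] by (intro span_sum span_scale span_base) auto

lemma vec_inner: "i < d \<Longrightarrow> vec x \<bullet> b i = x i"
  by (simp add: vec_def inner_sum_left orth if_distrib cong: if_cong)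

lemma vec_expand:
  assumes "\<zeta> \<in> skew_tangent v"
  shows "vec (\<lambda>i\<in>{..<d}. \<zeta> \<bullet> b i) = \<zeta>"
proof -
  let ?S = "{\<zeta>. vec (\<lambda>i\<in>{..<d}. \<zeta> \<bullet> b i) = \<zeta>}"
  have *: "vec (\<lambda>i\<in>{..<d}. \<zeta> \<bullet> b i) = (\<Sum>i<d. (\<zeta> \<bullet> b i) *\<^sub>R b i)" for \<zeta>
    unfolding vec_def by (intro sum.cong refl) simp
  have "subspace ?S"
    unfolding subspace_def *
  proof (intro conjI ballI allI)
    fix c \<zeta> assume "\<zeta> \<in> {\<zeta>. (\<Sum>i<d. (\<zeta> \<bullet> b i) *\<^sub>R b i) = \<zeta>}"
    then have "c *\<^sub>R (\<Sum>i<d. (\<zeta> \<bullet> b i) *\<^sub>R b i) = c *\<^sub>R \<zeta>" by simp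
    then show "c *\<^sub>R \<zeta> \<in> {\<zeta>. (\<Sum>i<d. (\<zeta> \<bullet> b i) *\<^sub>R b i) = \<zeta>}" by (simp add: scaleR_sum_right)
  qed (simp_all add: inner_add_left scaleR_add_left sum.distrib)
  moreover have "b j \<in> ?S" if "j < d" for j
  proof -
    have "(\<Sum>i<d. (b j \<bullet> b i) *\<^sub>R b i) = (\<Sum>i<d. if i = j then b i else 0)"
      by (intro sum.cong refl) (use that in \<open>auto simp: orth\<close>)
    then show ?thesis using that by (simp add: *)
  qed
  ultimately have "span (b ` {..<d}) \<subseteq> ?S" by (intro span_minimal) auto
  then have "\<zeta> \<in> ?S" using assms unfolding span_b by (rule subsetD)
  then show ?thesis by simp
qed

lemma image_chart: "chart ` coord_space d = {w \<in> stiefel. bop_invertible (bop_id + gram v w)}"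
proof (intro equalityI subsetI)
  fix w assume "w \<in> chart ` coord_space d"
  then show "w \<in> {w \<in> stiefel. bop_invertible (bop_id + gram v w)}"
    using cayley_in_stiefel[OF v] cayley_inv_cayley(2)[OF v] by (auto simp: chart_def)
next
  fix w assume "w \<in> {w \<in> stiefel. bop_invertible (bop_id + gram v w)}"
  then have "cayley_inv v w \<in> skew_tangent v" "cayley v (cayley_inv v w) = w"
    using cayley_cayley_inv[OF v] by auto
  then have "chart (coords w) = w" by (simp add: chart_def coords_def vec_expand)
  then show "w \<in> chart ` coord_space d"
    by (intro image_eqI[of _ _ "coords w"]) (simp_all add: coords_def)
qed

lemma germ_chart:
  assumes x: "x \<in> coord_space d"
  shows "germ d chart x"
proof -
  have \<xi>: "germ d vec x"
    unfolding vec_def[abs_def] by (intro germ_sum germ_scaleR germ_const germ_coord) simp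
  have np: "germ d (\<lambda>x. normal_part v (vec x)) x"
    unfolding normal_part_def
    by (intro germ_diff \<xi> germ_bounded_bilinear[OF _ _ bounded_bilinear_rmul]
        germ_bounded_bilinear[OF _ _ bounded_bilinear_gram] germ_const)
  have den: "germ d (\<lambda>x. cayley_den v (vec x)) x"
    unfolding cayley_den_def
    by (intro germ_add germ_diff \<xi> np germ_bounded_bilinear[OF _ _ bounded_bilinear_gram] germ_const)
  have inv: "germ d (\<lambda>x. bop_inv (cayley_den v (vec x))) x"
    by (rule germ_inverse[OF den x bounded_bilinear_comp norm_comp_le])
      (simp_all add: bop_invertible_inv[OF cayley_den_invertible] comp_assoc)
  show ?thesis
    unfolding chart_def[abs_def] cayley_def
    by (intro germ_add germ_diff germ_scaleR np inv germ_bounded_bilinear[OF _ _ bounded_bilinear_rmul] germ_const)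
qed

lemma chart_immersion:
  fixes e :: "nat \<Rightarrow> 'd::finite"
  assumes e: "bij_betw e {..<d} (UNIV :: 'd set)" and x: "x \<in> coord_space d"
    and 0: "(\<Sum>i<d. a i *\<^sub>R partial i chart x) = 0" and i: "i < d"
  shows "a i = 0"
proof -
  obtain B :: "(('h, 'k) bop ^ 'r) set" where B: "real_onb B" by (rule real_onb_tuple_exists)
  \<comment> \<open>Straight lines in coordinates are straight lines in the tangent space, which is
    the form in which \<open>cayley_immersion\<close> applies.\<close>
  have *: "chart (\<lambda>i\<in>{..<d}. x i + t * a i) = cayley v (vec x + t *\<^sub>R vec a)" for t
  proof -
    have "vec (\<lambda>i\<in>{..<d}. x i + t * a i) = vec x + t *\<^sub>R vec a"
      unfolding vec_def scaleR_sum_right sum.distrib[symmetric]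
      by (intro sum.cong refl) (simp add: scaleR_add_left)
    then show ?thesis by (simp add: chart_def)
  qed
  have "((\<lambda>t. cayley v (vec x + t *\<^sub>R vec a)) has_vector_derivative 0) (at 0)"
    using germ_directional_derivative[OF B e germ_chart[OF x] x, of a] by (simp only: * 0)
  then have "vec a = 0"
    by (rule cayley_immersion[OF v vec_tangent, rotated])
      (intro subspace_add subspace_scale subspace_skew_tangent vec_tangent)
  then show "a i = 0" using vec_inner[OF i, of a] by simp
qed

lemma continuous_map_vec: "continuous_map (coord_topology d) euclidean vec"
  unfolding vec_def[abs_def]
proof (intro continuous_map_sum)
  fix i assume "i \<in> {..<d}"
  then have "continuous_map (coord_topology d) euclideanreal (\<lambda>x. x i)" by (rule continuous_map_product_projection)
  moreover have "continuous_map euclideanreal euclidean (\<lambda>t. t *\<^sub>R b i)" by (auto intro!: continuous_intros)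
  ultimately show "continuous_map (coord_topology d) euclidean (\<lambda>x. x i *\<^sub>R b i)"
    using continuous_map_compose[of _ _ "\<lambda>x. x i" _ "\<lambda>t. t *\<^sub>R b i"] by (simp add: o_def)
qed simp

lemma homeomorphic_chart:
  "homeomorphic_map (subtopology (coord_topology d) (coord_space d)) (top_of_set (chart ` coord_space d)) chart"
proof (rule homeomorphic_maps_imp_map[of _ _ _ coords])
  let ?S = "chart ` coord_space d"
  have "continuous_map (coord_topology d) (top_of_set (skew_tangent v)) vec"
    unfolding continuous_map_in_subtopology using continuous_map_vec by simp
  moreover have "continuous_map (top_of_set (skew_tangent v)) euclidean (cayley v)"
    using continuous_on_cayley by simp
  ultimately have 1: "continuous_map (coord_topology d) euclidean chart"
    using continuous_map_compose[of _ _ vec _ "cayley v"] by (simp add: o_def chart_def[abs_def])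
  have "continuous_on ?S (cayley_inv v)"
    by (rule continuous_on_subset[OF continuous_on_cayley_inv]) (simp add: image_chart Collect_mono)
  then have 2: "continuous_map (top_of_set ?S) (coord_topology d) coords"
    unfolding continuous_map_componentwise coords_def[abs_def]
    by (intro conjI ballI) (simp_all add: image_subset_iff continuous_on_inner)
  have 3: "coords (chart x) = x" if x: "x \<in> coord_space d" for x
  proof
    show "coords (chart x) i = x i" for i
    proof (cases "i < d")
      case True
      then show ?thesis by (simp add: coords_def chart_def cayley_inv_cayley(1)[OF v] vec_inner)
    next
      case False
      then show ?thesis using PiE_arb[OF x, of i] by (simp add: coords_def)
    qed
  qed
  have top: "topspace (subtopology (coord_topology d) (coord_space d)) = coord_space d" by simp
  show "homeomorphic_maps (subtopology (coord_topology d) (coord_space d)) (top_of_set ?S) chart coords"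
    unfolding homeomorphic_maps_def continuous_map_in_subtopology
  proof (intro conjI funcsetI ballI)
    show "continuous_map (subtopology (coord_topology d) (coord_space d)) euclidean chart"
      by (rule continuous_map_from_subtopology[OF 1])
    show "chart x \<in> ?S" if "x \<in> topspace (subtopology (coord_topology d) (coord_space d))" for x
      using that unfolding top by (rule imageI)
    show "coords (chart x) = x" if "x \<in> topspace (subtopology (coord_topology d) (coord_space d))" for x
      using that unfolding top by (rule 3)
    show "continuous_map (top_of_set ?S) (coord_topology d) coords" by (rule 2)
    show "coords w \<in> coord_space d" for w by (simp add: coords_def)
    fix w assume "w \<in> topspace (top_of_set ?S)"
    then obtain x where "x \<in> coord_space d" "w = chart x" unfolding topspace_euclidean_subtopology by (rule imageE)
    then show "chart (coords w) = w" by (simp only: 3)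
  qed
qed

lemma local_parametrization_chart:
  fixes e :: "nat \<Rightarrow> 'd::finite"
  assumes "d = 0 \<or> bij_betw e {..<d} (UNIV :: 'd set)"
  shows "local_parametrization d stiefel (coord_space d) chart"
  unfolding local_parametrization_def
proof (intro conjI homeomorphic_chart)
  show "openin (coord_topology d) (coord_space d)"
    using openin_topspace[of "coord_topology d"] by simp
  have "chart ` coord_space d = stiefel \<inter> {w. bop_invertible (bop_id + gram v w)}"
    unfolding image_chart by blast
  then show "openin (top_of_set stiefel) (chart ` coord_space d)"
    by (simp only: openin_open_Int[OF open_cayley_range])
  show "real_analytic_on d chart (coord_space d)" by (rule real_analytic_onI) (rule germ_chart)
  show "\<forall>x\<in>coord_space d. \<forall>a. (\<Sum>i<d. a i *\<^sub>R partial i chart x) = 0 \<longrightarrow> (\<forall>i<d. a i = 0)"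
    using chart_immersion[of e] assms by blast
qed

lemma center_in_chart: "v \<in> chart ` coord_space d"
  by (rule image_eqI[of _ _ "\<lambda>i\<in>{..<d}. 0"]) (simp_all add: chart_def vec_def cayley_zero)

end

lemma analytic_submanifold_stiefel:
  fixes e :: "nat \<Rightarrow> 'd::finite"
  assumes d: "d = cdim TYPE('h::fd_hilbert) * (2 * CARD('r::finite) * cdim TYPE('k::fd_hilbert) - cdim TYPE('h))"
    and e: "d = 0 \<or> bij_betw e {..<d} (UNIV :: 'd set)"
  shows "analytic_submanifold d (stiefel :: (('h, 'k) bop ^ 'r) set)"
  unfolding analytic_submanifold_def
proof
  fix v :: "('h, 'k) bop ^ 'r" assume v: "v \<in> stiefel"
  have "\<exists>B. finite B \<and> span B = skew_tangent v \<and> card B = d \<and> (\<forall>a\<in>B. \<forall>b\<in>B. a \<bullet> b = (if a = b then 1 else 0))"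
    unfolding d
    by (rule skew_tangent_orthonormal_set[OF v], intro exI conjI ballI, assumption, assumption, assumption, blast)
  then obtain B where B: "finite B" "span B = skew_tangent v" "card B = d"
    "\<And>a b. a \<in> B \<Longrightarrow> b \<in> B \<Longrightarrow> a \<bullet> b = (if a = b then 1 else 0)"
    by blast
  obtain b where b: "bij_betw b {..<d} B"
    using ex_bij_betw_nat_finite[OF B(1)] B(3) by (auto simp: atLeast0LessThan)
  have "b i \<bullet> b j = (if i = j then 1 else 0)" if "i < d" "j < d" for i j
    using B(4)[of "b i" "b j"] b that by (auto simp: bij_betw_def inj_on_def)
  then interpret cayley_chart v d b
    using v B(2) b by unfold_locales (auto simp: bij_betw_def)
  show "\<exists>U \<phi>. local_parametrization d stiefel U \<phi> \<and> v \<in> \<phi> ` U"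
    using local_parametrization_chart[OF e] center_in_chart by blast
qed

section \<open>Uniqueness of invariant probabilities\<close>

text \<open>
  Christensen's argument: balls of equal radius have equal measure, so by Fubini two such
  probabilities agree on balls, and then on open sets.
\<close>

locale homogeneous_probability = prob_space P for P :: "'e::real_inner measure" +
  fixes M B :: "'e set"
  assumes onb: "real_onb B" and compact_M: "compact M" and sets_P: "sets P = sets (restrict_space borel M)"
    and homogeneous: "\<And>x y. x \<in> M \<Longrightarrow> y \<in> M \<Longrightarrow> \<exists>f\<in>measurable P P. distr P P f = P \<and> f x = y \<and>
      (\<forall>u\<in>M. \<forall>w\<in>M. dist (f u) (f w) = dist u w)"
begin

lemma space_P: "space P = M"
  using sets_eq_imp_space_eq[OF sets_P] by (simp add: space_restrict_space)

lemma open_sets_P: "open U \<Longrightarrow> M \<inter> U \<in> sets P"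
  by (auto simp: sets_P sets_restrict_space)

lemma ball_measure_eq:
  assumes x: "x \<in> M" and y: "y \<in> M"
  shows "emeasure P (M \<inter> ball x r) = emeasure P (M \<inter> ball y r)"
proof -
  obtain f where f: "f \<in> measurable P P" "distr P P f = P" "f x = y"
    "\<And>u w. u \<in> M \<Longrightarrow> w \<in> M \<Longrightarrow> dist (f u) (f w) = dist u w"
    using homogeneous[OF x y] by blast
  have fM: "f u \<in> M" if "u \<in> M" for u using measurable_space[OF f(1)] that by (simp add: space_P)
  have "emeasure P (M \<inter> ball y r) = emeasure (distr P P f) (M \<inter> ball y r)" by (simp add: f(2))
  also have "\<dots> = emeasure P (f -` (M \<inter> ball y r) \<inter> M)"
    by (subst emeasure_distr[OF f(1) open_sets_P]) (simp_all add: space_P)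
  also have "f -` (M \<inter> ball y r) \<inter> M = M \<inter> ball x r"
    using fM f(4)[OF x] by (auto simp: f(3))
  finally show ?thesis by simp
qed

text \<open>Finitely many balls of radius \<open>r\<close> cover the compact \<open>M\<close>, and
  all have the same measure. If it were zero, the total mass would be zero.\<close>

lemma ball_measure_pos:
  assumes x: "x \<in> M" and r: "r > 0"
  shows "emeasure P (M \<inter> ball x r) > 0"
proof (rule ccontr)
  assume "\<not> emeasure P (M \<inter> ball x r) > 0"
  then have 0: "M \<inter> ball y r \<in> null_sets P" if "y \<in> M" for y
    using ball_measure_eq[OF x that, of r] open_sets_P[of "ball y r"] by (simp add: null_sets_def)
  obtain C where C: "C \<subseteq> M" "finite C" "M \<subseteq> (\<Union>y\<in>C. ball y r)"
    using compactE_image[OF compact_M, of M "\<lambda>y. ball y r"] r by force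
  have "(\<Union>y\<in>C. M \<inter> ball y r) \<in> null_sets P" using C 0 by (intro null_sets.finite_UN) auto
  moreover have "(\<Union>y\<in>C. M \<inter> ball y r) = M" using C(3) by auto
  ultimately have "emeasure P M = 0" by (simp add: null_sets_def)
  then show False using emeasure_space_1 by (simp add: space_P)
qed

end

text \<open>Written in coordinates, the distance is built from real functions of one factor each. It
  is therefore measurable for the product sigma-algebra itself, with no comparison to the Borel sets
  of the product space.\<close>

lemma measurable_dist_pair:
  fixes P Q :: "'e::real_inner measure" and B :: "'e set"
  assumes B: "real_onb B" and P: "sets P = sets (restrict_space borel M)" and Q: "sets Q = sets (restrict_space borel M)"
  shows "(\<lambda>z. dist (fst z) (snd z)) \<in> borel_measurable (P \<Otimes>\<^sub>M Q)"
proof -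
  have m: "(\<lambda>x. x \<bullet> b) \<in> borel_measurable R" if "sets R = sets (restrict_space borel M)" for R :: "'e measure" and b
  proof -
    have "(\<lambda>x. x \<bullet> b) \<in> borel_measurable (restrict_space borel M)"
      by (intro measurable_restrict_space1 borel_measurable_continuous_onI continuous_intros)
    then show ?thesis using that by (simp cong: measurable_cong_sets)
  qed
  have "dist x y = sqrt (\<Sum>b\<in>B. (x \<bullet> b - y \<bullet> b)\<^sup>2)" for x y
  proof -
    have "(x - y) \<bullet> (x - y) = (x - y) \<bullet> (\<Sum>b\<in>B. ((x - y) \<bullet> b) *\<^sub>R b)" using real_onb_expand[OF B] by simp
    also have "\<dots> = (\<Sum>b\<in>B. (x \<bullet> b - y \<bullet> b)\<^sup>2)"
      by (simp only: inner_sum_right inner_scaleR_right inner_diff_left power2_eq_square)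
    finally show ?thesis by (simp add: dist_norm norm_eq_sqrt_inner)
  qed
  then have "(\<lambda>z. dist (fst z) (snd z)) = (\<lambda>z. sqrt (\<Sum>b\<in>B. (fst z \<bullet> b - snd z \<bullet> b)\<^sup>2))" by simp
  also have "\<dots> \<in> borel_measurable (P \<Otimes>\<^sub>M Q)"
    by (intro borel_measurable_continuous_on[OF continuous_on_real_sqrt[OF continuous_on_id]]
        borel_measurable_sum borel_measurable_power borel_measurable_diff
        measurable_compose[OF measurable_fst m[OF P]] measurable_compose[OF measurable_snd m[OF Q]])
  finally show ?thesis .
qed

text \<open>Both sides are the product measure of the pairs \<open>(x, y)\<close> with
  \<open>y \<in> U\<close> at distance less than \<open>r\<close>. Integrating over \<open>x\<close>
  first gives a constant, since the \<open>P\<close>-measure of a ball does not depend on its centre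
  in \<open>M\<close>.\<close>

lemma homogeneous_probability_fubini:
  fixes P Q :: "'e::real_inner measure"
  assumes P: "homogeneous_probability P M B" and Q: "homogeneous_probability Q M B"
    and U: "U \<in> sets Q" and z: "z \<in> M"
  shows "(\<integral>\<^sup>+x. emeasure Q (U \<inter> ball x r) \<partial>P) = emeasure Q U * emeasure P (M \<inter> ball z r)"
proof -
  interpret P: homogeneous_probability P M B by (rule P)
  interpret Q: homogeneous_probability Q M B by (rule Q)
  interpret pair_sigma_finite P Q by unfold_locales
  have UM: "U \<subseteq> M" using sets.sets_into_space[OF U] by (simp add: Q.space_P)
  let ?f = "\<lambda>x y. indicator U y * indicator (ball x r) y :: ennreal"
  have "case_prod ?f = (\<lambda>z. indicator U (snd z) * indicator {..<r} (dist (fst z) (snd z)))"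
    by (auto simp: indicator_def split: if_splits)
  moreover have "\<dots> \<in> borel_measurable (P \<Otimes>\<^sub>M Q)"
    using measurable_dist_pair[OF P.onb P.sets_P Q.sets_P] U
    by (intro borel_measurable_times_ennreal measurable_compose[OF measurable_snd borel_measurable_indicator]
        measurable_compose[OF _ borel_measurable_indicator]) auto
  ultimately have meas: "case_prod ?f \<in> borel_measurable (P \<Otimes>\<^sub>M Q)" by simp
  have "(\<integral>\<^sup>+x. emeasure Q (U \<inter> ball x r) \<partial>P) = (\<integral>\<^sup>+x. (\<integral>\<^sup>+y. ?f x y \<partial>Q) \<partial>P)"
  proof (rule nn_integral_cong)
    fix x
    have "U \<inter> ball x r = U \<inter> (M \<inter> ball x r)" using UM by blast
    then have "U \<inter> ball x r \<in> sets Q" using U Q.open_sets_P[of "ball x r"] by auto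
    then have "emeasure Q (U \<inter> ball x r) = (\<integral>\<^sup>+y. indicator (U \<inter> ball x r) y \<partial>Q)" by simp
    then show "emeasure Q (U \<inter> ball x r) = (\<integral>\<^sup>+y. ?f x y \<partial>Q)"
      by (simp only: indicator_inter_arith)
  qed
  also have "\<dots> = (\<integral>\<^sup>+y. (\<integral>\<^sup>+x. ?f x y \<partial>P) \<partial>Q)" by (rule Fubini'[OF meas, symmetric])
  also have "\<dots> = (\<integral>\<^sup>+y. emeasure P (M \<inter> ball z r) * indicator U y \<partial>Q)"
  proof (rule nn_integral_cong)
    fix y assume "y \<in> space Q"
    then have y: "y \<in> M" by (simp add: Q.space_P)
    have "(\<integral>\<^sup>+x. ?f x y \<partial>P) = (\<integral>\<^sup>+x. indicator U y * indicator (M \<inter> ball y r) x \<partial>P)"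
      by (rule nn_integral_cong) (auto simp: indicator_def P.space_P dist_commute)
    also have "\<dots> = indicator U y * emeasure P (M \<inter> ball y r)"
      by (rule nn_integral_cmult_indicator) (rule P.open_sets_P, simp)
    finally show "(\<integral>\<^sup>+x. ?f x y \<partial>P) = emeasure P (M \<inter> ball z r) * indicator U y"
      using P.ball_measure_eq[OF y z] by (simp add: mult.commute)
  qed
  also have "\<dots> = emeasure Q U * emeasure P (M \<inter> ball z r)"
    by (subst nn_integral_cmult_indicator[OF U]) (rule mult.commute)
  finally show ?thesis .
qed

text \<open>In the Fubini identity for \<open>U = M\<close> the integrand on the left is constant as
  well, and both total masses are 1.\<close>

lemma homogeneous_probability_ball_eq:
  assumes P: "homogeneous_probability P M B" and Q: "homogeneous_probability Q M B" and z: "z \<in> M"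
  shows "emeasure P (M \<inter> ball z r) = emeasure Q (M \<inter> ball z r)"
proof -
  interpret P: homogeneous_probability P M B by (rule P)
  interpret Q: homogeneous_probability Q M B by (rule Q)
  have "emeasure P (M \<inter> ball z r) = emeasure Q M * emeasure P (M \<inter> ball z r)"
    using Q.emeasure_space_1 by (simp add: Q.space_P)
  also have "\<dots> = (\<integral>\<^sup>+x. emeasure Q (M \<inter> ball x r) \<partial>P)"
    using homogeneous_probability_fubini[OF P Q _ z, of M r] sets.top[of Q] by (simp add: Q.space_P)
  also have "\<dots> = (\<integral>\<^sup>+x. emeasure Q (M \<inter> ball z r) \<partial>P)"
    by (intro nn_integral_cong Q.ball_measure_eq z) (simp add: P.space_P)
  also have "\<dots> = emeasure Q (M \<inter> ball z r)"
    using P.emeasure_space_1 by simp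
  finally show ?thesis .
qed

text \<open>Points at distance at least \<open>r\<close> from \<open>M - U\<close> have their whole
  \<open>r\<close>-ball in \<open>U\<close>, so there the Fubini integrand equals the common ball
  measure. That measure is positive and finite and cancels. As \<open>r\<close> decreases to 0,
  these points exhaust \<open>M \<inter> U\<close>.\<close>

lemma homogeneous_probability_open_le:
  assumes P: "homogeneous_probability P M B" and Q: "homogeneous_probability Q M B" and U: "open U"
  shows "emeasure P (M \<inter> U) \<le> emeasure Q (M \<inter> U)"
proof -
  interpret P: homogeneous_probability P M B by (rule P)
  interpret Q: homogeneous_probability Q M B by (rule Q)
  have "M \<noteq> {}" using P.not_empty by (simp add: P.space_P)
  then obtain z where z: "z \<in> M" by blast
  define I where "I = (\<lambda>r. M - (\<Union>y\<in>M - U. ball y r))"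
  have I: "I r \<in> sets P" for r
  proof -
    have "I r = space P - M \<inter> (\<Union>y\<in>M - U. ball y r)" by (auto simp: I_def P.space_P)
    then show ?thesis using P.open_sets_P[of "\<Union>y\<in>M - U. ball y r"] by auto
  qed
  have le: "emeasure P (I r) \<le> emeasure Q (M \<inter> U)" if r: "r > 0" for r
  proof -
    let ?q = "emeasure Q (M \<inter> ball z r)"
    have "?q * emeasure P (I r) = (\<integral>\<^sup>+x. ?q * indicator (I r) x \<partial>P)"
      using nn_integral_cmult_indicator[OF I] by simp
    also have "\<dots> \<le> (\<integral>\<^sup>+x. emeasure Q (M \<inter> U \<inter> ball x r) \<partial>P)"
    proof (rule nn_integral_mono)
      fix x assume "x \<in> space P"
      then have x: "x \<in> M" by (simp add: P.space_P)
      show "?q * indicator (I r) x \<le> emeasure Q (M \<inter> U \<inter> ball x r)"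
      proof (cases "x \<in> I r")
        case True
        then have "M \<inter> U \<inter> ball x r = M \<inter> ball x r" by (auto simp: I_def dist_commute)
        then show ?thesis using True Q.ball_measure_eq[OF x z, of r] by simp
      qed simp
    qed
    also have "\<dots> = emeasure Q (M \<inter> U) * emeasure P (M \<inter> ball z r)"
      by (rule homogeneous_probability_fubini[OF P Q Q.open_sets_P[OF U] z])
    also have "\<dots> = ?q * emeasure Q (M \<inter> U)"
      using homogeneous_probability_ball_eq[OF P Q z] by (simp add: mult.commute)
    finally have "?q * emeasure P (I r) \<le> ?q * emeasure Q (M \<inter> U)" .
    moreover have "?q > 0" by (rule Q.ball_measure_pos[OF z r])
    moreover have "?q < \<infinity>" using Q.emeasure_finite by (simp add: less_top[symmetric])
    ultimately show ?thesis by (simp add: ennreal_mult_le_mult_iff)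
  qed
  have inc: "incseq (\<lambda>n. I (inverse (real (Suc n))))"
  proof (rule incseq_SucI)
    fix n
    have "inverse (real (Suc (Suc n))) \<le> inverse (real (Suc n))" by (intro le_imp_inverse_le) auto
    then show "I (inverse (real (Suc n))) \<le> I (inverse (real (Suc (Suc n))))"
      unfolding I_def by (intro Diff_mono UN_mono order_refl subset_ball)
  qed
  have union: "(\<Union>n. I (inverse (real (Suc n)))) = M \<inter> U"
  proof (intro equalityI subsetI)
    fix x assume "x \<in> (\<Union>n. I (inverse (real (Suc n))))"
    then obtain n where "x \<in> I (inverse (real (Suc n)))" by blast
    moreover have "x \<in> ball x (inverse (real (Suc n)))" by simp
    ultimately show "x \<in> M \<inter> U" unfolding I_def by blast
  next
    fix x assume x: "x \<in> M \<inter> U"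
    then obtain \<epsilon> where \<epsilon>: "\<epsilon> > 0" "ball x \<epsilon> \<subseteq> U" using U open_contains_ball by blast
    obtain n where n: "inverse (real (Suc n)) < \<epsilon>" using reals_Archimedean[OF \<epsilon>(1)] by blast
    have "x \<in> I (inverse (real (Suc n)))"
      unfolding I_def
    proof (intro DiffI notI)
      assume "x \<in> (\<Union>y\<in>M - U. ball y (inverse (real (Suc n))))"
      then obtain y where y: "y \<in> M - U" "dist y x < inverse (real (Suc n))" by auto
      then have "y \<in> ball x \<epsilon>" using n by (simp add: dist_commute)
      then show False using y(1) \<epsilon>(2) by blast
    qed (use x in blast)
    then show "x \<in> (\<Union>n. I (inverse (real (Suc n))))" by blast
  qed
  have "emeasure P (M \<inter> U) = (SUP n. emeasure P (I (inverse (real (Suc n)))))"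
    unfolding union[symmetric] by (rule SUP_emeasure_incseq[OF _ inc, symmetric]) (use I in blast)
  also have "\<dots> \<le> emeasure Q (M \<inter> U)" by (intro SUP_least le) simp
  finally show ?thesis .
qed

text \<open>The two inequalities on open sets combine to an equality. Images under the inclusion are
  taken because in the ambient space the open sets form an intersection-stable generator of the
  Borel sets.\<close>

lemma homogeneous_probability_unique:
  fixes P Q :: "'e::real_inner measure"
  assumes P: "homogeneous_probability P M B" and Q: "homogeneous_probability Q M B"
  shows "P = Q"
proof -
  interpret P: homogeneous_probability P M B by (rule P)
  interpret Q: homogeneous_probability Q M B by (rule Q)
  have id: "(\<lambda>x. x) \<in> measurable R borel" if "sets R = sets (restrict_space borel M)" for R :: "'e measure"
    using measurable_restrict_space1[OF measurable_ident, of borel M] that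
    by (simp add: id_def cong: measurable_cong_sets)
  have ext: "emeasure (distr R borel (\<lambda>x. x)) A = emeasure R (M \<inter> A)"
    if "sets R = sets (restrict_space borel M)" "A \<in> sets borel" for R :: "'e measure" and A
    using emeasure_distr[OF id[OF that(1)] that(2)] sets_eq_imp_space_eq[OF that(1)]
    by (simp add: space_restrict_space Int_commute)
  have "distr P borel (\<lambda>x. x) = distr Q borel (\<lambda>x. x)"
  proof (rule measure_eqI_generator_eq[where E = "{S. open S}" and \<Omega> = UNIV and A = "\<lambda>_. UNIV"])
    show "Int_stable {S :: 'e set. open S}" by (auto simp: Int_stable_def)
    fix X :: "'e set" assume "X \<in> {S. open S}"
    then show "emeasure (distr P borel (\<lambda>x. x)) X = emeasure (distr Q borel (\<lambda>x. x)) X"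
      using homogeneous_probability_open_le[OF P Q] homogeneous_probability_open_le[OF Q P]
      by (auto simp: ext[OF P.sets_P] ext[OF Q.sets_P] intro!: antisym)
  next
    show "emeasure (distr P borel (\<lambda>x. x)) ((\<lambda>_. UNIV) i) \<noteq> \<infinity>" for i :: nat
      by (simp add: ext[OF P.sets_P])
  qed (auto simp: sets_borel)
  then have *: "emeasure P (M \<inter> A) = emeasure Q (M \<inter> A)" if "A \<in> sets borel" for A
    using ext[OF P.sets_P that] ext[OF Q.sets_P that] by simp
  show ?thesis
  proof (rule measure_eqI)
    show "sets P = sets Q" by (simp add: P.sets_P Q.sets_P)
    fix A assume "A \<in> sets P"
    then obtain A0 where "A0 \<in> sets borel" "A = M \<inter> A0" by (auto simp: P.sets_P sets_restrict_space)
    then show "emeasure P A = emeasure Q A" using * by simp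
  qed
qed

text \<open>
  An index type with \<open>d\<close> elements (one element if \<open>d = 0\<close>, as types are inhabited), so that the change
  of variables theorem on \<open>real ^ 'd\<close> becomes available.
\<close>

typedef (overloaded) ('h::fd_hilbert, 'k::fd_hilbert, 'r::finite) chart_index =
  "{i :: nat. i < max 1 (cdim TYPE('h) * (2 * CARD('r) * cdim TYPE('k) - cdim TYPE('h)))}"
  morphisms index_nat nat_index
  by (rule exI[of _ 0]) simp

instance chart_index :: (fd_hilbert, fd_hilbert, finite) finite
proof
  have "UNIV = (nat_index :: nat \<Rightarrow> ('a, 'b, 'c) chart_index) `
    {i. i < max 1 (cdim TYPE('a) * (2 * CARD('c) * cdim TYPE('b) - cdim TYPE('a)))}"
    by (rule type_definition.Abs_image[OF type_definition_chart_index, symmetric])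
  then show "finite (UNIV :: ('a, 'b, 'c) chart_index set)" by (metis finite_Collect_less_nat finite_imageI)
qed

text \<open>The change of variables theorem asks for a well-ordered index type; the order of the
  natural numbers is transported.\<close>

instantiation chart_index :: (fd_hilbert, fd_hilbert, finite) wellorder
begin

definition less_eq_chart_index :: "('a, 'b, 'c) chart_index \<Rightarrow> ('a, 'b, 'c) chart_index \<Rightarrow> bool"
  where "less_eq_chart_index i j \<longleftrightarrow> index_nat i \<le> index_nat j"

definition less_chart_index :: "('a, 'b, 'c) chart_index \<Rightarrow> ('a, 'b, 'c) chart_index \<Rightarrow> bool"
  where "less_chart_index i j \<longleftrightarrow> index_nat i < index_nat j"

instance
proof
  fix P :: "('a, 'b, 'c) chart_index \<Rightarrow> bool" and i
  assume *: "\<And>i. (\<And>j. j < i \<Longrightarrow> P j) \<Longrightarrow> P i"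
  show "P i"
    by (induction i rule: measure_induct_rule[of index_nat]) (rule *, simp add: less_chart_index_def)
qed (auto simp: less_eq_chart_index_def less_chart_index_def index_nat_inject)

end

section \<open>Assembling the statement for the Stiefel manifold\<close>

lemma nat_index_bij:
  assumes d: "d = cdim TYPE('h::fd_hilbert) * (2 * CARD('r::finite) * cdim TYPE('k::fd_hilbert) - cdim TYPE('h))"
    and "d > 0"
  shows "bij_betw (nat_index :: nat \<Rightarrow> ('h, 'k, 'r) chart_index) {..<d} UNIV"
proof -
  have d': "{i. i < max 1 (cdim TYPE('h) * (2 * CARD('r) * cdim TYPE('k) - cdim TYPE('h)))} = {..<d}"
    using assms by auto
  have "inj_on (nat_index :: nat \<Rightarrow> ('h, 'k, 'r) chart_index) {..<d}"
    unfolding d'[symmetric] by (intro inj_onI) (simp only: nat_index_inject)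
  moreover have "(nat_index :: nat \<Rightarrow> ('h, 'k, 'r) chart_index) ` {..<d} = UNIV"
    unfolding d'[symmetric] by (rule type_definition.Abs_image[OF type_definition_chart_index])
  ultimately show ?thesis by (simp add: bij_betw_def)
qed

text \<open>As \<open>n \<le> m\<close>, an orthonormal basis of one space can be mapped injectively
  into one of the other. The resulting isometry is put into one slot of the tuple, with zeros
  elsewhere.\<close>

lemma stiefel_nonempty:
  assumes "cdim TYPE('h::fd_hilbert) \<le> cdim TYPE('k::fd_hilbert)"
  shows "(stiefel :: (('h, 'k) bop ^ 'r) set) \<noteq> {}"
proof -
  obtain E :: "'h set" where E: "orthonormal_basis E" using orthonormal_basis_exists by blast
  obtain F :: "'k set" where F: "orthonormal_basis F" using orthonormal_basis_exists by blast
  have fin: "finite E" "finite F" using E F by (auto simp: orthonormal_basis_def)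
  obtain j where j: "j ` E \<subseteq> F" "inj_on j E"
    using card_le_inj[OF fin] assms by (auto simp: orthonormal_basis_card[OF E] orthonormal_basis_card[OF F])
  define A where "A = (\<Sum>e\<in>E. rank_one e (j e))"
  have Ae: "app A f = j f" if "f \<in> E" for f
  proof -
    have "app A f = (\<Sum>e\<in>E. if e = f then j e else 0)"
      unfolding A_def app_sum_bop app_rank_one
      by (intro sum.cong refl) (use E that in \<open>auto simp: orthonormal_basis_def orthonormal_def scaleC_one\<close>)
    then show ?thesis using fin that by simp
  qed
  have "adj A \<circ>\<^sub>B A = bop_id"
  proof (rule bop_eq_on_basis[OF E], rule orthonormal_basis_eqI[OF E])
    fix f e assume fe: "f \<in> E" "e \<in> E"
    have "j f \<in> F" "j e \<in> F" using j(1) fe by blast+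
    then have "cinner (j f) (j e) = cinner f e"
      using fe E F inj_on_eq_iff[OF j(2), of f e] by (simp add: orthonormal_basis_def orthonormal_def)
    then show "cinner (app (adj A \<circ>\<^sub>B A) f) e = cinner (app bop_id f) e"
      by (simp add: bop_comp.rep_eq bop_id.rep_eq cinner_adj_left Ae fe)
  qed
  moreover obtain k0 :: 'r where True by blast
  ultimately have "(\<chi> k. if k = k0 then A else 0) \<in> (stiefel :: (('h, 'k) bop ^ 'r) set)"
  proof -
    assume A: "adj A \<circ>\<^sub>B A = bop_id"
    have "(\<Sum>k\<in>UNIV. adj (if k = k0 then A else 0) \<circ>\<^sub>B (if k = k0 then A else 0))
        = (\<Sum>k\<in>UNIV. if k = k0 then adj A \<circ>\<^sub>B A else 0)"
      by (intro sum.cong refl) simp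
    then show ?thesis by (simp add: stiefel_def A)
  qed
  then show ?thesis by blast
qed

lemma linear_isometry_pair_unitary:
  fixes B :: "(('h::fd_hilbert, 'k::fd_hilbert) bop ^ 'r) set"
  assumes B: "real_onb B" and a: "a \<in> carrier unitary_group"
  shows "linear_isometry_pair (block_act a) (block_act (block_adj a)) stiefel B"
proof -
  have "linear (block_act a :: ('h, 'k) bop ^ 'r \<Rightarrow> _)" for a
    by (intro linearI) (simp_all add: block_act_def vec_eq_iff comp_distrib sum.distrib scaleR_sum_right)
  then have "bounded_linear (block_act a :: ('h, 'k) bop ^ 'r \<Rightarrow> _)" for a by (rule real_onb_linear_bounded[OF B])
  then show ?thesis
    by (simp add: linear_isometry_pair_def B unitary_inverse_act[OF a] inner_trace gram_unitary[OF a]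
        unitary_act_stiefel a unitary_adj)
qed

lemma homogeneous_invariant_probability:
  fixes P :: "(('h::fd_hilbert, 'k::fd_hilbert) bop ^ 'r) measure"
  assumes B: "real_onb B" and P: "is_invariant_probability unitary_group stiefel block_act P"
  shows "homogeneous_probability P stiefel B"
proof -
  have "\<exists>f\<in>measurable P P. distr P P f = P \<and> f x = y \<and> (\<forall>u\<in>stiefel. \<forall>w\<in>stiefel. dist (f u) (f w) = dist u w)"
    if xy: "x \<in> stiefel" "y \<in> stiefel" for x y
  proof -
    obtain a where a: "a \<in> carrier unitary_group" "block_act a x = y" using unitary_transitive[OF xy] by blast
    interpret linear_isometry_pair "block_act a" "block_act (block_adj a)" stiefel B
      by (rule linear_isometry_pair_unitary[OF B a(1)])
    have "dist (block_act a u) (block_act a w) = dist u w" for u w :: "('h, 'k) bop ^ 'r"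
      using inner_F[of "u - w" "u - w"] linear_diff[OF bounded_linear.linear[OF F], of u w]
      by (simp add: dist_norm norm_eq_sqrt_inner)
    then show ?thesis
      using P a by (intro bexI[of _ "block_act a"]) (auto simp: is_invariant_probability_def)
  qed
  then show ?thesis
    using P B compact_stiefel
    by (simp add: homogeneous_probability_def homogeneous_probability_axioms_def is_invariant_probability_def)
qed

lemma analytic_riemannian_manifold_induced:
  fixes M B :: "'e::{real_inner, banach} set"
  assumes B: "real_onb B" and M: "analytic_submanifold d M"
  shows "analytic_riemannian_manifold d M induced_metric"
  unfolding analytic_riemannian_manifold_def
proof (intro conjI ballI allI impI M)
  fix U \<phi> i j assume lp: "local_parametrization d M U \<phi>" and ij: "i < d" "j < d"
  show "real_analytic_on d (metric_coeff induced_metric \<phi> i j) U"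
    by (rule real_analytic_onI) (rule metric_coeff_germ[OF B local_parametrization_analytic[OF lp] _ ij])
qed (simp_all add: induced_metric_def inner_commute inner_add_left inner_add_right)

text \<open>The total mass \<open>c\<close> is finite by compactness and positive because
  \<open>M\<close> is nonempty, so it can be divided out. The image of \<open>\<mu>\<close> under a
  group element again has the defining property of the Riemannian measure and therefore equals
  \<open>\<mu>\<close>.\<close>

lemma (in coord_dim) invariant_probability_of_riemannian_measure:
  fixes M :: "'e set"
  assumes M: "compact M" "analytic_submanifold d M" "M \<noteq> {}" and \<mu>: "is_riemannian_measure d M induced_metric \<mu>"
    and act: "\<And>a. a \<in> carrier G \<Longrightarrow> \<exists>F'. linear_isometry_pair (act a) F' M B"
  obtains c where "c > 0" "is_invariant_probability G M act (scale_measure (ennreal (inverse c)) \<mu>)"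
    "\<mu> = scale_measure (ennreal c) (scale_measure (ennreal (inverse c)) \<mu>)"
proof -
  define c where "c = enn2real (emeasure \<mu> M)"
  have fin: "emeasure \<mu> M < \<infinity>" by (rule riemannian_measure_exists_unique(2)[OF M(1,2) \<mu>])
  have cM: "emeasure \<mu> M = ennreal c" using fin by (simp add: c_def less_top[symmetric])
  have "emeasure \<mu> M > 0" by (rule riemannian_measure_positive[OF M(2,3) \<mu>])
  then have c: "c > 0" by (simp add: cM)
  have s: "sets \<mu> = sets (restrict_space borel M)" using \<mu> by (simp add: is_riemannian_measure_iff)
  have sp: "space \<mu> = M" using sets_eq_imp_space_eq[OF s] by (simp add: space_restrict_space)
  define P where "P = scale_measure (ennreal (inverse c)) \<mu>"
  have sP: "sets P = sets \<mu>" "space P = M" by (simp_all add: P_def space_scale_measure sp)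
  have cc: "ennreal c * ennreal (inverse c) = 1" "ennreal (inverse c) * ennreal c = 1"
    using c by (simp_all add: ennreal_mult[symmetric])
  have "prob_space P" by (rule prob_spaceI) (simp add: P_def space_scale_measure sp cM cc)
  moreover have "act a \<in> measurable P P \<and> distr P P (act a) = P" if a: "a \<in> carrier G" for a
  proof -
    obtain F' where "linear_isometry_pair (act a) F' M B" using act[OF a] by blast
    then interpret linear_isometry_pair "act a" F' M B .
    have m: "act a \<in> measurable P P" "act a \<in> measurable \<mu> \<mu>" using measurable_F s sP by simp_all
    have "distr \<mu> \<mu> (act a) = \<mu>"
      using riemannian_measure_exists_unique(1)[OF M(1,2)] distr_riemannian_measure[OF \<mu>] \<mu> by blast
    then have "emeasure \<mu> (act a -` A \<inter> M) = emeasure \<mu> A" if "A \<in> sets \<mu>" for A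
      using emeasure_distr[OF m(2) that] by (simp add: sp)
    then have "distr P P (act a) = P"
      by (intro measure_eqI) (simp_all add: emeasure_distr[OF m(1)] sP, simp add: P_def sP)
    then show ?thesis using m(1) by blast
  qed
  ultimately have "is_invariant_probability G M act P" by (simp add: is_invariant_probability_def sP s)
  moreover have "\<mu> = scale_measure (ennreal c) P" by (simp add: P_def cc)
  ultimately show ?thesis by (rule that[OF c, folded P_def])
qed

theorem theorem2p1:
  fixes V :: "(('h::fd_hilbert, 'k::fd_hilbert) bop ^ 'r) set"
    and \<U> :: "(('k, 'k) bop ^ 'r ^ 'r) monoid"
    and n m r d :: nat
  assumes "V = stiefel" and "\<U> = unitary_group"
    and "n = cdim TYPE('h)" and "m = cdim TYPE('k)" and "r = CARD('r)"
    and "n \<le> m"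
    and "d = n * (2 * r * m - n)"
  shows "compact V \<and> connected V \<and>
    analytic_riemannian_manifold d V induced_metric \<and>
    transitive_action \<U> V (\<lambda>w. restrict (block_act w) V) \<and>
    (\<forall>w\<in>carrier \<U>. riemannian_isometry d V induced_metric (block_act w)) \<and>
    (\<exists>!\<mu>. is_riemannian_measure d V induced_metric \<mu>) \<and>
    (\<exists>!P. is_invariant_probability \<U> V block_act P) \<and>
    (\<forall>\<mu> P. is_riemannian_measure d V induced_metric \<mu> \<and>
       is_invariant_probability \<U> V block_act P \<longrightarrow>
       (\<exists>c>0. \<mu> = scale_measure (ennreal c) P))"
proof -
  let ?e = "nat_index :: nat \<Rightarrow> ('h, 'k, 'r) chart_index"
  obtain B :: "(('h, 'k) bop ^ 'r) set" where B: "real_onb B" by (rule real_onb_tuple_exists)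
  have d: "d = cdim TYPE('h) * (2 * CARD('r) * cdim TYPE('k) - cdim TYPE('h))" using assms by simp
  have e: "d = 0 \<or> bij_betw ?e {..<d} UNIV" using nat_index_bij[OF d] by blast
  interpret coord_dim d ?e B by unfold_locales (rule B, rule e)
  have compact: "compact V" unfolding assms(1) by (rule compact_stiefel)
  have sub: "analytic_submanifold d V" unfolding assms(1) by (rule analytic_submanifold_stiefel[OF d e])
  have ne: "V \<noteq> {}" unfolding assms(1) by (rule stiefel_nonempty) (use assms in simp)
  have iso: "linear_isometry_pair (block_act a) (block_act (block_adj a)) V B" if "a \<in> carrier \<U>" for a
    using linear_isometry_pair_unitary[OF B, of a] that by (simp add: assms(1,2))
  have uniq: "P = Q" if "is_invariant_probability \<U> V block_act P" "is_invariant_probability \<U> V block_act Q" for P Q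
    using homogeneous_probability_unique[OF homogeneous_invariant_probability[OF B]
        homogeneous_invariant_probability[OF B]] that by (simp add: assms(1,2))
  have proportional: "\<exists>c>0. \<exists>P. is_invariant_probability \<U> V block_act P \<and> \<mu> = scale_measure (ennreal c) P"
    if \<mu>: "is_riemannian_measure d V induced_metric \<mu>" for \<mu>
    by (rule invariant_probability_of_riemannian_measure[OF compact sub ne \<mu>, of \<U> block_act]) (use iso in blast)+
  obtain \<mu> where \<mu>: "is_riemannian_measure d V induced_metric \<mu>"
    using riemannian_measure_exists_unique(1)[OF compact sub] by blast
  show ?thesis
  proof (intro conjI compact sub)
    show "connected V" unfolding assms(1) by (rule connected_stiefel)
    show "analytic_riemannian_manifold d V induced_metric"
      by (rule analytic_riemannian_manifold_induced[OF B sub])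
    show "transitive_action \<U> V (\<lambda>w. restrict (block_act w) V)"
      unfolding assms(1,2) by (rule transitive_action_stiefel)
    show "\<forall>w\<in>carrier \<U>. riemannian_isometry d V induced_metric (block_act w)"
      using iso linear_isometry_pair.riemannian_isometry_F by blast
    show "\<exists>!\<mu>. is_riemannian_measure d V induced_metric \<mu>"
      by (rule riemannian_measure_exists_unique(1)[OF compact sub])
    show "\<exists>!P. is_invariant_probability \<U> V block_act P"
    proof -
      obtain P where P: "is_invariant_probability \<U> V block_act P" using proportional[OF \<mu>] by blast
      then show ?thesis by (rule ex1I) (rule uniq[OF _ P])
    qed
    show "\<forall>\<mu> P. is_riemannian_measure d V induced_metric \<mu> \<and> is_invariant_probability \<U> V block_act P \<longrightarrow>
        (\<exists>c>0. \<mu> = scale_measure (ennreal c) P)"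
    proof (intro allI impI, elim conjE)
      fix \<mu> P
      assume \<mu>: "is_riemannian_measure d V induced_metric \<mu>" and P: "is_invariant_probability \<U> V block_act P"
      obtain c Q where c: "c > 0" "\<mu> = scale_measure (ennreal c) Q" and Q: "is_invariant_probability \<U> V block_act Q"
        using proportional[OF \<mu>] by blast
      show "\<exists>c>0. \<mu> = scale_measure (ennreal c) P" using c unfolding uniq[OF Q P] by blast
    qed
  qed
qed

end
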